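(* Let $Q$ be a finite quiver with vertex set $I$, let $\overline{Q}$ be its double with a fixed total ordering $<$ on its arrows, and let $\mathbf{n}=(n_s)\in\mathbb{Z}_{\geq 0}^I$ be a dimension vector. Set $r_Q:=\frac12|Q|(|Q|-1)$, where $|Q|$ is the number of arrows of $Q$. Let $M_{\overline{Q}}^\circ$ be the open representation space with its action of $\mathrm{GL}_{\mathbf{n}}=\prod_{s\in I}\mathrm{GL}_{n_s}(\mathbb{C})$, and let $P$ and $\Phi$ be Van den Bergh's quasi-Poisson bivector and moment map on it, all recalled in the context. Then the $\mathrm{GL}_{\mathbf{n}}$-variety $M_{\overline{Q}}^\circ$ admits a Hamiltonian quasi-Poisson pencil of order $r\leq r_Q$ centered at $P$, with moment map $\Phi$. If $n_s\geq 1$ for each $s\in I$, the order is $r=r_Q$. Furthermore, each element from the pencil is non-degenerate, and the corresponding quasi-Hamiltonian $2$-form can be written explicitly. By reduction, this descends to a Poisson pencil on the associated multiplicative quiver varieties $\mathcal{M}_{\overline{Q},\mathbf{q},\theta}$.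
   Context: **Quasi-Poisson and quasi-Hamiltonian geometry.** Everything is over $\mathbb{C}$; wedges mean $u\wedge v=u\otimes v-v\otimes u$. Let $G\subset\mathrm{GL}_N(\mathbb{C})$ be a complex reductive algebraic subgroup, with Lie algebra $\mathfrak{g}\subset\mathfrak{gl}_N(\mathbb{C})$ on which the trace form $(\xi,\xi')_{\mathfrak g}=\mathrm{tr}(\xi\xi')$ is non-degenerate; let $(E_a),(E^a)$ be dual bases. Set $\phi:=\frac1{12}\sum_{a,b,c}(E^a,[E^b,E^c])_{\mathfrak g}\,E_a\wedge E_b\wedge E_c$. For $\xi\in\mathfrak g$, $\xi^L(F)(g)=\frac{d}{dt}|_{t=0}F(ge^{t\xi})$, $\xi^R(F)(g)=\frac{d}{dt}|_{t=0}F(e^{t\xi}g)$, and $\mathcal{D}(F):=\frac12\sum_a(E_a^L+E_a^R)(F)\,E^a$. Let $\theta^L=g^{-1}dg$, $\theta^R=dg\,g^{-1}$, $\eta:=\frac16\mathrm{tr}(dg\,g^{-1}\wedge dg\,g^{-1}\wedge dg\,g^{-1})$. For a $G$-variety $M$, $\xi_M(f)(x)=\frac{d}{dt}|_{t=0} f(\exp(-t\xi)\cdot x)$, extended to $\bigwedge^\bullet\mathfrak g$. For a bivector $P$, $P^\sharp(\alpha_1)(\alpha_2)=\langle P,\alpha_1\otimes\alpha_2\rangle$; for a 2-form $\omega$, $\omega^\flat(X_1)(X_2)=\langle X_1\otimes X_2,\omega\rangle$. A $G$-invariant bivector $P$ is *quasi-Poisson* if $[P,P]=\phi_M$ (Schouten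 bracket). It is *non-degenerate* if for all $x\in M$ the map $T_x^*M\times\mathfrak g\to T_xM$, $(\alpha,\xi)\mapsto P_x^\sharp(\alpha)+\xi_{M,x}$ is surjective. A *moment map* is a $G$-equivariant morphism $\Phi:M\to G$ (adjoint action on $G$) with $P^\sharp(d(\Phi^*F))=(\Phi^*\mathcal{D}(F))_M$ for all functions $F$ on $G$; then $(M,P,\Phi)$ is a *Hamiltonian quasi-Poisson variety*. A triple $(M,\omega,\Phi)$ with $\omega$ a $G$-invariant 2-form and $\Phi:M\to G$ a $G$-equivariant morphism is a *quasi-Hamiltonian variety* if $d\omega=\Phi^*\eta$; $\omega^\flat(\xi_M)=\frac12\Phi^*(\xi,\theta^L+\theta^R)_{\mathfrak g}$ for all $\xi\in\mathfrak g$; and for all $x\in M$ the map $T_xM\to T_x^*M\times\mathfrak g$, $X\mapsto(\omega_x^\flat(X),\langle X,(\Phi^*\theta^L)_x\rangle)$ is injective. Non-degenerate Hamiltonian quasi-Poisson structures and quasi-Hamiltonian structures on $M$ with the same moment map $\Phi$ are in bijection ( *correspond* to one another) via $P^\sharp\circ\omega^\flat=\mathrm{Id}_{TM}-\frac14\sum_a(E_a)_M\otimes\Phi^*(E^a,\theta^L-\theta^R)_{\mathfrak g}$. **Pencils.** Bivectors $(P_j)_{j\in J}$ form a *Poisson pencil* if every finite linear combination is Poisson. For a quasi-Poisson bivector $P_0$, a family of bivectors $(P_j)_{j\in J}$ is a *quasi-Poisson pencil centered at $P_0$* if $P_0+\sum_{j\in J_0}c_jP_j$ is quasi-Poisson for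 all finite $J_0\subset J$ and $c_j\in\mathbb{C}$; these bivectors are the elements of the pencil. It is *Hamiltonian with moment map $\Phi$* if $\Phi$ is a moment map for all these bivectors. The *order* is the largest $r$ for which there are $j_1,\dots,j_r\in J$ and $x\in M$ with $P_{j_1,x},\dots,P_{j_r,x}\in\bigwedge^2T_xM$ linearly independent (order $0$ is allowed). **Quivers.** A quiver $Q$ has finite sets of arrows $Q$ and vertices $I$, with tail and head maps $t,h:Q\to I$. The double $\overline{Q}$ adds an arrow $a^*:h(a)\to t(a)$ for each $a\in Q$, with $(a^* )^*=a$; $\epsilon(a)=1$, $\epsilon(a^* )=-1$ for $a\in Q$. $M_{\overline{Q}}=M_{\overline Q}(\mathbf{n})$ is the affine space of $\mathtt{X}=(\mathtt{X}_a)_{a\in\overline{Q}}$ with $\mathtt{X}_a\in\mathrm{End}(\bigoplus_s\mathbb{C}^{n_s})$ having only one possibly nonzero block, of size $n_{t(a)}\times n_{h(a)}$ (a map $\mathbb{C}^{n_{h(a)}}\to\mathbb{C}^{n_{t(a)}}$). $\mathrm{GL}_{\mathbf n}$ acts by $g\cdot\mathtt{X}=(g_{t(a)}\mathtt{X}_ag_{h(a)}^{-1})_a$. $M_{\overline{Q}}^\circ\subset M_{\overline Q}$ is the open subvariety where $\det(\mathrm{Id}+\mathtt{X}_a\mathtt{X}_{a^*})\neq0$ for all $a\in\overline{Q}$. $\partial_a$ is the matrix of vector fields with $(\partial_a)_{ij}=\partial/\partial(\mathtt{X}_a)_{ji}$ (a single nonzero block of size $n_{h(a)}\times n_{t(a)}$).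 Set $$\Phi:M_{\overline{Q}}^\circ\to\mathrm{GL}_{\mathbf n},\qquad \Phi(\mathtt{X})=\prod_{a\in\overline{Q}}(\mathrm{Id}+\mathtt{X}_a\mathtt{X}_{a^*})^{\epsilon(a)}$$ (product from left to right with respect to the ordering $<$), and $$P=\tfrac12\sum_{a\in\overline{Q}}\epsilon(a)\,\mathrm{tr}[(\mathrm{Id}+\mathtt{X}_{a^*}\mathtt{X}_a)\partial_a\wedge\partial_{a^*}]-\tfrac12\sum_{a<b,\;a,b\in\overline{Q}}\mathrm{tr}[(\partial_{a^*}\mathtt{X}_{a^*}-\mathtt{X}_a\partial_a)\wedge(\partial_{b^*}\mathtt{X}_{b^*}-\mathtt{X}_b\partial_b)].$$ It is known (Van den Bergh) that $(M_{\overline{Q}}^\circ,P,\Phi)$ is a non-degenerate Hamiltonian quasi-Poisson $\mathrm{GL}_{\mathbf n}$-variety. **Multiplicative quiver varieties.** For $\theta\in\mathbb{Q}^I$ with $\theta\cdot\mathbf{n}=\sum_s\theta_sn_s=0$, $\mathtt{X}\in M_{\overline Q}$ is $\theta$-semistable if $\theta\cdot\dim V\leq0$ for each nonempty vector subspace $V=\bigoplus_sV_s\subsetneq\bigoplus_s\mathbb{C}^{n_s}$ with $\mathtt{X}_a(V_{h(a)})\subset V_{t(a)}$ for all $a\in\overline Q$; the semistable locus is $M_{\overline Q}^{\theta.ss}$. For $\mathbf{q}=(q_s)\in(\mathbb{C}^\times)^I$, identified with $(q_s\mathrm{Id}_{n_s})_s\in \mathrm{GL}_{\mathbf n}$, the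 multiplicative quiver variety is the good quotient $\mathcal{M}_{\overline{Q},\mathbf{q},\theta}:=(M_{\overline Q}^{\theta.ss}\cap\Phi^{-1}(\mathbf{q}))/\!/\mathrm{GL}_{\mathbf n}$. A Hamiltonian quasi-Poisson pencil $(P_j)_{j\in J}$ centered at $P$ descends to $\mathcal{M}_{\overline{Q},\mathbf{q},\theta}$ (when non-empty) in the sense that the bivectors $P$ and $P_j$, $j\in J$, induce a Poisson pencil there through quasi-Poisson reduction. *)

theory Defs
  imports
    "HOL-Analysis.Derivative"
    "Graph_Theory.Digraph"
    "Jordan_Normal_Form.Gauss_Jordan_Elimination"
    "Jordan_Normal_Form.VS_Connect"
begin

section \<open>Open subvarieties of affine space, in coordinates\<close>

type_synonym 'c point = "'c \<Rightarrow> complex"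

definition affine_space :: "'c set \<Rightarrow> 'c point set" where
  "affine_space C = {x. \<forall>c. c \<notin> C \<longrightarrow> x c = 0}"

inductive_set poly_functions :: "'c set \<Rightarrow> ('c point \<Rightarrow> complex) set" for C :: "'c set" where
  const: "(\<lambda>x. k) \<in> poly_functions C"
| coord: "c \<in> C \<Longrightarrow> (\<lambda>x. x c) \<in> poly_functions C"
| add: "p \<in> poly_functions C \<Longrightarrow> q \<in> poly_functions C \<Longrightarrow> (\<lambda>x. p x + q x) \<in> poly_functions C"
| mult: "p \<in> poly_functions C \<Longrightarrow> q \<in> poly_functions C \<Longrightarrow> (\<lambda>x. p x * q x) \<in> poly_functions C"

definition zariski_open :: "'c set \<Rightarrow> 'c point set \<Rightarrow> bool" where
  "zariski_open C U \<longleftrightarrow> U \<subseteq> affine_space C \<and>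
     (\<forall>x\<in>U. \<exists>p\<in>poly_functions C. p x \<noteq> 0 \<and> {y \<in> affine_space C. p y \<noteq> 0} \<subseteq> U)"

definition zariski_closure :: "'c set \<Rightarrow> 'c point set \<Rightarrow> 'c point set" where
  "zariski_closure C S =
     {x \<in> affine_space C. \<forall>p\<in>poly_functions C. (\<forall>y\<in>S. p y = 0) \<longrightarrow> p x = 0}"

definition regular_on :: "'c set \<Rightarrow> 'c point set \<Rightarrow> ('c point \<Rightarrow> complex) \<Rightarrow> bool" where
  "regular_on C U f \<longleftrightarrow>
     (\<forall>x\<in>U. \<exists>p\<in>poly_functions C. \<exists>q\<in>poly_functions C.
        q x \<noteq> 0 \<and> (\<forall>y\<in>U. q y \<noteq> 0 \<longrightarrow> f y = p y / q y))"

text \<open>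
  All varieties below are Zariski open in some \<^term>\<open>affine_space C\<close> with \<^term>\<open>C\<close> finite,
  so every (co)tangent space is identified with \<^term>\<open>affine_space C\<close> through the coordinates:
  the vector \<^term>\<open>X\<close> stands for the sum of the \<^term>\<open>X c\<close> times \<open>\<partial>/\<partial>x\<^sub>c\<close>, the covector
  \<^term>\<open>\<alpha>\<close> for the sum of the \<^term>\<open>\<alpha> c\<close> times \<open>dx\<^sub>c\<close>.
\<close>

definition unit_pt :: "'c \<Rightarrow> 'c point" where
  "unit_pt c = (\<lambda>d. if d = c then 1 else 0)"

definition pderiv_at :: "'c \<Rightarrow> ('c point \<Rightarrow> complex) \<Rightarrow> 'c point \<Rightarrow> complex" where
  "pderiv_at c f x = deriv (\<lambda>t. f (x(c := t))) (x c)"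

text \<open>The differential at \<^term>\<open>x\<close> of a map \<^term>\<open>\<Phi>\<close> between open sets of affine spaces.\<close>
definition tangent_map :: "'c set \<Rightarrow> ('c point \<Rightarrow> 'd point) \<Rightarrow> 'c point \<Rightarrow> 'c point \<Rightarrow> 'd point" where
  "tangent_map C \<Phi> x X = (\<lambda>d. \<Sum>c\<in>C. pderiv_at c (\<lambda>y. \<Phi> y d) x * X c)"

definition wedge2 :: "'c point \<Rightarrow> 'c point \<Rightarrow> 'c \<Rightarrow> 'c \<Rightarrow> complex" where
  "wedge2 u v c d = u c * v d - v c * u d"

definition wedge3 ::
    "'c point \<Rightarrow> 'c point \<Rightarrow> 'c point \<Rightarrow> 'c \<Rightarrow> 'c \<Rightarrow> 'c \<Rightarrow> complex" where
  "wedge3 u v w c d e =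
     u c * v d * w e - u c * w d * v e + v c * w d * u e - v c * u d * w e
     + w c * u d * v e - w c * v d * u e"

text \<open>
  Bivector fields and 2-forms are both given by their components:
  \<open>P x c d = \<langle>P, dx\<^sub>c \<otimes> dx\<^sub>d\<rangle>\<close> and \<open>\<omega> x c d = \<langle>\<partial>/\<partial>x\<^sub>c \<otimes> \<partial>/\<partial>x\<^sub>d, \<omega>\<rangle>\<close>.
\<close>
type_synonym 'c tensor2 = "'c point \<Rightarrow> 'c \<Rightarrow> 'c \<Rightarrow> complex"

definition alternating_field :: "'c set \<Rightarrow> 'c point set \<Rightarrow> 'c tensor2 \<Rightarrow> bool" where
  "alternating_field C U T \<longleftrightarrow>
     (\<forall>x\<in>U. \<forall>c d. T x c d = - T x d c \<and> (c \<notin> C \<or> d \<notin> C \<longrightarrow> T x c d = 0)) \<and>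
     (\<forall>c\<in>C. \<forall>d\<in>C. regular_on C U (\<lambda>x. T x c d))"

text \<open>Both \<open>P\<^sup>\<sharp>\<close> and \<open>\<omega>\<^sup>\<flat>\<close>: insertion into the first slot.\<close>
definition insert_first :: "'c set \<Rightarrow> 'c tensor2 \<Rightarrow> 'c point \<Rightarrow> 'c point \<Rightarrow> 'c point" where
  "insert_first C T x \<alpha> = (\<lambda>d. \<Sum>c\<in>C. T x c d * \<alpha> c)"

definition bivector_bracket ::
    "'c set \<Rightarrow> 'c tensor2 \<Rightarrow> ('c point \<Rightarrow> complex) \<Rightarrow> ('c point \<Rightarrow> complex) \<Rightarrow> 'c point \<Rightarrow> complex" where
  "bivector_bracket C P f h x = (\<Sum>c\<in>C. \<Sum>d\<in>C. P x c d * pderiv_at c f x * pderiv_at d h x)"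

text \<open>
  The Schouten bracket of two bivector fields evaluated on \<open>dx\<^sub>c \<otimes> dx\<^sub>d \<otimes> dx\<^sub>e\<close>, normalised so that
  \<open>[u \<and> v, u \<and> v] = 2 [u, v] \<and> u \<and> v\<close>; thus \<open>[P, P]\<close> is twice the Jacobiator of \<open>P\<close>.
\<close>
definition schouten ::
    "'c set \<Rightarrow> 'c tensor2 \<Rightarrow> 'c tensor2 \<Rightarrow> 'c point \<Rightarrow> 'c \<Rightarrow> 'c \<Rightarrow> 'c \<Rightarrow> complex" where
  "schouten C P R x c d e =
     (\<Sum>l\<in>C. P x c l * pderiv_at l (\<lambda>y. R y d e) x + R x c l * pderiv_at l (\<lambda>y. P y d e) x
           + P x d l * pderiv_at l (\<lambda>y. R y e c) x + R x d l * pderiv_at l (\<lambda>y. P y e c) x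
           + P x e l * pderiv_at l (\<lambda>y. R y c d) x + R x e l * pderiv_at l (\<lambda>y. P y c d) x)"

definition ext_deriv2 :: "'c tensor2 \<Rightarrow> 'c point \<Rightarrow> 'c \<Rightarrow> 'c \<Rightarrow> 'c \<Rightarrow> complex" where
  "ext_deriv2 \<omega> x c d e =
     pderiv_at c (\<lambda>y. \<omega> y d e) x - pderiv_at d (\<lambda>y. \<omega> y c e) x + pderiv_at e (\<lambda>y. \<omega> y c d) x"


section \<open>Families of matrices as coordinate spaces\<close>

text \<open>
  \<^term>\<open>x (k, i, j)\<close> is the \<open>(i, j)\<close> entry of the \<open>k\<close>-th matrix, of size \<open>r k \<times> s k\<close>.
  This is used for representation spaces (\<open>k\<close> an arrow) and for the group \<open>GL\<^sub>n\<close> and its Lie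
  algebra (\<open>k\<close> a vertex, the matrices being the diagonal blocks).
\<close>
type_synonym 'k entry = "'k \<times> nat \<times> nat"

definition entries :: "'k set \<Rightarrow> ('k \<Rightarrow> nat) \<Rightarrow> ('k \<Rightarrow> nat) \<Rightarrow> 'k entry set" where
  "entries K r s = {(k, i, j). k \<in> K \<and> i < r k \<and> j < s k}"

definition block :: "('k \<Rightarrow> nat) \<Rightarrow> ('k \<Rightarrow> nat) \<Rightarrow> 'k entry point \<Rightarrow> 'k \<Rightarrow> complex mat" where
  "block r s x k = mat (r k) (s k) (\<lambda>(i, j). x (k, i, j))"

definition of_blocks ::
    "'k set \<Rightarrow> ('k \<Rightarrow> nat) \<Rightarrow> ('k \<Rightarrow> nat) \<Rightarrow> ('k \<Rightarrow> complex mat) \<Rightarrow> 'k entry point" where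
  "of_blocks K r s A = (\<lambda>(k, i, j). if k \<in> K \<and> i < r k \<and> j < s k then A k $$ (i, j) else 0)"

definition mtrace :: "complex mat \<Rightarrow> complex" where
  "mtrace A = (\<Sum>i<dim_row A. A $$ (i, i))"

definition minv :: "complex mat \<Rightarrow> complex mat" where
  "minv A = the (mat_inverse A)"

definition mexp :: "complex mat \<Rightarrow> complex mat" where
  "mexp A = mat (dim_row A) (dim_row A) (\<lambda>(i, j). \<Sum>m. (A ^\<^sub>m m) $$ (i, j) / fact m)"


section \<open>The group \<open>GL\<^sub>n\<close> and its Lie algebra\<close>

definition gl_entries :: "'s set \<Rightarrow> ('s \<Rightarrow> nat) \<Rightarrow> 's entry set" where
  "gl_entries S n = entries S n n"

definition gl_alg :: "'s set \<Rightarrow> ('s \<Rightarrow> nat) \<Rightarrow> 's entry point set" where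
  "gl_alg S n = affine_space (gl_entries S n)"

definition GL :: "'s set \<Rightarrow> ('s \<Rightarrow> nat) \<Rightarrow> 's entry point set" where
  "GL S n = {g \<in> gl_alg S n. \<forall>s\<in>S. invertible_mat (block n n g s)}"

definition gone :: "'s set \<Rightarrow> ('s \<Rightarrow> nat) \<Rightarrow> 's entry point" where
  "gone S n = of_blocks S n n (\<lambda>s. 1\<^sub>m (n s))"

definition gmul :: "'s set \<Rightarrow> ('s \<Rightarrow> nat) \<Rightarrow> 's entry point \<Rightarrow> 's entry point \<Rightarrow> 's entry point" where
  "gmul S n g h = of_blocks S n n (\<lambda>s. block n n g s * block n n h s)"

definition ginv :: "'s set \<Rightarrow> ('s \<Rightarrow> nat) \<Rightarrow> 's entry point \<Rightarrow> 's entry point" where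
  "ginv S n g = of_blocks S n n (\<lambda>s. minv (block n n g s))"

definition gexp :: "'s set \<Rightarrow> ('s \<Rightarrow> nat) \<Rightarrow> 's entry point \<Rightarrow> 's entry point" where
  "gexp S n \<xi> = of_blocks S n n (\<lambda>s. mexp (block n n \<xi> s))"

definition gtrace :: "'s set \<Rightarrow> ('s \<Rightarrow> nat) \<Rightarrow> 's entry point \<Rightarrow> complex" where
  "gtrace S n \<xi> = (\<Sum>s\<in>S. mtrace (block n n \<xi> s))"

definition trace_form ::
    "'s set \<Rightarrow> ('s \<Rightarrow> nat) \<Rightarrow> 's entry point \<Rightarrow> 's entry point \<Rightarrow> complex" where
  "trace_form S n \<xi> \<zeta> = gtrace S n (gmul S n \<xi> \<zeta>)"

definition lie_bracket ::
    "'s set \<Rightarrow> ('s \<Rightarrow> nat) \<Rightarrow> 's entry point \<Rightarrow> 's entry point \<Rightarrow> 's entry point" where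
  "lie_bracket S n \<xi> \<zeta> = (\<lambda>b. gmul S n \<xi> \<zeta> b - gmul S n \<zeta> \<xi> b)"

text \<open>
  The dual bases \<open>(E\<^sub>a)\<close> and \<open>(E\<^sup>a)\<close> for the trace form are taken to be the elementary matrices,
  indexed by \<^term>\<open>a \<in> gl_entries S n\<close>, and their transposes.
\<close>
definition basis_elt :: "'s entry \<Rightarrow> 's entry point" where
  "basis_elt a = unit_pt a"

fun dual_elt :: "'s entry \<Rightarrow> 's entry point" where
  "dual_elt (s, i, j) = unit_pt (s, j, i)"

definition left_vf ::
    "'s set \<Rightarrow> ('s \<Rightarrow> nat) \<Rightarrow> 's entry point \<Rightarrow> ('s entry point \<Rightarrow> complex) \<Rightarrow> 's entry point \<Rightarrow> complex" where
  "left_vf S n \<xi> F g = deriv (\<lambda>t. F (gmul S n g (gexp S n (\<lambda>b. t * \<xi> b)))) 0"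

definition right_vf ::
    "'s set \<Rightarrow> ('s \<Rightarrow> nat) \<Rightarrow> 's entry point \<Rightarrow> ('s entry point \<Rightarrow> complex) \<Rightarrow> 's entry point \<Rightarrow> complex" where
  "right_vf S n \<xi> F g = deriv (\<lambda>t. F (gmul S n (gexp S n (\<lambda>b. t * \<xi> b)) g)) 0"

definition averaged_diff ::
    "'s set \<Rightarrow> ('s \<Rightarrow> nat) \<Rightarrow> ('s entry point \<Rightarrow> complex) \<Rightarrow> 's entry point \<Rightarrow> 's entry point" where
  "averaged_diff S n F g =
     (\<lambda>b. 1/2 * (\<Sum>a\<in>gl_entries S n.
        (left_vf S n (basis_elt a) F g + right_vf S n (basis_elt a) F g) * dual_elt a b))"

text \<open>The pullbacks \<open>\<Phi>\<^sup>*\<theta>\<^sup>L\<close>, \<open>\<Phi>\<^sup>*\<theta>\<^sup>R\<close> at \<^term>\<open>x\<close> evaluated on the tangent vector \<^term>\<open>X\<close>.\<close>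
definition pull_thetaL ::
    "'s set \<Rightarrow> ('s \<Rightarrow> nat) \<Rightarrow> 'c set \<Rightarrow> ('c point \<Rightarrow> 's entry point) \<Rightarrow> 'c point \<Rightarrow> 'c point \<Rightarrow> 's entry point" where
  "pull_thetaL S n C \<Phi> x X = gmul S n (ginv S n (\<Phi> x)) (tangent_map C \<Phi> x X)"

definition pull_thetaR ::
    "'s set \<Rightarrow> ('s \<Rightarrow> nat) \<Rightarrow> 'c set \<Rightarrow> ('c point \<Rightarrow> 's entry point) \<Rightarrow> 'c point \<Rightarrow> 'c point \<Rightarrow> 's entry point" where
  "pull_thetaR S n C \<Phi> x X = gmul S n (tangent_map C \<Phi> x X) (ginv S n (\<Phi> x))"

definition pull_eta ::
    "'s set \<Rightarrow> ('s \<Rightarrow> nat) \<Rightarrow> 'c set \<Rightarrow> ('c point \<Rightarrow> 's entry point) \<Rightarrow> 'c point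
      \<Rightarrow> 'c point \<Rightarrow> 'c point \<Rightarrow> 'c point \<Rightarrow> complex" where
  "pull_eta S n C \<Phi> x X Y Z =
     (let tr3 = (\<lambda>U V W. gtrace S n (gmul S n (pull_thetaR S n C \<Phi> x U)
                  (gmul S n (pull_thetaR S n C \<Phi> x V) (pull_thetaR S n C \<Phi> x W))))
      in 1/6 * (tr3 X Y Z - tr3 X Z Y + tr3 Y Z X - tr3 Y X Z + tr3 Z X Y - tr3 Z Y X))"


section \<open>Quasi-Poisson and quasi-Hamiltonian structures\<close>

text \<open>A variety, open in an affine space, with an action of \<open>GL\<^sub>n\<close>.\<close>
record ('s, 'c) GL_variety =
  gverts :: "'s set"
  gdim :: "'s \<Rightarrow> nat"
  coords :: "'c set"
  points :: "'c point set"
  act :: "'s entry point \<Rightarrow> 'c point \<Rightarrow> 'c point"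

abbreviation grp :: "('s, 'c) GL_variety \<Rightarrow> 's entry point set" where
  "grp M \<equiv> GL (gverts M) (gdim M)"

abbreviation gbasis :: "('s, 'c) GL_variety \<Rightarrow> 's entry set" where
  "gbasis M \<equiv> gl_entries (gverts M) (gdim M)"

definition infinitesimal :: "('s, 'c) GL_variety \<Rightarrow> 's entry point \<Rightarrow> 'c point \<Rightarrow> 'c point" where
  "infinitesimal M \<xi> x =
     (\<lambda>c. deriv (\<lambda>t. act M (gexp (gverts M) (gdim M) (\<lambda>b. - t * \<xi> b)) x c) 0)"

definition cartan_trivector :: "('s, 'c) GL_variety \<Rightarrow> 'c point \<Rightarrow> 'c \<Rightarrow> 'c \<Rightarrow> 'c \<Rightarrow> complex" where
  "cartan_trivector M x c d e =
     1/12 * (\<Sum>a1\<in>gbasis M. \<Sum>a2\<in>gbasis M. \<Sum>a3\<in>gbasis M.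
        trace_form (gverts M) (gdim M) (dual_elt a1)
          (lie_bracket (gverts M) (gdim M) (dual_elt a2) (dual_elt a3))
        * wedge3 (infinitesimal M (basis_elt a1) x) (infinitesimal M (basis_elt a2) x)
            (infinitesimal M (basis_elt a3) x) c d e)"

definition bivector_field :: "('s, 'c) GL_variety \<Rightarrow> 'c tensor2 \<Rightarrow> bool" where
  "bivector_field M P \<longleftrightarrow> alternating_field (coords M) (points M) P"

definition two_form :: "('s, 'c) GL_variety \<Rightarrow> 'c tensor2 \<Rightarrow> bool" where
  "two_form M \<omega> \<longleftrightarrow> alternating_field (coords M) (points M) \<omega>"

definition invariant_bivector :: "('s, 'c) GL_variety \<Rightarrow> 'c tensor2 \<Rightarrow> bool" where
  "invariant_bivector M P \<longleftrightarrow>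
     (\<forall>g\<in>grp M. \<forall>x\<in>points M. \<forall>c\<in>coords M. \<forall>d\<in>coords M.
        P (act M g x) c d = bivector_bracket (coords M) P (\<lambda>y. act M g y c) (\<lambda>y. act M g y d) x)"

definition invariant_form :: "('s, 'c) GL_variety \<Rightarrow> 'c tensor2 \<Rightarrow> bool" where
  "invariant_form M \<omega> \<longleftrightarrow>
     (\<forall>g\<in>grp M. \<forall>x\<in>points M. \<forall>c\<in>coords M. \<forall>d\<in>coords M.
        \<omega> x c d = (\<Sum>a\<in>coords M. \<Sum>b\<in>coords M. \<omega> (act M g x) a b
          * pderiv_at c (\<lambda>y. act M g y a) x * pderiv_at d (\<lambda>y. act M g y b) x))"

definition quasi_poisson :: "('s, 'c) GL_variety \<Rightarrow> 'c tensor2 \<Rightarrow> bool" where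
  "quasi_poisson M P \<longleftrightarrow> bivector_field M P \<and> invariant_bivector M P \<and>
     (\<forall>x\<in>points M. \<forall>c\<in>coords M. \<forall>d\<in>coords M. \<forall>e\<in>coords M.
        schouten (coords M) P P x c d e = cartan_trivector M x c d e)"

definition nondegenerate :: "('s, 'c) GL_variety \<Rightarrow> 'c tensor2 \<Rightarrow> bool" where
  "nondegenerate M P \<longleftrightarrow>
     (\<forall>x\<in>points M.
        (\<lambda>(\<alpha>, \<xi>) c. insert_first (coords M) P x \<alpha> c + infinitesimal M \<xi> x c)
          ` (affine_space (coords M) \<times> gl_alg (gverts M) (gdim M)) = affine_space (coords M))"

definition equivariant_morphism ::
    "('s, 'c) GL_variety \<Rightarrow> ('c point \<Rightarrow> 's entry point) \<Rightarrow> bool" where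
  "equivariant_morphism M \<Phi> \<longleftrightarrow>
     \<Phi> ` points M \<subseteq> grp M \<and>
     (\<forall>b\<in>gbasis M. regular_on (coords M) (points M) (\<lambda>x. \<Phi> x b)) \<and>
     (\<forall>g\<in>grp M. \<forall>x\<in>points M. \<Phi> (act M g x) =
        gmul (gverts M) (gdim M) (gmul (gverts M) (gdim M) g (\<Phi> x)) (ginv (gverts M) (gdim M) g))"

definition moment_map ::
    "('s, 'c) GL_variety \<Rightarrow> 'c tensor2 \<Rightarrow> ('c point \<Rightarrow> 's entry point) \<Rightarrow> bool" where
  "moment_map M P \<Phi> \<longleftrightarrow> equivariant_morphism M \<Phi> \<and>
     (\<forall>F. regular_on (gbasis M) (grp M) F \<longrightarrow>
        (\<forall>x\<in>points M. \<forall>d\<in>coords M.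
           insert_first (coords M) P x (\<lambda>c. pderiv_at c (\<lambda>y. F (\<Phi> y)) x) d
           = infinitesimal M (averaged_diff (gverts M) (gdim M) F (\<Phi> x)) x d))"

definition quasi_hamiltonian ::
    "('s, 'c) GL_variety \<Rightarrow> 'c tensor2 \<Rightarrow> ('c point \<Rightarrow> 's entry point) \<Rightarrow> bool" where
  "quasi_hamiltonian M \<omega> \<Phi> \<longleftrightarrow>
     two_form M \<omega> \<and> invariant_form M \<omega> \<and> equivariant_morphism M \<Phi> \<and>
     (\<forall>x\<in>points M. \<forall>c\<in>coords M. \<forall>d\<in>coords M. \<forall>e\<in>coords M.
        ext_deriv2 \<omega> x c d e = pull_eta (gverts M) (gdim M) (coords M) \<Phi> x
          (unit_pt c) (unit_pt d) (unit_pt e)) \<and>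
     (\<forall>\<xi>\<in>gl_alg (gverts M) (gdim M). \<forall>x\<in>points M. \<forall>c\<in>coords M.
        insert_first (coords M) \<omega> x (infinitesimal M \<xi> x) c =
          1/2 * trace_form (gverts M) (gdim M) \<xi>
            (\<lambda>b. pull_thetaL (gverts M) (gdim M) (coords M) \<Phi> x (unit_pt c) b
               + pull_thetaR (gverts M) (gdim M) (coords M) \<Phi> x (unit_pt c) b)) \<and>
     (\<forall>x\<in>points M.
        inj_on (\<lambda>X. (insert_first (coords M) \<omega> x X,
                     pull_thetaL (gverts M) (gdim M) (coords M) \<Phi> x X))
          (affine_space (coords M)))"

definition corresponding ::
    "('s, 'c) GL_variety \<Rightarrow> 'c tensor2 \<Rightarrow> 'c tensor2 \<Rightarrow> ('c point \<Rightarrow> 's entry point) \<Rightarrow> bool" where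
  "corresponding M P \<omega> \<Phi> \<longleftrightarrow>
     (\<forall>x\<in>points M. \<forall>X\<in>affine_space (coords M). \<forall>d\<in>coords M.
        insert_first (coords M) P x (insert_first (coords M) \<omega> x X) d =
          X d - 1/4 * (\<Sum>a\<in>gbasis M. infinitesimal M (basis_elt a) x d *
            trace_form (gverts M) (gdim M) (dual_elt a)
              (\<lambda>b. pull_thetaL (gverts M) (gdim M) (coords M) \<Phi> x X b
                 - pull_thetaR (gverts M) (gdim M) (coords M) \<Phi> x X b)))"


section \<open>Pencils\<close>

definition pencil_element ::
    "'c tensor2 \<Rightarrow> ('j \<Rightarrow> 'c tensor2) \<Rightarrow> 'j set \<Rightarrow> ('j \<Rightarrow> complex) \<Rightarrow> 'c tensor2" where
  "pencil_element P\<^sub>0 Pf J\<^sub>0 w = (\<lambda>x c d. P\<^sub>0 x c d + (\<Sum>j\<in>J\<^sub>0. w j * Pf j x c d))"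

definition quasi_poisson_pencil ::
    "('s, 'c) GL_variety \<Rightarrow> 'c tensor2 \<Rightarrow> 'j set \<Rightarrow> ('j \<Rightarrow> 'c tensor2) \<Rightarrow> bool" where
  "quasi_poisson_pencil M P\<^sub>0 J Pf \<longleftrightarrow>
     quasi_poisson M P\<^sub>0 \<and> (\<forall>j\<in>J. bivector_field M (Pf j)) \<and>
     (\<forall>J\<^sub>0 w. finite J\<^sub>0 \<and> J\<^sub>0 \<subseteq> J \<longrightarrow> quasi_poisson M (pencil_element P\<^sub>0 Pf J\<^sub>0 w))"

definition hamiltonian_pencil ::
    "('s, 'c) GL_variety \<Rightarrow> 'c tensor2 \<Rightarrow> 'j set \<Rightarrow> ('j \<Rightarrow> 'c tensor2)
      \<Rightarrow> ('c point \<Rightarrow> 's entry point) \<Rightarrow> bool" where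
  "hamiltonian_pencil M P\<^sub>0 J Pf \<Phi> \<longleftrightarrow> quasi_poisson_pencil M P\<^sub>0 J Pf \<and>
     (\<forall>J\<^sub>0 w. finite J\<^sub>0 \<and> J\<^sub>0 \<subseteq> J \<longrightarrow> moment_map M (pencil_element P\<^sub>0 Pf J\<^sub>0 w) \<Phi>)"

definition independent_at ::
    "('s, 'c) GL_variety \<Rightarrow> ('j \<Rightarrow> 'c tensor2) \<Rightarrow> 'j set \<Rightarrow> 'c point \<Rightarrow> bool" where
  "independent_at M Pf S x \<longleftrightarrow>
     (\<forall>w. (\<forall>c\<in>coords M. \<forall>d\<in>coords M. (\<Sum>j\<in>S. w j * Pf j x c d) = 0) \<longrightarrow> (\<forall>j\<in>S. w j = 0))"

definition has_order :: "('s, 'c) GL_variety \<Rightarrow> 'j set \<Rightarrow> ('j \<Rightarrow> 'c tensor2) \<Rightarrow> nat \<Rightarrow> bool" where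
  "has_order M J Pf r \<longleftrightarrow>
     (let attained = (\<lambda>k. \<exists>S x. S \<subseteq> J \<and> finite S \<and> card S = k \<and> x \<in> points M \<and> independent_at M Pf S x)
      in attained r \<and> (\<forall>k. attained k \<longrightarrow> k \<le> r))"


section \<open>Quasi-Poisson reduction along a fibre of the moment map\<close>

text \<open>
  The locus \<^term>\<open>Z\<close> lies in the fibre of \<^term>\<open>\<Phi>\<close> over \<^term>\<open>q\<close> and carries the scheme structure of
  the fibre: two germs of regular functions of the ambient variety at \<^term>\<open>x\<close> restrict to the same
  germ if they differ by an element of the ideal generated by the entries of \<open>\<Phi> - q\<close>.
\<close>
definition germ_eq ::
    "('s, 'c) GL_variety \<Rightarrow> ('c point \<Rightarrow> 's entry point) \<Rightarrow> 's entry point \<Rightarrow> 'c point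
      \<Rightarrow> ('c point \<Rightarrow> complex) \<Rightarrow> ('c point \<Rightarrow> complex) \<Rightarrow> bool" where
  "germ_eq M \<Phi> q x f h \<longleftrightarrow>
     (\<exists>V u. zariski_open (coords M) V \<and> x \<in> V \<and> V \<subseteq> points M \<and>
        regular_on (coords M) V f \<and> regular_on (coords M) V h \<and>
        (\<forall>b\<in>gbasis M. regular_on (coords M) V (u b)) \<and>
        (\<forall>y\<in>V. f y - h y = (\<Sum>b\<in>gbasis M. u b y * (\<Phi> y b - q b))))"

text \<open>A section of the structure sheaf assigns to each point an element of the local ring there.\<close>
type_synonym 'c fibre_section = "'c point \<Rightarrow> ('c point \<Rightarrow> complex) set"

definition germ_class ::
    "('s, 'c) GL_variety \<Rightarrow> ('c point \<Rightarrow> 's entry point) \<Rightarrow> 's entry point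
      \<Rightarrow> ('c point \<Rightarrow> complex) \<Rightarrow> 'c fibre_section" where
  "germ_class M \<Phi> q f x = {h. germ_eq M \<Phi> q x h f}"

definition fibre_sections ::
    "('s, 'c) GL_variety \<Rightarrow> ('c point \<Rightarrow> 's entry point) \<Rightarrow> 's entry point \<Rightarrow> 'c point set
      \<Rightarrow> 'c fibre_section set" where
  "fibre_sections M \<Phi> q W =
     {\<sigma>. \<forall>x\<in>W. \<exists>V f. zariski_open (coords M) V \<and> x \<in> V \<and> V \<subseteq> points M \<and>
        regular_on (coords M) V f \<and> (\<forall>y\<in>V \<inter> W. \<sigma> y = germ_class M \<Phi> q f y)}"

definition invariant_section ::
    "('s, 'c) GL_variety \<Rightarrow> 'c point set \<Rightarrow> 'c fibre_section \<Rightarrow> bool" where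
  "invariant_section M W \<sigma> \<longleftrightarrow>
     (\<forall>g\<in>grp M. \<forall>x\<in>W. \<forall>f\<in>\<sigma> (act M g x). (\<lambda>y. f (act M g y)) \<in> \<sigma> x)"

definition section_comb ::
    "('s, 'c) GL_variety \<Rightarrow> ('c point \<Rightarrow> 's entry point) \<Rightarrow> 's entry point
      \<Rightarrow> 'k set \<Rightarrow> ('k \<Rightarrow> complex) \<Rightarrow> ('k \<Rightarrow> 'c fibre_section) \<Rightarrow> 'c fibre_section" where
  "section_comb M \<Phi> q K w \<sigma> x =
     {h. \<exists>f. (\<forall>k\<in>K. f k \<in> \<sigma> k x) \<and> germ_eq M \<Phi> q x h (\<lambda>y. \<Sum>k\<in>K. w k * f k y)}"

definition section_add ::
    "('s, 'c) GL_variety \<Rightarrow> ('c point \<Rightarrow> 's entry point) \<Rightarrow> 's entry point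
      \<Rightarrow> 'c fibre_section \<Rightarrow> 'c fibre_section \<Rightarrow> 'c fibre_section" where
  "section_add M \<Phi> q \<sigma> \<tau> x = {h. \<exists>f1\<in>\<sigma> x. \<exists>f2\<in>\<tau> x. germ_eq M \<Phi> q x h (\<lambda>y. f1 y + f2 y)}"

definition section_scale ::
    "('s, 'c) GL_variety \<Rightarrow> ('c point \<Rightarrow> 's entry point) \<Rightarrow> 's entry point
      \<Rightarrow> complex \<Rightarrow> 'c fibre_section \<Rightarrow> 'c fibre_section" where
  "section_scale M \<Phi> q k \<sigma> x = {h. \<exists>f\<in>\<sigma> x. germ_eq M \<Phi> q x h (\<lambda>y. k * f y)}"

definition section_mult ::
    "('s, 'c) GL_variety \<Rightarrow> ('c point \<Rightarrow> 's entry point) \<Rightarrow> 's entry point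
      \<Rightarrow> 'c fibre_section \<Rightarrow> 'c fibre_section \<Rightarrow> 'c fibre_section" where
  "section_mult M \<Phi> q \<sigma> \<tau> x = {h. \<exists>f1\<in>\<sigma> x. \<exists>f2\<in>\<tau> x. germ_eq M \<Phi> q x h (\<lambda>y. f1 y * f2 y)}"

text \<open>
  The good quotient \<open>Z // GL\<^sub>n\<close>: two points have the same image if and only if the closures in
  \<^term>\<open>Z\<close> of their orbits meet, the topology is the quotient topology, and the functions on an open
  set are the invariant functions on its preimage.
\<close>
definition orbit :: "('s, 'c) GL_variety \<Rightarrow> 'c point \<Rightarrow> 'c point set" where
  "orbit M x = (\<lambda>g. act M g x) ` grp M"

definition quot_map :: "('s, 'c) GL_variety \<Rightarrow> 'c point set \<Rightarrow> 'c point \<Rightarrow> 'c point set" where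
  "quot_map M Z x =
     {y \<in> Z. Z \<inter> zariski_closure (coords M) (orbit M x) \<inter> zariski_closure (coords M) (orbit M y) \<noteq> {}}"

definition good_quotient :: "('s, 'c) GL_variety \<Rightarrow> 'c point set \<Rightarrow> 'c point set set" where
  "good_quotient M Z = quot_map M Z ` Z"

definition quot_preimage ::
    "('s, 'c) GL_variety \<Rightarrow> 'c point set \<Rightarrow> 'c point set set \<Rightarrow> 'c point set" where
  "quot_preimage M Z U = {x \<in> Z. quot_map M Z x \<in> U}"

definition quot_open :: "('s, 'c) GL_variety \<Rightarrow> 'c point set \<Rightarrow> 'c point set set \<Rightarrow> bool" where
  "quot_open M Z U \<longleftrightarrow> U \<subseteq> good_quotient M Z \<and>
     (\<exists>V. zariski_open (coords M) V \<and> quot_preimage M Z U = V \<inter> Z)"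

definition quot_functions ::
    "('s, 'c) GL_variety \<Rightarrow> ('c point \<Rightarrow> 's entry point) \<Rightarrow> 's entry point \<Rightarrow> 'c point set
      \<Rightarrow> 'c point set set \<Rightarrow> 'c fibre_section set" where
  "quot_functions M \<Phi> q Z U =
     {\<sigma> \<in> fibre_sections M \<Phi> q (quot_preimage M Z U). invariant_section M (quot_preimage M Z U) \<sigma>}"

text \<open>
  An operation \<^term>\<open>\<beta>\<close> on sections acts on the functions over every open set \<^term>\<open>U\<close> of the quotient.
  Sections are only relevant on the preimage of \<^term>\<open>U\<close>; the second condition of
  \<^term>\<open>quot_bracket\<close> is independence of the values elsewhere, and hence compatibility with restriction.
\<close>
definition quot_bracket ::
    "('s, 'c) GL_variety \<Rightarrow> ('c point \<Rightarrow> 's entry point) \<Rightarrow> 's entry point \<Rightarrow> 'c point set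
      \<Rightarrow> ('c fibre_section \<Rightarrow> 'c fibre_section \<Rightarrow> 'c fibre_section) \<Rightarrow> bool" where
  "quot_bracket M \<Phi> q Z \<beta> \<longleftrightarrow>
     (\<forall>U. quot_open M Z U \<longrightarrow>
       (let OU = quot_functions M \<Phi> q Z U;
            eq = (\<lambda>\<sigma> \<tau>. \<forall>x\<in>quot_preimage M Z U. \<sigma> x = \<tau> x);
            add = section_add M \<Phi> q; scale = section_scale M \<Phi> q; mult = section_mult M \<Phi> q
        in (\<forall>\<sigma>\<in>OU. \<forall>\<tau>\<in>OU. \<beta> \<sigma> \<tau> \<in> OU) \<and>
           (\<forall>\<sigma>\<in>OU. \<forall>\<sigma>'\<in>OU. \<forall>\<tau>\<in>OU. \<forall>\<tau>'\<in>OU. eq \<sigma> \<sigma>' \<and> eq \<tau> \<tau>' \<longrightarrow> eq (\<beta> \<sigma> \<tau>) (\<beta> \<sigma>' \<tau>')) \<and>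
           (\<forall>\<sigma>\<in>OU. \<forall>\<tau>\<in>OU. eq (\<beta> \<sigma> \<tau>) (scale (-1) (\<beta> \<tau> \<sigma>))) \<and>
           (\<forall>\<rho>\<in>OU. \<forall>\<sigma>\<in>OU. \<forall>\<tau>\<in>OU. eq (\<beta> \<rho> (add \<sigma> \<tau>)) (add (\<beta> \<rho> \<sigma>) (\<beta> \<rho> \<tau>))) \<and>
           (\<forall>k. \<forall>\<rho>\<in>OU. \<forall>\<sigma>\<in>OU. eq (\<beta> \<rho> (scale k \<sigma>)) (scale k (\<beta> \<rho> \<sigma>))) \<and>
           (\<forall>\<rho>\<in>OU. \<forall>\<sigma>\<in>OU. \<forall>\<tau>\<in>OU.
              eq (\<beta> \<rho> (mult \<sigma> \<tau>)) (add (mult (\<beta> \<rho> \<sigma>) \<tau>) (mult \<sigma> (\<beta> \<rho> \<tau>))))))"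

definition quot_jacobi ::
    "('s, 'c) GL_variety \<Rightarrow> ('c point \<Rightarrow> 's entry point) \<Rightarrow> 's entry point \<Rightarrow> 'c point set
      \<Rightarrow> ('c fibre_section \<Rightarrow> 'c fibre_section \<Rightarrow> 'c fibre_section) \<Rightarrow> bool" where
  "quot_jacobi M \<Phi> q Z \<beta> \<longleftrightarrow>
     (\<forall>U. quot_open M Z U \<longrightarrow>
       (\<forall>\<rho>\<in>quot_functions M \<Phi> q Z U. \<forall>\<sigma>\<in>quot_functions M \<Phi> q Z U. \<forall>\<tau>\<in>quot_functions M \<Phi> q Z U.
          \<forall>x\<in>quot_preimage M Z U.
            section_add M \<Phi> q (\<beta> \<rho> (\<beta> \<sigma> \<tau>)) (section_add M \<Phi> q (\<beta> \<sigma> (\<beta> \<tau> \<rho>)) (\<beta> \<tau> (\<beta> \<rho> \<sigma>))) x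
            = germ_class M \<Phi> q (\<lambda>y. 0) x))"

text \<open>A family of bivectors (antisymmetric biderivations) all of whose linear combinations are Poisson.\<close>
definition quot_poisson_pencil ::
    "('s, 'c) GL_variety \<Rightarrow> ('c point \<Rightarrow> 's entry point) \<Rightarrow> 's entry point \<Rightarrow> 'c point set
      \<Rightarrow> 'k set \<Rightarrow> ('k \<Rightarrow> 'c fibre_section \<Rightarrow> 'c fibre_section \<Rightarrow> 'c fibre_section) \<Rightarrow> bool" where
  "quot_poisson_pencil M \<Phi> q Z K \<beta> \<longleftrightarrow>
     (\<forall>k\<in>K. quot_bracket M \<Phi> q Z (\<beta> k)) \<and>
     (\<forall>K\<^sub>0 w. finite K\<^sub>0 \<and> K\<^sub>0 \<subseteq> K \<longrightarrow>
        (let \<gamma> = (\<lambda>\<sigma> \<tau>. section_comb M \<Phi> q K\<^sub>0 w (\<lambda>k. \<beta> k \<sigma> \<tau>))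
         in quot_bracket M \<Phi> q Z \<gamma> \<and> quot_jacobi M \<Phi> q Z \<gamma>))"

text \<open>The bracket on the quotient is computed by evaluating the bivector on arbitrary local lifts.\<close>
definition induces_bracket ::
    "('s, 'c) GL_variety \<Rightarrow> ('c point \<Rightarrow> 's entry point) \<Rightarrow> 's entry point \<Rightarrow> 'c point set
      \<Rightarrow> 'c tensor2 \<Rightarrow> ('c fibre_section \<Rightarrow> 'c fibre_section \<Rightarrow> 'c fibre_section) \<Rightarrow> bool" where
  "induces_bracket M \<Phi> q Z P \<beta> \<longleftrightarrow>
     (\<forall>U. quot_open M Z U \<longrightarrow>
       (\<forall>\<sigma>\<in>quot_functions M \<Phi> q Z U. \<forall>\<tau>\<in>quot_functions M \<Phi> q Z U. \<forall>x\<in>quot_preimage M Z U.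
          \<forall>f\<in>\<sigma> x. \<forall>h\<in>\<tau> x. \<beta> \<sigma> \<tau> x = germ_class M \<Phi> q (bivector_bracket (coords M) P f h) x))"

definition descends_to_poisson_pencil ::
    "('s, 'c) GL_variety \<Rightarrow> ('c point \<Rightarrow> 's entry point) \<Rightarrow> 's entry point \<Rightarrow> 'c point set
      \<Rightarrow> 'c tensor2 \<Rightarrow> 'j set \<Rightarrow> ('j \<Rightarrow> 'c tensor2) \<Rightarrow> bool" where
  "descends_to_poisson_pencil M \<Phi> q Z P\<^sub>0 J Pf \<longleftrightarrow>
     (\<exists>\<beta>. induces_bracket M \<Phi> q Z P\<^sub>0 (\<beta> None) \<and>
          (\<forall>j\<in>J. induces_bracket M \<Phi> q Z (Pf j) (\<beta> (Some j))) \<and>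
          quot_poisson_pencil M \<Phi> q Z (insert None (Some ` J)) \<beta>)"


section \<open>Quivers and their representation spaces\<close>

text \<open>A quiver is a \<^locale>\<open>fin_digraph\<close>; \<^term>\<open>Inr a\<close> is the arrow \<open>a\<^sup>*\<close> of the double.\<close>
definition double :: "('s, 'e) pre_digraph \<Rightarrow> ('s, 'e + 'e) pre_digraph" where
  "double Q = \<lparr>verts = verts Q, arcs = Inl ` arcs Q \<union> Inr ` arcs Q,
     tail = case_sum (tail Q) (head Q), head = case_sum (head Q) (tail Q)\<rparr>"

definition star :: "'e + 'e \<Rightarrow> 'e + 'e" where
  "star = case_sum Inr Inl"

definition eps :: "'e + 'e \<Rightarrow> complex" where
  "eps = case_sum (\<lambda>_. 1) (\<lambda>_. -1)"

context
  fixes Q :: "('s, 'e) pre_digraph" and n :: "'s \<Rightarrow> nat"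
begin

definition row_dim :: "'e + 'e \<Rightarrow> nat" where
  "row_dim a = n (tail (double Q) a)"

definition col_dim :: "'e + 'e \<Rightarrow> nat" where
  "col_dim a = n (head (double Q) a)"

definition rep_coords :: "('e + 'e) entry set" where
  "rep_coords = entries (arcs (double Q)) row_dim col_dim"

definition rep_mat :: "('e + 'e) entry point \<Rightarrow> 'e + 'e \<Rightarrow> complex mat" where
  "rep_mat x a = block row_dim col_dim x a"

definition one_plus :: "'e + 'e \<Rightarrow> ('e + 'e) entry point \<Rightarrow> complex mat" where
  "one_plus a x = 1\<^sub>m (row_dim a) + rep_mat x a * rep_mat x (star a)"

definition rep_action ::
    "'s entry point \<Rightarrow> ('e + 'e) entry point \<Rightarrow> ('e + 'e) entry point" where
  "rep_action g x = of_blocks (arcs (double Q)) row_dim col_dim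
     (\<lambda>a. block n n g (tail (double Q) a) * rep_mat x a * minv (block n n g (head (double Q) a)))"

definition open_rep_variety :: "('s, ('e + 'e) entry) GL_variety" where
  "open_rep_variety = \<lparr>gverts = verts Q, gdim = n, coords = rep_coords,
     points = {x \<in> affine_space rep_coords. \<forall>a\<in>arcs (double Q). Determinant.det (one_plus a x) \<noteq> 0},
     act = rep_action\<rparr>"

text \<open>
  \<open>Id + X\<^sub>a X\<^sub>a\<^sub>*\<close> as a block diagonal matrix: it differs from the identity only in the block at \<open>t(a)\<close>.
\<close>
definition arrow_factor :: "'e + 'e \<Rightarrow> ('e + 'e) entry point \<Rightarrow> 's entry point" where
  "arrow_factor a x = of_blocks (verts Q) n n
     (\<lambda>s. if s = tail (double Q) a then one_plus a x else 1\<^sub>m (n s))"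

definition signed_factor :: "'e + 'e \<Rightarrow> ('e + 'e) entry point \<Rightarrow> 's entry point" where
  "signed_factor a x =
     (if eps a = 1 then arrow_factor a x else ginv (verts Q) n (arrow_factor a x))"

text \<open>
  A total ordering of the arrows of the double is given by the list \<^term>\<open>ord\<close> of these arrows in
  increasing order.
\<close>
definition vdb_moment :: "('e + 'e) list \<Rightarrow> ('e + 'e) entry point \<Rightarrow> 's entry point" where
  "vdb_moment ord x = foldr (\<lambda>a g. gmul (verts Q) n (signed_factor a x) g) ord (gone (verts Q) n)"

definition partial_mat :: "'e + 'e \<Rightarrow> nat \<Rightarrow> nat \<Rightarrow> ('e + 'e) entry point" where
  "partial_mat a i j = unit_pt (a, j, i)"

text \<open>The entries of \<open>\<partial>\<^sub>a\<^sub>* X\<^sub>a\<^sub>* - X\<^sub>a \<partial>\<^sub>a\<close>, a matrix of vector fields of size \<open>n\<^sub>t\<^sub>(\<^sub>a\<^sub>) \<times> n\<^sub>t\<^sub>(\<^sub>a\<^sub>)\<close>.\<close>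
definition fusion_mat ::
    "('e + 'e) entry point \<Rightarrow> 'e + 'e \<Rightarrow> nat \<Rightarrow> nat \<Rightarrow> ('e + 'e) entry point" where
  "fusion_mat x a i k = (\<lambda>c. \<Sum>j<col_dim a.
     partial_mat (star a) i j c * rep_mat x (star a) $$ (j, k)
     - rep_mat x a $$ (i, j) * partial_mat a j k c)"

text \<open>
  Van den Bergh's bivector; in the second sum the trace vanishes unless the two arrows have the same
  tail, since the two matrices are then nonzero in different diagonal blocks.
\<close>
definition vdb_bivector :: "('e + 'e) list \<Rightarrow> ('e + 'e) entry tensor2" where
  "vdb_bivector ord x c d =
     1/2 * (\<Sum>a\<in>arcs (double Q). eps a *
       (\<Sum>i<col_dim a. \<Sum>k<col_dim a. \<Sum>j<row_dim a.
          one_plus (star a) x $$ (i, k) * wedge2 (partial_mat a k j) (partial_mat (star a) j i) c d))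
     - 1/2 * (\<Sum>q<length ord. \<Sum>p<q.
         if tail (double Q) (ord ! p) = tail (double Q) (ord ! q) then
           (\<Sum>i<row_dim (ord ! p). \<Sum>k<row_dim (ord ! p).
              wedge2 (fusion_mat x (ord ! p) i k) (fusion_mat x (ord ! q) k i) c d)
         else 0)"

text \<open>\<open>d log det (Id + X\<^sub>a X\<^sub>a\<^sub>*)\<close>, that is \<open>tr ((Id + X\<^sub>a X\<^sub>a\<^sub>*)\<^sup>-\<^sup>1 d(X\<^sub>a X\<^sub>a\<^sub>*))\<close>.\<close>
definition dlogdet :: "'e + 'e \<Rightarrow> ('e + 'e) entry point \<Rightarrow> ('e + 'e) entry point \<Rightarrow> complex" where
  "dlogdet a x X = gtrace (verts Q) n (pull_thetaL (verts Q) n rep_coords (arrow_factor a) x X)"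

text \<open>
  Writing \<open>\<Phi>\<^sub>a = (Id + X\<^sub>a X\<^sub>a\<^sub>*)\<^sup>\<epsilon>\<^sup>(\<^sup>a\<^sup>)\<close> and \<open>\<Phi>\<^sub><\<^sub>a\<close> for the ordered product of the \<open>\<Phi>\<^sub>b\<close> with \<open>b < a\<close>, this is
  \<open>- 1/2 \<Sum>\<^sub>a \<epsilon>(a) tr ((Id + X\<^sub>a X\<^sub>a\<^sub>*)\<^sup>-\<^sup>1 dX\<^sub>a \<and> dX\<^sub>a\<^sub>*) - 1/2 \<Sum>\<^sub>a tr (\<Phi>\<^sub><\<^sub>a\<^sup>-\<^sup>1 d\<Phi>\<^sub><\<^sub>a \<and> d\<Phi>\<^sub>a \<Phi>\<^sub>a\<^sup>-\<^sup>1)\<close>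
  \<open>+ \<Sum>\<^sub>(\<^sub>a\<^sub>,\<^sub>b\<^sub>) w(a,b) d log det (Id + X\<^sub>a X\<^sub>a\<^sub>*) \<and> d log det (Id + X\<^sub>b X\<^sub>b\<^sub>*)\<close>,
  the last sum being over the pairs of arrows of \<open>Q\<close> in \<^term>\<open>J\<^sub>0\<close>.
\<close>
definition pencil_form ::
    "('e + 'e) list \<Rightarrow> ('e \<times> 'e) set \<Rightarrow> ('e \<times> 'e \<Rightarrow> complex) \<Rightarrow> ('e + 'e) entry tensor2" where
  "pencil_form ord J\<^sub>0 w x c d =
     (if c \<in> rep_coords \<and> d \<in> rep_coords then
       (let u = unit_pt c; v = unit_pt d;
            S = verts Q;
            term1 = (\<lambda>a X Y. mtrace (minv (one_plus a x) * rep_mat X a * rep_mat Y (star a)));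
            term2 = (\<lambda>p X Y. trace_form S n
                       (pull_thetaL S n rep_coords (vdb_moment (take p ord)) x X)
                       (pull_thetaR S n rep_coords (signed_factor (ord ! p)) x Y));
            term3 = (\<lambda>a b X Y. dlogdet (Inl a) x X * dlogdet (Inl b) x Y)
        in - 1/2 * (\<Sum>a\<in>arcs (double Q). eps a * (term1 a u v - term1 a v u))
           - 1/2 * (\<Sum>p<length ord. term2 p u v - term2 p v u)
           + (\<Sum>(a, b)\<in>J\<^sub>0. w (a, b) * (term3 a b u v - term3 a b v u)))
      else 0)"

text \<open>In each family \<open>V\<close> the members are subspaces of the spaces \<open>\<complex>\<^sup>n\<^sup>(\<^sup>s\<^sup>)\<close>, jointly not the whole space.\<close>
definition semistable :: "('s \<Rightarrow> rat) \<Rightarrow> ('e + 'e) entry point \<Rightarrow> bool" where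
  "semistable \<theta> x \<longleftrightarrow>
     (\<forall>V. (\<forall>s\<in>verts Q. VectorSpace.subspace class_ring (V s) (module_vec TYPE(complex) (n s))) \<and>
          (\<exists>s\<in>verts Q. V s \<noteq> carrier_vec (n s)) \<and>
          (\<forall>a\<in>arcs (double Q). \<forall>v\<in>V (head (double Q) a). rep_mat x a *\<^sub>v v \<in> V (tail (double Q) a))
      \<longrightarrow> (\<Sum>s\<in>verts Q. \<theta> s * of_nat (vectorspace.dim class_ring
              (module_vec TYPE(complex) (n s)\<lparr>carrier := V s\<rparr>))) \<le> 0)"

definition scalar_elt :: "('s \<Rightarrow> complex) \<Rightarrow> 's entry point" where
  "scalar_elt q = of_blocks (verts Q) n n (\<lambda>s. q s \<cdot>\<^sub>m 1\<^sub>m (n s))"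

definition semistable_fibre ::
    "('e + 'e) list \<Rightarrow> ('s \<Rightarrow> complex) \<Rightarrow> ('s \<Rightarrow> rat) \<Rightarrow> ('e + 'e) entry point set" where
  "semistable_fibre ord q \<theta> =
     {x \<in> points open_rep_variety. semistable \<theta> x \<and> vdb_moment ord x = scalar_elt q}"

end

definition multiplicative_quiver_variety ::
    "('s, 'e) pre_digraph \<Rightarrow> ('s \<Rightarrow> nat) \<Rightarrow> ('e + 'e) list \<Rightarrow> ('s \<Rightarrow> complex) \<Rightarrow> ('s \<Rightarrow> rat)
      \<Rightarrow> ('e + 'e) entry point set set" where
  "multiplicative_quiver_variety Q n ord q \<theta> =
     good_quotient (open_rep_variety Q n) (semistable_fibre Q n ord q \<theta>)"

end

theory Submission
  imports Defs
begin

text \<open>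
  The Euler fields \<open>tr (X\<^sub>a \<partial>\<^sub>a - X\<^sub>a\<^sub>* \<partial>\<^sub>a\<^sub>*)\<close> of the arrows \<open>a\<close> of \<open>Q\<close> commute with each other and fix
  \<open>Id + X\<^sub>a X\<^sub>a\<^sub>*\<close>, hence the moment map; up to sign they are the Hamiltonian fields of \<open>log det (Id + X\<^sub>a X\<^sub>a\<^sub>*)\<close>.  The pencil
  is spanned by their wedge products, which on the side of 2-forms correspond to the closed forms
  \<open>d log det \<and> d log det\<close>.  The bivector of a single pair \<open>(a, a\<^sup>*)\<close> is checked directly, and fusion along
  the order of the arrows makes the cubic terms of \<open>[P, P]\<close> and of \<open>d\<omega>\<close> telescope.  For the reduction,
  functions on the quotient are invariant germs modulo the ideal of the fibre of the moment map: this ideal is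
  stable under the infinitesimal action, and the moment map condition makes it stable under brackets with
  invariant germs, for which the Jacobiator, being \<open>\<phi>\<^sub>M\<close> up to a factor, lies in the ideal.
\<close>

section \<open>Finitely supported matrices with a unit adjoined\<close>

text \<open>The weights of the pencil enter \<open>spin\<close> only through scalars, and scalars
  drop out of the cubic form tr(x[y, z]). One computation with arbitrary antisymmetric
  \<open>k\<close> therefore gives [P, P] for every element of the pencil at once. On the side of
  forms the same scalars reappear as derivatives of log det and are matched by \<open>form2\<close>.
  Non-degeneracy is read off from the explicit composition of bivector and form, which splits a
  tangent vector and yields both surjectivity and injectivity. The obstacle in the reduction is
  twofold: germs are known only modulo an ideal, the fibre having its possibly non-reduced scheme
  structure, and invariance is given under the group while brackets involve vector fields. A limit
  inside an ideal is replaced by linear algebra: along the flow, polynomials are finite sums of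
  functions of t times functions of the point. The number |Q|(|Q| - 1)/2 arises from one pair for
  each two-element set of arrows of Q; independence is tested where the starred matrices vanish and
  each other matrix has a single entry 1.\<close>

text \<open>
  On the algebra \<open>\<complex> \<oplus> {finitely supported matrices}\<close> the trace of the second summand satisfies
  \<open>tr (x y) = tr (y x)\<close> without side conditions.  Blocks of all sizes live in this one ring, so that
  identities between quiver data need no dimension bookkeeping.
\<close>

typedef 'i umat = "{(c :: complex, F :: 'i => 'i => complex). finite {(i, j). F i j \<noteq> 0}}"
  by (rule exI[of _ "(0, \<lambda>_ _. 0)"]) auto

definition sca :: "'i umat => complex" where "sca A = fst (Rep_umat A)"

definition ent :: "'i umat => 'i => 'i => complex" where "ent A = snd (Rep_umat A)"

definition umat :: "complex => ('i => 'i => complex) => 'i umat" where "umat c F = Abs_umat (c, F)"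

text \<open>Row and column indices are put together, so that the middle index of a product can be
  summed over the same kind of finite set from either side.\<close>

definition idx :: "'i umat => 'i set" where "idx A = (\<Union>(i, j)\<in>{(i, j). ent A i j \<noteq> 0}. {i, j})"

lemma finite_ent: "finite {(i, j). ent A i j \<noteq> 0}" using Rep_umat[of A] by (auto simp: ent_def split_beta)

lemma finite_idx [simp]: "finite (idx A)" unfolding idx_def using finite_ent[of A] by auto

lemma ent_outside: "i \<notin> idx A \<or> j \<notin> idx A ==> ent A i j = 0" by (auto simp: idx_def)

lemma ent_nonzero: "ent A i j \<noteq> 0 ==> i \<in> idx A \<and> j \<in> idx A" by (auto simp: idx_def)

lemma umat_eqI: "sca A = sca B ==> (\<And>i j. ent A i j = ent B i j) ==> A = B"
  by (metis Rep_umat_inject ent_def ext prod_eqI sca_def)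

lemma finite_support_subset:
  assumes "finite K" "\<And>i j. F i j \<noteq> 0 ==> i \<in> K \<and> j \<in> K"
  shows "finite {(i, j). F i j \<noteq> (0 :: complex)}"
  by (rule finite_subset[of _ "K \<times> K"]) (use assms in auto)

lemma
  assumes "finite K" "\<And>i j. F i j \<noteq> 0 ==> i \<in> K \<and> j \<in> K"
  shows sca_umat: "sca (umat c F) = c" and ent_umat: "ent (umat c F) = F"
  using finite_support_subset[OF assms] by (auto simp: sca_def ent_def umat_def Abs_umat_inverse)

instantiation umat :: (type) ring_1
begin

definition zero_umat :: "'a umat" where "0 = umat 0 (\<lambda>_ _. 0)"
definition one_umat :: "'a umat" where "1 = umat 1 (\<lambda>_ _. 0)"
definition plus_umat :: "'a umat => 'a umat => 'a umat" where
  "A + B = umat (sca A + sca B) (\<lambda>i j. ent A i j + ent B i j)"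
definition uminus_umat :: "'a umat => 'a umat" where "- A = umat (- sca A) (\<lambda>i j. - ent A i j)"
definition minus_umat :: "'a umat => 'a umat => 'a umat" where
  "A - B = umat (sca A - sca B) (\<lambda>i j. ent A i j - ent B i j)"
definition times_umat :: "'a umat => 'a umat => 'a umat" where "A * B = umat (sca A * sca B)
     (\<lambda>i j. sca A * ent B i j + ent A i j * sca B + (\<Sum>k\<in>idx A. ent A i k * ent B k j))"

lemma sca_0 [simp]: "sca (0 :: 'a umat) = 0" and ent_0 [simp]: "ent (0 :: 'a umat) i j = 0"
  by (simp_all add: zero_umat_def sca_umat[of "{}"] ent_umat[of "{}"])

lemma sca_1 [simp]: "sca (1 :: 'a umat) = 1" and ent_1 [simp]: "ent (1 :: 'a umat) i j = 0"
  by (simp_all add: one_umat_def sca_umat[of "{}"] ent_umat[of "{}"])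

lemma sca_uminus [simp]: "sca (- A :: 'a umat) = - sca A"
  and ent_uminus [simp]: "ent (- A :: 'a umat) i j = - ent A i j" unfolding uminus_umat_def
  by (subst sca_umat[of "idx A"] ent_umat[of "idx A"]; auto dest: ent_nonzero)+

lemma sca_add [simp]: "sca (A + B :: 'a umat) = sca A + sca B"
  and ent_add [simp]: "ent (A + B :: 'a umat) i j = ent A i j + ent B i j" unfolding plus_umat_def
  by (subst sca_umat[of "idx A \<union> idx B"] ent_umat[of "idx A \<union> idx B"];
      auto; metis add.right_neutral ent_outside)+

lemma sca_diff [simp]: "sca (A - B :: 'a umat) = sca A - sca B"
  and ent_diff [simp]: "ent (A - B :: 'a umat) i j = ent A i j - ent B i j" unfolding minus_umat_def
  by (subst sca_umat[of "idx A \<union> idx B"] ent_umat[of "idx A \<union> idx B"];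
      auto; metis diff_zero ent_outside)+

lemma
  shows sca_mult [simp]: "sca (A * B :: 'a umat) = sca A * sca B"
  and ent_mult: "ent (A * B :: 'a umat) i j =
    sca A * ent B i j + ent A i j * sca B + (\<Sum>k\<in>idx A. ent A i k * ent B k j)"
proof -
  have *: "i \<in> idx A \<union> idx B \<and> j \<in> idx A \<union> idx B"
    if "sca A * ent B i j + ent A i j * sca B + (\<Sum>k\<in>idx A. ent A i k * ent B k j) \<noteq> 0" for i j
  proof (rule ccontr)
    assume "\<not> ?thesis"
    hence "ent A i j = 0" "ent B i j = 0" "\<forall>k. ent A i k = 0 \<or> ent B k j = 0" by (auto simp: ent_outside)
    hence "(\<Sum>k\<in>idx A. ent A i k * ent B k j) = 0" by (auto intro!: sum.neutral)
    with that show False by (simp add: \<open>ent A i j = 0\<close> \<open>ent B i j = 0\<close>)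
  qed
  show "sca (A * B) = sca A * sca B"
    unfolding times_umat_def by (rule sca_umat[of "idx A \<union> idx B"]) (use * in auto)
  show "ent (A * B) i j = sca A * ent B i j + ent A i j * sca B + (\<Sum>k\<in>idx A. ent A i k * ent B k j)"
    unfolding times_umat_def by (subst ent_umat[of "idx A \<union> idx B"]) (use * in auto)
qed

text \<open>An entry of either factor vanishes as soon as the middle index leaves its support, so
  every finite set containing the common indices may replace \<open>idx A\<close>. Associativity and
  \<open>tr_comm\<close> need one such set for all products involved.\<close>

lemma ent_mult_on:
  assumes "finite K" "\<And>k. k \<in> idx A \<inter> idx B ==> k \<in> K"
  shows "ent (A * B :: 'a umat) i j = sca A * ent B i j + ent A i j * sca B + (\<Sum>k\<in>K. ent A i k * ent B k j)"
proof -
  have "(\<Sum>k\<in>idx A. ent A i k * ent B k j) = (\<Sum>k\<in>idx A \<inter> idx B. ent A i k * ent B k j)"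
    by (rule sum.mono_neutral_right) (auto simp: ent_outside)
  also have "\<dots> = (\<Sum>k\<in>K. ent A i k * ent B k j)"
    by (rule sum.mono_neutral_left) (use assms in "auto dest: ent_nonzero")
  finally show ?thesis by (simp add: ent_mult)
qed

instance
proof
  fix A B C :: "'a umat"
  let ?K = "idx A \<union> idx B \<union> idx C"
  have AB: "ent (A * B) i j = sca A * ent B i j + ent A i j * sca B + (\<Sum>k\<in>?K. ent A i k * ent B k j)"
    and BC: "ent (B * C) i j = sca B * ent C i j + ent B i j * sca C + (\<Sum>k\<in>?K. ent B i k * ent C k j)"
    for i j by (rule ent_mult_on; auto)+
  have iAB: "idx (A * B) \<subseteq> ?K"
  proof
    fix k assume "k \<in> idx (A * B)"
    then obtain l where "ent (A * B) k l \<noteq> 0 \<or> ent (A * B) l k \<noteq> 0" unfolding idx_def by auto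
    thus "k \<in> ?K" by (rule contrapos_pp) (auto simp: ent_mult ent_outside intro!: sum.neutral)
  qed
  show "A * B * C = A * (B * C)"
  proof (rule umat_eqI)
    fix i j
    have "ent (A * B * C) i j = sca (A * B) * ent C i j + ent (A * B) i j * sca C
        + (\<Sum>k\<in>?K. ent (A * B) i k * ent C k j)" by (rule ent_mult_on) (use iAB in auto)
    also have "\<dots> = sca A * ent (B * C) i j + ent A i j * sca (B * C)
        + (\<Sum>k\<in>?K. ent A i k * ent (B * C) k j)"
      using sum.swap[of "\<lambda>k l. ent A i l * (ent B l k * ent C k j)" ?K ?K]
      by (simp add: AB BC algebra_simps sum.distrib sum_distrib_left sum_distrib_right)
    also have "\<dots> = ent (A * (B * C)) i j" by (rule ent_mult_on[symmetric]) auto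
    finally show "ent (A * B * C) i j = ent (A * (B * C)) i j" .
  qed (simp add: algebra_simps)
  show "(A + B) * C = A * C + B * C"
  proof (rule umat_eqI)
    fix i j
    show "ent ((A + B) * C) i j = ent (A * C + B * C) i j" by (subst ent_add, subst (1 2 3) ent_mult_on[of "idx C"])
        (auto simp: algebra_simps sum.distrib)
  qed (simp add: algebra_simps)
  show "A * (B + C) = A * B + A * C" by (rule umat_eqI) (simp_all add: ent_mult algebra_simps sum.distrib)
  show "(0 :: 'a umat) \<noteq> 1" by (metis sca_0 sca_1 zero_neq_one)
qed (rule umat_eqI; auto simp: ent_mult algebra_simps idx_def)+

end

definition tr :: "'i umat => complex" where "tr A = (\<Sum>i\<in>idx A. ent A i i)"

lemma tr_on: "finite K ==> (\<And>i. ent A i i \<noteq> 0 ==> i \<in> K) ==> tr A = (\<Sum>i\<in>K. ent A i i)"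
  unfolding tr_def by (rule trans[OF sum.mono_neutral_right[of _ "{i. ent A i i \<noteq> 0}"] sum.mono_neutral_left])
    (auto dest: ent_nonzero)

lemma tr_0 [simp]: "tr 0 = 0" and tr_1 [simp]: "tr 1 = 0" by (simp_all add: tr_def)

lemma tr_add: "tr (A + B) = tr A + tr B"
proof -
  have "tr X = (\<Sum>i\<in>idx A \<union> idx B. ent X i i)" if "X = A \<or> X = B \<or> X = A + B" for X
    by (rule tr_on) (use that ent_outside in force)+
  thus ?thesis by (simp add: sum.distrib)
qed

lemma tr_uminus: "tr (- A) = - tr A" using tr_add[of A "- A"] by (simp add: eq_neg_iff_add_eq_0 add.commute)

lemma tr_diff: "tr (A - B) = tr A - tr B" using tr_add[of A "- B"] by (simp add: tr_uminus)

lemma tr_sum: "tr (sum f S) = (\<Sum>s\<in>S. tr (f s))"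
  by (induction S rule: infinite_finite_induct) (auto simp: tr_add)

text \<open>The scalar parts are numbers, so the two mixed terms are exchanged together with the
  factors; the remaining double sum over the union of the supports is symmetric under exchange of
  its indices. Since \<open>tr 1 = 0\<close>, no trace of an infinite identity matrix
  arises.\<close>

lemma tr_comm: "tr (A * B) = tr (B * A)"
proof -
  let ?K = "idx A \<union> idx B"
  have 1: "tr (X * Y) = sca X * (\<Sum>i\<in>?K. ent Y i i) + (\<Sum>i\<in>?K. ent X i i) * sca Y
      + (\<Sum>i\<in>?K. \<Sum>k\<in>?K. ent X i k * ent Y k i)" if "X = A \<and> Y = B \<or> X = B \<and> Y = A" for X Y
  proof -
    have e: "ent (X * Y) i i = sca X * ent Y i i + ent X i i * sca Y + (\<Sum>k\<in>?K. ent X i k * ent Y k i)"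
      for i by (rule ent_mult_on) (use that in auto)
    have "tr (X * Y) = (\<Sum>i\<in>?K. ent (X * Y) i i)"
    proof (rule tr_on)
      show "i \<in> ?K" if "ent (X * Y) i i \<noteq> 0" for i
      proof (rule ccontr)
        assume "i \<notin> ?K"
        hence "ent (X * Y) i i = 0" using \<open>X = A \<and> Y = B \<or> X = B \<and> Y = A\<close> unfolding e
          by (auto simp: ent_outside intro!: sum.neutral)
        with that show False by simp
      qed
    qed simp
    thus ?thesis by (simp add: e sum.distrib sum_distrib_left sum_distrib_right)
  qed
  show ?thesis using sum.swap[of "\<lambda>i k. ent A i k * ent B k i" ?K ?K]
    by (simp add: 1[of A B] 1[of B A] mult.commute)
qed

definition scl :: "complex => 'i umat" where "scl c = umat c (\<lambda>_ _. 0)"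

lemma sca_scl [simp]: "sca (scl c) = c" and ent_scl [simp]: "ent (scl c) i j = 0"
  by (simp_all add: scl_def sca_umat[of "{}"] ent_umat[of "{}"])

lemma idx_scl [simp]: "idx (scl c) = {}" by (auto simp: idx_def)

lemma ent_scl_mult [simp]: "ent (scl c * A) i j = c * ent A i j" by (simp add: ent_mult)

lemma scl_commute: "A * scl c = scl c * A" by (rule umat_eqI) (simp_all add: ent_mult mult.commute)

lemma scl_1 [simp]: "scl 1 = 1" and scl_0 [simp]: "scl 0 = 0" by (rule umat_eqI; simp)+

lemma scl_mult: "scl (c * d) = scl c * scl d" and scl_uminus: "scl (- c) = - scl c" by (rule umat_eqI; simp)+

lemma tr_scl_mult: "tr (scl c * A) = c * tr A"
proof -
  have "tr (scl c * A) = (\<Sum>i\<in>idx A. ent (scl c * A) i i)" by (rule tr_on) (auto dest: ent_nonzero)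
  thus ?thesis by (simp add: tr_def sum_distrib_left)
qed

lemma tr_scl [simp]: "tr (scl c) = 0" by (simp add: tr_def)

lemma sca_sum: "sca (sum f S) = (\<Sum>s\<in>S. sca (f s))"
  and ent_sum: "ent (sum f S) i j = (\<Sum>s\<in>S. ent (f s) i j)" by (induction S rule: infinite_finite_induct) auto

section \<open>Rectangular blocks\<close>

type_synonym ('e, 'i) fam = "'e + 'e => 'i umat"

text \<open>The vertices are part of the indices, so blocks with different inner vertices multiply
  to 0, as non-composable paths do, while composable ones multiply as matrices.\<close>

definition um :: "'s => 's => complex mat => ('s \<times> nat) umat" where "um s t A = umat 0 (\<lambda>(p, i) (q, j).
     if p = s \<and> q = t \<and> i < dim_row A \<and> j < dim_col A then A $$ (i, j) else 0)"

lemma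
  shows sca_um [simp]: "sca (um s t A) = 0"
  and ent_um: "ent (um s t A) (p, i) (q, j) =
    (if p = s \<and> q = t \<and> i < dim_row A \<and> j < dim_col A then A $$ (i, j) else 0)"
proof -
  let ?K = "{s} \<times> {..<dim_row A} \<union> {t} \<times> {..<dim_col A}"
  have *: "x \<in> ?K \<and> y \<in> ?K"
    if "(case x of (p, i) => \<lambda>(q, j). if p = s \<and> q = t \<and> i < dim_row A \<and> j < dim_col A
      then A $$ (i, j) else 0) y \<noteq> 0" for x y using that by (auto split: prod.splits if_splits)
  show "sca (um s t A) = 0" unfolding um_def by (rule sca_umat[of ?K]) (use * in auto)
  show "ent (um s t A) (p, i) (q, j) =
    (if p = s \<and> q = t \<and> i < dim_row A \<and> j < dim_col A then A $$ (i, j) else 0)"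
    unfolding um_def by (subst ent_umat[of ?K]) (use * in auto)
qed

lemma um_eqI:
  assumes "sca A = 0" "\<And>p i q j. ent A (p, i) (q, j) =
    (if p = s \<and> q = t \<and> i < dim_row B \<and> j < dim_col B then B $$ (i, j) else 0)" shows "A = um s t B"
  by (rule umat_eqI) (use assms in "auto simp: ent_um split_paired_all")

lemma um_mult:
  assumes "dim_col A = dim_row B"
  shows "um s t A * um t u B = um s u (A * B)"
proof (rule um_eqI)
  fix p i q j
  let ?K = "Pair t ` {..<dim_col A}" and ?e = "\<lambda>k. ent (um s t A) (p, i) k * ent (um t u B) k (q, j)"
  let ?r = "if p = s \<and> q = u \<and> i < dim_row (A * B) \<and> j < dim_col (A * B) then (A * B) $$ (i, j) else 0"
  have "ent (um s t A * um t u B) (p, i) (q, j) = (\<Sum>k\<in>?K. ?e k)"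
  proof (subst ent_mult)
    have "(\<Sum>k\<in>idx (um s t A). ?e k) = (\<Sum>k\<in>{k \<in> ?K. ent (um s t A) (p, i) k \<noteq> 0}. ?e k)"
      by (rule sum.mono_neutral_right) (auto dest: ent_nonzero simp: ent_um split: if_splits)
    also have "\<dots> = (\<Sum>k\<in>?K. ?e k)" by (rule sum.mono_neutral_left) auto
    finally show "sca (um s t A) * ent (um t u B) (p, i) (q, j) + ent (um s t A) (p, i) (q, j) * sca (um t u B)
       + (\<Sum>k\<in>idx (um s t A). ?e k) = (\<Sum>k\<in>?K. ?e k)" by simp qed
  also have "\<dots> = (\<Sum>k<dim_col A. ent (um s t A) (p, i) (t, k) * ent (um t u B) (t, k) (q, j))"
    by (subst sum.reindex) (auto simp: inj_on_def)
  also have "\<dots> = ?r" using assms by (auto simp: ent_um times_mat_def scalar_prod_def atLeast0LessThan)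
  finally show "ent (um s t A * um t u B) (p, i) (q, j) = ?r" .
qed simp

lemma um_mult_ne: "t \<noteq> t' ==> um s t A * um t' u B = 0"
  by (rule umat_eqI) (auto simp: ent_mult ent_um split_paired_all intro!: sum.neutral)

lemma um_add: "dim_row A = dim_row B ==> dim_col A = dim_col B ==> um s t (A + B) = um s t A + um s t B"
  by (rule um_eqI[symmetric]) (auto simp: ent_um)

lemma um_diff: "dim_row A = dim_row B ==> dim_col A = dim_col B ==> um s t (A - B) = um s t A - um s t B"
  by (rule um_eqI[symmetric]) (auto simp: ent_um)

lemma um_smult: "um s t (c \<cdot>\<^sub>m A) = scl c * um s t A" by (rule um_eqI[symmetric]) (auto simp: ent_um)

lemma um_zero [simp]: "um s t (0\<^sub>m r c) = 0" by (rule um_eqI[symmetric]) auto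

lemma tr_um:
  assumes "dim_row A = dim_col A"
  shows "tr (um s s A) = mtrace A"
proof -
  have "tr (um s s A) = (\<Sum>i\<in>Pair s ` {..<dim_row A}. ent (um s s A) i i)"
    by (rule tr_on) (auto simp: ent_um split: if_splits)
  also have "\<dots> = (\<Sum>i<dim_row A. ent (um s s A) (s, i) (s, i))"
    by (subst sum.reindex) (auto simp: inj_on_def)
  finally show ?thesis using assms by (simp add: ent_um mtrace_def)
qed

section \<open>The bivector in terms of traces\<close>

text \<open>
  Tangent vectors and covectors of the representation space are families \<open>V\<close>, \<open>A\<close> of ring
  elements indexed by the arrows, with pairing \<open>\<Sum>\<^sub>a tr (A\<^sub>a V\<^sub>a)\<close>.
\<close>

definition pairing :: "'a set => ('a => 'i umat) => ('a => 'i umat) => complex" where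
  "pairing R A V = (\<Sum>a\<in>R. tr (A a * V a))"

text \<open>The contribution of \<open>a\<close> to the moment matrix at its tail: by
  \<open>sum_fus_dual\<close> and \<open>pairing_vact\<close> it is, up to sign, the transpose of
  the action \<open>vact\<close> with respect to the parameter at \<open>a\<close>.\<close>

definition fus :: "('e, 'i) fam => ('e, 'i) fam => ('e, 'i) fam" where
  "fus X A a = A (star a) * X (star a) - X a * A a"

text \<open>The infinitesimal action with an independent parameter for each arrow, acting at its
  tail; the head of \<open>a\<close> is the tail of \<open>star a\<close>. A constant
  \<open>s\<close> is the action of the Lie algebra, and the independent parameters are what fusion
  couples.\<close>

definition vact :: "('e, 'i) fam => ('e, 'i) fam => ('e, 'i) fam" where "vact s V a = s a * V a - V a * s (star a)"

definition cact :: "('e, 'i) fam => ('e, 'i) fam => ('e, 'i) fam" where "cact s A a = s (star a) * A a - A a * s a"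

definition biv0 :: "('e + 'e) set => ('e, 'i) fam => ('e, 'i) fam => ('e, 'i) fam => complex" where
  "biv0 R X A B = 1/2 * (\<Sum>a\<in>R. eps a * tr ((1 + X (star a) * X a) * (A a * B (star a) - B a * A (star a))))"

text \<open>The derivative of \<open>biv0\<close> at \<open>X\<close> along \<open>V\<close> with
  constant covectors, written out in advance so that the Jacobi identity becomes an identity of
  traces without any analysis.\<close>

definition dbiv0 :: "('e + 'e) set => ('e, 'i) fam => ('e, 'i) fam => ('e, 'i) fam => ('e, 'i) fam => complex" where
  "dbiv0 R X V A B = 1/2 * (\<Sum>a\<in>R. eps a *
     tr ((V (star a) * X a + X (star a) * V a) * (A a * B (star a) - B a * A (star a))))"

text \<open>Twice the contraction of the covector \<open>A\<close> with \<^const>\<open>biv0\<close>.\<close>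
definition sharp0 :: "('e, 'i) fam => ('e, 'i) fam => ('e, 'i) fam" where
  "sharp0 X A a = - scl (eps a) * (A (star a) + A (star a)
     + X a * X (star a) * A (star a) + A (star a) * X (star a) * X a)"

lemma star_star [simp]: "star (star a) = a" by (simp add: star_def split: sum.splits)

lemma eps_star [simp]: "eps (star a) = - eps a" by (simp add: star_def eps_def split: sum.splits)

lemma eps_sq [simp]: "eps a * eps a = 1" by (simp add: eps_def split: sum.splits)

lemma eps_sq_left [simp]: "eps a * (eps a * z) = z" by (simp add: eps_def split: sum.splits)

lemma eps_cases: "eps a = 1 \<or> eps a = - 1" by (simp add: eps_def split: sum.splits)

lemma star_inject [simp]: "star a = star b \<longleftrightarrow> a = b" by (metis star_star)

lemmas tr_linear = tr_add tr_diff tr_uminus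

lemma biv0_antisym: "biv0 R X A B = - biv0 R X B A" unfolding biv0_def
  by (simp add: sum_negf[symmetric] algebra_simps tr_linear)

lemma dbiv0_add_vec: "dbiv0 R X (\<lambda>a. V a + V' a) A B = dbiv0 R X V A B + dbiv0 R X V' A B"
  by (simp add: dbiv0_def algebra_simps tr_linear sum.distrib sum_subtractf sum_distrib_left)

lemma dbiv0_scl_vec: "dbiv0 R X (\<lambda>a. scl c * V a) A B = c * dbiv0 R X V A B"
proof -
  have "scl c * V (star a) * X a + X (star a) * (scl c * V a) = scl c * (V (star a) * X a + X (star a) * V a)" for a
    by (metis (no_types, lifting) distrib_left mult.assoc scl_commute)
  hence "tr ((scl c * V (star a) * X a + X (star a) * (scl c * V a)) * M)
      = c * tr ((V (star a) * X a + X (star a) * V a) * M)" for a M by (simp only: mult.assoc tr_scl_mult)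
  thus ?thesis by (simp add: dbiv0_def sum_distrib_left mult.left_commute)
qed

lemma pairing_add_right: "pairing R A (\<lambda>a. V a + V' a) = pairing R A V + pairing R A V'"
  and pairing_diff_right: "pairing R A (\<lambda>a. V a - V' a) = pairing R A V - pairing R A V'"
  by (simp_all add: pairing_def algebra_simps tr_linear sum.distrib sum_subtractf)

lemma pairing_scl_right: "pairing R A (\<lambda>a. scl c * V a) = c * pairing R A V"
proof -
  have "A a * (scl c * V a) = scl c * (A a * V a)" for a by (metis mult.assoc scl_commute)
  thus ?thesis by (simp add: pairing_def tr_scl_mult sum_distrib_left)
qed

lemma pairing_vact: "pairing R B (vact s V) = - pairing R (cact s B) V" unfolding pairing_def sum_negf[symmetric]
proof (rule sum.cong)
  fix a
  show "tr (B a * vact s V a) = - tr (cact s B a * V a)" using tr_comm[of "B a * V a" "s (star a)"]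
    by (simp add: vact_def cact_def algebra_simps tr_linear)
qed simp

lemma vact_commutator: "vact s (vact s' X) a - vact s' (vact s X) a = vact (\<lambda>q. s q * s' q - s' q * s q) X a"
  by (simp add: vact_def algebra_simps)

text \<open>The invariant 3-form of the Lie algebra given by the trace form. Both the trivector
  [P, P] and the exterior derivative of the 2-form are expressed by it.\<close>

definition cubic :: "'i umat => 'i umat => 'i umat => complex" where "cubic x y z = tr (x * (y * z - z * y))"

text \<open>With \<open>VX\<close> and \<open>VY\<close> the components of \<open>sharp0\<close> at
  an arrow and at its star, both sides expand into traces of the same words up to cyclic rotation;
  the instances of \<open>tr_comm\<close> bring each word to one rotation. The two cubic forms
  belong to the two ends of the pair.\<close>

lemma jacobi_pair:
  fixes X Y A A' B B' C C' :: "'i umat"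
  defines "VX \<equiv> \<lambda>A A'. - (A' + A' + X * Y * A' + A' * Y * X)"
    and "VY \<equiv> \<lambda>A A'. A + A + Y * X * A + A * X * Y"
  defines "D \<equiv> \<lambda>A A' B B' C C'. tr ((VY A A' * X + Y * VX A A') * (B * C' - C * B'))
     - tr ((VX A A' * Y + X * VY A A') * (B' * C - C' * B))"
  shows "D A A' B B' C C' + D B B' C C' A A' + D C C' A A' B B'
    = cubic (A' * Y - X * A) (B' * Y - X * B) (C' * Y - X * C)
      + cubic (A * X - Y * A') (B * X - Y * B') (C * X - Y * C')" unfolding D_def VX_def VY_def cubic_def
  by (simp add: algebra_simps tr_linear tr_comm[of X] tr_comm[of Y] tr_comm[of B] tr_comm[of B']
      tr_comm[of C] tr_comm[of C'])

locale arrow_set =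
  fixes R :: "('e + 'e) set"
  assumes fin [simp]: "finite R" and star_in: "a \<in> R ==> star a \<in> R"
begin

lemma sum_star: "(\<Sum>a\<in>R. f (star a)) = sum f R"
proof (rule sum.reindex_bij_betw)
  show "bij_betw star R R" by (rule bij_betwI[of _ _ _ star]) (auto intro: star_in)
qed

text \<open>In the first product of \<open>fus\<close> the arrow is replaced by its star, which
  turns the parameter at the tail into the one at the head.\<close>

lemma sum_fus_dual: "(\<Sum>q\<in>R. tr (s q * fus V B q)) = pairing R (cact s B) V"
proof -
  have "(\<Sum>q\<in>R. tr (s q * fus V B q)) =
      (\<Sum>q\<in>R. tr (s q * (B (star q) * V (star q)))) - (\<Sum>q\<in>R. tr (s q * (V q * B q)))"
    by (simp add: fus_def algebra_simps tr_linear sum_subtractf)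
  also have "(\<Sum>q\<in>R. tr (s q * (B (star q) * V (star q)))) = (\<Sum>q\<in>R. tr (s (star q) * B q * V q))"
    by (subst sum_star[symmetric]) (simp add: mult.assoc)
  also have "(\<Sum>q\<in>R. tr (s q * (V q * B q))) = (\<Sum>q\<in>R. tr (B q * s q * V q))"
    by (rule sum.cong) (metis mult.assoc tr_comm)+
  finally show ?thesis by (simp add: pairing_def cact_def left_diff_distrib tr_linear sum_subtractf)
qed

lemma pairing_sharp0: "pairing R B (sharp0 X A) = 2 * biv0 R X A B"
proof -
  let ?f = "\<lambda>a. eps a * tr (X (star a) * X a * A a * B (star a) + A a * B (star a))"
  let ?g = "\<lambda>a. eps a * tr (X (star a) * X a * B a * A (star a) + B a * A (star a))"
  have "2 * biv0 R X A B = sum ?f R - sum ?g R"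
    by (simp add: biv0_def algebra_simps sum_subtractf tr_linear sum.distrib)
  also have "sum ?f R = (\<Sum>a\<in>R. ?f (star a))" by (rule sum_star[symmetric])
  also have "\<dots> - sum ?g R = (\<Sum>a\<in>R. tr (B a * sharp0 X A a))" unfolding sum_subtractf[symmetric]
  proof (rule sum.cong)
    fix a :: "'e + 'e"
    have e: "tr (scl (eps a) * (u + u + v + w)) = eps a * (2 * tr u + tr v + tr w)" for u v w
      by (simp add: tr_scl_mult tr_linear)
    have 1: "B a * sharp0 X A a = - (scl (eps a) * (B a * A (star a) + B a * A (star a)
      + B a * X a * X (star a) * A (star a) + B a * A (star a) * X (star a) * X a))"
      by (simp add: sharp0_def algebra_simps) (simp add: mult.assoc[symmetric] scl_commute)
    have 2: "tr (A (star a) * B a) = tr (B a * A (star a))" by (rule tr_comm)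
    have 3: "tr (B a * X a * X (star a) * A (star a)) = tr (X a * X (star a) * A (star a) * B a)"
      by (metis mult.assoc tr_comm)
    have 4: "tr (B a * A (star a) * X (star a) * X a) = tr (X (star a) * X a * B a * A (star a))"
      by (metis mult.assoc tr_comm)
    show "?f (star a) - ?g a = tr (B a * sharp0 X A a)"
      unfolding 1 tr_uminus e using 2 3 4 by (simp add: tr_linear algebra_simps)
  qed simp
  finally show ?thesis by (simp add: pairing_def)
qed

text \<open>Leibniz rule for the invariance of \<open>biv0\<close>. The parameters at different
  arrows are independent, which is stronger than invariance under the group and is what the fusion
  terms require.\<close>

lemma dbiv0_vact: "dbiv0 R X (vact s X) A B + biv0 R X (cact s A) B + biv0 R X A (cact s B) = 0"
proof -
  have t: "tr ((vact s X (star a) * X a + X (star a) * vact s X a) * M)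
      + tr ((1 + X (star a) * X a) * (s (star a) * M - M * s (star a))) = 0" for a M
    using tr_comm[of M "s (star a)"] tr_comm[of "X (star a) * X a * M" "s (star a)"]
    by (simp add: vact_def algebra_simps tr_linear)
  have m: "(cact s A a * B (star a) - B a * cact s A (star a)) + (A a * cact s B (star a) - cact s B a * A (star a))
      = s (star a) * M - M * s (star a)" if "M = A a * B (star a) - B a * A (star a)" for a M
    by (simp add: that cact_def algebra_simps)
  have "eps a * tr ((vact s X (star a) * X a + X (star a) * vact s X a) * (A a * B (star a) - B a * A (star a)))
    + eps a * tr ((1 + X (star a) * X a) * (cact s A a * B (star a) - B a * cact s A (star a)))
    + eps a * tr ((1 + X (star a) * X a) * (A a * cact s B (star a) - cact s B a * A (star a))) = 0" for a
    using t[of a "A a * B (star a) - B a * A (star a)"]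
    unfolding m[OF refl, symmetric] distrib_left[of "1 + X (star a) * X a"] tr_add
    by (metis (no_types, opaque_lifting) add.assoc distrib_left mult_zero_right)
  hence "(\<Sum>a\<in>R. eps a * tr ((vact s X (star a) * X a + X (star a) * vact s X a) * (A a * B (star a) - B a * A (star a)))
    + eps a * tr ((1 + X (star a) * X a) * (cact s A a * B (star a) - B a * cact s A (star a)))
    + eps a * tr ((1 + X (star a) * X a) * (A a * cact s B (star a) - cact s B a * A (star a)))) = 0" by simp
  thus ?thesis unfolding biv0_def dbiv0_def sum.distrib distrib_left[of "1/2 :: complex", symmetric] by simp
qed

text \<open>The summands are paired with those of the starred arrow: \<open>jacobi_pair\<close>
  covers the orientation with \<open>eps a = 1\<close>, and the other one is the same identity read
  from the other end. Each pair is then counted twice on both sides.\<close>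

lemma jacobi_biv0: "2 * (dbiv0 R X (sharp0 X A) B C + dbiv0 R X (sharp0 X B) C A + dbiv0 R X (sharp0 X C) A B)
    = (\<Sum>q\<in>R. cubic (fus X A q) (fus X B q) (fus X C q))"
proof -
  let ?d = "\<lambda>V A B a. eps a * tr ((V (star a) * X a + X (star a) * V a) * (A a * B (star a) - B a * A (star a)))"
  let ?T = "\<lambda>a. ?d (sharp0 X A) B C a + ?d (sharp0 X B) C A a + ?d (sharp0 X C) A B a"
  let ?K = "\<lambda>q. cubic (fus X A q) (fus X B q) (fus X C q)"
  have pos: "?T a + ?T (star a) = ?K a + ?K (star a)" if "eps a = 1" for a
    using that jacobi_pair[of "A a" "X (star a)" "X a" "A (star a)" "B a" "C (star a)" "C a" "B (star a)"]
    by (simp add: sharp0_def fus_def scl_uminus algebra_simps)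
  have pair: "?T a + ?T (star a) = ?K a + ?K (star a)" for a
    using pos[of a] pos[of "star a"] eps_cases[of a] by (auto simp: add.commute)
  have "2 * sum ?T R = (\<Sum>a\<in>R. ?T a + ?T (star a))"
    by (simp only: sum.distrib[of ?T "\<lambda>a. ?T (star a)"] sum_star[of ?T] mult_2)
  also have "\<dots> = (\<Sum>a\<in>R. ?K a + ?K (star a))" by (simp only: pair)
  also have "\<dots> = 2 * sum ?K R"
    by (simp only: sum.distrib[of ?K "\<lambda>a. ?K (star a)"] sum_star[of ?K] mult_2)
  finally have "sum ?T R = sum ?K R"
    by (rule mult_left_cancel[THEN iffD1, rotated]) (rule zero_neq_numeral[symmetric])
  thus ?thesis by (simp only: dbiv0_def sum.distrib distrib_left[of "1/2 :: complex", symmetric]) simp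
qed

end

section \<open>Fusion along a total order\<close>

text \<open>
  The arrows carry the order of the list \<open>ord\<close>; the antisymmetric weights \<open>k\<close> are those of the
  pencil.  Fusion adds to the bivector of the separate pairs \<open>(a, a\<^sup>*)\<close> the terms
  \<open>- 1/2 \<Sum>\<^sub>q tr (spin F q F\<^sub>q)\<close>, where \<open>F\<close> is the family of the moment matrices; the central
  summand of \<open>spin\<close> accounts for the pencil.
\<close>

locale arrow_order =
  fixes ord :: "('e + 'e) list" and k :: "'e + 'e => 'e + 'e => complex"
  assumes dist: "distinct ord" and star_ord: "a \<in> set ord ==> star a \<in> set ord"
    and k_antisym: "k a b = - k b a"
begin

sublocale arrow_set "set ord" by unfold_locales (auto intro: star_ord)

definition pos :: "'e + 'e => nat" where "pos a = (THE i. i < length ord \<and> ord ! i = a)"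

lemma pos_nth [simp]: "i < length ord ==> pos (ord ! i) = i"
  unfolding pos_def using dist by (auto simp: nth_eq_iff_index_eq)

definition sg :: "'e + 'e => 'e + 'e => complex" where
  "sg p q = (if pos p < pos q then 1 else if pos p = pos q then 0 else - 1)"

lemma sg_antisym: "sg p q = - sg q p" by (auto simp: sg_def)

definition spin :: "('e, 'i) fam => ('e, 'i) fam" where
  "spin f q = (\<Sum>p\<in>set ord. scl (sg p q) * f p) + scl (\<Sum>p\<in>set ord. k q p * tr (f p))"

lemma sum_ord: "sum f (set ord) = (\<Sum>i<length ord. f (ord ! i))"
  by (rule sum.reindex_bij_betw[symmetric]) (simp add: bij_betw_nth dist lessThan_def)

text \<open>Both \<open>sg\<close> and \<open>k\<close> are antisymmetric, so \<open>spin\<close> is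
  skew for the sum of the traces. The antisymmetry of \<open>biv\<close> and the shape of
  \<open>dbiv_eq\<close> rest on this.\<close>

lemma spin_dual: "(\<Sum>q\<in>set ord. tr (spin f q * g q)) = - (\<Sum>q\<in>set ord. tr (spin g q * f q))"
proof -
  let ?R = "set ord"
  let ?S = "\<lambda>F. \<Sum>q\<in>?R. \<Sum>p\<in>?R. F q p"
  have e: "(\<Sum>q\<in>?R. tr (spin f q * g q)) =
      ?S (\<lambda>q p. sg p q * tr (f p * g q)) + ?S (\<lambda>q p. k q p * (tr (f p) * tr (g q)))"
    for f g :: "('e, 'i) fam"
    by (simp add: spin_def distrib_right sum_distrib_right tr_add tr_sum mult.assoc tr_scl_mult
        sum.distrib)
  have "?S (\<lambda>q p. sg p q * tr (f p * g q)) = ?S (\<lambda>q p. sg q p * tr (f q * g p))" by (rule sum.swap)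
  also have "\<dots> = - ?S (\<lambda>q p. sg p q * tr (g p * f q))"
    by (subst sg_antisym) (simp add: sum_negf tr_comm[of "f _"])
  finally have 1: "?S (\<lambda>q p. sg p q * tr (f p * g q)) = - ?S (\<lambda>q p. sg p q * tr (g p * f q))" .
  have "?S (\<lambda>q p. k q p * (tr (f p) * tr (g q))) = ?S (\<lambda>q p. k p q * (tr (f q) * tr (g p)))"
    by (rule sum.swap)
  also have "\<dots> = - ?S (\<lambda>q p. k q p * (tr (g p) * tr (f q)))"
    by (subst k_antisym) (simp add: sum_negf mult.commute)
  finally show ?thesis by (simp add: e 1)
qed

definition biv :: "('e, 'i) fam => ('e, 'i) fam => ('e, 'i) fam => complex" where
  "biv X A B = biv0 (set ord) X A B - 1/2 * (\<Sum>q\<in>set ord. tr (spin (fus X A) q * fus X B q))"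

definition dbiv :: "('e, 'i) fam => ('e, 'i) fam => ('e, 'i) fam => ('e, 'i) fam => complex" where
  "dbiv X V A B = dbiv0 (set ord) X V A B
     - 1/2 * (\<Sum>q\<in>set ord. tr (spin (fus V A) q * fus X B q) + tr (spin (fus X A) q * fus V B q))"

text \<open>Twice \<open>P\<^sup>\<sharp>\<close>.\<close>
definition sharp :: "('e, 'i) fam => ('e, 'i) fam => ('e, 'i) fam" where
  "sharp X A a = sharp0 X A a + vact (spin (fus X A)) X a"

lemma pairing_sharp: "pairing (set ord) B (sharp X A) = 2 * biv X A B"
proof -
  have "pairing (set ord) B (sharp X A) =
      pairing (set ord) B (sharp0 X A) + pairing (set ord) B (vact (spin (fus X A)) X)"
    unfolding sharp_def by (rule pairing_add_right)
  thus ?thesis by (simp add: pairing_sharp0 pairing_vact sum_fus_dual[symmetric] biv_def algebra_simps)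
qed

lemma biv_antisym: "biv X A B = - biv X B A"
  unfolding biv_def using biv0_antisym[of "set ord" X A B] spin_dual[of "fus X A" "fus X B"] by simp

text \<open>Skewness of \<open>spin\<close> allows it to be applied always to the factor that is not
  differentiated; the fusion terms then become pairings of \<open>V\<close> with covectors moved by
  \<open>cact\<close>.\<close>

lemma dbiv_eq: "2 * dbiv X V A B = 2 * dbiv0 (set ord) X V A B
    + pairing (set ord) (cact (spin (fus X B)) A) V - pairing (set ord) (cact (spin (fus X A)) B) V"
  unfolding dbiv_def sum.distrib using spin_dual[of "fus V A" "fus X B"] by (simp add: sum_fus_dual algebra_simps)

text \<open>\<open>c\<close> takes the entries before position \<open>i\<close> with a plus and the
  others with a minus. Carrying the entry at \<open>i\<close> to the other side adds it twice;
  \<open>spin\<close> gives it weight 0 and so stops half way, up to a central term.\<close>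

lemma cubic_spin:
  defines "c \<equiv> \<lambda>f i. (\<Sum>j<i. f (ord ! j)) - (\<Sum>j\<in>{i..<length ord}. f (ord ! j))"
  assumes i: "i < length ord"
  shows "spin f (ord ! i) = c f i + f (ord ! i) + scl (\<Sum>p\<in>set ord. k (ord ! i) p * tr (f p))"
    and "c f (Suc i) = c f i + f (ord ! i) + f (ord ! i)"
proof -
  have "(\<Sum>p\<in>set ord. scl (sg p (ord ! i)) * f p) = (\<Sum>j<length ord. scl (sg (ord ! j) (ord ! i)) * f (ord ! j))"
    by (rule sum_ord)
  also have "{..<length ord} = {..<i} \<union> {i} \<union> {Suc i..<length ord}" using i by auto
  also have "(\<Sum>j\<in>\<dots>. scl (sg (ord ! j) (ord ! i)) * f (ord ! j)) =
      (\<Sum>j<i. scl (sg (ord ! j) (ord ! i)) * f (ord ! j)) + scl (sg (ord ! i) (ord ! i)) * f (ord ! i)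
      + (\<Sum>j\<in>{Suc i..<length ord}. scl (sg (ord ! j) (ord ! i)) * f (ord ! j))"
    by (subst sum.union_disjoint; auto)+
  also have "(\<Sum>j<i. scl (sg (ord ! j) (ord ! i)) * f (ord ! j)) = (\<Sum>j<i. f (ord ! j))"
    by (rule sum.cong) (use i in "auto simp: sg_def")
  also have "(\<Sum>j\<in>{Suc i..<length ord}. scl (sg (ord ! j) (ord ! i)) * f (ord ! j))
      = - (\<Sum>j\<in>{Suc i..<length ord}. f (ord ! j))"
    unfolding sum_negf[symmetric] by (rule sum.cong) (use i in "auto simp: sg_def scl_uminus")
  also have "(\<Sum>j<i. f (ord ! j)) + scl (sg (ord ! i) (ord ! i)) * f (ord ! i)
      + - (\<Sum>j\<in>{Suc i..<length ord}. f (ord ! j)) = c f i + f (ord ! i)"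
    using i by (simp add: c_def sg_def sum.atLeast_Suc_lessThan)
  finally show "spin f (ord ! i) = c f i + f (ord ! i) + scl (\<Sum>p\<in>set ord. k (ord ! i) p * tr (f p))"
    by (simp add: spin_def)
  show "c f (Suc i) = c f i + f (ord ! i) + f (ord ! i)" using i by (simp add: c_def sum.atLeast_Suc_lessThan)
qed

text \<open>Scalars leave commutators unchanged, and the trace of a scalar times a commutator is 0.
  Hence the weights \<open>k\<close> never reach the cubic terms, and all elements of the pencil
  have the same Schouten square.\<close>

lemma cubic_scl: "cubic (x + scl a) (y + scl b) (z + scl c) = cubic x y z"
proof -
  have "(y + scl b) * (z + scl c) - (z + scl c) * (y + scl b) = y * z - z * y"
    by (simp add: algebra_simps scl_commute[of y c] scl_commute[of z b] scl_mult[symmetric] mult.commute)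
  thus ?thesis using tr_comm[of y z] by (simp add: cubic_def distrib_right tr_linear tr_scl_mult)
qed

text \<open>The third-order terms telescope, since each \<open>spin f q\<close> is the midpoint of two successive partial sums.\<close>
lemma cubic_total:
  fixes f g h :: "('e, 'i) fam"
  shows "(\<Sum>q\<in>set ord. cubic (f q) (g q) (h q) + cubic (f q) (spin g q) (spin h q)
      + cubic (g q) (spin h q) (spin f q) + cubic (h q) (spin f q) (spin g q))
    = cubic (sum f (set ord)) (sum g (set ord)) (sum h (set ord))" (is "(\<Sum>q\<in>_. ?S q) = _")
proof -
  define c where "c = (\<lambda>f :: ('e, 'i) fam. \<lambda>i. (\<Sum>j<i. f (ord ! j)) - (\<Sum>j\<in>{i..<length ord}. f (ord ! j)))"
  let ?C = "\<lambda>i. cubic (c f i) (c g i) (c h i)"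
  \<comment> \<open>Polarisation: the left side is the part of the trilinear form at
    \<open>x' + x\<close>, \<open>y' + y\<close>, \<open>z' + z\<close> that is odd in the unprimed
    variables, doubled.\<close>
  have step: "2 * (cubic x y z + cubic x y' z' + cubic y z' x' + cubic z x' y')
      = cubic (x' + x) (y' + y) (z' + z) - cubic (x' - x) (y' - y) (z' - z)" for x y z x' y' z' :: "'i umat"
    unfolding cubic_def
    by (simp add: algebra_simps tr_linear tr_comm[of y] tr_comm[of y'] tr_comm[of z] tr_comm[of z'])
  have "2 * ?S q = ?C (Suc i) - ?C i"
    if "i < length ord" "q = ord ! i" for i q
  proof -
    have 1: "spin u q + u q = c u (Suc i) + scl (\<Sum>p\<in>set ord. k (ord ! i) p * tr (u p))"
      and 2: "spin u q - u q = c u i + scl (\<Sum>p\<in>set ord. k (ord ! i) p * tr (u p))" for u :: "('e, 'i) fam"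
      using cubic_spin[OF that(1), of u] by (simp_all add: that(2) c_def algebra_simps)
    show ?thesis unfolding step 1 2 cubic_scl ..
  qed
  hence "2 * (\<Sum>q\<in>set ord. ?S q) = (\<Sum>i<length ord. ?C (Suc i) - ?C i)"
    unfolding sum_ord sum_distrib_left by (intro sum.cong) auto
  also have "\<dots> = ?C (length ord) - ?C 0" by (rule sum_lessThan_telescope)
  also have "\<dots> = 2 * cubic (sum f (set ord)) (sum g (set ord)) (sum h (set ord))"
    by (simp add: c_def sum_ord atLeast0LessThan cubic_def tr_linear algebra_simps)
  finally show ?thesis by (rule mult_left_cancel[THEN iffD1, rotated]) (rule zero_neq_numeral[symmetric])
qed

text \<open>Derivatives of \<open>biv0\<close> along \<open>vact\<close> cancel, by
  \<open>dbiv0_vact\<close>, against the terms in which \<open>cact\<close> acts on a covector. What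
  is left of the fusion terms are double actions, hence commutators of \<open>spin\<close>, and
  these are exactly the mixed terms of \<open>cubic_total\<close>.\<close>

theorem jacobi_biv: "2 * (dbiv X (sharp X A) B C + dbiv X (sharp X B) C A + dbiv X (sharp X C) A B)
    = cubic (sum (fus X A) (set ord)) (sum (fus X B) (set ord)) (sum (fus X C) (set ord))"
proof -
  let ?R = "set ord"
  let ?s = "\<lambda>A. spin (fus X A)"
  let ?b = "biv0 ?R X"
  have sharp_split: "sharp X A = (\<lambda>a. sharp0 X A a + vact (?s A) X a)" for A
    by (simp add: sharp_def fun_eq_iff)
  have d: "2 * dbiv X (sharp X A) B C = 2 * dbiv0 ?R X (sharp0 X A) B C
      - 2 * ?b (cact (?s A) B) C - 2 * ?b B (cact (?s A) C) + 2 * ?b A (cact (?s C) B) - 2 * ?b A (cact (?s B) C)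
      - pairing ?R B (vact (?s C) (vact (?s A) X)) + pairing ?R C (vact (?s B) (vact (?s A) X))" for A B C proof -
    have v: "dbiv0 ?R X (vact (?s A) X) B C = - ?b (cact (?s A) B) C - ?b B (cact (?s A) C)"
    proof -
      have "x = - y - z" if "x + y + z = 0" for x y z :: complex
      proof -
        have "x = (x + y + z) - y - z" by simp
        thus ?thesis using that by simp
      qed
      from this[OF dbiv0_vact[of X "?s A" B C]] show ?thesis .
    qed
    show ?thesis unfolding dbiv_eq unfolding sharp_split
    by (simp add: v dbiv0_add_vec pairing_add_right pairing_sharp0 pairing_vact algebra_simps)
  qed
  \<comment> \<open>In the cyclic sum every double action occurs in both orders with opposite signs,
    so only commutators matter.\<close>
  have comm: "pairing ?R B (vact (?s A) (vact (?s C) X)) - pairing ?R B (vact (?s C) (vact (?s A) X))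
     = (\<Sum>q\<in>?R. cubic (fus X B q) (?s C q) (?s A q))" for A B C proof -
    have "pairing ?R B (vact (?s A) (vact (?s C) X)) - pairing ?R B (vact (?s C) (vact (?s A) X))
        = pairing ?R B (vact (\<lambda>q. ?s A q * ?s C q - ?s C q * ?s A q) X)"
      by (simp only: pairing_diff_right[symmetric] vact_commutator)
    also have "\<dots> = - (\<Sum>q\<in>?R. tr ((?s A q * ?s C q - ?s C q * ?s A q) * fus X B q))"
      by (simp only: pairing_vact sum_fus_dual)
    also have "\<dots> = (\<Sum>q\<in>?R. cubic (fus X B q) (?s C q) (?s A q))"
      unfolding sum_negf[symmetric] cubic_def
      by (rule sum.cong) (simp_all add: tr_comm[of "fus X B _"] algebra_simps tr_linear)
    finally show ?thesis .
  qed
  have "2 * (dbiv X (sharp X A) B C + dbiv X (sharp X B) C A + dbiv X (sharp X C) A B)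
    = 2 * (dbiv0 ?R X (sharp0 X A) B C + dbiv0 ?R X (sharp0 X B) C A + dbiv0 ?R X (sharp0 X C) A B)
      + (\<Sum>q\<in>?R. cubic (fus X A q) (?s B q) (?s C q)) + (\<Sum>q\<in>?R. cubic (fus X B q) (?s C q) (?s A q))
      + (\<Sum>q\<in>?R. cubic (fus X C q) (?s A q) (?s B q))" unfolding distrib_left[of "2 :: complex"] d
    using comm[of B A C] comm[of C B A] comm[of A C B]
      biv0_antisym[of ?R X "cact (?s A) B" C] biv0_antisym[of ?R X "cact (?s B) C" A]
      biv0_antisym[of ?R X "cact (?s C) A" B] by (simp add: algebra_simps)
  also have "\<dots> = cubic (sum (fus X A) ?R) (sum (fus X B) ?R) (sum (fus X C) ?R)"
    unfolding jacobi_biv0 by (subst cubic_total[symmetric]) (simp add: sum.distrib)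
  finally show ?thesis .
qed

end

section \<open>The 2-form and the moment map in terms of traces\<close>

primrec pprod :: "(nat => 'r :: ring_1) => nat => 'r" where "pprod g 0 = 1"
| "pprod g (Suc i) = pprod g i * g i"

primrec pprod_inv :: "(nat => 'r :: ring_1) => nat => 'r" where "pprod_inv h 0 = 1"
| "pprod_inv h (Suc i) = h i * pprod_inv h i"

primrec dpprod :: "(nat => 'r :: ring_1) => (nat => 'r) => nat => 'r" where "dpprod g a 0 = 0"
| "dpprod g a (Suc i) = dpprod g a i * g i + pprod g i * a i"

lemma pprod_inverse:
  assumes "\<And>i. i < m ==> h i * g i = 1" "\<And>i. i < m ==> g i * h i = 1"
  shows "pprod_inv h m * pprod g m = 1" "pprod g m * pprod_inv h m = 1"
proof -
  have "pprod_inv h m * pprod g m = 1 \<and> pprod g m * pprod_inv h m = 1" using assms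
  proof (induction m)
    case (Suc m)
    have "h m * (pprod_inv h m * pprod g m) * g m = 1" "pprod g m * (g m * h m) * pprod_inv h m = 1" using Suc by auto
    thus ?case by (simp add: mult.assoc)
  qed simp
  thus "pprod_inv h m * pprod g m = 1" "pprod g m * pprod_inv h m = 1" by auto
qed

text \<open>Each factor moves by a gauge variation, from the left by \<open>c i\<close> and from the
  right by \<open>c (Suc i)\<close>; neighbouring terms cancel in the product and only the two ends
  survive.\<close>

lemma dpprod_telescope:
  assumes "\<And>i. i < m ==> a i = c i * g i - g i * c (Suc i)"
  shows "dpprod g a m = c 0 * pprod g m - pprod g m * c m" using assms
proof (induction m)
  case (Suc m)
  hence "dpprod g a m = c 0 * pprod g m - pprod g m * c m" "a m = c m * g m - g m * c (Suc m)" by auto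
  hence "dpprod g a (Suc m) = (c 0 * pprod g m - pprod g m * c m) * g m + pprod g m * (c m * g m - g m * c (Suc m))"
    by (simp only: dpprod.simps)
  also have "\<dots> = c 0 * pprod g (Suc m) - pprod g (Suc m) * c (Suc m)"
    by (simp add: left_diff_distrib right_diff_distrib mult.assoc)
  finally show ?case .
qed simp

text \<open>Contraction of the second term of the 2-form with such a gauge variation. Every prefix
  is moved only at its ends, by \<open>dpprod_telescope\<close>; the outer ends produce the
  logarithmic differentials of the whole product, and the rest those of the single factors.\<close>

lemma sum_theta_telescope:
  fixes g h a b c :: "nat => 'i umat"
  assumes hg: "\<And>i. i < m ==> h i * g i = 1" and gh: "\<And>i. i < m ==> g i * h i = 1"
    and a: "\<And>i. i < m ==> a i = c i * g i - g i * c (Suc i)"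
  shows "(\<Sum>i<m. tr (pprod_inv h i * dpprod g a i * (b i * h i)) - tr (pprod_inv h i * dpprod g b i * (a i * h i)))
    = tr (c 0 * (dpprod g b m * pprod_inv h m)) + tr (c m * (pprod_inv h m * dpprod g b m))
      - (\<Sum>i<m. tr (c i * (b i * h i)) + tr (c (Suc i) * (h i * b i)))" using assms
proof (induction m)
  case (Suc m)
  have hg': "h m * g m = 1" and gh': "g m * h m = 1" and am: "a m = c m * g m - g m * c (Suc m)"
    using Suc.prems by auto
  have hgl: "h m * (g m * z) = z" and ghl: "g m * (h m * z) = z" for z
    using hg' gh' by (simp_all add: mult.assoc[symmetric])
  have inv: "pprod_inv h m * pprod g m = 1" by (rule pprod_inverse) (use Suc.prems in auto)
  have invl: "pprod_inv h m * (pprod g m * z) = z" for z using inv by (simp add: mult.assoc[symmetric])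
  have da: "dpprod g a m = c 0 * pprod g m - pprod g m * c m" by (rule dpprod_telescope) (use Suc.prems in auto)
  let ?G = "pprod g m" and ?I = "pprod_inv h m" and ?D = "dpprod g b m"
  have 1: "tr (?I * dpprod g a m * (b m * h m)) = tr (c 0 * (?G * b m * h m * ?I)) - tr (c m * (b m * h m))"
    using tr_comm[of ?I "c 0 * ?G * (b m * h m)"] by (simp add: da algebra_simps tr_linear invl)
  have 2: "tr (?I * ?D * (a m * h m)) = tr (c m * (?I * ?D)) - tr (c (Suc m) * (h m * ?I * ?D * g m))"
    using tr_comm[of "?I * ?D" "c m"] tr_comm[of "?I * ?D * g m" "c (Suc m) * h m"]
    by (simp add: am algebra_simps tr_linear ghl gh')
  have 3: "tr (c 0 * (dpprod g b (Suc m) * pprod_inv h (Suc m)))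
      = tr (c 0 * (?D * ?I)) + tr (c 0 * (?G * b m * h m * ?I))" by (simp add: algebra_simps tr_linear ghl)
  have 4: "tr (c (Suc m) * (pprod_inv h (Suc m) * dpprod g b (Suc m)))
      = tr (c (Suc m) * (h m * ?I * ?D * g m)) + tr (c (Suc m) * (h m * b m))"
    by (simp add: algebra_simps tr_linear invl)
  have IH: "(\<Sum>i<m. tr (pprod_inv h i * dpprod g a i * (b i * h i)) - tr (pprod_inv h i * dpprod g b i * (a i * h i)))
    = tr (c 0 * (?D * ?I)) + tr (c m * (?I * ?D)) - (\<Sum>i<m. tr (c i * (b i * h i)) + tr (c (Suc i) * (h i * b i)))"
    by (rule Suc.IH) (use Suc.prems in auto)
  show ?case unfolding sum.lessThan_Suc IH 1 2 3 4 by (simp add: algebra_simps)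
qed simp

text \<open>
  With \<open>a, b, c\<close> the values of \<open>g\<^sup>-\<^sup>1 dg\<close> and \<open>x, y, z\<close> those of \<open>dh h\<^sup>-\<^sup>1\<close> on three commuting vector
  fields, and \<open>p\<close>, \<open>q\<close> the second derivatives, this says that the deviation of the pulled back cubic
  form from multiplicativity is the exterior derivative of \<open>tr (g\<^sup>-\<^sup>1 dg \<and> dh h\<^sup>-\<^sup>1)\<close> (Polyakov-Wiegmann).
\<close>
lemma polyakov_wiegmann:
  fixes a b c x y z :: "'i umat"
  shows "cubic (a + x) (b + y) (c + z) = cubic a b c + cubic x y z
    - ((tr ((puv - a * b) * z + b * (quw - z * x)) - tr ((puw - a * c) * y + c * (quv - y * x)))
     + (tr ((pvw - b * c) * x + c * (quv - x * y)) - tr ((puv - b * a) * z + a * (qvw - z * y)))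
     + (tr ((puw - c * a) * y + a * (qvw - y * z)) - tr ((pvw - c * b) * x + b * (quw - x * z))))" unfolding cubic_def
  by (simp add: algebra_simps tr_linear tr_comm[of b] tr_comm[of c] tr_comm[of y] tr_comm[of z])

text \<open>\<open>U\<close> and \<open>W\<close> stand for the inverses of 1 + XY and 1 + YX, and
  the hypotheses are their push-through relations. The form of one pair is contracted here with the
  action by \<open>s\<close> at one end and by \<open>s'\<close> at the other.\<close>

lemma form_moment_pair:
  fixes X Y U W s s' V V' :: "'i umat"
  assumes UX: "U * X = X * W" and WY: "W * Y = Y * U"
  shows "(tr (U * (s * X - X * s') * V') - tr (U * V * (s' * Y - Y * s)))
     - (tr (W * (s' * Y - Y * s) * V) - tr (W * V' * (s * X - X * s')))
   = tr (s * (U * (V * Y + X * V') + (V * Y + X * V') * U)) - tr (s' * (W * (Y * V + V' * X) + (Y * V + V' * X) * W))"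
proof -
  have UXl: "U * (X * z) = X * (W * z)" and WYl: "W * (Y * z) = Y * (U * z)" for z using UX WY by (metis mult.assoc)+
  show ?thesis by (simp add: algebra_simps tr_linear tr_comm[of U] tr_comm[of W] tr_comm[of X] tr_comm[of Y]
        tr_comm[of s] tr_comm[of s'] UX WY UXl WYl)
qed

text \<open>For one pair, form and bivector are inverse to each other up to moment terms. The factor
  4 appears because \<open>P\<close> and \<open>Q\<close> are the doubled contraction and the form
  is doubled as well. The relations for \<open>X * (Y * U)\<close> and \<open>Y * (X * W)\<close>
  shorten the longer words until both sides agree.\<close>

lemma form_sharp_pair:
  fixes X Y U W A A' V V' :: "'i umat"
  assumes UX: "U * X = X * W" and WY: "W * Y = Y * U"
    and XYU: "X * (Y * U) = 1 - U" and YXW: "Y * (X * W) = 1 - W"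
  defines "P \<equiv> - (A' + A' + X * Y * A' + A' * Y * X)" and "Q \<equiv> A + A + Y * X * A + A * X * Y"
    and "D \<equiv> V * Y + X * V'" and "D' \<equiv> Y * V + V' * X"
    and "\<mu> \<equiv> A' * Y - X * A" and "\<mu>' \<equiv> A * X - Y * A'"
  shows "- (tr (U * P * V') - tr (U * V * Q)) + (tr (W * Q * V) - tr (W * V' * P))
    = 4 * tr (A * V) + 4 * tr (A' * V') - tr (\<mu> * (U * D - D * U)) - tr (\<mu>' * (W * D' - D' * W))"
proof -
  have l: "U * (X * z) = X * (W * z)" "W * (Y * z) = Y * (U * z)"
    "X * (Y * (U * z)) = z - U * z" "Y * (X * (W * z)) = z - W * z" for z
    using assms(1-4) by (metis mult.assoc left_diff_distrib mult_1_left)+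
  show ?thesis unfolding P_def Q_def D_def D'_def \<mu>_def \<mu>'_def
    by (simp only: distrib_left distrib_right left_diff_distrib right_diff_distrib tr_linear mult.assoc
        mult_minus_left mult_minus_right tr_comm[of U] tr_comm[of W] tr_comm[of X] tr_comm[of Y]
        tr_comm[of A] tr_comm[of A'] UX WY XYU YXW l mult_1_left mult_1_right) (simp add: field_simps)
qed

text \<open>On constant vector fields only the inverses vary, by - U D U and - W D' W, so
  \<open>E\<close> is the derivative of the doubled form of one pair. The arguments of the two cubic
  forms are the right logarithmic derivatives of the factor 1 + XY and of the inverted factor at the
  starred arrow.\<close>

lemma form_closed_pair:
  fixes X Y U W u u' v v' w w' :: "'i umat"
  assumes UX: "U * X = X * W" and WY: "W * Y = Y * U"
    and XYU: "X * (Y * U) = 1 - U" and YXW: "Y * (X * W) = 1 - W"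
  defines "D \<equiv> \<lambda>V V'. V * Y + X * V'" and "D' \<equiv> \<lambda>V V'. Y * V + V' * X"
  defines "E \<equiv> \<lambda>u u' v v' w w'. - (tr (- (U * D u u' * U) * v * w') - tr (- (U * D u u' * U) * w * v'))
      + (tr (- (W * D' u u' * W) * v' * w) - tr (- (W * D' u u' * W) * w' * v))"
  shows "E u u' v v' w w' + E v v' w w' u u' + E w w' u u' v v' = cubic (D u u' * U) (D v v' * U) (D w w' * U)
      + cubic (- (W * D' u u')) (- (W * D' v v')) (- (W * D' w w'))"
proof -
  have l: "U * (X * z) = X * (W * z)" "W * (Y * z) = Y * (U * z)"
    "X * (Y * (U * z)) = z - U * z" "Y * (X * (W * z)) = z - W * z" for z
    using assms(1-4) by (metis mult.assoc left_diff_distrib mult_1_left)+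
  show ?thesis unfolding E_def D_def D'_def cubic_def
    by (simp add: algebra_simps tr_linear tr_comm[of U] tr_comm[of W] tr_comm[of X] tr_comm[of Y]
        tr_comm[of v] tr_comm[of w] tr_comm[of v'] tr_comm[of w'] UX WY XYU YXW l)
qed

section \<open>The 2-form and the moment map at one point, as ring identities\<close>

locale arrow_point = arrow_order ord k for ord :: "('e + 'e) list" and k +
  fixes X U :: "('e, 'i) fam"
  assumes U_left: "a \<in> set ord ==> U a * (1 + X a * X (star a)) = 1"
    and U_right: "a \<in> set ord ==> (1 + X a * X (star a)) * U a = 1"
begin

definition factor :: "('e, 'i) fam" where "factor a = (if eps a = 1 then 1 + X a * X (star a) else U a)"

definition ifactor :: "('e, 'i) fam" where "ifactor a = (if eps a = 1 then U a else 1 + X a * X (star a))"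

definition dplus :: "('e, 'i) fam => ('e, 'i) fam" where "dplus V a = V a * X (star a) + X a * V (star a)"

definition dfactor :: "('e, 'i) fam => ('e, 'i) fam" where
  "dfactor V a = (if eps a = 1 then dplus V a else - (U a * dplus V a * U a))"

abbreviation thL :: "('e, 'i) fam => ('e, 'i) fam" where "thL V a \<equiv> ifactor a * dfactor V a"

abbreviation thR :: "('e, 'i) fam => ('e, 'i) fam" where "thR V a \<equiv> dfactor V a * ifactor a"

definition form0 :: "('e, 'i) fam => ('e, 'i) fam => complex" where
  "form0 u v = - 1/2 * (\<Sum>a\<in>set ord. eps a * (tr (U a * u a * v (star a)) - tr (U a * v a * u (star a))))"

lemma ifactor_factor: "a \<in> set ord ==> ifactor a * factor a = 1"
  and factor_ifactor: "a \<in> set ord ==> factor a * ifactor a = 1"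
  by (simp_all add: ifactor_def factor_def U_left U_right)

lemma XX_U: "a \<in> set ord ==> X a * (X (star a) * U a) = 1 - U a"
  using U_right[of a] by (simp add: algebra_simps)

text \<open>The push-through identity for inverses, which comes from X(1 + YX) = (1 + XY)X.\<close>

lemma U_X: "U a * X a = X a * U (star a)" if "a \<in> set ord"
proof -
  have "U a * X a = U a * (X a * ((1 + X (star a) * X a) * U (star a)))" using U_right[OF star_ord[OF that]] by simp
  also have "\<dots> = (U a * (1 + X a * X (star a))) * (X a * U (star a))" by (simp add: algebra_simps)
  finally show ?thesis by (simp add: U_left[OF that])
qed

text \<open>The parameters at the head cancel between X_a and its partner, so 1 + X_a X_(star a) is
  conjugated by the parameter at the tail alone; for \<open>eps a = - 1\<close> the same follows for
  the inverse.\<close>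

lemma dfactor_vact:
  assumes a: "a \<in> set ord"
  shows "dfactor (vact s X) a = s a * factor a - factor a * s a"
proof -
  have p: "dplus (vact s X) a = s a * (1 + X a * X (star a)) - (1 + X a * X (star a)) * s a"
    by (simp add: dplus_def vact_def algebra_simps)
  have "U a * (s a * F - F * s a) * U a = U a * s a * (F * U a) - U a * F * (s a * U a)" for F
    by (simp add: algebra_simps)
  from this[of "1 + X a * X (star a)"] show ?thesis
    unfolding dfactor_def factor_def p using a by (simp add: U_left U_right)
qed

text \<open>The moment map condition of a single factor. For the inverted factors the sign of
  \<open>sharp0\<close> and the sign from differentiating an inverse compensate, so both
  orientations give the same formula.\<close>

lemma dfactor_sharp0: "a \<in> set ord ==> dfactor (sharp0 X A) a = - (factor a * fus X A a + fus X A a * factor a)"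
proof -
  assume a: "a \<in> set ord"
  let ?F = "1 + X a * X (star a)"
  have e: "sharp0 X A a = - (A (star a) + A (star a) + X a * X (star a) * A (star a) + A (star a) * X (star a) * X a)"
    "sharp0 X A (star a) = A a + A a + X (star a) * X a * A a + A a * X a * X (star a)"
    if "eps a = 1" for a :: "'e + 'e" and A :: "('e, 'i) fam" using that by (simp_all add: sharp0_def scl_uminus)
  have e': "sharp0 X A a = A (star a) + A (star a) + X a * X (star a) * A (star a) + A (star a) * X (star a) * X a"
    "sharp0 X A (star a) = - (A a + A a + X (star a) * X a * A a + A a * X a * X (star a))"
    if "eps a = - 1" for a :: "'e + 'e" and A :: "('e, 'i) fam" using that by (simp_all add: sharp0_def scl_uminus)
  have 1: "dplus (sharp0 X A) a = - (?F * fus X A a + fus X A a * ?F)" if "eps a = 1"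
    by (simp add: dplus_def fus_def e[OF that] algebra_simps)
  have 2: "dplus (sharp0 X A) a = ?F * fus X A a + fus X A a * ?F" if "eps a = - 1"
    by (simp add: dplus_def fus_def e'[OF that] algebra_simps)
  have "U a * (F * m + m * F) * U a = (U a * F) * m * U a + U a * m * (F * U a)" for F m by (simp add: algebra_simps)
  from this[of ?F] have 3: "U a * (?F * m + m * ?F) * U a = m * U a + U a * m" for m
    using a by (simp only: U_left U_right mult_1_left mult_1_right)
  show ?thesis using eps_cases[of a] 1 2 3 by (auto simp: dfactor_def factor_def add.commute)
qed

lemma dfactor_add: "dfactor (\<lambda>a. V a + V' a) a = dfactor V a + dfactor V' a"
  by (simp add: dfactor_def dplus_def algebra_simps)

text \<open>Up to a common scalar the two coefficients are the successive partial sums of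
  \<open>cubic_spin\<close>, so each factor undergoes a gauge variation to which the telescoping
  lemmas apply.\<close>

lemma dfactor_sharp:
  assumes "a \<in> set ord"
  shows "dfactor (sharp X A) a = (spin (fus X A) a - fus X A a) * factor a - factor a * (spin (fus X A) a + fus X A a)"
proof -
  have "sharp X A = (\<lambda>a. sharp0 X A a + vact (spin (fus X A)) X a)" by (simp add: sharp_def fun_eq_iff)
  thus ?thesis using assms by (simp add: dfactor_add dfactor_vact dfactor_sharp0 algebra_simps)
qed

lemma form0_add_left: "form0 (\<lambda>a. u a + u' a) v = form0 u v + form0 u' v"
proof -
  have "tr (U a * (u a + u' a) * v (star a)) - tr (U a * v a * (u (star a) + u' (star a)))
    = (tr (U a * u a * v (star a)) - tr (U a * v a * u (star a)))
      + (tr (U a * u' a * v (star a)) - tr (U a * v a * u' (star a)))" for a by (simp add: algebra_simps tr_linear)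
  thus ?thesis unfolding form0_def by (simp only: distrib_left sum.distrib)
qed

lemma thL_thR_eps:
  assumes "a \<in> set ord"
  shows "eps a = 1 ==> thL V a = U a * dplus V a" "eps a = 1 ==> thR V a = dplus V a * U a"
    "eps a = - 1 ==> thL V a = - (dplus V a * U a)" "eps a = - 1 ==> thR V a = - (U a * dplus V a)"
proof -
  have "(1 + X a * X (star a)) * (U a * (D * U a)) = D * U a" "U a * (D * (U a * (1 + X a * X (star a)))) = U a * D" for D
    using U_left[OF assms] U_right[OF assms] by (simp_all add: mult.assoc[symmetric])
  thus "eps a = 1 ==> thL V a = U a * dplus V a" "eps a = 1 ==> thR V a = dplus V a * U a"
    "eps a = - 1 ==> thL V a = - (dplus V a * U a)" "eps a = - 1 ==> thR V a = - (U a * dplus V a)"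
    by (simp_all add: ifactor_def dfactor_def mult.assoc)
qed

lemma sum_pairs:
  fixes f g :: "'e + 'e => complex"
  assumes "\<And>a. a \<in> set ord ==> eps a = 1 ==> f a + f (star a) = g a + g (star a)"
  shows "sum f (set ord) = sum g (set ord)"
proof -
  have pair: "f a + f (star a) = g a + g (star a)" if "a \<in> set ord" for a
    using assms[of a] assms[of "star a"] eps_cases[of a] star_ord[OF that] that by (auto simp: add.commute)
  have "sum f (set ord) + sum f (set ord) = (\<Sum>a\<in>set ord. f a + f (star a))"
    by (simp only: sum.distrib[of f "\<lambda>a. f (star a)"] sum_star[of f])
  also have "\<dots> = (\<Sum>a\<in>set ord. g a + g (star a))" by (rule sum.cong) (use pair in auto)
  also have "\<dots> = sum g (set ord) + sum g (set ord)"
    by (simp only: sum.distrib[of g "\<lambda>a. g (star a)"] sum_star[of g])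
  finally show ?thesis by simp
qed

lemma form0_vact: "2 * form0 (vact s X) v = - (\<Sum>a\<in>set ord. tr (s a * (thL v a + thR v a)))"
  unfolding form0_def mult.assoc[symmetric] sum_negf[symmetric] sum_distrib_left
proof (rule sum_pairs)
  fix a assume a: "a \<in> set ord" "eps a = 1"
  have a': "star a \<in> set ord" "eps (star a) = - 1" using a star_ord by auto
  note pair = form_moment_pair[OF U_X[OF a(1)] U_X[OF a'(1), unfolded star_star], of "s a" "s (star a)" "v (star a)" "v a"]
  show "2 * (- 1/2) * eps a * (tr (U a * vact s X a * v (star a)) - tr (U a * v a * vact s X (star a))) +
      2 * (- 1/2) * eps (star a) * (tr (U (star a) * vact s X (star a) * v (star (star a)))
        - tr (U (star a) * v (star a) * vact s X (star (star a))))
    = - tr (s a * (thL v a + thR v a)) + - tr (s (star a) * (thL v (star a) + thR v (star a)))" using pair a a'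
    by (simp add: thL_thR_eps vact_def dplus_def algebra_simps tr_linear)
qed

lemma form0_sharp0:
  "2 * form0 (sharp0 X A) v = 4 * pairing (set ord) A v - (\<Sum>a\<in>set ord. tr (fus X A a * (thL v a - thR v a)))"
  unfolding form0_def pairing_def sum_subtractf[symmetric] sum_distrib_left
proof (rule sum_pairs)
  fix a assume a: "a \<in> set ord" "eps a = 1"
  have a': "star a \<in> set ord" "eps (star a) = - 1" using a star_ord by auto
  note pair = form_sharp_pair[OF U_X[OF a(1)] U_X[OF a'(1), unfolded star_star]
      XX_U[OF a(1)] XX_U[OF a'(1), unfolded star_star],
      where A = "A a" and A' = "A (star a)" and V = "v a" and V' = "v (star a)"]
  show "2 * (- 1/2 * (eps a * (tr (U a * sharp0 X A a * v (star a)) - tr (U a * v a * sharp0 X A (star a))))) +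
      2 * (- 1/2 * (eps (star a) * (tr (U (star a) * sharp0 X A (star a) * v (star (star a)))
        - tr (U (star a) * v (star a) * sharp0 X A (star (star a))))))
    = 4 * tr (A a * v a) - tr (fus X A a * (thL v a - thR v a)) +
     (4 * tr (A (star a) * v (star a)) - tr (fus X A (star a) * (thL v (star a) - thR v (star a))))" proof -
    have s: "sharp0 X A a = - (A (star a) + A (star a) + X a * X (star a) * A (star a) + A (star a) * X (star a) * X a)"
      "sharp0 X A (star a) = A a + A a + X (star a) * X a * A a + A a * X a * X (star a)"
      using a by (simp_all add: sharp0_def scl_uminus)
    have d: "thL v a - thR v a = U a * dplus v a - dplus v a * U a"
      "thL v (star a) - thR v (star a) = U (star a) * dplus v (star a) - dplus v (star a) * U (star a)"
      using a a' by (simp_all add: thL_thR_eps)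
    have e: "2 * (- 1/2 * (eps a * p)) + 2 * (- 1/2 * (eps (star a) * q)) = - p + q" for p q using a by simp
    have D: "dplus v (star a) = X (star a) * v a + v (star a) * X a" by (simp add: dplus_def add.commute)
    show ?thesis unfolding e unfolding d D s fus_def star_star pair by (simp add: dplus_def)
  qed
qed

abbreviation gseq :: "nat => 'i umat" where "gseq i \<equiv> factor (ord ! i)"
abbreviation hseq :: "nat => 'i umat" where "hseq i \<equiv> ifactor (ord ! i)"
abbreviation dseq :: "('e, 'i) fam => nat => 'i umat" where "dseq V i \<equiv> dfactor V (ord ! i)"

definition mom :: "'i umat" where "mom = pprod gseq (length ord)"
definition imom :: "'i umat" where "imom = pprod_inv hseq (length ord)"
definition dmom :: "('e, 'i) fam => 'i umat" where "dmom V = dpprod gseq (dseq V) (length ord)"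

definition form1 :: "('e, 'i) fam => ('e, 'i) fam => complex" where
  "form1 u v = (\<Sum>i<length ord. tr (pprod_inv hseq i * dpprod gseq (dseq u) i * thR v (ord ! i))
       - tr (pprod_inv hseq i * dpprod gseq (dseq v) i * thR u (ord ! i)))"

text \<open>The trace of \<open>thL\<close> is the derivative of log det of the factor, so with
  \<open>k\<close> antisymmetric this is a combination of wedge products of logarithmic
  differentials. The 1/2 in \<open>form\<close> matches the 1/2 before the fusion terms of
  \<open>biv\<close>.\<close>

definition form2 :: "('e, 'i) fam => ('e, 'i) fam => complex" where
  "form2 u v = (\<Sum>p\<in>set ord. \<Sum>q\<in>set ord. k p q * (tr (thL u p) * tr (thL v q)))"

definition form :: "('e, 'i) fam => ('e, 'i) fam => complex" where
  "form u v = form0 u v - 1/2 * form1 u v + 1/2 * form2 u v"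

lemma form_double: "2 * form u v = 2 * form0 u v - form1 u v + form2 u v" by (simp add: form_def)

abbreviation mu :: "('e, 'i) fam => 'i umat" where "mu A \<equiv> sum (fus X A) (set ord)"

lemma seq_inverse: "i < length ord ==> hseq i * gseq i = 1" "i < length ord ==> gseq i * hseq i = 1"
  by (auto simp: ifactor_factor factor_ifactor)

lemma imom_mom: "imom * mom = 1" and mom_imom: "mom * imom = 1"
  unfolding mom_def imom_def by (rule pprod_inverse; simp add: seq_inverse)+

definition csum :: "('e, 'i) fam => nat => 'i umat" where
  "csum f i = (\<Sum>j<i. f (ord ! j)) - (\<Sum>j\<in>{i..<length ord}. f (ord ! j))"

lemma csum_0: "csum f 0 = - sum f (set ord)" and csum_length: "csum f (length ord) = sum f (set ord)"
  by (simp_all add: csum_def sum_ord atLeast0LessThan)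

text \<open>The central part of \<open>spin\<close> commutes with the factor and cancels between its
  two sides; so the weights of the pencil do not affect how the factors move.\<close>

lemma dseq_sharp:
  assumes "i < length ord"
  shows "dseq (sharp X A) i = csum (fus X A) i * gseq i - gseq i * csum (fus X A) (Suc i)"
proof -
  let ?f = "fus X A" and ?c = "\<Sum>p\<in>set ord. k (ord ! i) p * tr (fus X A p)"
  have 1: "spin ?f (ord ! i) - ?f (ord ! i) = csum ?f i + scl ?c"
    and 2: "spin ?f (ord ! i) + ?f (ord ! i) = csum ?f (Suc i) + scl ?c"
    using cubic_spin[OF assms, of ?f] by (simp_all add: csum_def algebra_simps)
  show ?thesis unfolding dfactor_sharp[OF nth_mem[OF assms]] 1 2
    by (simp add: distrib_left distrib_right scl_commute[of "gseq i" ?c])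
qed

text \<open>The partial sums equal minus and plus the total moment matrix at the two ends. This is
  the moment map condition for the whole product.\<close>

lemma dmom_sharp: "dmom (sharp X A) = - (mu A * mom + mom * mu A)" unfolding dmom_def mom_def
  using dpprod_telescope[of "length ord" "dseq (sharp X A)" "csum (fus X A)" gseq]
  by (simp add: dseq_sharp csum_0 csum_length)

lemma form1_telescope:
  assumes "\<And>i. i < length ord ==> dseq u i = c i * gseq i - gseq i * c (Suc i)"
  shows "form1 u v = tr (c 0 * (dmom v * imom)) + tr (c (length ord) * (imom * dmom v))
    - (\<Sum>i<length ord. tr (c i * thR v (ord ! i)) + tr (c (Suc i) * thL v (ord ! i)))"
  unfolding form1_def dmom_def imom_def by (rule sum_theta_telescope) (use assms seq_inverse in auto)

text \<open>Conjugation preserves log det. This is why the pencil does not change the contraction of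
  the form with the action.\<close>

lemma tr_thL_vact: "a \<in> set ord ==> tr (thL (vact s X) a) = 0" using tr_comm[of "ifactor a * s a" "factor a"]
  by (simp add: dfactor_vact algebra_simps tr_linear) (simp add: mult.assoc[symmetric] factor_ifactor ifactor_factor)

lemma tr_thL_thR: "tr (thR v a) = tr (thL v a)" by (rule tr_comm)

text \<open>For a constant parameter the terms of the single factors cancel between
  \<open>form0\<close> and \<open>form1\<close>; the ends of \<open>form1\<close> give the
  differentials of the whole product, and \<open>form2\<close> contributes nothing.\<close>

lemma form_vact: "2 * form (vact (\<lambda>_. z) X) v = - tr (z * (imom * dmom v + dmom v * imom))"
proof -
  have 2: "form2 (vact (\<lambda>_. z) X) v = 0"
    unfolding form2_def by (intro sum.neutral ballI) (simp add: tr_thL_vact)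
  have 1: "form1 (vact (\<lambda>_. z) X) v = tr (z * (dmom v * imom)) + tr (z * (imom * dmom v))
    - (\<Sum>i<length ord. tr (z * thR v (ord ! i)) + tr (z * thL v (ord ! i)))"
    by (rule form1_telescope) (simp add: dfactor_vact)
  have 0: "2 * form0 (vact (\<lambda>_. z) X) v = - (\<Sum>i<length ord. tr (z * thR v (ord ! i)) + tr (z * thL v (ord ! i)))"
    unfolding form0_vact sum_ord by (simp add: distrib_left tr_add add.commute)
  show ?thesis unfolding form_double 0 1 2 by (simp add: distrib_left tr_add)
qed

text \<open>The weights of the bivector and of the form meet here. The central part of
  \<open>spin\<close> leaves the terms \<open>2 * (\<kappa> a * tr (thL v a))\<close>, with a minus
  sign, in the contraction of \<open>form0\<close>; \<open>form2\<close> supplies the same terms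
  with a plus, because log det of the factor at \<open>p\<close> changes at the rate
  \<open>- 2 * tr (?f p)\<close>.\<close>

lemma form_sharp: "2 * form (sharp X A) v = 4 * pairing (set ord) A v - tr (mu A * (imom * dmom v - dmom v * imom))"
proof -
  let ?f = "fus X A"
  define \<kappa> where "\<kappa> = (\<lambda>q. \<Sum>p\<in>set ord. k q p * tr (?f p))"
  have sharp_split: "sharp X A = (\<lambda>a. sharp0 X A a + vact (spin ?f) X a)" by (simp add: sharp_def fun_eq_iff)
  have 0: "2 * form0 (sharp X A) v = 4 * pairing (set ord) A v
      - (\<Sum>a\<in>set ord. tr (?f a * (thL v a - thR v a)) + tr (spin ?f a * (thL v a + thR v a)))"
    unfolding sharp_split form0_add_left distrib_left[of "2 :: complex"] form0_sharp0 form0_vact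
    by (simp add: sum.distrib)
  have s: "tr (?f a * (thL v a - thR v a)) + tr (spin ?f a * (thL v a + thR v a))
    = tr (csum ?f i * thR v a) + tr (csum ?f (Suc i) * thL v a) + 2 * (\<kappa> a * tr (thL v a))"
    if "i < length ord" "a = ord ! i" for i a
  proof -
    have 1: "csum ?f i = spin ?f a - ?f a - scl (\<kappa> a)" "csum ?f (Suc i) = spin ?f a + ?f a - scl (\<kappa> a)"
      using cubic_spin[OF that(1), of ?f] by (simp_all add: csum_def algebra_simps \<kappa>_def that(2))
    show ?thesis unfolding 1 by (simp add: distrib_left distrib_right right_diff_distrib left_diff_distrib
          tr_linear tr_scl_mult tr_thL_thR mult.assoc)
  qed
  have 1: "form1 (sharp X A) v = - tr (mu A * (dmom v * imom)) + tr (mu A * (imom * dmom v))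
    - (\<Sum>i<length ord. tr (csum ?f i * thR v (ord ! i)) + tr (csum ?f (Suc i) * thL v (ord ! i)))"
    using form1_telescope[of "sharp X A" "csum ?f" v, OF dseq_sharp] by (simp add: csum_0 csum_length tr_uminus)
  have t: "tr (thL (sharp X A) p) = - 2 * tr (?f p)" if "p \<in> set ord" for p
  proof -
    have "tr (thL (sharp X A) p) = tr (ifactor p * (spin ?f p - ?f p) * factor p)
        - tr (ifactor p * factor p * (spin ?f p + ?f p))"
      using that by (simp add: dfactor_sharp algebra_simps tr_linear)
    also have "\<dots> = tr (factor p * ifactor p * (spin ?f p - ?f p)) - tr (ifactor p * factor p * (spin ?f p + ?f p))"
      using tr_comm[of "ifactor p * (spin ?f p - ?f p)" "factor p"] by (simp add: mult.assoc)
    finally show ?thesis using that by (simp add: factor_ifactor ifactor_factor tr_linear)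
  qed
  have "form2 (sharp X A) v = (\<Sum>q\<in>set ord. \<Sum>p\<in>set ord. k p q * (tr (thL (sharp X A) p) * tr (thL v q)))"
    unfolding form2_def by (rule sum.swap)
  also have "\<dots> = (\<Sum>q\<in>set ord. 2 * (\<kappa> q * tr (thL v q)))"
    unfolding \<kappa>_def sum_distrib_left sum_distrib_right by (intro sum.cong refl) (subst k_antisym, simp add: t)
  finally have 2: "form2 (sharp X A) v = (\<Sum>i<length ord. 2 * (\<kappa> (ord ! i) * tr (thL v (ord ! i))))"
    by (simp only: sum_ord)
  have "(\<Sum>a\<in>set ord. tr (?f a * (thL v a - thR v a)) + tr (spin ?f a * (thL v a + thR v a)))
    = (\<Sum>i<length ord. tr (csum ?f i * thR v (ord ! i)) + tr (csum ?f (Suc i) * thL v (ord ! i))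
        + 2 * (\<kappa> (ord ! i) * tr (thL v (ord ! i))))" unfolding sum_ord by (intro sum.cong refl) (use s in auto)
  thus ?thesis unfolding form_double 0 1 2 by (simp add: sum.distrib right_diff_distrib tr_diff)
qed

end

section \<open>Calculus of regular functions\<close>

lemma poly_uminus: "p \<in> poly_functions C ==> (\<lambda>x. - p x) \<in> poly_functions C"
  using poly_functions.mult[OF poly_functions.const[of "-1"]] by fastforce

lemma poly_diff:
  "p \<in> poly_functions C ==> q \<in> poly_functions C ==> (\<lambda>x. p x - q x) \<in> poly_functions C"
  using poly_functions.add[OF _ poly_uminus] by fastforce

lemma poly_sum:
  "(\<And>i. i \<in> I ==> p i \<in> poly_functions C) ==> (\<lambda>x. \<Sum>i\<in>I. p i x) \<in> poly_functions C"
  by (induction I rule: infinite_finite_induct) (auto intro: poly_functions.intros)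

lemma poly_prod:
  "(\<And>i. i \<in> I ==> p i \<in> poly_functions C) ==> (\<lambda>x. \<Prod>i\<in>I. p i x) \<in> poly_functions C"
  by (induction I rule: infinite_finite_induct) (auto intro: poly_functions.intros)

abbreviation tangent_curve :: "'c set => (complex => 'c point) => 'c point => complex => bool" where
  "tangent_curve C \<gamma> \<gamma>' t \<equiv> \<forall>b\<in>C. DERIV (\<lambda>s. \<gamma> s b) t :> \<gamma>' b"

text \<open>The partial derivatives are produced by induction together with the chain rule, for
  \<open>deriv\<close> carries no information before differentiability is known. Testing on
  coordinate lines afterwards identifies \<open>D b\<close> with
  \<open>pderiv_at b p\<close>.\<close>

lemma poly_curve_ex:
  fixes C :: "'c set"
  assumes "finite C" "p \<in> poly_functions C"
  shows "\<exists>D. (\<forall>b. D b \<in> poly_functions C) \<and>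
    (\<forall>\<gamma> \<gamma>' t. tangent_curve C \<gamma> \<gamma>' t \<longrightarrow>
       (DERIV (\<lambda>s. p (\<gamma> s)) t :> (\<Sum>b\<in>C. D b (\<gamma> t) * \<gamma>' b)))" using assms(2)
proof induction
  case (const k)
  show ?case by (rule exI[of _ "\<lambda>_ _. 0"]) (auto intro: poly_functions.const)
next
  case (coord c)
  have "(\<Sum>b\<in>C. (if b = c then 1 else 0) * \<gamma>' b) = \<gamma>' c" for \<gamma>' :: "'c => complex"
    using assms(1) coord by (simp add: if_distrib[of "\<lambda>z. z * _"] sum.delta' cong: if_cong)
  thus ?case
    using coord by (intro exI[of _ "\<lambda>b _. if b = c then 1 else 0"]) (auto intro: poly_functions.const)
next
  case (add p q)
  then obtain D E where D: "\<And>b. D b \<in> poly_functions C" "\<And>\<gamma> \<gamma>' t. tangent_curve C \<gamma> \<gamma>' t ==>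
       DERIV (\<lambda>s. p (\<gamma> s)) t :> (\<Sum>b\<in>C. D b (\<gamma> t) * \<gamma>' b)"
    and E: "\<And>b. E b \<in> poly_functions C" "\<And>\<gamma> \<gamma>' t. tangent_curve C \<gamma> \<gamma>' t ==>
       DERIV (\<lambda>s. q (\<gamma> s)) t :> (\<Sum>b\<in>C. E b (\<gamma> t) * \<gamma>' b)" by blast show ?case
  proof (intro exI[of _ "\<lambda>b x. D b x + E b x"] conjI allI impI poly_functions.add D(1) E(1))
    fix \<gamma> :: "complex => 'c point" and \<gamma>' :: "'c => complex" and t :: complex
    assume "tangent_curve C \<gamma> \<gamma>' t"
    from DERIV_add[OF D(2)[OF this] E(2)[OF this]]
    show "DERIV (\<lambda>s. p (\<gamma> s) + q (\<gamma> s)) t :> (\<Sum>b\<in>C. (D b (\<gamma> t) + E b (\<gamma> t)) * \<gamma>' b)"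
      by (simp add: distrib_right sum.distrib)
  qed
next
  case (mult p q)
  then obtain D E where D: "\<And>b. D b \<in> poly_functions C" "\<And>\<gamma> \<gamma>' t. tangent_curve C \<gamma> \<gamma>' t ==>
       DERIV (\<lambda>s. p (\<gamma> s)) t :> (\<Sum>b\<in>C. D b (\<gamma> t) * \<gamma>' b)"
    and E: "\<And>b. E b \<in> poly_functions C" "\<And>\<gamma> \<gamma>' t. tangent_curve C \<gamma> \<gamma>' t ==>
       DERIV (\<lambda>s. q (\<gamma> s)) t :> (\<Sum>b\<in>C. E b (\<gamma> t) * \<gamma>' b)" by blast show ?case
  proof (intro exI[of _ "\<lambda>b x. p x * E b x + D b x * q x"] conjI allI impI
      poly_functions.add poly_functions.mult D(1) E(1) mult.hyps)
    fix \<gamma> :: "complex => 'c point" and \<gamma>' :: "'c => complex" and t :: complex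
    assume "tangent_curve C \<gamma> \<gamma>' t"
    from DERIV_mult'[OF D(2)[OF this] E(2)[OF this]]
    show "DERIV (\<lambda>s. p (\<gamma> s) * q (\<gamma> s)) t :> (\<Sum>b\<in>C. (p (\<gamma> t) * E b (\<gamma> t) + D b (\<gamma> t) * q (\<gamma> t)) * \<gamma>' b)"
      by (simp add: distrib_right sum.distrib sum_distrib_left sum_distrib_right algebra_simps)
  qed
qed

lemma line_deriv: "DERIV (\<lambda>s. (x(c := s)) b) t :> (if b = c then 1 else 0)"
  for x :: "'c point" by (cases "b = c") auto

lemma sum_indicator: "finite C ==> c \<in> C ==> (\<Sum>b\<in>C. f b * (if b = c then 1 else 0)) = (f c :: complex)"
  by (simp add: if_distrib[of "\<lambda>z. _ * z"] sum.delta' cong: if_cong)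

lemma
  assumes "finite C" "p \<in> poly_functions C"
  shows poly_pderiv: "c \<in> C ==> pderiv_at c p \<in> poly_functions C"
    and poly_curve: "(\<And>b. b \<in> C ==> DERIV (\<lambda>s. \<gamma> s b) t :> \<gamma>' b) ==>
       DERIV (\<lambda>s. p (\<gamma> s)) t :> (\<Sum>b\<in>C. pderiv_at b p (\<gamma> t) * \<gamma>' b)"
proof -
  obtain D where D: "\<And>b. D b \<in> poly_functions C" "\<And>\<gamma> \<gamma>' t. tangent_curve C \<gamma> \<gamma>' t ==>
       DERIV (\<lambda>s. p (\<gamma> s)) t :> (\<Sum>b\<in>C. D b (\<gamma> t) * \<gamma>' b)"
    using poly_curve_ex[OF assms] by blast
  have e: "pderiv_at c p = D c" if "c \<in> C" for c
  proof
    fix x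
    have "DERIV (\<lambda>s. p (x(c := s))) (x c) :> (\<Sum>b\<in>C. D b (x(c := x c)) * (if b = c then 1 else 0))"
      by (intro D(2) ballI line_deriv)
    thus "pderiv_at c p x = D c x" using assms(1) that by (simp add: sum_indicator pderiv_at_def DERIV_imp_deriv)
  qed
  show "c \<in> C ==> pderiv_at c p \<in> poly_functions C" using D(1) by (simp add: e)
  show "DERIV (\<lambda>s. p (\<gamma> s)) t :> (\<Sum>b\<in>C. pderiv_at b p (\<gamma> t) * \<gamma>' b)"
    if "\<And>b. b \<in> C ==> DERIV (\<lambda>s. \<gamma> s b) t :> \<gamma>' b"
    using D(2)[of \<gamma> \<gamma>' t] that by (simp add: e)
qed

lemma affine_space_upd: "x \<in> affine_space C ==> c \<in> C ==> x(c := t) \<in> affine_space C"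
  by (auto simp: affine_space_def)

lemma zariski_open_Int:
  assumes "zariski_open C U" "zariski_open C V"
  shows "zariski_open C (U \<inter> V)" unfolding zariski_open_def
proof (intro conjI ballI)
  fix x assume "x \<in> U \<inter> V"
  then obtain p q where p: "p \<in> poly_functions C" "p x \<noteq> 0" "{y \<in> affine_space C. p y \<noteq> 0} \<subseteq> U"
    and q: "q \<in> poly_functions C" "q x \<noteq> 0" "{y \<in> affine_space C. q y \<noteq> 0} \<subseteq> V"
    using assms unfolding zariski_open_def by blast
  show "\<exists>r\<in>poly_functions C. r x \<noteq> 0 \<and> {y \<in> affine_space C. r y \<noteq> 0} \<subseteq> U \<inter> V"
    by (rule bexI[OF _ poly_functions.mult[OF p(1) q(1)]]) (use p q in auto)
qed (use assms in "auto simp: zariski_open_def")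

lemma zariski_open_nonzero: "p \<in> poly_functions C ==> zariski_open C {x \<in> affine_space C. p x \<noteq> 0}"
  by (auto simp: zariski_open_def)

lemma zariski_open_subset: "zariski_open C U ==> x \<in> U ==> x \<in> affine_space C"
  by (auto simp: zariski_open_def)

lemma regular_onD:
  "regular_on C U f ==> x \<in> U ==> \<exists>p q. p \<in> poly_functions C \<and> q \<in> poly_functions C \<and> q x \<noteq> 0 \<and>
    (\<forall>y\<in>U. q y \<noteq> 0 \<longrightarrow> f y = p y / q y)" unfolding regular_on_def
  apply (drule (1) bspec)
  apply (elim bexE)
  subgoal for p q by (rule exI[of _ p], rule exI[of _ q]) simp
  done

lemma regular_subset:
  assumes f: "regular_on C U f" and V: "V \<subseteq> U"
  shows "regular_on C V f" unfolding regular_on_def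
proof
  fix x assume "x \<in> V"
  hence "x \<in> U" using V by auto
  obtain p q where "p \<in> poly_functions C" "q \<in> poly_functions C" "q x \<noteq> 0"
    "\<And>y. y \<in> U ==> q y \<noteq> 0 ==> f y = p y / q y"
    using regular_onD[OF f \<open>x \<in> U\<close>] by blast
  thus "\<exists>p\<in>poly_functions C. \<exists>q\<in>poly_functions C. q x \<noteq> 0 \<and> (\<forall>y\<in>V. q y \<noteq> 0 \<longrightarrow> f y = p y / q y)"
    using V by (intro bexI[of _ p] bexI[of _ q]) auto
qed

lemma regular_poly: "p \<in> poly_functions C ==> regular_on C U p" unfolding regular_on_def
  by (intro ballI bexI[of _ p] bexI[of _ "\<lambda>_. 1"]) (auto intro: poly_functions.const)

lemma regular_const: "regular_on C U (\<lambda>_. k)" by (rule regular_poly[OF poly_functions.const])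

lemma regular_coord: "c \<in> C ==> regular_on C U (\<lambda>x. x c)" by (rule regular_poly[OF poly_functions.coord])

lemma regular_cong: "(\<And>x. x \<in> U ==> f x = g x) ==> regular_on C U f \<longleftrightarrow> regular_on C U g"
  unfolding regular_on_def by simp

lemma
  assumes f: "regular_on C U f" and g: "regular_on C U g"
  shows regular_add: "regular_on C U (\<lambda>x. f x + g x)" and regular_mult: "regular_on C U (\<lambda>x. f x * g x)"
proof -
  let ?Q = "\<lambda>x f. \<exists>p\<in>poly_functions C. \<exists>q\<in>poly_functions C. q x \<noteq> 0 \<and> (\<forall>y\<in>U. q y \<noteq> 0 \<longrightarrow> f y = p y / q y)"
  have "?Q x (\<lambda>y. f y + g y) \<and> ?Q x (\<lambda>y. f y * g y)" if x: "x \<in> U" for x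
  proof -
    obtain p q r s where h: "p \<in> poly_functions C" "q \<in> poly_functions C" "q x \<noteq> 0"
      "\<And>y. y \<in> U ==> q y \<noteq> 0 ==> f y = p y / q y"
      and k: "r \<in> poly_functions C" "s \<in> poly_functions C" "s x \<noteq> 0"
      "\<And>y. y \<in> U ==> s y \<noteq> 0 ==> g y = r y / s y"
      using regular_onD[OF f x] regular_onD[OF g x] by (elim exE conjE) blast
    have "?Q x (\<lambda>y. f y + g y)"
      by (rule bexI[of _ "\<lambda>y. p y * s y + r y * q y"], rule bexI[of _ "\<lambda>y. q y * s y"])
        (use h k in "auto intro!: poly_functions.add poly_functions.mult simp: field_simps")
    moreover have "?Q x (\<lambda>y. f y * g y)"
      by (rule bexI[of _ "\<lambda>y. p y * r y"], rule bexI[of _ "\<lambda>y. q y * s y"])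
        (use h k in "auto intro!: poly_functions.mult")
    ultimately show ?thesis ..
  qed
  thus "regular_on C U (\<lambda>x. f x + g x)" "regular_on C U (\<lambda>x. f x * g x)"
    unfolding regular_on_def by blast+
qed

lemma regular_inverse:
  assumes "regular_on C U f" "\<And>x. x \<in> U ==> f x \<noteq> 0"
  shows "regular_on C U (\<lambda>x. inverse (f x))" unfolding regular_on_def
proof
  fix x assume x: "x \<in> U"
  obtain p q where h: "p \<in> poly_functions C" "q \<in> poly_functions C" "q x \<noteq> 0"
      "\<And>y. y \<in> U ==> q y \<noteq> 0 ==> f y = p y / q y" using regular_onD[OF assms(1) x] by blast
  have "p x \<noteq> 0" using h(3) h(4)[OF x] assms(2)[OF x] by auto
  moreover have "inverse (f y) = q y * q y / (p y * q y)" if "y \<in> U" "p y * q y \<noteq> 0" for y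
    using h(4)[OF that(1)] that(2) by simp
  ultimately show "\<exists>r\<in>poly_functions C. \<exists>s\<in>poly_functions C. s x \<noteq> 0 \<and> (\<forall>y\<in>U. s y \<noteq> 0 \<longrightarrow> inverse (f y) = r y / s y)"
    using h by (intro bexI[of _ "\<lambda>y. q y * q y"] bexI[of _ "\<lambda>y. p y * q y"]) (auto intro: poly_functions.mult)
qed

lemma regular_uminus: "regular_on C U f ==> regular_on C U (\<lambda>x. - f x)"
  using regular_mult[OF regular_const[of C U "-1"]] by fastforce

lemma regular_diff: "regular_on C U f ==> regular_on C U g ==> regular_on C U (\<lambda>x. f x - g x)"
  using regular_add[OF _ regular_uminus] by fastforce

lemma regular_divide:
  "regular_on C U f ==> regular_on C U g ==> (\<And>x. x \<in> U ==> g x \<noteq> 0) ==> regular_on C U (\<lambda>x. f x / g x)"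
  unfolding divide_inverse by (intro regular_mult regular_inverse)

lemma regular_sum: "(\<And>i. i \<in> I ==> regular_on C U (f i)) ==> regular_on C U (\<lambda>x. \<Sum>i\<in>I. f i x)"
  by (induction I rule: infinite_finite_induct) (auto intro: regular_const regular_add)

lemma regular_prod: "(\<And>i. i \<in> I ==> regular_on C U (f i)) ==> regular_on C U (\<lambda>x. \<Prod>i\<in>I. f i x)"
  by (induction I rule: infinite_finite_induct) (auto intro: regular_const regular_mult)

lemmas regular_intros = regular_const regular_coord regular_add regular_mult regular_uminus
  regular_diff regular_sum regular_prod

lemma eventually_nonzero: "isCont g t ==> g t \<noteq> 0 ==> eventually (\<lambda>s. g s \<noteq> 0) (nhds t)"
  for g :: "complex => complex" unfolding isCont_def tendsto_at_iff_tendsto_nhds by (rule tendsto_imp_eventually_ne)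

locale affine_open =
  fixes C :: "'c set" and U :: "'c point set"
  assumes finC [simp]: "finite C" and openU: "zariski_open C U"
begin

lemma in_affine: "x \<in> U ==> x \<in> affine_space C" using openU by (rule zariski_open_subset)

lemma upd_affine: "x \<in> U ==> c \<in> C ==> x(c := s) \<in> affine_space C" by (intro affine_space_upd in_affine)

text \<open>A polynomial that is nonzero at the point and whose nonvanishing locus lies in
  \<open>U\<close> stays nonzero along the curve by continuity. The curve need only be
  differentiable at \<open>t\<close>, so this serves for exponential curves as well as for
  coordinate lines.\<close>

lemma curve_stays:
  assumes "\<And>b. b \<in> C ==> DERIV (\<lambda>s. \<gamma> s b) t :> \<gamma>' b"
    and "\<And>s. \<gamma> s \<in> affine_space C" and "\<gamma> t \<in> U"
  shows "eventually (\<lambda>s. \<gamma> s \<in> U) (nhds t)"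
proof -
  obtain p where p: "p \<in> poly_functions C" "p (\<gamma> t) \<noteq> 0" "{y \<in> affine_space C. p y \<noteq> 0} \<subseteq> U"
    using openU assms(3) unfolding zariski_open_def by blast
  have "DERIV (\<lambda>s. p (\<gamma> s)) t :> (\<Sum>b\<in>C. pderiv_at b p (\<gamma> t) * \<gamma>' b)"
    by (rule poly_curve) (use p assms in auto)
  hence "eventually (\<lambda>s. p (\<gamma> s) \<noteq> 0) (nhds t)"
    using p(2) by (intro eventually_nonzero DERIV_isCont)
  thus ?thesis by (rule eventually_mono) (use assms(2) p(3) in auto)
qed

lemma regular_curve_local:
  assumes f: "\<And>y. y \<in> U ==> q y \<noteq> 0 ==> f y = p y / q y"
    and pq: "p \<in> poly_functions C" "q \<in> poly_functions C"
    and \<gamma>: "\<And>b. b \<in> C ==> DERIV (\<lambda>s. \<gamma> s b) t :> \<gamma>' b"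
      "\<And>s. \<gamma> s \<in> affine_space C" and x: "\<gamma> t = x" "x \<in> U" "q x \<noteq> 0"
  shows "DERIV (\<lambda>s. f (\<gamma> s)) t :> (\<Sum>b\<in>C. (pderiv_at b p x * q x - p x * pderiv_at b q x) / (q x * q x) * \<gamma>' b)"
proof -
  let ?d = "((\<Sum>b\<in>C. pderiv_at b p x * \<gamma>' b) * q x - p x * (\<Sum>b\<in>C. pderiv_at b q x * \<gamma>' b)) / (q x * q x)"
  have p': "DERIV (\<lambda>s. p (\<gamma> s)) t :> (\<Sum>b\<in>C. pderiv_at b p (\<gamma> t) * \<gamma>' b)"
    and q': "DERIV (\<lambda>s. q (\<gamma> s)) t :> (\<Sum>b\<in>C. pderiv_at b q (\<gamma> t) * \<gamma>' b)"
    by (rule poly_curve; use pq \<gamma> in auto)+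
  have qne: "eventually (\<lambda>s. q (\<gamma> s) \<noteq> 0) (nhds t)"
    using x by (intro eventually_nonzero DERIV_isCont[OF q']) auto
  have d: "DERIV (\<lambda>s. p (\<gamma> s) / q (\<gamma> s)) t :> ?d" using DERIV_divide[OF p' q'] x by simp
  have ev: "eventually (\<lambda>s. f (\<gamma> s) = p (\<gamma> s) / q (\<gamma> s)) (nhds t)"
    using eventually_conj[OF curve_stays[OF \<gamma>] qne] x by (auto elim: eventually_mono simp: f)
  have "DERIV (\<lambda>s. f (\<gamma> s)) t :> ?d" by (rule DERIV_cong_ev[OF refl ev refl, THEN iffD2, OF d])
  also have "?d = (\<Sum>b\<in>C. (pderiv_at b p x * q x - p x * pderiv_at b q x) / (q x * q x) * \<gamma>' b)"
    unfolding sum_distrib_left sum_distrib_right sum_subtractf[symmetric] sum_divide_distrib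
    by (rule sum.cong) (use x in "auto simp: field_simps")
  finally show ?thesis .
qed

lemma pderiv_quotient:
  assumes f: "\<And>y. y \<in> U ==> q y \<noteq> 0 ==> f y = p y / q y"
    and pq: "p \<in> poly_functions C" "q \<in> poly_functions C" and x: "x \<in> U" "q x \<noteq> 0" "c \<in> C"
  shows "pderiv_at c f x = (pderiv_at c p x * q x - p x * pderiv_at c q x) / (q x * q x)"
proof -
  have "DERIV (\<lambda>s. f (x(c := s))) (x c) :> (\<Sum>b\<in>C. (pderiv_at b p x * q x - p x * pderiv_at b q x) / (q x * q x) * (if b = c then 1 else 0))"
    by (rule regular_curve_local[where \<gamma> = "\<lambda>s. x(c := s)", OF f pq line_deriv])
      (use x upd_affine in auto)
  hence "DERIV (\<lambda>s. f (x(c := s))) (x c) :> (pderiv_at c p x * q x - p x * pderiv_at c q x) / (q x * q x)"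
    by (subst (asm) sum_indicator) (use x in auto)
  thus ?thesis unfolding pderiv_at_def[of c f] by (rule DERIV_imp_deriv)
qed

lemma regular_curve:
  assumes f: "regular_on C U f"
    and \<gamma>: "\<And>b. b \<in> C ==> DERIV (\<lambda>s. \<gamma> s b) t :> \<gamma>' b"
      "\<And>s. \<gamma> s \<in> affine_space C" and x: "\<gamma> t \<in> U"
  shows "DERIV (\<lambda>s. f (\<gamma> s)) t :> (\<Sum>b\<in>C. pderiv_at b f (\<gamma> t) * \<gamma>' b)"
proof -
  obtain p q where h: "p \<in> poly_functions C" "q \<in> poly_functions C" "q (\<gamma> t) \<noteq> 0"
      "\<And>y. y \<in> U ==> q y \<noteq> 0 ==> f y = p y / q y" using regular_onD[OF f x] by blast
  show ?thesis using regular_curve_local[OF h(4,1,2) \<gamma> refl x h(3)]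
    by (simp add: pderiv_quotient[OF h(4,1,2) x h(3)])
qed

lemma regular_line:
  assumes "regular_on C U f" "x \<in> U" "c \<in> C"
  shows "DERIV (\<lambda>s. f (x(c := s))) (x c) :> pderiv_at c f x"
proof -
  have "DERIV (\<lambda>s. f (x(c := s))) (x c) :> (\<Sum>b\<in>C. pderiv_at b f (x(c := x c)) * (if b = c then 1 else 0))"
    by (rule regular_curve[where \<gamma> = "\<lambda>s. x(c := s)", OF assms(1) line_deriv]) (use assms upd_affine in auto)
  thus ?thesis using assms by (simp add: sum_indicator)
qed

lemma regular_pderiv:
  assumes f: "regular_on C U f" and c: "c \<in> C"
  shows "regular_on C U (pderiv_at c f)" unfolding regular_on_def
proof
  fix x assume x: "x \<in> U"
  obtain p q where h: "p \<in> poly_functions C" "q \<in> poly_functions C" "q x \<noteq> 0"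
      "\<And>y. y \<in> U ==> q y \<noteq> 0 ==> f y = p y / q y" using regular_onD[OF f x] by blast
  show "\<exists>p\<in>poly_functions C. \<exists>q\<in>poly_functions C. q x \<noteq> 0 \<and>
      (\<forall>y\<in>U. q y \<noteq> 0 \<longrightarrow> pderiv_at c f y = p y / q y)"
    by (rule bexI[of _ "\<lambda>y. pderiv_at c p y * q y - p y * pderiv_at c q y"], rule bexI[of _ "\<lambda>y. q y * q y"])
      (use h c pderiv_quotient[OF h(4,1,2)] poly_pderiv[OF finC] in
        \<open>auto intro!: poly_functions.mult poly_diff\<close>)
qed

text \<open>The coordinate line in \<open>pderiv_at\<close> may leave \<open>U\<close>, but by
  \<open>curve_stays\<close> it lies in \<open>U\<close> near the point, and the derivative sees
  nothing else.\<close>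

lemma pderiv_cong:
  assumes "\<And>y. y \<in> U ==> f y = g y" "x \<in> U" "c \<in> C"
  shows "pderiv_at c f x = pderiv_at c g x"
proof -
  have "eventually (\<lambda>s. x(c := s) \<in> U) (nhds (x c))"
    by (rule curve_stays[where \<gamma> = "\<lambda>s. x(c := s)", OF line_deriv]) (use assms upd_affine in auto)
  hence "eventually (\<lambda>s. f (x(c := s)) = g (x(c := s))) (nhds (x c))"
    by (rule eventually_mono) (use assms in auto)
  thus ?thesis unfolding pderiv_at_def by (rule deriv_cong_ev) simp
qed

context
  fixes f g x c
  assumes fg: "regular_on C U f" "regular_on C U g" and xc: "x \<in> U" "c \<in> C"
begin

lemma pderiv_add: "pderiv_at c (\<lambda>y. f y + g y) x = pderiv_at c f x + pderiv_at c g x"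
  unfolding pderiv_at_def[of c "\<lambda>y. f y + g y"] by (rule DERIV_imp_deriv DERIV_add regular_line fg xc)+

lemma pderiv_diff: "pderiv_at c (\<lambda>y. f y - g y) x = pderiv_at c f x - pderiv_at c g x"
  unfolding pderiv_at_def[of c "\<lambda>y. f y - g y"] by (rule DERIV_imp_deriv DERIV_diff regular_line fg xc)+

lemma pderiv_mult: "pderiv_at c (\<lambda>y. f y * g y) x = f x * pderiv_at c g x + pderiv_at c f x * g x"
  unfolding pderiv_at_def[of c "\<lambda>y. f y * g y"]
  using DERIV_mult'[OF regular_line[OF fg(1) xc] regular_line[OF fg(2) xc]] by (simp add: DERIV_imp_deriv)

end

lemma pderiv_const [simp]: "pderiv_at c (\<lambda>_. k) x = 0" by (simp add: pderiv_at_def)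

lemma pderiv_coord: "pderiv_at c (\<lambda>y. y b) x = (if b = c then 1 else 0)"
  unfolding pderiv_at_def by (rule DERIV_imp_deriv[OF line_deriv])

lemma pderiv_cmult:
  assumes "regular_on C U f" "x \<in> U" "c \<in> C"
  shows "pderiv_at c (\<lambda>y. k * f y) x = k * pderiv_at c f x"
  using pderiv_mult[OF regular_const assms(1)] assms by simp

lemma pderiv_sum:
  assumes "\<And>i. i \<in> I ==> regular_on C U (f i)" "x \<in> U" "c \<in> C"
  shows "pderiv_at c (\<lambda>y. \<Sum>i\<in>I. f i y) x = (\<Sum>i\<in>I. pderiv_at c (f i) x)" using assms(1)
  by (induction I rule: infinite_finite_induct) (simp_all add: pderiv_add regular_sum assms)

lemma pderiv2_add:
  assumes "regular_on C U f" "regular_on C U g" "x \<in> U" "b \<in> C" "c \<in> C"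
  shows "pderiv_at b (pderiv_at c (\<lambda>x. f x + g x)) x = pderiv_at b (pderiv_at c f) x + pderiv_at b (pderiv_at c g) x"
proof -
  have "pderiv_at b (pderiv_at c (\<lambda>x. f x + g x)) x = pderiv_at b (\<lambda>y. pderiv_at c f y + pderiv_at c g y) x"
    by (rule pderiv_cong) (use assms pderiv_add in auto)
  also have "\<dots> = pderiv_at b (pderiv_at c f) x + pderiv_at b (pderiv_at c g) x"
    by (rule pderiv_add) (use assms regular_pderiv in auto)
  finally show ?thesis .
qed

lemma pderiv2_mult:
  assumes "regular_on C U f" "regular_on C U g" "x \<in> U" "b \<in> C" "c \<in> C"
  shows "pderiv_at b (pderiv_at c (\<lambda>x. f x * g x)) x = f x * pderiv_at b (pderiv_at c g) x
    + (pderiv_at b f x * pderiv_at c g x + pderiv_at c f x * pderiv_at b g x) + pderiv_at b (pderiv_at c f) x * g x"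
proof -
  have "pderiv_at b (pderiv_at c (\<lambda>x. f x * g x)) x = pderiv_at b (\<lambda>y. f y * pderiv_at c g y + pderiv_at c f y * g y) x"
    by (rule pderiv_cong) (use assms pderiv_mult in auto)
  also have "\<dots> = pderiv_at b (\<lambda>y. f y * pderiv_at c g y) x + pderiv_at b (\<lambda>y. pderiv_at c f y * g y) x"
    by (rule pderiv_add) (intro regular_mult regular_pderiv assms)+
  finally show ?thesis using assms by (simp add: pderiv_mult regular_pderiv)
qed

lemma pderiv_swap_poly:
  assumes "p \<in> poly_functions C" "x \<in> U" "b \<in> C" "c \<in> C"
  shows "pderiv_at b (pderiv_at c p) x = pderiv_at c (pderiv_at b p) x" using assms(1)
proof induction
  case (add p q)
  thus ?case using assms by (simp add: pderiv2_add regular_poly)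
next
  case (mult p q)
  thus ?case using assms by (simp add: pderiv2_mult regular_poly)
qed (simp_all add: pderiv_const[abs_def] pderiv_coord[abs_def])

end

text \<open>No quotient is differentiated twice: the product f q = p is, and in its Leibniz
  expansion everything except q times the second derivative of f is symmetric in \<open>b\<close>
  and \<open>c\<close>, the polynomials being covered by \<open>pderiv_swap_poly\<close>.\<close>

lemma (in affine_open) pderiv_swap:
  assumes f: "regular_on C U f" and x: "x \<in> U" and bc: "b \<in> C" "c \<in> C"
  shows "pderiv_at b (pderiv_at c f) x = pderiv_at c (pderiv_at b f) x"
proof -
  obtain p q where h: "p \<in> poly_functions C" "q \<in> poly_functions C" "q x \<noteq> 0"
      "\<And>y. y \<in> U ==> q y \<noteq> 0 ==> f y = p y / q y" using regular_onD[OF f x] by blast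
  let ?V = "U \<inter> {y \<in> affine_space C. q y \<noteq> 0}"
  interpret V: affine_open C ?V by unfold_locales (auto intro: zariski_open_Int openU zariski_open_nonzero h)
  have xV: "x \<in> ?V" using x h in_affine by auto
  have reg: "regular_on C ?V f" "regular_on C ?V q" "regular_on C ?V p"
    using f h regular_poly by (auto intro: regular_subset)
  have p: "pderiv_at b (pderiv_at c p) x = f x * pderiv_at b (pderiv_at c q) x
    + (pderiv_at b f x * pderiv_at c q x + pderiv_at c f x * pderiv_at b q x) + pderiv_at b (pderiv_at c f) x * q x"
    if "b \<in> C" "c \<in> C" for b c
  proof -
    have "pderiv_at c p y = pderiv_at c (\<lambda>x. f x * q x) y" if "y \<in> ?V" for y
      by (rule V.pderiv_cong) (use h that \<open>c \<in> C\<close> in auto)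
    hence "pderiv_at b (pderiv_at c p) x = pderiv_at b (pderiv_at c (\<lambda>x. f x * q x)) x"
      by (rule V.pderiv_cong) (use that xV in auto)
    thus ?thesis using V.pderiv2_mult[OF reg(1,2) xV that] by simp
  qed
  have "pderiv_at b (pderiv_at c f) x * q x = pderiv_at c (pderiv_at b f) x * q x"
  proof -
    have "u = v" if "P = a + e + u" "P = a + e + v" for P a e u v :: complex using that by (simp add: algebra_simps)
    from this[OF p[OF bc] p[OF bc(2,1), folded V.pderiv_swap_poly[OF h(1) xV bc] V.pderiv_swap_poly[OF h(2) xV bc],
      unfolded add.commute[of "pderiv_at c f x * _"]]] show ?thesis .
  qed
  thus ?thesis using h(3) by simp
qed

section \<open>Matrix-valued regular functions\<close>

context affine_open
begin

definition dirD :: "'c point => ('c point => complex) => 'c point => complex" where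
  "dirD V f x = (\<Sum>c\<in>C. V c * pderiv_at c f x)"

text \<open>A support common to all points keeps the entrywise derivative finitely supported, so
  that \<open>mD\<close> is a ring element again; the constant scalar part has derivative 0.\<close>

definition mreg :: "('c point => 'i umat) => bool" where
  "mreg A \<longleftrightarrow> (\<exists>K. finite K \<and> (\<forall>y\<in>U. idx (A y) \<subseteq> K)) \<and> (\<exists>c. \<forall>y\<in>U. sca (A y) = c)
     \<and> (\<forall>i j. regular_on C U (\<lambda>y. ent (A y) i j))"

definition mD :: "'c point => ('c point => 'i umat) => 'c point => 'i umat" where
  "mD V A x = umat 0 (\<lambda>i j. dirD V (\<lambda>y. ent (A y) i j) x)"

lemma dirD_cong: "(\<And>y. y \<in> U ==> f y = g y) ==> x \<in> U ==> dirD V f x = dirD V g x"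
  unfolding dirD_def by (intro sum.cong arg_cong2[where f = "(*)"] refl pderiv_cong)

lemma dirD_const [simp]: "dirD V (\<lambda>_. k) x = 0" by (simp add: dirD_def)

lemma dirD_unit: "c \<in> C ==> dirD (unit_pt c) f x = pderiv_at c f x"
  by (simp add: dirD_def unit_pt_def if_distrib[of "\<lambda>z. z * _"] cong: if_cong)

lemma dirD_coord: "c \<in> C ==> dirD V (\<lambda>y. y c) x = V c"
  by (simp add: dirD_def pderiv_coord if_distrib[of "\<lambda>z. _ * z"] cong: if_cong)

lemma dirD_regular: "regular_on C U f ==> regular_on C U (dirD V f)"
  unfolding dirD_def[abs_def] by (intro regular_sum regular_mult regular_const regular_pderiv) auto

lemma dirD_add:
  "regular_on C U f ==> regular_on C U g ==> x \<in> U ==> dirD V (\<lambda>y. f y + g y) x = dirD V f x + dirD V g x"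
  by (simp add: dirD_def pderiv_add distrib_left sum.distrib)

lemma dirD_diff:
  "regular_on C U f ==> regular_on C U g ==> x \<in> U ==> dirD V (\<lambda>y. f y - g y) x = dirD V f x - dirD V g x"
  by (simp add: dirD_def pderiv_diff right_diff_distrib sum_subtractf)

lemma dirD_mult: "regular_on C U f ==> regular_on C U g ==> x \<in> U
    ==> dirD V (\<lambda>y. f y * g y) x = f x * dirD V g x + dirD V f x * g x"
  by (simp add: dirD_def pderiv_mult distrib_left sum.distrib sum_distrib_left sum_distrib_right algebra_simps)

lemma dirD_cmult: "regular_on C U f ==> x \<in> U ==> dirD V (\<lambda>y. k * f y) x = k * dirD V f x"
  by (simp add: dirD_mult regular_const)

lemma dirD_sum:
  assumes "\<And>i. i \<in> I ==> regular_on C U (f i)" "x \<in> U"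
  shows "dirD V (\<lambda>y. \<Sum>i\<in>I. f i y) x = (\<Sum>i\<in>I. dirD V (f i) x)" using assms(1)
  by (induction I rule: infinite_finite_induct) (simp_all add: dirD_add regular_sum assms)

lemma dirD_swap:
  assumes "regular_on C U f" "x \<in> U"
  shows "dirD u (dirD v f) x = dirD v (dirD u f) x"
proof -
  have e: "dirD u (dirD v f) x = (\<Sum>b\<in>C. \<Sum>c\<in>C. u b * v c * pderiv_at b (pderiv_at c f) x)" for u v
  proof -
    have "pderiv_at b (dirD v f) x = (\<Sum>c\<in>C. v c * pderiv_at b (pderiv_at c f) x)" if "b \<in> C" for b
      unfolding dirD_def[abs_def] using assms that
      by (simp add: pderiv_sum pderiv_cmult regular_mult regular_const regular_pderiv)
    thus ?thesis by (simp add: dirD_def[of u] sum_distrib_left mult.assoc)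
  qed
  show ?thesis unfolding e by (subst sum.swap) (simp add: pderiv_swap[OF assms] mult.commute)
qed

lemma mreg_ent: "mreg A ==> regular_on C U (\<lambda>y. ent (A y) i j)" by (simp add: mreg_def)

lemma mregI:
  assumes "finite K" "\<And>y i j. y \<in> U ==> ent (A y) i j \<noteq> 0 ==> i \<in> K \<and> j \<in> K" "\<And>y. y \<in> U ==> sca (A y) = c"
    "\<And>i j. regular_on C U (\<lambda>y. ent (A y) i j)"
  shows "mreg A"
proof -
  have "idx (A y) \<subseteq> K" if "y \<in> U" for y using assms(2)[OF that] by (fastforce simp: idx_def)
  thus ?thesis unfolding mreg_def using assms(1,3,4) by blast
qed

lemma dirD_ent_outside:
  assumes K: "\<And>y. y \<in> U ==> idx (A y) \<subseteq> K" and "x \<in> U" "i \<notin> K \<or> j \<notin> K"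
  shows "dirD V (\<lambda>y. ent (A y) i j) x = 0"
proof -
  have "ent (A y) i j = 0" if "y \<in> U" for y by (rule ent_outside) (use K[OF that] assms(3) in auto)
  hence "dirD V (\<lambda>y. ent (A y) i j) x = dirD V (\<lambda>_. 0) x" by (rule dirD_cong[OF _ assms(2)])
  thus ?thesis by simp
qed

lemma
  assumes "mreg A" "x \<in> U"
  shows sca_mD: "sca (mD V A x) = 0"
    and ent_mD: "ent (mD V A x) i j = dirD V (\<lambda>y. ent (A y) i j) x"
proof -
  obtain K where K: "finite K" "\<And>y. y \<in> U ==> idx (A y) \<subseteq> K"
    using assms(1) unfolding mreg_def by blast
  have *: "i \<in> K \<and> j \<in> K" if "dirD V (\<lambda>y. ent (A y) i j) x \<noteq> 0" for i j
    using that dirD_ent_outside[of A K x i j V, OF K(2) assms(2)] by auto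
  show "sca (mD V A x) = 0" "ent (mD V A x) i j = dirD V (\<lambda>y. ent (A y) i j) x"
    unfolding mD_def using sca_umat[OF K(1) *] ent_umat[OF K(1) *] by simp_all
qed

lemma mreg_const: "mreg (\<lambda>_. A)" by (rule mregI[of "idx A"]) (auto dest: ent_nonzero intro: regular_const)

lemma mreg_add:
  assumes A: "mreg A" and B: "mreg B"
  shows "mreg (\<lambda>y. A y + B y)"
proof -
  obtain K where K: "finite K" "\<And>y. y \<in> U ==> idx (A y) \<subseteq> K" using A unfolding mreg_def by blast
  obtain L where L: "finite L" "\<And>y. y \<in> U ==> idx (B y) \<subseteq> L" using B unfolding mreg_def by blast
  obtain c where c: "\<And>y. y \<in> U ==> sca (A y) = c" using A unfolding mreg_def by blast
  obtain d where d: "\<And>y. y \<in> U ==> sca (B y) = d" using B unfolding mreg_def by blast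
  show ?thesis
  proof (rule mregI[of "K \<union> L" _ "c + d"])
    show "i \<in> K \<union> L \<and> j \<in> K \<union> L" if y: "y \<in> U" and n: "ent (A y + B y) i j \<noteq> 0" for y i j
    proof -
      have "ent (A y) i j \<noteq> 0 \<or> ent (B y) i j \<noteq> 0" using n by auto
      thus ?thesis using ent_nonzero[of "A y" i j] ent_nonzero[of "B y" i j] K(2)[OF y] L(2)[OF y] by auto
    qed
    show "regular_on C U (\<lambda>y. ent (A y + B y) i j)" for i j
      using regular_add[OF mreg_ent[OF A] mreg_ent[OF B]] by simp
  qed (simp_all add: K L c d)
qed

lemma mreg_uminus:
  assumes A: "mreg A"
  shows "mreg (\<lambda>y. - A y)"
proof -
  obtain K where K: "finite K" "\<And>y. y \<in> U ==> idx (A y) \<subseteq> K" using A unfolding mreg_def by blast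
  obtain c where c: "\<And>y. y \<in> U ==> sca (A y) = c" using A unfolding mreg_def by blast
  show ?thesis
  proof (rule mregI[of K _ "- c"])
    show "i \<in> K \<and> j \<in> K" if y: "y \<in> U" and n: "ent (- A y) i j \<noteq> 0" for y i j
      using n ent_nonzero[of "A y" i j] K(2)[OF y] by auto
    show "regular_on C U (\<lambda>y. ent (- A y) i j)" for i j using regular_uminus[OF mreg_ent[OF A]] by simp
  qed (simp_all add: K c)
qed

lemma mreg_diff: "mreg A ==> mreg B ==> mreg (\<lambda>y. A y - B y)" using mreg_add[OF _ mreg_uminus, of A B] by simp

lemma mreg_mult: "mreg A ==> mreg B ==> mreg (\<lambda>y. A y * B y)"
  and mD_mult: "mreg A ==> mreg B ==> x \<in> U ==> mD V (\<lambda>y. A y * B y) x = A x * mD V B x + mD V A x * B x"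
proof -
  assume A: "mreg A" and B: "mreg B"
  obtain K where K: "finite K" "\<And>y. y \<in> U ==> idx (A y) \<subseteq> K" using A unfolding mreg_def by blast
  obtain L where L: "finite L" "\<And>y. y \<in> U ==> idx (B y) \<subseteq> L" using B unfolding mreg_def by blast
  obtain c where c: "\<And>y. y \<in> U ==> sca (A y) = c" using A unfolding mreg_def by blast
  obtain d where d: "\<And>y. y \<in> U ==> sca (B y) = d" using B unfolding mreg_def by blast
  let ?K = "K \<union> L"
  have e: "ent (A y * B y) i j = c * ent (B y) i j + ent (A y) i j * d + (\<Sum>k\<in>?K. ent (A y) i k * ent (B y) k j)"
    if "y \<in> U" for y i j
    using ent_mult_on[of ?K "A y" "B y" i j] K(1) L(1) K(2)[OF that] by (auto simp: c[OF that] d[OF that])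
  have reg: "regular_on C U (\<lambda>y. c * ent (B y) i j + ent (A y) i j * d + (\<Sum>k\<in>?K. ent (A y) i k * ent (B y) k j))" for i j
    by (intro regular_intros mreg_ent A B)
  show AB: "mreg (\<lambda>y. A y * B y)"
  proof (rule mregI[of ?K _ "c * d"])
    show "i \<in> ?K \<and> j \<in> ?K" if y: "y \<in> U" and n: "ent (A y * B y) i j \<noteq> 0" for y i j
    proof (rule ccontr)
      assume "\<not> ?thesis"
      hence "i \<notin> idx (A y) \<and> i \<notin> idx (B y) \<or> j \<notin> idx (A y) \<and> j \<notin> idx (B y)"
        using K(2)[OF y] L(2)[OF y] by blast
      hence "ent (A y * B y) i j = 0" by (auto simp: ent_mult ent_outside intro!: sum.neutral)
      with n show False by simp
    qed
    show "regular_on C U (\<lambda>y. ent (A y * B y) i j)" for i j using reg by (subst regular_cong[OF e])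
  qed (use K L c d in auto)
  show "mD V (\<lambda>y. A y * B y) x = A x * mD V B x + mD V A x * B x" if x: "x \<in> U"
  proof (rule umat_eqI)
    fix i j
    have i: "idx (mD V A x) \<subseteq> K"
      unfolding idx_def by (auto simp: ent_mD[OF A x]; use dirD_ent_outside[of A K x, OF K(2) x] in force)
    have "ent (mD V (\<lambda>y. A y * B y) x) i j = dirD V (\<lambda>y. ent (A y * B y) i j) x"
      by (rule ent_mD[OF AB x])
    also have "\<dots> = dirD V (\<lambda>y. c * ent (B y) i j + ent (A y) i j * d + (\<Sum>k\<in>?K. ent (A y) i k * ent (B y) k j)) x"
      by (rule dirD_cong[OF e x])
    also have "\<dots> = dirD V (\<lambda>y. c * ent (B y) i j) x + dirD V (\<lambda>y. ent (A y) i j * d) x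
        + (\<Sum>k\<in>?K. dirD V (\<lambda>y. ent (A y) i k * ent (B y) k j) x)"
      by (subst dirD_add dirD_sum; (intro regular_intros mreg_ent A B x)?)+ simp
    also have "\<dots> = c * dirD V (\<lambda>y. ent (B y) i j) x + dirD V (\<lambda>y. ent (A y) i j) x * d
        + (\<Sum>k\<in>?K. ent (A x) i k * dirD V (\<lambda>y. ent (B y) k j) x + dirD V (\<lambda>y. ent (A y) i k) x * ent (B x) k j)"
      using x by (simp add: dirD_mult regular_const mreg_ent A B)
    also have "\<dots> = ent (A x * mD V B x) i j + ent (mD V A x * B x) i j" using K(1) L(1) K(2)[OF x] i
      by (subst (1 2) ent_mult_on[of ?K]) (auto simp: sca_mD ent_mD A B x c d sum.distrib)
    finally show "ent (mD V (\<lambda>y. A y * B y) x) i j = ent (A x * mD V B x + mD V A x * B x) i j" by simp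
  qed (simp add: sca_mD A B AB x)
qed

lemma mD_cong: "(\<And>y. y \<in> U ==> A y = B y) ==> x \<in> U ==> mD V A x = mD V B x"
proof -
  assume "\<And>y. y \<in> U ==> A y = B y" "x \<in> U"
  hence "dirD V (\<lambda>y. ent (A y) i j) x = dirD V (\<lambda>y. ent (B y) i j) x" for i j
    by (intro dirD_cong) auto
  thus ?thesis by (simp add: mD_def)
qed

lemma mreg_cong:
  assumes "\<And>y. y \<in> U ==> A y = B y" shows "mreg A \<longleftrightarrow> mreg B"
proof -
  have "regular_on C U (\<lambda>y. ent (A y) i j) \<longleftrightarrow> regular_on C U (\<lambda>y. ent (B y) i j)" for i j
    by (rule regular_cong) (simp add: assms)
  thus ?thesis by (simp add: mreg_def assms)
qed

lemma mD_const [simp]: "x \<in> U ==> mD V (\<lambda>_. A) x = 0"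
  by (rule umat_eqI) (simp_all add: sca_mD ent_mD mreg_const)

lemma mD_add: "mreg A ==> mreg B ==> x \<in> U ==> mD V (\<lambda>y. A y + B y) x = mD V A x + mD V B x"
  and mD_diff: "mreg A ==> mreg B ==> x \<in> U ==> mD V (\<lambda>y. A y - B y) x = mD V A x - mD V B x"
  by (rule umat_eqI; simp add: sca_mD ent_mD mreg_add mreg_diff dirD_add dirD_diff mreg_ent)+

lemma mreg_mD:
  assumes A: "mreg A"
  shows "mreg (mD V A)"
proof -
  obtain K where K: "finite K" "\<And>y. y \<in> U ==> idx (A y) \<subseteq> K" using A unfolding mreg_def by blast
  show ?thesis
  proof (rule mregI[OF K(1), of _ 0])
    show "i \<in> K \<and> j \<in> K" if "y \<in> U" "ent (mD V A y) i j \<noteq> 0" for y i j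
      using that dirD_ent_outside[of A K y i j V, OF K(2) that(1)] by (auto simp: ent_mD A)
    show "regular_on C U (\<lambda>y. ent (mD V A y) i j)" for i j
      using dirD_regular[OF mreg_ent[OF A]] by (subst regular_cong[OF ent_mD[OF A]])
  qed (simp add: sca_mD A)
qed

lemma mD_swap: "mreg A ==> x \<in> U ==> mD u (mD v A) x = mD v (mD u A) x"
proof (rule umat_eqI)
  assume A: "mreg A" and x: "x \<in> U"
  fix i j
  have "dirD u (\<lambda>y. ent (mD v A y) i j) x = dirD u (dirD v (\<lambda>y. ent (A y) i j)) x" for u v
    by (rule dirD_cong) (simp_all add: ent_mD A x)
  thus "ent (mD u (mD v A) x) i j = ent (mD v (mD u A) x) i j" by (simp add: ent_mD mreg_mD A x dirD_swap mreg_ent)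
qed (simp add: sca_mD mreg_mD)

lemma regular_tr: "mreg A ==> regular_on C U (\<lambda>y. tr (A y))"
  and dirD_tr: "mreg A ==> x \<in> U ==> dirD V (\<lambda>y. tr (A y)) x = tr (mD V A x)"
proof -
  assume A: "mreg A"
  obtain K where K: "finite K" "\<And>y. y \<in> U ==> idx (A y) \<subseteq> K" using A unfolding mreg_def by blast
  have e: "tr (A y) = (\<Sum>i\<in>K. ent (A y) i i)" if "y \<in> U" for y
    by (rule tr_on[OF K(1)]) (use K(2)[OF that] in "auto dest: ent_nonzero")
  show "regular_on C U (\<lambda>y. tr (A y))"
  proof -
    have "regular_on C U (\<lambda>y. \<Sum>i\<in>K. ent (A y) i i)" by (intro regular_sum mreg_ent A)
    thus ?thesis using regular_cong[of U _ _ C, OF e] by simp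
  qed
  assume x: "x \<in> U"
  have "tr (mD V A x) = (\<Sum>i\<in>K. ent (mD V A x) i i)"
  proof (rule tr_on[OF K(1)])
    show "i \<in> K" if "ent (mD V A x) i i \<noteq> 0" for i
      using that dirD_ent_outside[of A K x i i V, OF K(2) x] by (auto simp: ent_mD A x)
  qed
  thus "dirD V (\<lambda>y. tr (A y)) x = tr (mD V A x)" by (simp add: dirD_cong[OF e x] dirD_sum mreg_ent A x ent_mD)
qed

lemma mD_inverse:
  assumes "mreg A" "mreg B" "\<And>y. y \<in> U ==> A y * B y = 1" "\<And>y. y \<in> U ==> B y * A y = 1" "x \<in> U"
  shows "mD V B x = - (B x * mD V A x * B x)"
proof -
  have "A x * mD V B x + mD V A x * B x = mD V (\<lambda>_. 1) x"
    using mD_mult[OF assms(1,2,5), of V] mD_cong[of "\<lambda>y. A y * B y" "\<lambda>_. 1" x V] assms(3,5) by simp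
  hence "A x * mD V B x = - (mD V A x * B x)" using assms(5) by (simp add: eq_neg_iff_add_eq_0)
  hence "B x * (A x * mD V B x) = - (B x * (mD V A x * B x))" by simp
  thus ?thesis using assms(4,5) by (simp add: mult.assoc[symmetric])
qed

end

section \<open>Inverses of matrices\<close>

text \<open>The inverse found by elimination is identified with the adjugate divided by the
  determinant, because that formula exhibits its entries as regular functions.\<close>

lemma
  assumes A: "A \<in> carrier_mat n n" and d: "Determinant.det A \<noteq> (0 :: complex)"
  shows minv_carrier: "minv A \<in> carrier_mat n n"
    and minv_left: "minv A * A = 1\<^sub>m n" and minv_right: "A * minv A = 1\<^sub>m n"
    and minv_adj: "minv A = (1 / Determinant.det A) \<cdot>\<^sub>m adj_mat A"
proof -
  let ?B = "(1 / Determinant.det A) \<cdot>\<^sub>m adj_mat A"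
  have s: "(1 / Determinant.det A) \<cdot>\<^sub>m (Determinant.det A \<cdot>\<^sub>m 1\<^sub>m n) = 1\<^sub>m n"
    using d by (intro eq_matI) auto
  have B: "?B \<in> carrier_mat n n" "A * ?B = 1\<^sub>m n" "?B * A = 1\<^sub>m n"
    using adj_mat[OF A] s by (simp_all add: mult_smult_distrib[OF A] mult_smult_assoc_mat[OF _ A])
  have "mat_inverse A \<noteq> None"
  proof
    assume "mat_inverse A = None"
    from mat_inverse(1)[OF A this] B A show False by (auto simp: Units_def ring_mat_def)
  qed
  then obtain I where I: "mat_inverse A = Some I" by auto
  from mat_inverse(2)[OF A I] have I': "I * A = 1\<^sub>m n" "A * I = 1\<^sub>m n" "I \<in> carrier_mat n n" by auto
  have "I = I * (A * ?B)" using B I' by simp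
  also have "\<dots> = (I * A) * ?B" using A B(1) I'(3) by (simp add: assoc_mult_mat)
  also have "\<dots> = ?B" by (simp only: I' left_mult_one_mat[OF B(1)])
  finally show "minv A = ?B" by (simp add: minv_def I)
  show "minv A \<in> carrier_mat n n" "minv A * A = 1\<^sub>m n" "A * minv A = 1\<^sub>m n"
    using I' I by (simp_all add: minv_def)
qed

lemma minv_unique:
  assumes "A \<in> carrier_mat n n" "B \<in> carrier_mat n n" "A * B = 1\<^sub>m n"
  shows "minv A = (B :: complex mat)" "Determinant.det A \<noteq> 0"
proof -
  have "Determinant.det A * Determinant.det B = 1" using det_mult[OF assms(1,2)] by (simp add: assms(3))
  thus d: "Determinant.det A \<noteq> 0" by auto
  have "minv A = minv A * (A * B)" using minv_carrier[OF assms(1) d] by (simp add: assms(3))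
  also have "\<dots> = minv A * A * B" using minv_carrier[OF assms(1) d] assms by (simp add: assoc_mult_mat)
  finally show "minv A = B" using minv_left[OF assms(1) d] assms(2) by simp
qed

lemma invertible_det_iff:
  assumes A: "A \<in> carrier_mat n n"
  shows "invertible_mat A \<longleftrightarrow> Determinant.det A \<noteq> (0 :: complex)"
proof
  assume "invertible_mat A"
  then obtain B where B: "A * B = 1\<^sub>m (dim_row A)" "B * A = 1\<^sub>m (dim_row B)"
    unfolding invertible_mat_def inverts_mat_def by auto
  have "dim_col B = n" using arg_cong[OF B(1), of dim_col] A by simp
  moreover have "dim_row B = n" using arg_cong[OF B(2), of dim_col] A by simp
  ultimately have "B \<in> carrier_mat n n" by auto
  thus "Determinant.det A \<noteq> 0" using minv_unique(2)[OF A] B(1) A by auto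
next
  assume "Determinant.det A \<noteq> 0"
  thus "invertible_mat A" using minv_carrier[OF A] minv_left[OF A] minv_right[OF A] A
    unfolding invertible_mat_def inverts_mat_def by (auto intro!: exI[of _ "minv A"])
qed

lemma regular_det:
  assumes "\<And>y. A y \<in> carrier_mat n n" "\<And>i j. i < n ==> j < n ==> regular_on C U (\<lambda>y. A y $$ (i, j))"
  shows "regular_on C U (\<lambda>y. Determinant.det (A y))"
proof -
  have "Determinant.det (A y) = (\<Sum>p | p permutes {0..<n}. signof p * (\<Prod>i = 0..<n. A y $$ (i, p i)))" for y
    using assms(1)[of y] by (simp add: Determinant.det_def')
  thus ?thesis
    by (simp only:) (intro regular_sum regular_mult regular_const regular_prod assms(2); auto simp: permutes_in_image)
qed

lemma poly_det:
  assumes "\<And>y. A y \<in> carrier_mat n n" "\<And>i j. i < n ==> j < n ==> (\<lambda>y. A y $$ (i, j)) \<in> poly_functions C"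
  shows "(\<lambda>y. Determinant.det (A y)) \<in> poly_functions C"
proof -
  have "Determinant.det (A y) = (\<Sum>p | p permutes {0..<n}. signof p * (\<Prod>i = 0..<n. A y $$ (i, p i)))" for y
    using assms(1)[of y] by (simp add: Determinant.det_def')
  thus ?thesis
    by (simp only:) (intro poly_sum poly_functions.mult poly_functions.const poly_prod assms(2); auto simp: permutes_in_image)
qed

lemma regular_minv:
  assumes A: "\<And>y. A y \<in> carrier_mat n n" "\<And>i j. i < n ==> j < n ==> regular_on C U (\<lambda>y. A y $$ (i, j))"
    and d: "\<And>y. y \<in> U ==> Determinant.det (A y) \<noteq> 0" and ij: "i < n" "j < n"
  shows "regular_on C U (\<lambda>y. minv (A y) $$ (i, j))"
proof -
  have e: "minv (A y) $$ (i, j) = (- 1) ^ (j + i) * Determinant.det (mat_delete (A y) j i) / Determinant.det (A y)"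
    if "y \<in> U" for y using minv_adj[OF A(1) d[OF that]] A(1)[of y] ij by (auto simp: adj_mat_def cofactor_def)
  have m: "mat_delete (A y) j i \<in> carrier_mat (n - 1) (n - 1)" for y using A(1) by (rule mat_delete_carrier)
  have r: "regular_on C U (\<lambda>y. mat_delete (A y) j i $$ (k, l))" if "k < n - 1" "l < n - 1" for k l
  proof -
    have "mat_delete (A y) j i $$ (k, l) = A y $$ (if k < j then k else Suc k, if l < i then l else Suc l)" for y
      using A(1)[of y] that by (auto simp: mat_delete_def)
    thus ?thesis using A(2) that by simp
  qed
  show ?thesis by (subst regular_cong[OF e])
      (auto intro!: regular_divide regular_mult regular_const regular_det[OF m r] regular_det[OF A] d)
qed

section \<open>Block diagonal matrices\<close>

definition elem :: "'i => 'i => 'i umat" where "elem p q = umat 0 (\<lambda>i j. if i = p \<and> j = q then 1 else 0)"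

lemma sca_elem [simp]: "sca (elem p q) = 0"
  and ent_elem: "ent (elem p q) i j = (if i = p \<and> j = q then 1 else 0)"
  unfolding elem_def by (subst sca_umat[of "{p, q}"] ent_umat[of "{p, q}"]; auto split: if_splits)+

lemma tr_elem:
  assumes "sca A = 0"
  shows "tr (elem p q * A) = ent A q p"
proof -
  have e: "ent (elem p q * A) i i = (if i = p then ent A q p else 0)" for i
  proof -
    have "ent (elem p q * A) i i = (\<Sum>k\<in>{q}. ent (elem p q) i k * ent A k i)"
      by (subst ent_mult_on[of "{p, q}"]; cases "p = q") (auto simp: assms ent_elem idx_def split: if_splits)
    thus ?thesis by (simp add: ent_elem)
  qed
  have "tr (elem p q * A) = (\<Sum>i\<in>{p}. ent (elem p q * A) i i)" by (rule tr_on) (auto simp: e split: if_splits)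
  thus ?thesis by (simp add: e)
qed

locale gl_group =
  fixes S :: "'s set" and n :: "'s => nat"
  assumes finS [simp]: "finite S"
begin

abbreviation gmuln where "gmuln \<equiv> gmul S n"
abbreviation ginvn where "ginvn \<equiv> ginv S n"
abbreviation GLn where "GLn \<equiv> GL S n"
abbreviation Gn where "Gn \<equiv> gl_entries S n"
abbreviation gln where "gln \<equiv> gl_alg S n"
abbreviation gonen where "gonen \<equiv> gone S n"
abbreviation gexpn where "gexpn \<equiv> gexp S n"

definition emb :: "'s entry point => ('s \<times> nat) umat" where "emb g = (\<Sum>s\<in>S. um s s (block n n g s))"

lemma sca_emb [simp]: "sca (emb g) = 0" by (simp add: emb_def sca_sum)

lemma ent_emb: "ent (emb g) (s, i) (t, j) = (if s = t \<and> s \<in> S \<and> i < n s \<and> j < n s then g (s, i, j) else 0)"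
proof -
  have "ent (emb g) (s, i) (t, j) =
      (\<Sum>r\<in>S. if r = s then (if s = t \<and> i < n s \<and> j < n s then g (s, i, j) else 0) else 0)"
    unfolding emb_def ent_sum by (rule sum.cong) (auto simp: ent_um block_def)
  also have "\<dots> = (if s \<in> S then (if s = t \<and> i < n s \<and> j < n s then g (s, i, j) else 0) else 0)"
    by (rule sum.delta) simp
  finally show ?thesis by auto
qed

lemma gl_entries_iff: "(s, i, j) \<in> Gn \<longleftrightarrow> s \<in> S \<and> i < n s \<and> j < n s"
  by (simp add: gl_entries_def entries_def)

lemma finite_gl_entries [simp]: "finite Gn"
proof -
  have "Gn \<subseteq> (\<Union>s\<in>S. {s} \<times> {..<n s} \<times> {..<n s})"
    by (auto simp: gl_entries_def entries_def)
  thus ?thesis by (rule finite_subset) simp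
qed

lemma emb_coord: "(s, i, j) \<in> Gn ==> ent (emb g) (s, i) (s, j) = g (s, i, j)"
  by (simp add: ent_emb gl_entries_iff)

lemma emb_eq_iff: "emb g = emb h \<longleftrightarrow> (\<forall>b\<in>Gn. g b = h b)"
proof
  assume "emb g = emb h"
  thus "\<forall>b\<in>Gn. g b = h b" using emb_coord by (metis prod_cases3)
next
  assume h: "\<forall>b\<in>Gn. g b = h b"
  show "emb g = emb h" by (rule umat_eqI) (use h in "auto simp: ent_emb gl_entries_iff split_paired_all")
qed

lemma gl_alg_zero: "g \<in> gln ==> b \<notin> Gn ==> g b = 0" unfolding gl_alg_def affine_space_def by blast

lemma emb_inj: "g \<in> gln ==> h \<in> gln ==> emb g = emb h ==> g = h"
  unfolding emb_eq_iff by (rule ext) (metis gl_alg_zero)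

lemma emb_add: "emb (\<lambda>b. g b + h b) = emb g + emb h"
  and emb_diff: "emb (\<lambda>b. g b - h b) = emb g - emb h"
  and emb_scale: "emb (\<lambda>b. c * g b) = scl c * emb g" by (rule umat_eqI; auto simp: ent_emb)+

lemma emb_sum: "emb (\<lambda>b. \<Sum>i\<in>I. f i b) = (\<Sum>i\<in>I. emb (f i))"
proof -
  have 0: "emb (\<lambda>b. 0) = 0" by (rule umat_eqI) (auto simp: ent_emb)
  show ?thesis by (induction I rule: infinite_finite_induct) (simp_all add: 0 emb_add)
qed

lemma of_blocks_gl: "of_blocks S n n A \<in> gln"
  by (auto simp: of_blocks_def gl_alg_def affine_space_def gl_entries_def entries_def)

lemma block_of_blocks: "s \<in> S ==> A s \<in> carrier_mat (n s) (n s) ==> block n n (of_blocks S n n A) s = A s"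
  by (intro eq_matI) (auto simp: block_def of_blocks_def)

lemma emb_of_blocks:
  "(\<And>s. s \<in> S ==> A s \<in> carrier_mat (n s) (n s)) ==> emb (of_blocks S n n A) = (\<Sum>s\<in>S. um s s (A s))"
  unfolding emb_def by (rule sum.cong) (simp_all add: block_of_blocks)

lemma block_carrier [simp]: "block n n g s \<in> carrier_mat (n s) (n s)" by (simp add: block_def)

lemma sum_um_mult:
  assumes "\<And>s. s \<in> S ==> A s \<in> carrier_mat (n s) (n s)" "\<And>s. s \<in> S ==> B s \<in> carrier_mat (n s) (n s)"
  shows "(\<Sum>s\<in>S. um s s (A s)) * (\<Sum>s\<in>S. um s s (B s)) = (\<Sum>s\<in>S. um s s (A s * B s))"
proof -
  have "(\<Sum>s\<in>S. um s s (A s)) * (\<Sum>s\<in>S. um s s (B s))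
      = (\<Sum>s\<in>S. \<Sum>t\<in>S. if t = s then um s s (A s * B s) else 0)"
    unfolding sum_distrib_left sum_distrib_right
  proof (subst sum.swap, intro sum.cong refl)
    fix s t assume "s \<in> S" "t \<in> S"
    hence "dim_col (A s) = dim_row (B s)" using assms[of s] by auto
    thus "um s s (A s) * um t t (B t) = (if t = s then um s s (A s * B s) else 0)" by (auto simp: um_mult um_mult_ne)
  qed
  thus ?thesis by simp
qed

lemma gmul_gl: "gmuln g h \<in> gln" unfolding gmul_def by (rule of_blocks_gl)

lemma emb_gmul: "emb (gmuln g h) = emb g * emb h" unfolding gmul_def by (subst emb_of_blocks)
    (simp_all add: emb_def sum_um_mult mult_carrier_mat[OF block_carrier block_carrier])

definition pr :: "('s \<times> nat) umat" where "pr = (\<Sum>s\<in>S. um s s (1\<^sub>m (n s)))"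

lemma emb_gone: "emb gonen = pr" unfolding gone_def pr_def by (rule emb_of_blocks) simp

lemma pr_emb [simp]: "pr * emb g = emb g"
  by (simp add: pr_def emb_def sum_um_mult left_mult_one_mat[OF block_carrier])

lemma emb_pr [simp]: "emb g * pr = emb g"
  by (simp add: pr_def emb_def sum_um_mult right_mult_one_mat[OF block_carrier])

lemma pr_pr [simp]: "pr * pr = pr" using pr_emb[of "gonen"] by (simp add: emb_gone)

text \<open>Elements of the group are completed by the identity outside the blocks.\<close>
definition emb1 :: "'s entry point => ('s \<times> nat) umat" where "emb1 g = emb g + (1 - pr)"

lemma emb1_emb: "emb1 g * emb h = emb g * emb h" and emb_emb1: "emb h * emb1 g = emb h * emb g"
  by (simp_all add: emb1_def algebra_simps)

lemma emb1_gmul: "emb1 (gmuln g h) = emb1 g * emb1 h" by (simp add: emb1_def emb_gmul algebra_simps)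

lemma emb1_gone: "emb1 gonen = 1" by (simp add: emb1_def emb_gone)

lemma emb1_inj: "g \<in> gln ==> h \<in> gln ==> emb1 g = emb1 h ==> g = h" by (rule emb_inj) (auto simp: emb1_def)

lemma gtrace_emb: "gtrace S n g = tr (emb g)" by (simp add: gtrace_def emb_def tr_sum tr_um block_def)

lemma trace_form_emb: "trace_form S n g h = tr (emb g * emb h)" by (simp add: trace_form_def gtrace_emb emb_gmul)

lemma emb_lie_bracket: "emb (lie_bracket S n g h) = emb g * emb h - emb h * emb g"
  unfolding lie_bracket_def emb_diff emb_gmul ..

lemma GL_gl: "g \<in> GLn ==> g \<in> gln" by (simp add: GL_def)

lemma GL_iff: "g \<in> GLn \<longleftrightarrow> g \<in> gln \<and> (\<forall>s\<in>S. Determinant.det (block n n g s) \<noteq> 0)"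
  unfolding GL_def using invertible_det_iff[OF block_carrier] by auto

lemma gone_GL: "gonen \<in> GLn" by (auto simp: GL_iff gone_def of_blocks_gl block_of_blocks)

lemma gmul_GL:
  assumes g: "g \<in> GLn" and h: "h \<in> GLn"
  shows "gmuln g h \<in> GLn"
proof -
  have "block n n (gmuln g h) s = block n n g s * block n n h s" if "s \<in> S" for s
    using block_of_blocks[OF that, of "\<lambda>s. block n n g s * block n n h s"]
    by (simp add: gmul_def mult_carrier_mat[OF block_carrier block_carrier])
  thus ?thesis using g h by (simp add: GL_iff gmul_gl det_mult[OF block_carrier block_carrier])
qed

lemma minv_block: "g \<in> GLn ==> s \<in> S ==> minv (block n n g s) \<in> carrier_mat (n s) (n s)"
  by (rule minv_carrier) (auto simp: GL_iff)

lemma emb_ginv: "g \<in> GLn ==> emb (ginvn g) = (\<Sum>s\<in>S. um s s (minv (block n n g s)))"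
  unfolding ginv_def by (rule emb_of_blocks) (rule minv_block)

lemma emb_ginv_left: "g \<in> GLn ==> emb (ginvn g) * emb g = pr"
  and emb_ginv_right: "g \<in> GLn ==> emb g * emb (ginvn g) = pr" unfolding emb_ginv emb_def[of g] pr_def
  by (subst sum_um_mult; auto intro!: sum.cong arg_cong[where f = "um _ _"] minv_block minv_left minv_right simp: GL_iff)+

lemma emb1_ginv_left: "g \<in> GLn ==> emb1 (ginvn g) * emb1 g = 1"
  and emb1_ginv_right: "g \<in> GLn ==> emb1 g * emb1 (ginvn g) = 1"
  by (simp_all add: emb1_def emb_ginv_left emb_ginv_right algebra_simps)

lemma ginv_gl: "ginvn g \<in> gln" unfolding ginv_def by (rule of_blocks_gl)

lemma ginv_GL:
  assumes g: "g \<in> GLn"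
  shows "ginvn g \<in> GLn"
proof -
  have "Determinant.det (minv (block n n g s)) \<noteq> 0" if "s \<in> S" for s
  proof -
    have "minv (block n n g s) * block n n g s = 1\<^sub>m (n s)"
      by (rule minv_left) (use g that in "auto simp: GL_iff")
    thus ?thesis by (rule minv_unique(2)[OF minv_block[OF g that] block_carrier])
  qed
  thus ?thesis unfolding GL_iff using ginv_gl g by (auto simp: ginv_def block_of_blocks minv_block)
qed

lemma emb1_inverse_unique:
  assumes "g \<in> GLn" "emb1 g * A = 1"
  shows "emb1 (ginvn g) = A" using assms emb1_ginv_left[OF assms(1)] by (metis mult.assoc mult_1_left mult_1_right)

lemma emb_basis: "(s, i, j) \<in> Gn ==> emb (basis_elt (s, i, j)) = elem (s, i) (s, j)"
  by (rule umat_eqI) (auto simp: ent_emb ent_elem basis_elt_def unit_pt_def gl_entries_iff split_paired_all)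

lemma emb_dual: "(s, i, j) \<in> Gn ==> emb (dual_elt (s, i, j)) = elem (s, j) (s, i)"
  by (rule umat_eqI) (auto simp: ent_emb ent_elem unit_pt_def gl_entries_iff split_paired_all)

lemma tr_dual_emb: "a \<in> Gn ==> tr (emb (dual_elt a) * emb z) = z a"
  by (cases a) (simp del: dual_elt.simps add: emb_dual tr_elem emb_coord)

lemma gl_expand: "z \<in> gln ==> z = (\<lambda>b. \<Sum>a\<in>Gn. z a * basis_elt a b)"
proof
  fix b assume "z \<in> gln"
  thus "z b = (\<Sum>a\<in>Gn. z a * basis_elt a b)"
    by (simp add: basis_elt_def unit_pt_def if_distrib[of "\<lambda>y. _ * y"] gl_alg_zero cong: if_cong)
qed

lemma tr_basis_dual: "(\<Sum>a\<in>Gn. z a * tr (emb (dual_elt a) * M)) = tr (M * emb (\<lambda>b. \<Sum>a\<in>Gn. z a * dual_elt a b))"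
  unfolding emb_sum emb_scale sum_distrib_left tr_sum
  by (rule sum.cong) (simp_all add: tr_comm[of M] mult.assoc tr_scl_mult)

end

section \<open>Representation spaces\<close>

lemma tr_um_mult:
  assumes "dim_col A = dim_row B" "dim_row A = dim_col B"
  shows "tr (um s t A * um t s B) = (\<Sum>i<dim_row A. \<Sum>k<dim_col A. A $$ (i, k) * B $$ (k, i))"
proof -
  have "tr (um s t A * um t s B) = mtrace (A * B)" using assms by (simp add: um_mult tr_um)
  also have "\<dots> = (\<Sum>i<dim_row A. (A * B) $$ (i, i))" by (simp add: mtrace_def)
  also have "\<dots> = (\<Sum>i<dim_row A. \<Sum>k<dim_col A. A $$ (i, k) * B $$ (k, i))"
    using assms by (intro sum.cong refl) (auto simp: scalar_prod_def atLeast0LessThan)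
  finally show ?thesis .
qed

locale rep_variety = fin_digraph Q for Q :: "('s, 'e) pre_digraph" +
  fixes n :: "'s => nat" and ord :: "('e + 'e) list"
  assumes distinct_ord: "distinct ord" and set_ord: "set ord = arcs (double Q)"
begin

sublocale gl_group "verts Q" n by unfold_locales simp

abbreviation R where "R \<equiv> arcs (double Q)"
abbreviation tla where "tla \<equiv> tail (double Q)"
abbreviation hda where "hda \<equiv> head (double Q)"
abbreviation rd where "rd \<equiv> row_dim Q n"
abbreviation cd where "cd \<equiv> col_dim Q n"
abbreviation C where "C \<equiv> rep_coords Q n"
abbreviation pthetaL where "pthetaL \<equiv> pull_thetaL (verts Q) n C"
abbreviation pthetaR where "pthetaR \<equiv> pull_thetaR (verts Q) n C"
abbreviation M where "M \<equiv> open_rep_variety Q n"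
abbreviation rmat where "rmat \<equiv> rep_mat Q n"
abbreviation onep where "onep \<equiv> one_plus Q n"

lemma star_R: "a \<in> R ==> star a \<in> R" by (auto simp: double_def star_def)

lemma tl_star [simp]: "tla (star a) = hda a" and hd_star [simp]: "hda (star a) = tla a"
  by (auto simp: double_def star_def split: sum.splits)

lemma rd_star [simp]: "rd (star a) = cd a" and cd_star [simp]: "cd (star a) = rd a"
  by (simp_all add: row_dim_def col_dim_def)

lemma n_tl [simp]: "n (tla a) = rd a" and n_hd [simp]: "n (hda a) = cd a" by (simp_all add: row_dim_def col_dim_def)

lemma tl_verts: "a \<in> R ==> tla a \<in> verts Q" and hd_verts: "a \<in> R ==> hda a \<in> verts Q"
  by (auto simp: double_def)

lemma finite_R [simp]: "finite R" by (simp add: double_def)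

lemma C_Sigma: "C = (SIGMA a:R. {..<rd a} \<times> {..<cd a})" by (auto simp: rep_coords_def entries_def)

lemma C_iff: "(a, i, j) \<in> C \<longleftrightarrow> a \<in> R \<and> i < rd a \<and> j < cd a"
  by (simp add: C_Sigma)

lemma finite_C [simp]: "finite C" by (simp add: C_Sigma)

lemma sum_C: "(\<Sum>c\<in>C. f c) = (\<Sum>a\<in>R. \<Sum>i<rd a. \<Sum>j<cd a. f (a, i, j))"
proof -
  have "(\<Sum>a\<in>R. \<Sum>z\<in>{..<rd a} \<times> {..<cd a}. f (a, z)) = (\<Sum>(a, z)\<in>C. f (a, z))"
    unfolding C_Sigma by (rule sum.Sigma) auto
  thus ?thesis by (simp add: sum.cartesian_product split_def)
qed

definition RX :: "('e + 'e) entry point => ('e, 's \<times> nat) fam" where "RX x a = um (tla a) (hda a) (rmat x a)"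

text \<open>Transposed, as is the matrix of partial derivatives, so that the pairing with a tangent
  vector is the trace of a product.\<close>

definition cov_mat :: "('e + 'e) entry point => 'e + 'e => complex mat" where
  "cov_mat \<alpha> a = mat (cd a) (rd a) (\<lambda>(i, j). \<alpha> (a, j, i))"

definition RA :: "('e + 'e) entry point => ('e, 's \<times> nat) fam" where
  "RA \<alpha> a = um (hda a) (tla a) (cov_mat \<alpha> a)"

abbreviation dX where "dX c \<equiv> RA (unit_pt c)"
abbreviation eX where "eX c \<equiv> RX (unit_pt c)"

lemma rep_mat_carrier [simp]: "rmat x a \<in> carrier_mat (rd a) (cd a)" by (simp add: rep_mat_def block_def)

lemma rep_mat_dim [simp]: "dim_row (rmat x a) = rd a" "dim_col (rmat x a) = cd a"
  by (simp_all add: rep_mat_def block_def)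

lemma rep_mat_index [simp]: "i < rd a ==> j < cd a ==> rmat x a $$ (i, j) = x (a, i, j)"
  by (simp add: rep_mat_def block_def)

lemma cov_mat_dim [simp]: "dim_row (cov_mat \<alpha> a) = cd a" "dim_col (cov_mat \<alpha> a) = rd a"
  by (simp_all add: cov_mat_def)

lemma cov_mat_index [simp]: "i < cd a ==> j < rd a ==> cov_mat \<alpha> a $$ (i, j) = \<alpha> (a, j, i)"
  by (simp add: cov_mat_def)

lemma sca_RX [simp]: "sca (RX x a) = 0" and sca_RA [simp]: "sca (RA x a) = 0" by (simp_all add: RX_def RA_def)

lemma ent_RX: "ent (RX x a) (s, i) (t, j) = (if s = tla a \<and> t = hda a \<and> i < rd a \<and> j < cd a then x (a, i, j) else 0)"
  by (auto simp: RX_def ent_um)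

lemma ent_RA: "ent (RA x a) (s, i) (t, j) = (if s = hda a \<and> t = tla a \<and> i < cd a \<and> j < rd a then x (a, j, i) else 0)"
  by (auto simp: RA_def ent_um)

lemma RX_add: "RX (\<lambda>c. V c + W c) a = RX V a + RX W a" and RX_scale: "RX (\<lambda>c. k * V c) a = scl k * RX V a" by (rule umat_eqI; auto simp: ent_RX split_paired_all)+

lemma pairing_coords: "(\<Sum>c\<in>C. \<alpha> c * V c) = pairing R (RA \<alpha>) (RX V)"
proof -
  have "tr (RA \<alpha> a * RX V a) = (\<Sum>i<rd a. \<Sum>j<cd a. \<alpha> (a, i, j) * V (a, i, j))" for a
    unfolding RA_def RX_def by (subst tr_um_mult) (auto intro: sum.swap)
  thus ?thesis by (simp add: sum_C pairing_def)
qed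

lemma sum_unit: "c \<in> C ==> (\<Sum>b\<in>C. unit_pt c b * V b) = V c"
  by (simp add: unit_pt_def if_distrib[of "\<lambda>z. z * _"] cong: if_cong)

lemma coord_pairing: "c \<in> C ==> V c = pairing R (dX c) (RX V)"
  unfolding pairing_coords[symmetric] by (simp add: sum_unit)

lemma RX_of_blocks:
  "a \<in> R ==> B a \<in> carrier_mat (rd a) (cd a) ==> RX (of_blocks R rd cd B) a = um (tla a) (hda a) (B a)"
  by (rule umat_eqI) (auto simp: ent_RX ent_um of_blocks_def split_paired_all)

lemma of_blocks_affine: "of_blocks R rd cd B \<in> affine_space C"
  by (auto simp: affine_space_def of_blocks_def C_iff)

text \<open>The moment matrices of the partial actions are those of \<^const>\<open>fusion_mat\<close>.\<close>
lemma fus_um: "fus (RX x) (RA \<alpha>) a = um (tla a) (tla a) (mat (rd a) (rd a) (\<lambda>(i, k).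
    \<Sum>j<cd a. \<alpha> (star a, j, i) * x (star a, j, k) - x (a, i, j) * \<alpha> (a, k, j)))"
proof -
  have "fus (RX x) (RA \<alpha>) a = um (tla a) (tla a) (cov_mat \<alpha> (star a) * rmat x (star a) - rmat x a * cov_mat \<alpha> a)"
    by (simp add: fus_def RX_def RA_def um_mult um_diff)
  also have "cov_mat \<alpha> (star a) * rmat x (star a) - rmat x a * cov_mat \<alpha> a
      = mat (rd a) (rd a) (\<lambda>(i, k). \<Sum>j<cd a. \<alpha> (star a, j, i) * x (star a, j, k) - x (a, i, j) * \<alpha> (a, k, j))"
    by (rule eq_matI) (auto simp: scalar_prod_def atLeast0LessThan sum_subtractf)
  finally show ?thesis .
qed

lemma fusion_mat_eq:
  assumes "i < rd a" "k < rd a"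
  shows "fusion_mat Q n x a i k c = (\<Sum>j<cd a. unit_pt c (star a, j, i) * x (star a, j, k) - x (a, i, j) * unit_pt c (a, k, j))"
  unfolding fusion_mat_def partial_mat_def by (intro sum.cong refl) (use assms in "auto simp: unit_pt_def")

lemma one_plus_carrier [simp]: "onep a x \<in> carrier_mat (rd a) (rd a)"
  by (simp add: one_plus_def mult_carrier_mat[OF rep_mat_carrier] rep_mat_carrier[of x "star a", simplified])

definition blk1 :: "('e, 's \<times> nat) fam" where "blk1 a = um (tla a) (tla a) (1\<^sub>m (rd a))"

lemma um_one_plus: "um (tla a) (tla a) (onep a x) = blk1 a + RX x a * RX x (star a)"
  by (simp add: one_plus_def blk1_def RX_def um_mult um_add)

lemma one_plus_RX: "1 + RX x a * RX x (star a) = um (tla a) (tla a) (onep a x) + (1 - blk1 a)"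
  by (simp add: um_one_plus)

lemma blk1_left: "dim_row B = rd a ==> blk1 a * um (tla a) t B = um (tla a) t B"
  unfolding blk1_def by (subst um_mult) (auto simp: left_mult_one_mat[OF carrier_matI[OF _ refl]])

lemma blk1_right: "dim_col B = rd a ==> um t (tla a) B * blk1 a = um t (tla a) B"
  unfolding blk1_def by (subst um_mult) (auto simp: right_mult_one_mat[OF carrier_matI[OF refl]])

lemma biv0_coords: "biv0 R (RX x) (dX c) (dX d) = 1/2 * (\<Sum>a\<in>R. eps a *
       (\<Sum>i<cd a. \<Sum>k<cd a. \<Sum>j<rd a.
          onep (star a) x $$ (i, k) * wedge2 (partial_mat a k j) (partial_mat (star a) j i) c d))" unfolding biv0_def
proof (intro arg_cong[where f = "\<lambda>z. 1/2 * z"] sum.cong refl arg_cong[where f = "\<lambda>z. eps _ * z"])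
  fix a
  let ?A = "dX c" and ?B = "dX d" and ?O = "onep (star a) x"
  have O: "?O \<in> carrier_mat (cd a) (cd a)" using one_plus_carrier[of "star a" x] by simp
  have e: "tr ((1 + RX x (star a) * RX x a) * (RA \<alpha> a * RA \<beta> (star a))) =
      (\<Sum>i<cd a. \<Sum>k<cd a. \<Sum>j<rd a. ?O $$ (i, k) * (\<alpha> (a, j, k) * \<beta> (star a, i, j)))" for \<alpha> \<beta>
  proof -
    have ab: "RA \<alpha> a * RA \<beta> (star a) = um (hda a) (hda a) (cov_mat \<alpha> a * cov_mat \<beta> (star a))"
      by (simp add: RA_def um_mult)
    have "(1 + RX x (star a) * RX x a) * (RA \<alpha> a * RA \<beta> (star a)) =
        um (hda a) (hda a) ?O * um (hda a) (hda a) (cov_mat \<alpha> a * cov_mat \<beta> (star a))" proof -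
      have "um (hda a) (hda a) ?O = blk1 (star a) + RX x (star a) * RX x a" using um_one_plus[of "star a" x] by simp
      thus ?thesis unfolding ab using blk1_left[of "cov_mat \<alpha> a * cov_mat \<beta> (star a)" "star a" "hda a"]
        by (simp add: distrib_right)
    qed
    thus ?thesis using O by (simp add: tr_um_mult scalar_prod_def atLeast0LessThan sum_distrib_left)
  qed
  have w: "wedge2 (partial_mat a k j) (partial_mat (star a) j i) c d =
      unit_pt c (a, j, k) * unit_pt d (star a, i, j) - unit_pt d (a, j, k) * unit_pt c (star a, i, j)" for i j k
    by (auto simp: wedge2_def partial_mat_def unit_pt_def)
  show "tr ((1 + RX x (star a) * RX x a) * (?A a * ?B (star a) - ?B a * ?A (star a))) =
      (\<Sum>i<cd a. \<Sum>k<cd a. \<Sum>j<rd a. ?O $$ (i, k) * wedge2 (partial_mat a k j) (partial_mat (star a) j i) c d)"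
    unfolding right_diff_distrib tr_diff e w by (simp add: sum_subtractf right_diff_distrib)
qed

text \<open>The wedge product of two matrices of fields gives the two orders of the trace. If the
  tails differ, the blocks do not compose and both traces are 0, in agreement with the convention of
  \<open>vdb_bivector\<close>.\<close>

lemma fusion_coords:
  "(if tla p = tla q then (\<Sum>i<rd p. \<Sum>k<rd p. wedge2 (fusion_mat Q n x p i k) (fusion_mat Q n x q k i) c d) else 0)
   = tr (fus (RX x) (dX c) p * fus (RX x) (dX d) q) - tr (fus (RX x) (dX c) q * fus (RX x) (dX d) p)"
proof (cases "tla p = tla q")
  case True
  hence rd: "rd q = rd p" by (metis n_tl)
  define F where "F = (\<lambda>p c i k. \<Sum>j<cd p. unit_pt c (star p, j, i) * x (star p, j, k) - x (p, i, j) * unit_pt c (p, k, j))"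
  have e: "tr (fus (RX x) (dX c) p * fus (RX x) (dX d) q) =
      (\<Sum>i<rd p. \<Sum>k<rd p. F p c i k * F q d k i)" if "tla p = tla q" "rd q = rd p" for p q c d
    unfolding fus_um that(1) by (subst tr_um_mult) (auto simp: that F_def)
  have w: "wedge2 (fusion_mat Q n x p i k) (fusion_mat Q n x q k i) c d = F p c i k * F q d k i - F q c k i * F p d i k"
    if "i < rd p" "k < rd p" for i k using that by (simp only: wedge2_def fusion_mat_eq rd F_def)
  have "(\<Sum>i<rd p. \<Sum>k<rd p. wedge2 (fusion_mat Q n x p i k) (fusion_mat Q n x q k i) c d)
      = (\<Sum>i<rd p. \<Sum>k<rd p. F p c i k * F q d k i - F q c k i * F p d i k)" by (intro sum.cong refl w) auto
  also have "\<dots> = (\<Sum>i<rd p. \<Sum>k<rd p. F p c i k * F q d k i) - (\<Sum>i<rd p. \<Sum>k<rd p. F q c k i * F p d i k)"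
    by (simp only: sum_subtractf)
  also have "(\<Sum>i<rd p. \<Sum>k<rd p. F q c k i * F p d i k) = (\<Sum>k<rd p. \<Sum>i<rd p. F q c k i * F p d i k)"
    by (rule sum.swap)
  finally show ?thesis unfolding e[OF True rd] e[OF True[symmetric] rd[symmetric]] rd using True by simp
next
  case False
  thus ?thesis by (simp add: fus_um um_mult_ne)
qed

end

lemma (in arrow_order) sum_spin:
  "(\<Sum>q\<in>set ord. tr (spin f q * g q)) = (\<Sum>q\<in>set ord. \<Sum>p\<in>set ord. sg p q * tr (f p * g q))
    + (\<Sum>q\<in>set ord. \<Sum>p\<in>set ord. k q p * (tr (f p) * tr (g q)))"
  by (simp add: spin_def distrib_right sum_distrib_right tr_add tr_sum mult.assoc tr_scl_mult sum.distrib)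

lemma sum_sign:
  fixes T :: "nat => nat => complex"
  shows "(\<Sum>q<m. \<Sum>p<m. (if p < q then 1 else if p = q then 0 else - 1) * T p q) = (\<Sum>q<m. \<Sum>p<q. T p q - T q p)"
proof (induction m)
  case (Suc m)
  let ?s = "\<lambda>p q :: nat. if p < q then 1 else if p = q then 0 else - 1 :: complex"
  have "(\<Sum>q<Suc m. \<Sum>p<Suc m. ?s p q * T p q)
      = (\<Sum>q<m. (\<Sum>p<m. ?s p q * T p q) + ?s m q * T m q) + ((\<Sum>p<m. ?s p m * T p m) + 0)" by simp
  also have "(\<Sum>p<m. ?s p m * T p m) = (\<Sum>p<m. T p m)" by (rule sum.cong) auto
  also have "(\<Sum>q<m. (\<Sum>p<m. ?s p q * T p q) + ?s m q * T m q) = (\<Sum>q<m. (\<Sum>p<m. ?s p q * T p q) - T m q)"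
    by (rule sum.cong) auto
  finally show ?case using Suc by (simp add: sum_subtractf)
qed simp

lemma (in affine_open) mreg_um:
  fixes s t :: 's
  assumes "\<And>y. y \<in> U ==> A y \<in> carrier_mat r c" "\<And>i j. i < r ==> j < c ==> regular_on C (U) (\<lambda>y. A y $$ (i, j))"
  shows "mreg (\<lambda>y. um s t (A y))"
proof (rule mregI)
  show "finite ({s} \<times> {..<r} \<union> {t} \<times> {..<c})" by simp
  fix p q :: "'s \<times> nat"
  obtain p1 p2 q1 q2 where pq: "p = (p1, p2)" "q = (q1, q2)" by (cases p, cases q)
  have e: "ent (um s t (A y)) p q = (if p1 = s \<and> q1 = t \<and> p2 < r \<and> q2 < c then A y $$ (p2, q2) else 0)"
    if "y \<in> U" for y using assms(1)[OF that] by (auto simp: pq ent_um)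
  show "p \<in> {s} \<times> {..<r} \<union> {t} \<times> {..<c} \<and> q \<in> {s} \<times> {..<r} \<union> {t} \<times> {..<c}"
    if "y \<in> U" "ent (um s t (A y)) p q \<noteq> 0" for y
    using that(2) unfolding e[OF that(1)] by (auto simp: pq split: if_splits)
  have "regular_on C (U) (\<lambda>y. if p1 = s \<and> q1 = t \<and> p2 < r \<and> q2 < c then A y $$ (p2, q2) else 0)"
    using assms(2) by (cases "p1 = s \<and> q1 = t \<and> p2 < r \<and> q2 < c") (auto intro: regular_const)
  thus "regular_on C (U) (\<lambda>y. ent (um s t (A y)) p q)" by (subst regular_cong[OF e]) simp_all
qed simp

context rep_variety
begin

definition euler :: "'e => ('e + 'e) entry point => ('e + 'e) entry point" where
  "euler a x c = (if c \<in> C then (if fst c = Inl a then x c else if fst c = Inr a then - x c else 0) else 0)"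

definition pencil_biv :: "'e \<times> 'e => ('e + 'e) entry tensor2" where
  "pencil_biv j x = wedge2 (euler (fst j) x) (euler (snd j) x)"

lemma tr_RA_unit:
  assumes b: "b \<in> R"
  shows "tr (dX c b * RX x b) = (if c \<in> C \<and> fst c = b then x c else 0)"
proof -
  obtain a i j where c: "c = (a, i, j)" by (cases c)
  have "tr (dX c b * RX x b) = (\<Sum>j'<cd b. \<Sum>i'<rd b. unit_pt c (b, i', j') * x (b, i', j'))"
    unfolding RA_def RX_def by (subst tr_um_mult) auto
  also have "\<dots> = (\<Sum>j'<cd b. if j' = j then (\<Sum>i'<rd b. if i' = i then (if a = b then x (b, i, j) else 0) else 0) else 0)"
  proof (rule sum.cong[OF refl])
    fix j'
    have "(\<Sum>i'<rd b. unit_pt c (b, i', j') * x (b, i', j'))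
        = (\<Sum>i'<rd b. if i' = i then (if a = b \<and> j' = j then x (b, i, j) else 0) else 0)"
      by (rule sum.cong) (auto simp: unit_pt_def c)
    thus "(\<Sum>i'<rd b. unit_pt c (b, i', j') * x (b, i', j'))
        = (if j' = j then (\<Sum>i'<rd b. if i' = i then (if a = b then x (b, i, j) else 0) else 0) else 0)" by simp
  qed
  also have "\<dots> = (if c \<in> C \<and> fst c = b then x c else 0)" using b by (auto simp: c C_iff)
  finally show ?thesis .
qed

text \<open>The trace of a moment matrix is an Euler field up to sign. Wedge products of Euler
  fields therefore consist of products of two such traces, and these are what the central part of
  \<open>spin\<close> produces.\<close>

lemma euler_trace:
  assumes "a \<in> arcs Q"
  shows "euler a x c = - tr (fus (RX x) (dX c) (Inl a))"
proof -
  from assms have R: "Inl a \<in> R" "Inr a \<in> R" by (auto simp: double_def)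
  have "tr (fus (RX x) (dX c) (Inl a)) = tr (dX c (Inr a) * RX x (Inr a)) - tr (dX c (Inl a) * RX x (Inl a))"
    by (simp add: fus_def star_def tr_diff tr_comm[of "RX x (Inl a)"])
  thus ?thesis by (auto simp: tr_RA_unit R euler_def)
qed

end

section \<open>An element of the pencil in coordinates and in traces\<close>

locale rep_pencil = rep_variety Q n ord
  for Q :: "('s, 'e) pre_digraph" and n :: "'s => nat" and ord :: "('e + 'e) list" +
  fixes J\<^sub>0 :: "('e \<times> 'e) set" and w :: "'e \<times> 'e => complex"
  assumes finJ: "finite J\<^sub>0" and J_sub: "J\<^sub>0 \<subseteq> arcs Q \<times> arcs Q"
begin

text \<open>The factor 2 compensates the 1/2 before the fusion terms of \<open>biv\<close>. A pair
  of arrows of Q is placed, antisymmetrised, on the unstarred copies \<open>Inl\<close>; all weights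
  involving a starred arrow are 0.\<close>

definition kk :: "'e + 'e => 'e + 'e => complex" where
  "kk p q = (\<Sum>j\<in>J\<^sub>0. 2 * w j * (of_bool (p = Inl (fst j) \<and> q = Inl (snd j)) - of_bool (p = Inl (snd j) \<and> q = Inl (fst j))))"

sublocale arrow_order ord kk by unfold_locales
    (auto simp: distinct_ord set_ord star_R kk_def sum_negf[symmetric] conj_commute algebra_simps intro!: sum.cong)

lemma sum_kk: "(\<Sum>p\<in>R. \<Sum>q\<in>R. kk p q * (f p * g q))
    = (\<Sum>j\<in>J\<^sub>0. 2 * w j * (f (Inl (fst j)) * g (Inl (snd j)) - f (Inl (snd j)) * g (Inl (fst j))))"
proof -
  let ?l = "\<lambda>j :: 'e \<times> 'e. Inl (fst j)" and ?r = "\<lambda>j :: 'e \<times> 'e. Inl (snd j)"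
  let ?F = "\<lambda>p q j. 2 * w j * (of_bool (p = ?l j \<and> q = ?r j) * (f p * g q) - of_bool (p = ?r j \<and> q = ?l j) * (f p * g q))"
    and ?G = "\<lambda>j. 2 * w j * (f (?l j) * g (?r j) - f (?r j) * g (?l j))"
  have b: "(\<Sum>p\<in>R. \<Sum>q\<in>R. of_bool (p = a \<and> q = b) * (f p * g q)) = f a * g b" if "a \<in> R" "b \<in> R" for a b
  proof -
    have "(\<Sum>p\<in>R. \<Sum>q\<in>R. of_bool (p = a \<and> q = b) * (f p * g q)) = (\<Sum>p\<in>R. if p = a then (\<Sum>q\<in>R. if q = b then f a * g b else 0) else 0)"
      by (intro sum.cong refl) (auto intro!: sum.cong sum.neutral)
    thus ?thesis using that by simp
  qed
  have "(\<Sum>p\<in>R. \<Sum>q\<in>R. kk p q * (f p * g q)) = (\<Sum>p\<in>R. \<Sum>j\<in>J\<^sub>0. \<Sum>q\<in>R. ?F p q j)"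
    unfolding kk_def sum_distrib_right by (rule sum.cong[OF refl], subst sum.swap) (simp add: algebra_simps)
  also have "\<dots> = (\<Sum>j\<in>J\<^sub>0. \<Sum>p\<in>R. \<Sum>q\<in>R. ?F p q j)" by (rule sum.swap)
  also have "\<dots> = (\<Sum>j\<in>J\<^sub>0. ?G j)"
  proof (rule sum.cong[OF refl])
    fix j assume "j \<in> J\<^sub>0"
    hence "Inl (fst j) \<in> R" "Inl (snd j) \<in> R" using J_sub by (auto simp: double_def)
    thus "(\<Sum>p\<in>R. \<Sum>q\<in>R. ?F p q j) = ?G j"
      unfolding sum_distrib_left[symmetric] sum_subtractf by (simp only: b)
  qed
  finally show ?thesis .
qed

abbreviation P where "P \<equiv> pencil_element (vdb_bivector Q n ord) pencil_biv J\<^sub>0 w"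

text \<open>Two encodings meet: the sum over increasing positions becomes a sum over all pairs with
  signs by \<open>sum_sign\<close>, and the weights of the pencil are extracted by
  \<open>sum_kk\<close>.\<close>

lemma biv_coords: "P x c d = biv (RX x) (dX c) (dX d)"
proof -
  let ?f = "fus (RX x) (dX c)" and ?g = "fus (RX x) (dX d)"
  have "(\<Sum>q\<in>set ord. \<Sum>p\<in>set ord. sg p q * tr (?f p * ?g q))
      = (\<Sum>q<length ord. \<Sum>p<length ord. (if p < q then 1 else if p = q then 0 else - 1) * tr (?f (ord ! p) * ?g (ord ! q)))"
    unfolding sum_ord by (intro sum.cong refl) (auto simp: sg_def)
  also have "\<dots> = (\<Sum>q<length ord. \<Sum>p<q. tr (?f (ord ! p) * ?g (ord ! q)) - tr (?f (ord ! q) * ?g (ord ! p)))"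
    by (rule sum_sign)
  also have "\<dots> = (\<Sum>q<length ord. \<Sum>p<q. if tla (ord ! p) = tla (ord ! q) then
           (\<Sum>i<rd (ord ! p). \<Sum>k<rd (ord ! p).
              wedge2 (fusion_mat Q n x (ord ! p) i k) (fusion_mat Q n x (ord ! q) k i) c d) else 0)"
    unfolding fusion_coords ..
  finally have 1: "vdb_bivector Q n ord x c d = biv0 R (RX x) (dX c) (dX d)
      - 1/2 * (\<Sum>q\<in>set ord. \<Sum>p\<in>set ord. sg p q * tr (?f p * ?g q))"
    unfolding vdb_bivector_def biv0_coords by simp
  have "(\<Sum>q\<in>R. \<Sum>p\<in>R. kk q p * (tr (?f p) * tr (?g q))) = (\<Sum>q\<in>R. \<Sum>p\<in>R. kk q p * (tr (?g q) * tr (?f p)))"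
    by (simp only: mult.commute[of "tr (?f _)"])
  also have "\<dots> = (\<Sum>j\<in>J\<^sub>0. 2 * w j * (tr (?g (Inl (fst j))) * tr (?f (Inl (snd j))) - tr (?g (Inl (snd j))) * tr (?f (Inl (fst j)))))"
    by (rule sum_kk)
  also have "\<dots> = - 2 * (\<Sum>j\<in>J\<^sub>0. w j * pencil_biv j x c d)" unfolding sum_distrib_left
  proof (rule sum.cong[OF refl])
    fix j assume "j \<in> J\<^sub>0"
    hence "fst j \<in> arcs Q" "snd j \<in> arcs Q" using J_sub by auto
    thus "2 * w j * (tr (?g (Inl (fst j))) * tr (?f (Inl (snd j))) - tr (?g (Inl (snd j))) * tr (?f (Inl (fst j))))
        = - 2 * (w j * pencil_biv j x c d)" by (simp add: pencil_biv_def wedge2_def euler_trace algebra_simps) qed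
  finally show ?thesis
    unfolding pencil_element_def 1 biv_def sum_spin unfolding set_ord by (simp add: diff_divide_distrib)
qed

end

context rep_variety
begin

lemma points_iff: "x \<in> points M \<longleftrightarrow> x \<in> affine_space C \<and> (\<forall>a\<in>R. Determinant.det (onep a x) \<noteq> 0)"
  by (simp add: open_rep_variety_def)

lemma one_plus_entry:
  "i < rd a ==> j < rd a ==> onep a x $$ (i, j) = (if i = j then 1 else 0) + (\<Sum>k<cd a. x (a, i, k) * x (star a, k, j))"
  by (simp add: one_plus_def scalar_prod_def atLeast0LessThan)

lemma one_plus_poly:
  assumes "a \<in> R" "i < rd a" "j < rd a"
  shows "(\<lambda>x. onep a x $$ (i, j)) \<in> poly_functions C" unfolding one_plus_entry[OF assms(2,3)]
  using assms star_R[OF assms(1)]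
  by (intro poly_functions.add poly_functions.const poly_sum poly_functions.mult poly_functions.coord)
    (auto simp: C_iff)

lemma det_poly: "a \<in> R ==> (\<lambda>x. Determinant.det (onep a x)) \<in> poly_functions C"
  by (rule poly_det[OF one_plus_carrier one_plus_poly])

sublocale M: affine_open C "points M"
proof
  have p: "(\<lambda>x. \<Prod>a\<in>R. Determinant.det (onep a x)) \<in> poly_functions C"
    by (rule poly_prod[OF det_poly])
  have "points M = {x \<in> affine_space C. (\<Prod>a\<in>R. Determinant.det (onep a x)) \<noteq> 0}"
    by (auto simp: points_iff)
  thus "zariski_open C (points M)" using zariski_open_nonzero[OF p] by simp
qed simp

text \<open>The inverse block is completed by the identity, so that it inverts 1 + X_a X_(star a) in
  the whole ring.\<close>

definition UX :: "('e + 'e) entry point => ('e, 's \<times> nat) fam" where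
  "UX x a = um (tla a) (tla a) (minv (onep a x)) + (1 - blk1 a)"

lemma minv_one_plus:
  assumes "x \<in> points M" "a \<in> R"
  shows "minv (onep a x) \<in> carrier_mat (rd a) (rd a)"
    "minv (onep a x) * onep a x = 1\<^sub>m (rd a)" "onep a x * minv (onep a x) = 1\<^sub>m (rd a)"
  using assms by (auto intro!: minv_carrier minv_left minv_right simp: points_iff)

lemma UX_inverse:
  assumes "x \<in> points M" "a \<in> R"
  shows "UX x a * (1 + RX x a * RX x (star a)) = 1" "(1 + RX x a * RX x (star a)) * UX x a = 1"
proof -
  let ?O = "um (tla a) (tla a) (onep a x)" and ?I = "um (tla a) (tla a) (minv (onep a x))"
  note m = minv_one_plus[OF assms]
  have d: "dim_row (onep a x) = rd a" "dim_col (onep a x) = rd a"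
    "dim_row (minv (onep a x)) = rd a" "dim_col (minv (onep a x)) = rd a"
    using one_plus_carrier[of a x] m(1) by (metis carrier_matD)+
  have e: "blk1 a * ?O = ?O" "?O * blk1 a = ?O" "blk1 a * ?I = ?I" "?I * blk1 a = ?I" "?I * ?O = blk1 a" "?O * ?I = blk1 a"
    "blk1 a * blk1 a = blk1 a"
    by (simp_all only: blk1_left[OF d(1)] blk1_right[OF d(2)] blk1_left[OF d(3)] blk1_right[OF d(4)]
        um_mult[OF trans[OF d(4) d(1)[symmetric]]] um_mult[OF trans[OF d(2) d(3)[symmetric]]] m(2,3))
      (simp_all add: blk1_def um_mult)
  show "UX x a * (1 + RX x a * RX x (star a)) = 1" "(1 + RX x a * RX x (star a)) * UX x a = 1"
    unfolding UX_def one_plus_RX by (simp_all add: algebra_simps e)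
qed

lemma mreg_RX: "a \<in> R ==> M.mreg (\<lambda>x. RX x a)" unfolding RX_def
  by (rule M.mreg_um[OF rep_mat_carrier]) (auto intro: regular_coord simp: C_iff)

lemma mD_RX: "a \<in> R ==> x \<in> points M ==> M.mD V (\<lambda>x. RX x a) x = RX V a"
proof (rule umat_eqI)
  assume a: "a \<in> R" "x \<in> points M"
  show "ent (M.mD V (\<lambda>x. RX x a) x) p q = ent (RX V a) p q" for p q
  proof -
    obtain s i t j where pq: "p = (s, i)" "q = (t, j)" by (cases p, cases q)
    have "ent (M.mD V (\<lambda>x. RX x a) x) p q = M.dirD V (\<lambda>y. ent (RX y a) p q) x"
      by (rule M.ent_mD[OF mreg_RX[OF a(1)] a(2)])
    also have "\<dots> = ent (RX V a) p q" using a(1) by (auto simp: pq ent_RX M.dirD_coord C_iff)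
    finally show ?thesis .
  qed
qed (simp add: M.sca_mD mreg_RX)

lemma mreg_UX:
  assumes a: "a \<in> R"
  shows "M.mreg (\<lambda>x. UX x a)"
proof -
  have r: "regular_on C (points M) (\<lambda>x. onep a x $$ (i, j))" if "i < rd a" "j < rd a" for i j
    by (rule regular_poly[OF one_plus_poly[OF a that]])
  have d: "Determinant.det (onep a x) \<noteq> 0" if "x \<in> points M" for x using that a by (simp add: points_iff)
  show ?thesis unfolding UX_def by (intro M.mreg_add M.mreg_const M.mreg_um[OF minv_one_plus(1)[OF _ a]]
        regular_minv[OF one_plus_carrier r d])
qed

end

section \<open>The moment map, its logarithmic differentials and the 2-form in the ring\<close>

context rep_pencil
begin

lemma arrow_point_at: "x \<in> points M ==> arrow_point ord kk (RX x) (UX x)"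
  by unfold_locales (auto simp: set_ord UX_inverse)

abbreviation fac :: "('e + 'e) entry point => ('e, 's \<times> nat) fam" where
  "fac x \<equiv> arrow_point.factor (RX x) (UX x)"

abbreviation ifac :: "('e + 'e) entry point => ('e, 's \<times> nat) fam" where
  "ifac x \<equiv> arrow_point.ifactor (RX x) (UX x)"

abbreviation dfac :: "('e + 'e) entry point => ('e, 's \<times> nat) fam => ('e, 's \<times> nat) fam" where
  "dfac x \<equiv> arrow_point.dfactor (RX x) (UX x)"

lemma emb_arrow_factor:
  assumes "a \<in> R"
  shows "emb (arrow_factor Q n a x) = pr - blk1 a + um (tla a) (tla a) (onep a x)"
proof -
  let ?B = "\<lambda>s. if s = tla a then onep a x else 1\<^sub>m (n s)"
  have "emb (arrow_factor Q n a x) = (\<Sum>s\<in>verts Q. um s s (?B s))"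
    unfolding arrow_factor_def by (rule emb_of_blocks) (use one_plus_carrier[of a x] in auto)
  also have "\<dots> = (\<Sum>s\<in>verts Q. um s s (1\<^sub>m (n s)) + (if s = tla a then um (tla a) (tla a) (onep a x) - blk1 a else 0))"
    by (rule sum.cong) (auto simp: blk1_def)
  also have "\<dots> = pr + (um (tla a) (tla a) (onep a x) - blk1 a)"
    unfolding sum.distrib pr_def using tl_verts[OF assms] by simp
  finally show ?thesis by simp
qed

lemma emb1_arrow_factor: "a \<in> R ==> emb1 (arrow_factor Q n a x) = 1 + RX x a * RX x (star a)"
  unfolding one_plus_RX by (simp add: emb1_def emb_arrow_factor)

lemma arrow_factor_GL:
  assumes x: "x \<in> points M" and a: "a \<in> R"
  shows "arrow_factor Q n a x \<in> GLn"
proof -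
  have "block n n (arrow_factor Q n a x) s = (if s = tla a then onep a x else 1\<^sub>m (n s))"
    if "s \<in> verts Q" for s unfolding arrow_factor_def
    by (rule block_of_blocks[OF that]) (use one_plus_carrier[of a x] in auto)
  thus ?thesis using x a by (auto simp: GL_iff points_iff arrow_factor_def of_blocks_gl)
qed

lemma
  assumes "x \<in> points M" "a \<in> R"
  shows signed_factor_GL: "signed_factor Q n a x \<in> GLn"
    and emb1_signed_factor: "emb1 (signed_factor Q n a x) = fac x a"
proof -
  interpret arrow_point ord kk "RX x" "UX x" by (rule arrow_point_at[OF assms(1)])
  have "emb1 (ginvn (arrow_factor Q n a x)) = UX x a" by (rule emb1_inverse_unique[OF arrow_factor_GL[OF assms]])
      (simp add: emb1_arrow_factor assms UX_inverse)
  thus "signed_factor Q n a x \<in> GLn" "emb1 (signed_factor Q n a x) = fac x a"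
    using assms by (auto simp: signed_factor_def factor_def emb1_arrow_factor arrow_factor_GL ginv_GL)
qed

lemma emb1_moment_list:
  assumes "x \<in> points M" "set l \<subseteq> R"
  shows "vdb_moment Q n l x \<in> GLn \<and> emb1 (vdb_moment Q n l x) = prod_list (map (fac x) l)" using assms(2)
proof (induction l)
  case Nil
  show ?case by (simp add: vdb_moment_def gone_GL emb1_gone)
next
  case (Cons a l)
  thus ?case using assms(1) by (simp add: vdb_moment_def gmul_GL signed_factor_GL emb1_gmul emb1_signed_factor)
qed

lemma pprod_take: "p \<le> length ord ==> pprod (\<lambda>i. f (ord ! i)) p = prod_list (map f (take p ord))"
  by (induction p) (simp_all add: take_Suc_conv_app_nth)

lemma
  assumes "x \<in> points M" "p \<le> length ord"
  shows moment_take_GL: "vdb_moment Q n (take p ord) x \<in> GLn"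
    and emb1_moment_take: "emb1 (vdb_moment Q n (take p ord) x) = pprod (\<lambda>i. fac x (ord ! i)) p"
  using emb1_moment_list[OF assms(1), of "take p ord"] set_take_subset[of p ord] set_ord
  unfolding pprod_take[OF assms(2)] by auto

lemma mreg_fac:
  assumes a: "a \<in> R"
  shows "M.mreg (\<lambda>x. fac x a)"
proof -
  have e: "fac x a = (if eps a = 1 then 1 + RX x a * RX x (star a) else UX x a)" if "x \<in> points M" for x
    by (rule arrow_point.factor_def[OF arrow_point_at[OF that]])
  have "M.mreg (\<lambda>x. if eps a = 1 then 1 + RX x a * RX x (star a) else UX x a)" by (cases "eps a = 1")
      (simp_all add: M.mreg_add M.mreg_const M.mreg_mult mreg_RX mreg_UX a star_R)
  thus ?thesis using M.mreg_cong[of "\<lambda>x. fac x a", OF e] by simp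
qed

lemma mD_plus:
  assumes "x \<in> points M" "a \<in> R"
  shows "M.mD V (\<lambda>x. 1 + RX x a * RX x (star a)) x = arrow_point.dplus (RX x) (RX V) a"
proof -
  interpret arrow_point ord kk "RX x" "UX x" by (rule arrow_point_at[OF assms(1)])
  show ?thesis using assms star_R[OF assms(2)]
    by (simp add: M.mD_add M.mD_mult M.mreg_const M.mreg_mult mreg_RX mD_RX dplus_def)
qed

lemma mD_fac:
  assumes "x \<in> points M" "a \<in> R"
  shows "M.mD V (\<lambda>x. fac x a) x = dfac x (RX V) a"
proof -
  interpret arrow_point ord kk "RX x" "UX x" by (rule arrow_point_at[OF assms(1)])
  have e: "fac y a = (if eps a = 1 then 1 + RX y a * RX y (star a) else UX y a)" if "y \<in> points M" for y
    by (rule arrow_point.factor_def[OF arrow_point_at[OF that]])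
  have "M.mD V (\<lambda>x. UX x a) x = - (UX x a * M.mD V (\<lambda>x. 1 + RX x a * RX x (star a)) x * UX x a)"
    by (rule M.mD_inverse)
      (use assms star_R in "simp_all add: M.mreg_add M.mreg_const M.mreg_mult mreg_RX mreg_UX UX_inverse")
  hence u: "M.mD V (\<lambda>x. UX x a) x = - (UX x a * dplus (RX V) a * UX x a)" by (simp only: mD_plus[OF assms])
  have "M.mD V (\<lambda>x. fac x a) x = M.mD V (\<lambda>y. if eps a = 1 then 1 + RX y a * RX y (star a) else UX y a) x"
    by (rule M.mD_cong[OF e assms(1)])
  also have "\<dots> = dfactor (RX V) a" by (cases "eps a = 1") (simp_all add: dfactor_def u mD_plus[OF assms])
  finally show ?thesis .
qed

lemma
  assumes "p \<le> length ord"
  shows mreg_pprod: "M.mreg (\<lambda>x. pprod (\<lambda>i. fac x (ord ! i)) p)"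
    and mD_pprod: "x \<in> points M ==> M.mD V (\<lambda>x. pprod (\<lambda>i. fac x (ord ! i)) p) x
      = dpprod (\<lambda>i. fac x (ord ! i)) (\<lambda>i. dfac x (RX V) (ord ! i)) p"
proof -
  have "M.mreg (\<lambda>x. pprod (\<lambda>i. fac x (ord ! i)) p) \<and> (\<forall>x\<in>points M. M.mD V (\<lambda>x. pprod (\<lambda>i. fac x (ord ! i)) p) x
      = dpprod (\<lambda>i. fac x (ord ! i)) (\<lambda>i. dfac x (RX V) (ord ! i)) p)" for V using assms
  proof (induction p)
    case 0
    show ?case by (simp add: M.mreg_const)
  next
    case (Suc p)
    hence "ord ! p \<in> R" using set_ord nth_mem[of p ord] by simp
    with Suc show ?case by (simp add: M.mreg_mult mreg_fac M.mD_mult mD_fac)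
  qed
  thus "M.mreg (\<lambda>x. pprod (\<lambda>i. fac x (ord ! i)) p)" "x \<in> points M ==> M.mD V (\<lambda>x. pprod (\<lambda>i. fac x (ord ! i)) p) x
      = dpprod (\<lambda>i. fac x (ord ! i)) (\<lambda>i. dfac x (RX V) (ord ! i)) p" by blast+
qed

lemma tangent_dirD: "tangent_map C F x V b = M.dirD V (\<lambda>y. F y b) x"
  by (simp add: tangent_map_def M.dirD_def mult.commute)

text \<open>\<open>emb1\<close> is multiplicative and \<open>emb\<close> is linear; they differ by
  the constant \<open>1 - pr\<close>, so the derivative may be computed with the multiplicative
  one.\<close>

lemma emb_tangent:
  assumes "M.mreg (\<lambda>y. emb1 (F y))" "x \<in> points M"
  shows "emb (tangent_map C F x V) = M.mD V (\<lambda>y. emb1 (F y)) x"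
proof -
  have m: "M.mreg (\<lambda>y. emb (F y))"
    using M.mreg_diff[OF assms(1) M.mreg_const[of "1 - pr"]] by (simp add: emb1_def)
  have "M.mD V (\<lambda>y. emb1 (F y)) x = M.mD V (\<lambda>y. emb (F y)) x"
    unfolding emb1_def by (simp add: M.mD_add m M.mreg_const assms(2))
  also have "\<dots> = emb (tangent_map C F x V)"
  proof (rule umat_eqI)
    show "ent (M.mD V (\<lambda>y. emb (F y)) x) p q = ent (emb (tangent_map C F x V)) p q" for p q
    proof -
      obtain s i t j where pq: "p = (s, i)" "q = (t, j)" by (cases p, cases q)
      have "ent (M.mD V (\<lambda>y. emb (F y)) x) p q = M.dirD V (\<lambda>y. ent (emb (F y)) p q) x"
        by (rule M.ent_mD[OF m assms(2)])
      moreover define b where "b \<longleftrightarrow> s = t \<and> s \<in> verts Q \<and> i < n s \<and> j < n s"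
      have "ent (emb g) p q = (if b then g (s, i, j) else 0)" for g by (simp add: pq ent_emb b_def)
      ultimately show ?thesis by (cases b) (simp_all add: tangent_dirD)
    qed
  qed (simp add: M.sca_mD m assms(2))
  finally show ?thesis by simp
qed

lemma
  assumes "M.mreg (\<lambda>y. emb1 (F y))" "x \<in> points M" "F x \<in> GLn" "emb1 (F x) * I = 1"
  shows emb_thetaL: "emb (pthetaL F x V) = I * M.mD V (\<lambda>y. emb1 (F y)) x"
    and emb_thetaR: "emb (pthetaR F x V) = M.mD V (\<lambda>y. emb1 (F y)) x * I"
proof -
  let ?g = "emb (ginvn (F x))" and ?t = "emb (tangent_map C F x V)"
  have 1: "?g * ?t = I * ?t" "?t * ?g = ?t * I"
    using emb1_inverse_unique[OF assms(3,4)] emb1_emb[of "ginvn (F x)" "tangent_map C F x V"]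
      emb_emb1[of "tangent_map C F x V" "ginvn (F x)"] by simp_all
  thus "emb (pthetaL F x V) = I * M.mD V (\<lambda>y. emb1 (F y)) x"
    "emb (pthetaR F x V) = M.mD V (\<lambda>y. emb1 (F y)) x * I"
    unfolding pull_thetaL_def pull_thetaR_def emb_gmul emb_tangent[OF assms(1,2)] by simp_all
qed

lemma mD_emb1_cong:
  assumes "\<forall>y\<in>points M. emb1 (F y) = G y" "M.mreg G"
  shows "M.mreg (\<lambda>y. emb1 (F y))" "x \<in> points M ==> M.mD V (\<lambda>y. emb1 (F y)) x = M.mD V G x"
  using M.mreg_cong[of "\<lambda>y. emb1 (F y)" G] M.mD_cong[of "\<lambda>y. emb1 (F y)" G x V] assms by auto

lemma
  assumes "x \<in> points M" "p \<le> length ord"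
  shows thetaL_take: "emb (pthetaL (vdb_moment Q n (take p ord)) x V)
      = pprod_inv (\<lambda>i. ifac x (ord ! i)) p * dpprod (\<lambda>i. fac x (ord ! i)) (\<lambda>i. dfac x (RX V) (ord ! i)) p"
    and thetaR_take: "emb (pthetaR (vdb_moment Q n (take p ord)) x V)
      = dpprod (\<lambda>i. fac x (ord ! i)) (\<lambda>i. dfac x (RX V) (ord ! i)) p * pprod_inv (\<lambda>i. ifac x (ord ! i)) p"
proof -
  interpret arrow_point ord kk "RX x" "UX x" by (rule arrow_point_at[OF assms(1)])
  have i: "pprod gseq p * pprod_inv hseq p = 1" by (rule pprod_inverse) (use assms(2) seq_inverse in auto)
  have e: "\<forall>y\<in>points M. emb1 (vdb_moment Q n (take p ord) y) = pprod (\<lambda>i. fac y (ord ! i)) p"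
    using emb1_moment_take[OF _ assms(2)] by blast
  note m = mD_emb1_cong[OF e mreg_pprod[OF assms(2)]]
  have j: "emb1 (vdb_moment Q n (take p ord) x) * pprod_inv hseq p = 1"
    using i by (simp add: emb1_moment_take[OF assms])
  show "emb (pthetaL (vdb_moment Q n (take p ord)) x V) = pprod_inv hseq p * dpprod gseq (dseq (RX V)) p"
    "emb (pthetaR (vdb_moment Q n (take p ord)) x V) = dpprod gseq (dseq (RX V)) p * pprod_inv hseq p"
    using emb_thetaL[OF m(1) assms(1) moment_take_GL[OF assms] j, of V]
      emb_thetaR[OF m(1) assms(1) moment_take_GL[OF assms] j, of V]
    by (simp_all add: m(2)[OF assms(1)] mD_pprod[OF assms(2,1)])
qed

lemma
  assumes "x \<in> points M"
  shows thetaL_moment: "emb (pthetaL (vdb_moment Q n ord) x V)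
      = arrow_point.imom ord (RX x) (UX x) * arrow_point.dmom ord (RX x) (UX x) (RX V)"
    and thetaR_moment: "emb (pthetaR (vdb_moment Q n ord) x V)
      = arrow_point.dmom ord (RX x) (UX x) (RX V) * arrow_point.imom ord (RX x) (UX x)"
proof -
  interpret arrow_point ord kk "RX x" "UX x" by (rule arrow_point_at[OF assms(1)])
  show "emb (pthetaL (vdb_moment Q n ord) x V) = imom * dmom (RX V)"
    "emb (pthetaR (vdb_moment Q n ord) x V) = dmom (RX V) * imom"
    using thetaL_take[OF assms, of "length ord" V] thetaR_take[OF assms, of "length ord" V]
    by (simp_all add: imom_def dmom_def)
qed

lemma
  assumes "x \<in> points M"
  shows moment_GL: "vdb_moment Q n ord x \<in> GLn"
    and emb1_moment: "emb1 (vdb_moment Q n ord x) = arrow_point.mom ord (RX x) (UX x)"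
    and emb_tangent_moment: "emb (tangent_map C (vdb_moment Q n ord) x V) = arrow_point.dmom ord (RX x) (UX x) (RX V)"
proof -
  interpret arrow_point ord kk "RX x" "UX x" by (rule arrow_point_at[OF assms(1)])
  have e: "\<forall>y\<in>points M. emb1 (vdb_moment Q n ord y) = pprod (\<lambda>i. fac y (ord ! i)) (length ord)"
    using emb1_moment_take[OF _ order_refl] by auto
  note m = mD_emb1_cong[OF e mreg_pprod[OF order_refl]]
  show "vdb_moment Q n ord x \<in> GLn" "emb1 (vdb_moment Q n ord x) = mom"
    using moment_take_GL[OF assms order_refl] emb1_moment_take[OF assms order_refl] by (simp_all add: mom_def)
  show "emb (tangent_map C (vdb_moment Q n ord) x V) = dmom (RX V)"
    using emb_tangent[OF m(1) assms, of V] m(2)[OF assms] mD_pprod[OF order_refl assms] by (simp add: dmom_def)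
qed

lemma
  assumes "x \<in> points M" "a \<in> R"
  shows thetaR_signed: "emb (pthetaR (signed_factor Q n a) x V) = dfac x (RX V) a * ifac x a"
    and dlogdet_eq: "eps a = 1 ==> dlogdet Q n a x V = tr (ifac x a * dfac x (RX V) a)"
proof -
  interpret arrow_point ord kk "RX x" "UX x" by (rule arrow_point_at[OF assms(1)])
  have e: "\<forall>y\<in>points M. emb1 (signed_factor Q n a y) = fac y a"
    using emb1_signed_factor[OF _ assms(2)] by blast
  note m = mD_emb1_cong[OF e mreg_fac[OF assms(2)]]
  have j: "emb1 (signed_factor Q n a x) * ifactor a = 1"
    using assms by (simp add: emb1_signed_factor factor_ifactor set_ord)
  show "emb (pthetaR (signed_factor Q n a) x V) = dfactor (RX V) a * ifactor a"
    using emb_thetaR[OF m(1) assms(1) signed_factor_GL[OF assms] j, of V]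
    by (simp add: m(2)[OF assms(1)] mD_fac[OF assms])
  assume e: "eps a = 1"
  have "arrow_factor Q n a = signed_factor Q n a" using e by (auto simp: signed_factor_def)
  thus "dlogdet Q n a x V = tr (ifactor a * dfactor (RX V) a)"
    using emb_thetaL[OF m(1) assms(1) signed_factor_GL[OF assms] j, of V]
    by (simp add: dlogdet_def gtrace_emb m(2)[OF assms(1)] mD_fac[OF assms])
qed

lemma term1_trace:
  assumes "x \<in> points M" "a \<in> R"
  shows "mtrace (minv (onep a x) * rmat X a * rmat Y (star a)) = tr (UX x a * RX X a * RX Y (star a))"
proof -
  let ?I = "minv (onep a x)"
  have I: "?I \<in> carrier_mat (rd a) (rd a)" by (rule minv_one_plus(1)[OF assms])
  have z: "(1 - blk1 a) * RX X a = 0" unfolding RX_def left_diff_distrib by (simp add: blk1_left)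
  have "UX x a * RX X a * RX Y (star a) = um (tla a) (tla a) ?I * RX X a * RX Y (star a)"
    unfolding UX_def distrib_right[of _ "1 - blk1 a"] z by simp
  also have "\<dots> = um (tla a) (tla a) (?I * rmat X a * rmat Y (star a))" using I by (simp add: RX_def um_mult)
  finally show ?thesis using I by (simp add: tr_um)
qed

abbreviation \<omega> where "\<omega> \<equiv> pencil_form Q n ord J\<^sub>0 w"

text \<open>A comparison term by term with the definition in coordinates; the 2 in \<open>kk\<close>
  cancels the 1/2 before \<open>form2\<close>.\<close>

lemma form_coords:
  assumes "x \<in> points M" "c \<in> C" "d \<in> C"
  shows "\<omega> x c d = arrow_point.form ord kk (RX x) (UX x) (eX c) (eX d)"
proof -
  interpret arrow_point ord kk "RX x" "UX x" by (rule arrow_point_at[OF assms(1)])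
  let ?u = "eX c" and ?v = "eX d"
  let ?T = "\<lambda>p c d. trace_form (verts Q) n (pthetaL (vdb_moment Q n (take p ord)) x (unit_pt c))
      (pthetaR (signed_factor Q n (ord ! p)) x (unit_pt d))"
    and ?V = "\<lambda>j. 2 * w j * (tr (thL ?u (Inl (fst j))) * tr (thL ?v (Inl (snd j))) - tr (thL ?u (Inl (snd j))) * tr (thL ?v (Inl (fst j))))"
  let ?l = "\<lambda>a c. dlogdet Q n (Inl a) x (unit_pt c)"
  let ?W = "\<lambda>j. w j * (?l (fst j) c * ?l (snd j) d - ?l (fst j) d * ?l (snd j) c)"
  have 0: "form0 ?u ?v = - 1/2 * (\<Sum>a\<in>R. eps a *
      (mtrace (minv (onep a x) * rmat (unit_pt c) a * rmat (unit_pt d) (star a))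
     - mtrace (minv (onep a x) * rmat (unit_pt d) a * rmat (unit_pt c) (star a))))" unfolding form0_def set_ord
    by (intro arg_cong[where f = "\<lambda>z. - 1/2 * z"] sum.cong refl) (simp add: term1_trace assms)
  have 1: "form1 ?u ?v = (\<Sum>p<length ord. ?T p c d - ?T p d c)" unfolding form1_def
  proof (rule sum.cong[OF refl])
    fix p assume "p \<in> {..<length ord}"
    hence "p \<le> length ord" "ord ! p \<in> R" using set_ord nth_mem[of p ord] by auto
    thus "tr (pprod_inv hseq p * dpprod gseq (dseq ?u) p * thR ?v (ord ! p))
        - tr (pprod_inv hseq p * dpprod gseq (dseq ?v) p * thR ?u (ord ! p)) = ?T p c d - ?T p d c"
      by (simp add: trace_form_emb thetaL_take[OF assms(1)] thetaR_signed[OF assms(1)])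
  qed
  have "form2 ?u ?v = (\<Sum>j\<in>J\<^sub>0. ?V j)" unfolding form2_def set_ord by (rule sum_kk)
  also have "\<dots> = (\<Sum>j\<in>J\<^sub>0. 2 * ?W j)"
  proof (rule sum.cong[OF refl])
    fix j assume "j \<in> J\<^sub>0"
    hence R: "Inl (fst j) \<in> R" "Inl (snd j) \<in> R" using J_sub by (auto simp: double_def)
    have e: "eps (Inl a :: 'e + 'e) = 1" for a by (simp add: eps_def)
    show "?V j = 2 * ?W j" by (simp add: dlogdet_eq[OF assms(1)] R e)
  qed
  finally have 2: "form2 ?u ?v = 2 * (\<Sum>j\<in>J\<^sub>0. ?W j)" by (simp only: sum_distrib_left)
  show ?thesis unfolding form_def 0 1 2 using assms(2,3) by (simp add: pencil_form_def Let_def split_beta)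
qed

end

section \<open>The exponential and the action\<close>

lemma smult_pow_mat: "A \<in> carrier_mat n n ==> (t \<cdot>\<^sub>m A) ^\<^sub>m m = t ^ m \<cdot>\<^sub>m (A ^\<^sub>m m)" for t :: complex
proof (induction m)
  case (Suc m)
  note A = Suc.prems
  have P: "A ^\<^sub>m m \<in> carrier_mat n n" by (rule pow_carrier_mat[OF A])
  have tA: "t \<cdot>\<^sub>m A \<in> carrier_mat n n" using A by simp
  have "(t \<cdot>\<^sub>m A) ^\<^sub>m Suc m = (t ^ m \<cdot>\<^sub>m (A ^\<^sub>m m)) * (t \<cdot>\<^sub>m A)"
    using Suc by simp
  also have "\<dots> = t ^ m \<cdot>\<^sub>m (t \<cdot>\<^sub>m (A ^\<^sub>m m * A))"
    by (simp only: mult_smult_assoc_mat[OF P tA] mult_smult_distrib[OF P A])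
  finally show ?case by (auto intro!: eq_matI)
qed (auto intro!: eq_matI)

text \<open>Crude, but it lets an ordinary exponential series dominate the entries of the matrix
  exponential in \<open>mexp_deriv\<close>.\<close>

lemma pow_mat_bound:
  assumes A: "A \<in> carrier_mat n n" and K: "\<And>i j. i < n ==> j < n ==> cmod (A $$ (i, j)) \<le> K" and ij: "i < n" "j < n"
  shows "cmod ((A ^\<^sub>m m) $$ (i, j)) \<le> (real n * K) ^ m" using ij(2)
proof (induction m arbitrary: j)
  case 0
  thus ?case using A ij by simp
next
  case (Suc m)
  have "(A ^\<^sub>m Suc m) $$ (i, j) = (\<Sum>k<n. (A ^\<^sub>m m) $$ (i, k) * A $$ (k, j))"
    using A ij(1) Suc.prems pow_carrier_mat[OF A, of m] by (auto simp: scalar_prod_def atLeast0LessThan)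
  also have "cmod \<dots> \<le> (\<Sum>k<n. (real n * K) ^ m * K)" using Suc.IH Suc.prems K
    by (intro sum_norm_le) (auto simp: norm_mult intro!: mult_mono order_trans[OF norm_ge_zero Suc.IH])
  finally show ?case by (simp add: mult_ac)
qed

text \<open>The entry is a power series in t that converges everywhere, and its linear coefficient
  is the entry of \<open>A\<close>.\<close>

lemma mexp_deriv:
  assumes A: "A \<in> carrier_mat n n" and ij: "i < n" "j < n"
  shows "DERIV (\<lambda>t. mexp (t \<cdot>\<^sub>m A) $$ (i, j)) 0 :> A $$ (i, j)"
proof -
  define c where "c = (\<lambda>m. (A ^\<^sub>m m) $$ (i, j) / fact m)"
  define K where "K = (\<Sum>i<n. \<Sum>j<n. cmod (A $$ (i, j)))"
  have K: "cmod (A $$ (i, j)) \<le> K" if "i < n" "j < n" for i j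
  proof -
    have "cmod (A $$ (i, j)) \<le> (\<Sum>j<n. cmod (A $$ (i, j)))"
      by (rule member_le_sum[of j "{..<n}" "\<lambda>j. cmod (A $$ (i, j))"]) (use that in auto)
    also have "\<dots> \<le> K"
      unfolding K_def by (rule member_le_sum[of i "{..<n}" "\<lambda>i. \<Sum>j<n. cmod (A $$ (i, j))"])
        (use that in "auto intro: sum_nonneg")
    finally show ?thesis .
  qed
  have e: "mexp (t \<cdot>\<^sub>m A) $$ (i, j) = (\<Sum>m. c m * t ^ m)" for t
    using A ij by (simp add: mexp_def smult_pow_mat[OF A] c_def pow_carrier_mat[OF A, THEN carrier_matD(1)]
        pow_carrier_mat[OF A, THEN carrier_matD(2)] mult_ac)
  have "summable (\<lambda>m. c m * t ^ m)" for t
  proof (rule summable_comparison_test')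
    show "summable (\<lambda>m. (real n * K * cmod t) ^ m /\<^sub>R fact m)" by (rule summable_exp_generic)
    fix m :: nat
    have "cmod (c m * t ^ m) = cmod ((A ^\<^sub>m m) $$ (i, j)) * cmod t ^ m / fact m"
      by (simp add: c_def norm_mult norm_divide norm_power)
    also have "\<dots> \<le> (real n * K) ^ m * cmod t ^ m / fact m"
      using pow_mat_bound[OF A K ij] by (intro divide_right_mono mult_right_mono) auto
    finally show "cmod (c m * t ^ m) \<le> (real n * K * cmod t) ^ m /\<^sub>R fact m"
      by (simp add: power_mult_distrib field_simps)
  qed
  hence "DERIV (\<lambda>t. \<Sum>m. c m * t ^ m) 0 :> (\<Sum>m. diffs c m * 0 ^ m)"
    by (rule termdiffs_strong_converges_everywhere)
  moreover have "(\<Sum>m. diffs c m * 0 ^ m) = A $$ (i, j)"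
    unfolding powser_zero using A by (simp add: diffs_def c_def)
  ultimately show ?thesis by (simp add: e)
qed

lemma mexp_zero: "mexp (0 \<cdot>\<^sub>m A) = 1\<^sub>m n" if A: "A \<in> carrier_mat n n"
proof (rule eq_matI)
  fix i j assume ij: "i < dim_row (1\<^sub>m n)" "j < dim_col (1\<^sub>m n)"
  have "mexp (0 \<cdot>\<^sub>m A) $$ (i, j) = (\<Sum>m. (A ^\<^sub>m m) $$ (i, j) / fact m * 0 ^ m)"
    using A ij by (simp add: mexp_def smult_pow_mat[OF A] pow_carrier_mat[OF A, THEN carrier_matD(1)]
        pow_carrier_mat[OF A, THEN carrier_matD(2)] mult_ac)
  also have "\<dots> = 1\<^sub>m n $$ (i, j)" unfolding powser_zero using A ij by simp
  finally show "mexp (0 \<cdot>\<^sub>m A) $$ (i, j) = 1\<^sub>m n $$ (i, j)" .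
qed (use A in "auto simp: mexp_def")

context gl_group
begin

lemma block_scale: "block n n (\<lambda>b. c * g b) s = c \<cdot>\<^sub>m block n n g s"
  by (rule eq_matI) (auto simp: block_def)

lemma gexp_gl: "gexpn z \<in> gln" unfolding gexp_def by (rule of_blocks_gl)

lemma gexp_deriv:
  assumes "b \<in> Gn"
  shows "DERIV (\<lambda>t. gexpn (\<lambda>b. t * z b) b) 0 :> z b"
proof -
  obtain s i j where b: "b = (s, i, j)" by (cases b)
  have "DERIV (\<lambda>t. mexp (t \<cdot>\<^sub>m block n n z s) $$ (i, j)) 0 :> block n n z s $$ (i, j)"
    by (rule mexp_deriv[OF block_carrier]) (use assms in "auto simp: b gl_entries_iff")
  thus ?thesis using assms by (simp add: b gexp_def of_blocks_def gl_entries_iff block_scale) (simp add: block_def)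
qed

lemma gexp_zero: "gexpn (\<lambda>b. 0 * z b) = gonen"
  unfolding gexp_def gone_def block_scale mexp_zero[OF block_carrier] ..

sublocale G: affine_open "Gn" "GLn"
proof
  have p: "(\<lambda>g. \<Prod>s\<in>S. Determinant.det (block n n g s)) \<in> poly_functions Gn"
    by (intro poly_prod poly_det[OF block_carrier]) (auto simp: block_def gl_entries_iff intro: poly_functions.coord)
  have "GLn = {g \<in> affine_space Gn. (\<Prod>s\<in>S. Determinant.det (block n n g s)) \<noteq> 0}"
    by (auto simp: GL_iff gl_alg_def)
  thus "zariski_open Gn GLn" using zariski_open_nonzero[OF p] by simp
qed simp

lemma Gmreg_sum: "(\<And>i. i \<in> I ==> G.mreg (A i)) ==> G.mreg (\<lambda>g. \<Sum>i\<in>I. A i g)"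
  by (induction I rule: infinite_finite_induct) (simp_all add: G.mreg_const G.mreg_add)

lemma Gmreg_emb: "G.mreg emb" unfolding emb_def[abs_def] by (intro Gmreg_sum G.mreg_um[OF block_carrier])
    (auto simp: block_def gl_entries_iff intro: regular_coord)

lemma Gmreg_emb1: "G.mreg emb1" unfolding emb1_def[abs_def] by (intro G.mreg_add G.mreg_const Gmreg_emb)

lemma GmD_emb1: "g \<in> GLn ==> G.mD z emb1 g = emb z"
proof (rule umat_eqI)
  assume g: "g \<in> GLn"
  show "ent (G.mD z emb1 g) p q = ent (emb z) p q" for p q
  proof -
    obtain s i t j where pq: "p = (s, i)" "q = (t, j)" by (cases p, cases q)
    define b where "b \<longleftrightarrow> s = t \<and> s \<in> S \<and> i < n s \<and> j < n s"
    have e: "ent (emb g) p q = (if b then g (s, i, j) else 0)" for g by (simp add: pq ent_emb b_def)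
    have "G.mD z emb1 g = G.mD z emb g"
      unfolding emb1_def[abs_def] using g by (simp add: G.mD_add Gmreg_emb G.mreg_const)
    also have "ent \<dots> p q = G.dirD z (\<lambda>g. ent (emb g) p q) g" by (rule G.ent_mD[OF Gmreg_emb g])
    also have "\<dots> = ent (emb z) p q"
    proof (cases b)
      case True
      hence "(s, i, j) \<in> Gn" by (auto simp: b_def gl_entries_iff)
      thus ?thesis unfolding e by (simp add: True G.dirD_coord)
    qed (simp add: e)
    finally show ?thesis .
  qed
qed (simp add: G.sca_mD Gmreg_emb1)

lemma Gmreg_ginv: "G.mreg (\<lambda>g. emb1 (ginvn g))"
proof -
  have r: "regular_on Gn GLn (\<lambda>g. minv (block n n g s) $$ (i, j))"
    if "s \<in> S" "i < n s" "j < n s" for s i j by (rule regular_minv[OF block_carrier])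
      (use that in "auto simp: GL_iff block_def gl_entries_iff intro: regular_coord")
  have "G.mreg (\<lambda>g. (\<Sum>s\<in>S. um s s (minv (block n n g s))) + (1 - pr))"
    by (intro G.mreg_add G.mreg_const Gmreg_sum G.mreg_um[OF minv_block r])
  moreover have "\<forall>g\<in>GLn. emb1 (ginvn g) = (\<Sum>s\<in>S. um s s (minv (block n n g s))) + (1 - pr)"
    by (simp add: emb1_def emb_ginv)
  ultimately show ?thesis
    using G.mreg_cong[of "\<lambda>g. emb1 (ginvn g)" "\<lambda>g. (\<Sum>s\<in>S. um s s (minv (block n n g s))) + (1 - pr)"]
    by simp
qed

lemma GmD_ginv: "g \<in> GLn ==> G.mD z (\<lambda>g. emb1 (ginvn g)) g = - (emb1 (ginvn g) * emb z * emb1 (ginvn g))"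
  using G.mD_inverse[OF Gmreg_emb1 Gmreg_ginv emb1_ginv_right emb1_ginv_left, of g z] by (simp add: GmD_emb1)

lemma emb_um:
  assumes t: "t \<in> S" and B: "dim_row B = n t"
  shows "emb g * um t h B = um t h (block n n g t * B)"
proof -
  have "emb g * um t h B = (\<Sum>s\<in>S. if s = t then um t h (block n n g t * B) else 0)"
    unfolding emb_def sum_distrib_right by (rule sum.cong) (auto simp: um_mult um_mult_ne B block_def)
  thus ?thesis using t by simp
qed

lemma um_emb:
  assumes t: "t \<in> S" and B: "dim_col B = n t"
  shows "um h t B * emb g = um h t (B * block n n g t)"
proof -
  have "um h t B * emb g = (\<Sum>s\<in>S. if s = t then um h t (B * block n n g t) else 0)"
    unfolding emb_def sum_distrib_left by (rule sum.cong) (auto simp: um_mult um_mult_ne B block_def)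
  thus ?thesis using t by simp
qed

lemma block_gone: "s \<in> S ==> block n n gonen s = 1\<^sub>m (n s)" by (simp add: gone_def block_of_blocks)

lemma pr_um: "t \<in> S ==> dim_row B = n t ==> pr * um t h B = um t h B"
  and um_pr: "t \<in> S ==> dim_col B = n t ==> um h t B * pr = um h t B"
  using emb_um[of t B "gonen" h] um_emb[of t B h "gonen"]
    left_mult_one_mat[of B "n t" "dim_col B"] right_mult_one_mat[of B "dim_row B" "n t"]
  by (auto simp: emb_gone block_gone)

lemma emb1_um: "t \<in> S ==> dim_row B = n t ==> emb1 g * um t h B = um t h (block n n g t * B)"
  and um_emb1: "t \<in> S ==> dim_col B = n t ==> um h t B * emb1 g = um h t (B * block n n g t)"
  by (simp_all add: emb1_def distrib_left distrib_right left_diff_distrib right_diff_distrib emb_um um_emb pr_um um_pr)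

lemma block_ginv: "g \<in> GLn ==> s \<in> S ==> block n n (ginvn g) s = minv (block n n g s)"
  unfolding ginv_def by (rule block_of_blocks[OF _ minv_block])

end

context rep_variety
begin

abbreviation act1 where "act1 \<equiv> rep_action Q n"

lemma act_affine: "act1 g x \<in> affine_space C" unfolding rep_action_def by (rule of_blocks_affine)

lemma RX_act:
  assumes "g \<in> GLn" "a \<in> R"
  shows "RX (act1 g x) a = emb1 g * RX x a * emb1 (ginvn g)"
proof -
  let ?B = "\<lambda>a. block n n g (tla a) * rmat x a * minv (block n n g (hda a))"
  have t: "tla a \<in> verts Q" "hda a \<in> verts Q" using assms(2) by (auto simp: tl_verts hd_verts)
  have m: "minv (block n n g (hda a)) \<in> carrier_mat (cd a) (cd a)" using minv_block[OF assms(1) t(2)] by simp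
  have g: "block n n g (tla a) \<in> carrier_mat (rd a) (rd a)" using block_carrier[of g "tla a"] by simp
  have gx: "block n n g (tla a) * rmat x a \<in> carrier_mat (rd a) (cd a)"
    by (rule mult_carrier_mat[OF g rep_mat_carrier])
  have "RX (act1 g x) a = um (tla a) (hda a) (?B a)"
    unfolding rep_action_def by (rule RX_of_blocks[where B = ?B, OF assms(2) mult_carrier_mat[OF gx m]])
  also have "\<dots> = um (tla a) (hda a) (block n n g (tla a) * rmat x a) * emb1 (ginvn g)"
    using gx by (subst um_emb1) (auto simp: t block_ginv[OF assms(1)])
  also have "um (tla a) (hda a) (block n n g (tla a) * rmat x a) = emb1 g * RX x a"
    unfolding RX_def by (subst emb1_um) (auto simp: t)
  finally show ?thesis .
qed

lemma um_inj:
  assumes "um s t A = um s t B" and A: "A \<in> carrier_mat r c" and B: "B \<in> carrier_mat r c"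
  shows "A = B"
proof (rule eq_matI)
  fix i j assume ij: "i < dim_row B" "j < dim_col B"
  have "A $$ (i, j) = ent (um s t A) (s, i) (t, j)" using A B ij by (auto simp: ent_um)
  also have "\<dots> = ent (um s t B) (s, i) (t, j)" by (simp only: assms(1))
  also have "\<dots> = B $$ (i, j)" using ij by (simp add: ent_um)
  finally show "A $$ (i, j) = B $$ (i, j)" .
qed (use A B in auto)

text \<open>1 + X_a X_(star a) is conjugated by the block of \<open>g\<close> at the tail, so its
  determinant stays nonzero. In the ring the identity of that block is the idempotent
  \<open>blk1 a\<close>, whose conjugation is computed separately.\<close>

lemma act_points:
  assumes "g \<in> GLn" "x \<in> points M"
  shows "act1 g x \<in> points M"
proof -
  have "Determinant.det (onep a (act1 g x)) \<noteq> 0" if a: "a \<in> R" for a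
  proof -
    let ?g = "block n n g (tla a)" and ?O = "onep a x"
    have t: "tla a \<in> verts Q" using a by (rule tl_verts)
    have g: "?g \<in> carrier_mat (rd a) (rd a)" "minv ?g \<in> carrier_mat (rd a) (rd a)"
      using block_carrier[of g "tla a"] minv_block[OF assms(1) t] by simp_all
    have gO: "?g * ?O \<in> carrier_mat (rd a) (rd a)" by (rule mult_carrier_mat[OF g(1) one_plus_carrier])
    have O: "?O \<in> carrier_mat (rd a) (rd a)" by (rule one_plus_carrier)
    let ?G = "emb1 g" and ?H = "emb1 (ginvn g)"
    have gb: "?G * blk1 a * ?H = blk1 a"
    proof -
      have "?G * blk1 a = um (tla a) (tla a) ?g" unfolding blk1_def using g(1) t by (subst emb1_um) auto
      also have "\<dots> * ?H = um (tla a) (tla a) (?g * minv ?g)"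
        using g(1) t by (subst um_emb1) (auto simp: block_ginv[OF assms(1)])
      also have "?g * minv ?g = 1\<^sub>m (rd a)"
        by (rule minv_right[OF g(1)]) (use assms(1) t in "auto simp: GL_iff")
      finally show ?thesis by (simp add: blk1_def)
    qed
    have "um (tla a) (tla a) (onep a (act1 g x)) = blk1 a + ?G * RX x a * ?H * (?G * RX x (star a) * ?H)"
      by (simp add: um_one_plus RX_act assms(1) a star_R)
    also have "\<dots> = ?G * blk1 a * ?H + ?G * RX x a * (?H * ?G) * RX x (star a) * ?H"
      by (simp add: gb[unfolded mult.assoc] mult.assoc)
    also have "\<dots> = ?G * um (tla a) (tla a) ?O * ?H"
      by (simp add: emb1_ginv_left[OF assms(1)] um_one_plus algebra_simps)
    also have "?G * um (tla a) (tla a) ?O = um (tla a) (tla a) (?g * ?O)"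
      using t carrier_matD(1)[OF O] by (subst emb1_um) simp_all
    also have "\<dots> * ?H = um (tla a) (tla a) (?g * ?O * minv ?g)"
      using gO t by (subst um_emb1) (auto simp: block_ginv[OF assms(1)])
    finally have "onep a (act1 g x) = ?g * ?O * minv ?g"
      by (rule um_inj[OF _ one_plus_carrier mult_carrier_mat[OF gO g(2)]])
    moreover have "Determinant.det ?g \<noteq> 0" using assms(1) t by (simp add: GL_iff)
    moreover from this have "Determinant.det ?g * Determinant.det (minv ?g) = 1"
      using det_mult[OF g] minv_right[OF g(1)] by simp
    ultimately show ?thesis using assms(2) a by (auto simp: det_mult[OF gO g(2)] det_mult[OF g(1) O] points_iff)
  qed
  thus ?thesis by (simp add: points_iff act_affine)
qed

lemma RX_inj: "x \<in> affine_space C ==> y \<in> affine_space C ==> (\<And>a. a \<in> R ==> RX x a = RX y a) ==> x = y"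
proof
  fix c assume h: "x \<in> affine_space C" "y \<in> affine_space C" "\<And>a. a \<in> R ==> RX x a = RX y a"
  have "pairing R A (RX x) = pairing R A (RX y)" for A unfolding pairing_def by (rule sum.cong) (simp_all add: h)
  hence "x c = y c" if "c \<in> C" using coord_pairing[OF that] by metis
  moreover have "x c = y c" if "c \<notin> C" using h(1,2) that unfolding affine_space_def by fastforce
  ultimately show "x c = y c" by blast
qed

text \<open>The action is a regular function of the group element, so the chain rule on the group
  applies along the exponential curve; the sign in exp(-t z) turns z X - X z into X z - z X.\<close>

lemma
  assumes "c \<in> C"
  shows act_curve: "DERIV (\<lambda>t. act1 (gexpn (\<lambda>b. - t * z b)) x c) 0 :> infinitesimal M z x c"
    and infinitesimal_eq: "infinitesimal M z x c = ent (RX x (fst c) * emb z - emb z * RX x (fst c))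
    (tla (fst c), fst (snd c)) (hda (fst c), snd (snd c))"
proof -
  obtain a i j where c: "c = (a, i, j)" by (cases c)
  have a: "a \<in> R" "i < rd a" "j < cd a" using assms by (auto simp: c C_iff)
  let ?F = "\<lambda>g. emb1 g * RX x a * emb1 (ginvn g)"
  have m: "G.mreg ?F" by (intro G.mreg_mult G.mreg_const Gmreg_emb1 Gmreg_ginv)
  have e: "act1 g x c = ent (?F g) (tla a, i) (hda a, j)" if "g \<in> GLn" for g
    using RX_act[OF that a(1), of x] a by (metis c ent_RX)
  have reg: "regular_on Gn GLn (\<lambda>g. act1 g x c)" using G.mreg_ent[OF m] by (subst regular_cong[OF e]) simp_all
  let ?\<gamma> = "\<lambda>t. gexpn (\<lambda>b. t * (- z b))"
  have "DERIV (\<lambda>t. act1 (?\<gamma> t) x c) 0 :> (\<Sum>b\<in>Gn. pderiv_at b (\<lambda>g. act1 g x c) (?\<gamma> 0) * - z b)"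
  proof (rule G.regular_curve[OF reg])
    show "DERIV (\<lambda>s. ?\<gamma> s b) 0 :> - z b" if "b \<in> Gn" for b
      using gexp_deriv[OF that, of "\<lambda>b. - z b"] .
    show "?\<gamma> s \<in> affine_space Gn" for s using gexp_gl by (simp add: gl_alg_def)
    show "?\<gamma> 0 \<in> GLn" using gone_GL by (subst gexp_zero)
  qed
  hence d: "DERIV (\<lambda>t. act1 (gexpn (\<lambda>b. - t * z b)) x c) 0 :> (\<Sum>b\<in>Gn. pderiv_at b (\<lambda>g. act1 g x c) (?\<gamma> 0) * - z b)"
    by simp
  hence i: "infinitesimal M z x c = (\<Sum>b\<in>Gn. pderiv_at b (\<lambda>g. act1 g x c) (?\<gamma> 0) * - z b)"
    by (simp add: infinitesimal_def open_rep_variety_def DERIV_imp_deriv)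
  show "DERIV (\<lambda>t. act1 (gexpn (\<lambda>b. - t * z b)) x c) 0 :> infinitesimal M z x c" using d i by simp
  note i
  also have "?\<gamma> 0 = gonen" by (rule gexp_zero)
  also have "(\<Sum>b\<in>Gn. pderiv_at b (\<lambda>g. act1 g x c) gonen * - z b)
      = G.dirD (\<lambda>b. - 1 * z b) (\<lambda>g. act1 g x c) gonen" by (simp add: G.dirD_def mult.commute)
  also have "\<dots> = G.dirD (\<lambda>b. - 1 * z b) (\<lambda>g. ent (?F g) (tla a, i) (hda a, j)) gonen"
    by (rule G.dirD_cong[OF e gone_GL])
  also have "\<dots> = ent (G.mD (\<lambda>b. - 1 * z b) ?F gonen) (tla a, i) (hda a, j)"
    by (rule G.ent_mD[OF m gone_GL, symmetric])
  also have "G.mD (\<lambda>b. - 1 * z b) ?F gonen = RX x a * emb z - emb z * RX x a"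
  proof -
    have i1: "emb1 (ginvn gonen) = 1" using emb1_inverse_unique[OF gone_GL, of 1] by (simp add: emb1_gone)
    have s: "scl (- 1) = (- 1 :: ('s \<times> nat) umat)" using scl_uminus[of 1] by simp
    have ez: "emb (\<lambda>b. - z b) = - emb z" using emb_scale[of "- 1" z] by (simp add: s)
    show ?thesis unfolding G.mD_mult[OF G.mreg_mult[OF Gmreg_emb1 G.mreg_const] Gmreg_ginv gone_GL]
        G.mD_mult[OF Gmreg_emb1 G.mreg_const gone_GL] by (simp add: GmD_emb1 GmD_ginv gone_GL i1 emb1_gone ez)
  qed
  finally show "infinitesimal M z x c = ent (RX x (fst c) * emb z - emb z * RX x (fst c))
    (tla (fst c), fst (snd c)) (hda (fst c), snd (snd c))" by (simp add: c)
qed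

end

context affine_open
begin

text \<open>Regularity, membership and the value of the derivative travel together, so that the
  derivative of a long expression is found by resolution alone.\<close>

definition hasd :: "'c point => 'c point => ('c point => complex) => complex => bool" where
  "hasd V x f d \<longleftrightarrow> regular_on C U f \<and> x \<in> U \<and> dirD V f x = d"

definition mhasd :: "'c point => 'c point => ('c point => 'i umat) => 'i umat => bool" where
  "mhasd V x A D \<longleftrightarrow> mreg A \<and> x \<in> U \<and> mD V A x = D"

lemma hasd_add: "hasd V x f d ==> hasd V x g e ==> hasd V x (\<lambda>y. f y + g y) (d + e)"
  and hasd_diff: "hasd V x f d ==> hasd V x g e ==> hasd V x (\<lambda>y. f y - g y) (d - e)"
  and hasd_mult: "hasd V x f d ==> hasd V x g e ==> hasd V x (\<lambda>y. f y * g y) (f x * e + d * g x)"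
  and hasd_cmult: "hasd V x f d ==> hasd V x (\<lambda>y. k * f y) (k * d)"
  by (simp_all add: hasd_def dirD_add dirD_diff dirD_mult dirD_cmult regular_intros)

lemma hasd_sum: "x \<in> U ==> (\<And>i. i \<in> I ==> hasd V x (f i) (d i)) ==> hasd V x (\<lambda>y. \<Sum>i\<in>I. f i y) (\<Sum>i\<in>I. d i)"
  by (simp add: hasd_def dirD_sum regular_sum)

lemma mhasd_const: "x \<in> U ==> mhasd V x (\<lambda>_. A) 0" by (simp add: mhasd_def mreg_const)

lemma mhasd_add: "mhasd V x A D ==> mhasd V x B E ==> mhasd V x (\<lambda>y. A y + B y) (D + E)"
  and mhasd_diff: "mhasd V x A D ==> mhasd V x B E ==> mhasd V x (\<lambda>y. A y - B y) (D - E)"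
  and mhasd_mult: "mhasd V x A D ==> mhasd V x B E ==> mhasd V x (\<lambda>y. A y * B y) (A x * E + D * B x)"
  and mhasd_cmult: "mhasd V x A D ==> mhasd V x (\<lambda>y. K * A y) (K * D)"
  and mhasd_multc: "mhasd V x A D ==> mhasd V x (\<lambda>y. A y * K) (D * K)"
  by (simp_all add: mhasd_def mD_add mD_diff mD_mult mreg_add mreg_diff mreg_mult mreg_const)

lemma hasd_tr: "mhasd V x A D ==> hasd V x (\<lambda>y. tr (A y)) (tr D)"
  by (simp add: mhasd_def hasd_def regular_tr dirD_tr)

end

section \<open>Passing back from blocks to coordinates\<close>

context rep_variety
begin

text \<open>Ring elements that come from a genuine block. Coordinates see only the entries of such
  blocks, so this is the condition under which a ring element can be read as part of a tangent
  vector or covector.\<close>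

definition inb :: "'s => 's => ('s \<times> nat) umat => bool" where
  "inb s t Z \<longleftrightarrow> (\<exists>B\<in>carrier_mat (n s) (n t). Z = um s t B)"

lemma inb_um: "B \<in> carrier_mat (n s) (n t) ==> inb s t (um s t B)" by (auto simp: inb_def)

lemma inb_zero: "inb s t 0" using inb_um[OF zero_carrier_mat] by simp

lemma inb_RX: "inb (tla a) (hda a) (RX x a)" and inb_RA: "inb (hda a) (tla a) (RA x a)"
  unfolding RX_def RA_def by (rule inb_um, rule carrier_matI; simp)+

lemma inb_add: "inb s t Y ==> inb s t Z ==> inb s t (Y + Z)"
  unfolding inb_def by (metis add_carrier_mat carrier_matD um_add)

lemma inb_scl: "inb s t Y ==> inb s t (scl c * Y)" unfolding inb_def by (metis smult_carrier_mat um_smult)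

lemma inb_uminus: "inb s t Y ==> inb s t (- Y)" using inb_scl[of s t Y "- 1"] by (simp add: scl_uminus)

lemma inb_diff: "inb s t Y ==> inb s t Z ==> inb s t (Y - Z)" using inb_add[OF _ inb_uminus] by fastforce

lemma inb_mult: "inb s t Y ==> inb t u Z ==> inb s u (Y * Z)"
  unfolding inb_def by (metis carrier_matD mult_carrier_mat um_mult)

lemma inb_mult_ne: "inb s t Y ==> inb t' u Z ==> t \<noteq> t' ==> Y * Z = 0" by (auto simp: inb_def um_mult_ne)

lemma inb_sum: "(\<And>i. i \<in> I ==> inb s t (f i)) ==> inb s t (sum f I)"
  by (induction I rule: infinite_finite_induct) (auto intro: inb_zero inb_add)

lemma inb_diag_left: "inb p p F ==> inb s t Z ==> inb s t (F * Z)"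
  by (cases "p = s") (auto intro: inb_mult inb_zero simp: inb_mult_ne)

lemma inb_diag_right: "inb p p F ==> inb s t Z ==> inb s t (Z * F)"
  by (cases "p = t") (auto intro: inb_mult inb_zero simp: inb_mult_ne)

lemma ent_inb: "inb s t Z ==> ent Z (s', i) (t', j) \<noteq> 0 ==> s' = s \<and> t' = t \<and> i < n s \<and> j < n t"
  by (auto simp: inb_def ent_um split: if_splits)

lemma sca_inb: "inb s t Z ==> sca Z = 0" by (auto simp: inb_def)

lemma inb_fus: "inb (tla a) (tla a) (fus (RX x) (RA \<alpha>) a)"
proof -
  have "inb (tla a) (tla a) (RA \<alpha> (star a) * RX x (star a))"
    using inb_mult[OF inb_RA[of "star a" \<alpha>] inb_RX[of "star a" x]] by simp
  thus ?thesis unfolding fus_def using inb_mult[OF inb_RX inb_RA] by (rule inb_diff)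
qed

lemma inb_emb_left: "s \<in> verts Q ==> inb s t Z ==> inb s t (emb z * Z)"
  and inb_emb_right: "t \<in> verts Q ==> inb s t Z ==> inb s t (Z * emb z)" unfolding inb_def
  by (metis emb_um carrier_matD(1) mult_carrier_mat block_carrier, metis um_emb carrier_matD(2) mult_carrier_mat block_carrier)

lemma RX_cong: "(\<And>c. c \<in> C ==> V c = W c) ==> a \<in> R ==> RX V a = RX W a"
  by (rule umat_eqI) (auto simp: ent_RX C_iff split_paired_all)

lemma RA_cong: "(\<And>c. c \<in> C ==> V c = W c) ==> a \<in> R ==> RA V a = RA W a"
  by (rule umat_eqI) (auto simp: ent_RA C_iff split_paired_all)

lemma pairing_cong: "(\<And>a. a \<in> S ==> A a = B a) ==> (\<And>a. a \<in> S ==> V a = W a) ==> pairing S A V = pairing S B W"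
  by (simp add: pairing_def)

text \<open>A family of blocks is a tangent vector, and pairing with the coordinate covectors
  recovers its coordinates; so a formula for the pairings determines the vector.\<close>

lemma RX_of_pairing:
  assumes W: "\<And>a. a \<in> R ==> inb (tla a) (hda a) (W a)"
    and V: "\<And>c. c \<in> C ==> V c = pairing R (dX c) W" and a: "a \<in> R"
  shows "RX V a = W a"
proof -
  define B where "B = (\<lambda>a. SOME B. B \<in> carrier_mat (rd a) (cd a) \<and> W a = um (tla a) (hda a) B)"
  have B: "B a \<in> carrier_mat (rd a) (cd a) \<and> W a = um (tla a) (hda a) (B a)" if "a \<in> R" for a
    unfolding B_def by (rule someI_ex) (use W[OF that] in "auto simp: inb_def")
  have W': "RX (of_blocks R rd cd B) a = W a" if "a \<in> R" for a using RX_of_blocks[of a B] B[OF that] that by simp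
  have "RX V a = RX (of_blocks R rd cd B) a"
  proof (rule RX_cong[OF _ a])
    fix c assume c: "c \<in> C"
    have "of_blocks R rd cd B c = pairing R (dX c) (RX (of_blocks R rd cd B))" by (rule coord_pairing[OF c])
    also have "\<dots> = pairing R (dX c) W" by (rule pairing_cong) (simp_all add: W')
    finally show "V c = of_blocks R rd cd B c" using V[OF c] by simp
  qed
  thus ?thesis using W'[OF a] by simp
qed

lemma RA_of_pairing:
  assumes W: "\<And>a. a \<in> R ==> inb (hda a) (tla a) (W a)"
    and V: "\<And>c. c \<in> C ==> \<alpha> c = pairing R W (eX c)" and a: "a \<in> R"
  shows "RA \<alpha> a = W a"
proof -
  define \<beta> where "\<beta> = (\<lambda>(a, j, i). ent (W a) (hda a, i) (tla a, j))"
  have W': "RA \<beta> a = W a" if "a \<in> R" for a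
  proof (rule umat_eqI)
    fix p q :: "'s \<times> nat"
    obtain s i t j where pq: "p = (s, i)" "q = (t, j)" by (cases p, cases q)
    show "ent (RA \<beta> a) p q = ent (W a) p q"
    proof (cases "s = hda a \<and> t = tla a \<and> i < cd a \<and> j < rd a")
      case True
      thus ?thesis by (simp add: pq ent_RA \<beta>_def)
    next
      case False
      have "ent (W a) (s, i) (t, j) = 0"
      proof (rule ccontr)
        assume "ent (W a) (s, i) (t, j) \<noteq> 0"
        from ent_inb[OF W[OF that] this] False show False by simp
      qed
      moreover have "ent (RA \<beta> a) (s, i) (t, j) = 0" unfolding ent_RA using False by (rule if_not_P)
      ultimately show ?thesis by (simp only: pq)
    qed
  qed (simp add: sca_inb[OF W[OF that]])
  have "RA \<alpha> a = RA \<beta> a"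
  proof (rule RA_cong[OF _ a])
    fix c assume c: "c \<in> C"
    have "\<beta> c = (\<Sum>b\<in>C. \<beta> b * unit_pt c b)"
      using sum_unit[OF c, of \<beta>] by (simp add: mult.commute)
    also have "\<dots> = pairing R W (eX c)" unfolding pairing_coords by (rule pairing_cong) (simp_all add: W')
    finally show "\<alpha> c = \<beta> c" using V[OF c] by simp
  qed
  thus ?thesis using W'[OF a] by simp
qed

lemma RX_infinitesimal:
  assumes "a \<in> R"
  shows "RX (infinitesimal M z x) a = - vact (\<lambda>_. emb z) (RX x) a"
proof -
  let ?Z = "RX x a * emb z - emb z * RX x a"
  have Z: "inb (tla a) (hda a) ?Z" by (intro inb_diff inb_emb_left inb_emb_right tl_verts hd_verts assms inb_RX)
  have "RX (infinitesimal M z x) a = ?Z"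
  proof (rule umat_eqI)
    fix p q :: "'s \<times> nat"
    obtain s i t j where pq: "p = (s, i)" "q = (t, j)" by (cases p, cases q)
    show "ent (RX (infinitesimal M z x) a) p q = ent ?Z p q"
    proof (cases "s = tla a \<and> t = hda a \<and> i < rd a \<and> j < cd a")
      case True
      hence "(a, i, j) \<in> C" using assms by (simp add: C_iff)
      from infinitesimal_eq[OF this, of z x] True show ?thesis by (simp add: pq ent_RX)
    next
      case False
      have "ent ?Z (s, i) (t, j) = 0"
      proof (rule ccontr)
        assume "ent ?Z (s, i) (t, j) \<noteq> 0"
        from ent_inb[OF Z this] False show False by simp
      qed
      moreover have "ent (RX (infinitesimal M z x) a) (s, i) (t, j) = 0"
        unfolding ent_RX using False by (rule if_not_P)
      ultimately show ?thesis by (simp only: pq)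
    qed
  qed (simp add: sca_inb[OF Z])
  thus ?thesis by (simp add: vact_def)
qed

lemma infinitesimal_affine: "infinitesimal M z x \<in> affine_space C"
proof -
  have "infinitesimal M z x c = 0" if "c \<notin> C" for c
  proof -
    have "act M g x c = 0" for g
    proof -
      have "act1 g x c = 0" using act_affine[of g x] that unfolding affine_space_def by blast
      thus ?thesis by (simp add: open_rep_variety_def)
    qed
    thus ?thesis by (simp add: infinitesimal_def)
  qed
  thus ?thesis by (simp add: affine_space_def)
qed

abbreviation mux :: "('e + 'e) entry point => ('e + 'e) entry => ('s \<times> nat) umat" where
  "mux x c \<equiv> sum (fus (RX x) (dX c)) R"

end

context rep_pencil
begin

text \<open>Two signs cancel: one from differentiating along exp(-t z), the other from transposing
  \<open>vact\<close> into the moment matrices.\<close>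

lemma infinitesimal_mux:
  assumes "c \<in> C"
  shows "infinitesimal M z x c = tr (emb z * mux x c)"
proof -
  have "infinitesimal M z x c = pairing R (dX c) (RX (infinitesimal M z x))" by (rule coord_pairing[OF assms])
  also have "\<dots> = pairing R (dX c) (\<lambda>a. - vact (\<lambda>_. emb z) (RX x) a)"
    by (rule pairing_cong) (simp_all add: RX_infinitesimal)
  also have "\<dots> = - pairing R (dX c) (vact (\<lambda>_. emb z) (RX x))"
    by (simp add: pairing_def tr_uminus sum_negf)
  also have "\<dots> = (\<Sum>q\<in>R. tr (emb z * fus (RX x) (dX c) q))"
    using sum_fus_dual[of "\<lambda>_. emb z" "RX x" "dX c"] by (simp add: pairing_vact set_ord)
  finally show ?thesis by (simp add: sum_distrib_left tr_sum)
qed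

definition muz :: "('e + 'e) entry point => ('e + 'e) entry => 's entry point" where
  "muz x c = (\<lambda>(s, i, j). if (s, i, j) \<in> Gn then ent (mux x c) (s, i) (s, j) else 0)"

lemma muz_gl: "muz x c \<in> gln" by (auto simp: muz_def gl_alg_def affine_space_def)

text \<open>Every moment matrix is a diagonal block at the tail of its arrow, so their sum is an
  element of the Lie algebra and nothing is lost in passing to coordinates.\<close>

lemma emb_muz: "emb (muz x c) = mux x c"
proof (rule umat_eqI)
  fix p q :: "'s \<times> nat"
  obtain s i t j where pq: "p = (s, i)" "q = (t, j)" by (cases p, cases q)
  show "ent (emb (muz x c)) p q = ent (mux x c) p q"
  proof (cases "s = t \<and> s \<in> verts Q \<and> i < n s \<and> j < n s")
    case True
    thus ?thesis by (auto simp: pq ent_emb muz_def gl_entries_iff)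
  next
    case False
    have "ent (fus (RX x) (dX c) a) (s, i) (t, j) = 0" if "a \<in> R" for a
    proof (rule ccontr)
      assume "ent (fus (RX x) (dX c) a) (s, i) (t, j) \<noteq> 0"
      from ent_inb[OF inb_fus this] False tl_verts[OF that] show False by (metis n_tl)
    qed
    hence "ent (mux x c) p q = 0" by (simp add: pq ent_sum)
    thus ?thesis using False by (auto simp: pq ent_emb)
  qed
qed (simp add: sca_sum sca_inb[OF inb_fus])

text \<open>\<open>spin\<close> is in general not a block itself: it may have parts at several
  vertices and a scalar part. But multiplication by a diagonal block or a scalar keeps a block in
  its place.\<close>

lemma inb_spin_left: "inb s t Z ==> inb s t (spin (fus (RX x) (RA \<alpha>)) q * Z)"
  and inb_spin_right: "inb s t Z ==> inb s t (Z * spin (fus (RX x) (RA \<alpha>)) q)"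
proof -
  assume Z: "inb s t Z"
  let ?f = "fus (RX x) (RA \<alpha>)"
  have "spin ?f q * Z = (\<Sum>p\<in>set ord. scl (sg p q) * (?f p * Z)) + scl (\<Sum>p\<in>set ord. kk q p * tr (?f p)) * Z"
    by (simp add: spin_def distrib_right sum_distrib_right mult.assoc)
  thus "inb s t (spin ?f q * Z)" using Z by (auto intro!: inb_add inb_sum inb_scl inb_diag_left inb_fus)
  have "Z * (scl c * F) = scl c * (Z * F)" for c F by (simp add: mult.assoc[symmetric] scl_commute)
  hence "Z * spin ?f q = (\<Sum>p\<in>set ord. scl (sg p q) * (Z * ?f p)) + scl (\<Sum>p\<in>set ord. kk q p * tr (?f p)) * Z"
    by (simp add: spin_def distrib_left sum_distrib_left scl_commute)
  thus "inb s t (Z * spin ?f q)" using Z by (auto intro!: inb_add inb_sum inb_scl inb_diag_right inb_fus)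
qed

lemma inb_sharp: "inb (tla a) (hda a) (sharp (RX x) (RA \<alpha>) a)"
proof -
  have A: "inb (tla a) (hda a) (RA \<alpha> (star a))" and Y: "inb (hda a) (tla a) (RX x (star a))"
    using inb_RA[of "star a" \<alpha>] inb_RX[of "star a" x] by simp_all
  note X = inb_RX[of a x]
  have "inb (tla a) (hda a) (sharp0 (RX x) (RA \<alpha>) a)" unfolding sharp0_def minus_mult_left[symmetric]
    by (intro inb_uminus inb_scl inb_add A inb_mult[OF inb_mult[OF X Y] A] inb_mult[OF inb_mult[OF A Y] X])
  thus ?thesis unfolding sharp_def vact_def by (intro inb_add inb_diff inb_spin_left inb_spin_right X)
qed

lemma RX_sharp:
  assumes "a \<in> R"
  shows "RX (\<lambda>c. P x d c) a = scl (1/2) * sharp (RX x) (dX d) a"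
proof (rule RX_of_pairing[OF _ _ assms])
  show "inb (tla a) (hda a) (scl (1/2) * sharp (RX x) (dX d) a)" for a by (intro inb_scl inb_sharp)
  show "P x d c = pairing R (dX c) (\<lambda>a. scl (1/2) * sharp (RX x) (dX d) a)" for c
    using pairing_sharp[of "dX c" "RX x" "dX d"] by (simp add: pairing_scl_right biv_coords set_ord)
qed

lemma P_antisym: "P x c d = - P x d c" unfolding biv_coords by (rule biv_antisym)

lemma RA_outside: "c \<notin> C ==> a \<in> R ==> dX c a = 0"
  by (rule umat_eqI) (auto simp: ent_RA unit_pt_def C_iff split_paired_all)

lemma P_outside:
  assumes c: "c \<notin> C"
  shows "P x c d = 0"
proof -
  have "P x d c = 1/2 * pairing R (dX c) (sharp (RX x) (dX d))"
    using pairing_sharp[of "dX c" "RX x" "dX d"] by (simp add: biv_coords set_ord)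
  also have "\<dots> = 0" by (simp add: pairing_def RA_outside[OF c])
  finally show ?thesis using P_antisym[of x c d] by simp
qed

lemma mhasd_RX: "q \<in> R ==> x \<in> points M ==> M.mhasd V x (\<lambda>y. RX y q) (RX V q)"
  by (simp add: M.mhasd_def mreg_RX mD_RX)

lemma mhasd_fus: "x \<in> points M ==> q \<in> R ==> M.mhasd V x (\<lambda>y. fus (RX y) A q) (fus (RX V) A q)"
  unfolding fus_def by (intro M.mhasd_diff M.mhasd_cmult M.mhasd_multc mhasd_RX star_R)

lemma mhasd_plus_star:
  assumes x: "x \<in> points M" "a \<in> R"
  shows "M.mhasd V x (\<lambda>y. (1 + RX y (star a) * RX y a) * K) ((RX V (star a) * RX x a + RX x (star a) * RX V a) * K)"
proof -
  have "M.mhasd V x (\<lambda>y. (1 + RX y (star a) * RX y a) * K)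
      ((0 + (RX x (star a) * RX V a + RX V (star a) * RX x a)) * K)"
    by (intro M.mhasd_multc M.mhasd_add M.mhasd_const M.mhasd_mult mhasd_RX star_R x)
  thus ?thesis by (simp add: add.commute)
qed

lemma biv_expand: "biv X A B = 1/2 * (\<Sum>a\<in>R. eps a * tr ((1 + X (star a) * X a) * (A a * B (star a) - B a * A (star a))))
    - 1/2 * ((\<Sum>q\<in>R. \<Sum>p\<in>R. sg p q * tr (fus X A p * fus X B q))
      + (\<Sum>q\<in>R. \<Sum>p\<in>R. kk q p * (tr (fus X A p) * tr (fus X B q))))"
  by (simp add: biv_def biv0_def sum_spin) (simp add: set_ord)

lemma dbiv_expand: "dbiv X V A B = 1/2 * (\<Sum>a\<in>R. eps a * tr ((V (star a) * X a + X (star a) * V a) * (A a * B (star a) - B a * A (star a))))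
    - 1/2 * ((\<Sum>q\<in>R. \<Sum>p\<in>R. sg p q * tr (fus X A p * fus V B q + fus V A p * fus X B q))
      + (\<Sum>q\<in>R. \<Sum>p\<in>R. kk q p * (tr (fus X A p) * tr (fus V B q) + tr (fus V A p) * tr (fus X B q))))"
  unfolding dbiv_def dbiv0_def sum.distrib sum_spin
  by (simp add: set_ord tr_add distrib_left sum.distrib algebra_simps)

text \<open>Justifies the formal derivative: the rules for \<open>hasd\<close>, applied to the
  traces that make up \<open>biv\<close>, reproduce \<open>dbiv\<close> term by term.\<close>

lemma hasd_biv: "x \<in> points M ==> M.hasd V x (\<lambda>y. biv (RX y) A B) (dbiv (RX x) (RX V) A B)"
  unfolding biv_expand dbiv_expand by (intro M.hasd_diff M.hasd_add M.hasd_cmult M.hasd_sum M.hasd_mult M.hasd_tr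
      M.mhasd_mult mhasd_fus mhasd_plus_star)

end

section \<open>The quasi-Poisson property\<close>

lemma (in arrow_set) dbiv0_cong: "(\<And>a. a \<in> R ==> V a = W a) ==> dbiv0 R X V A B = dbiv0 R X W A B"
  unfolding dbiv0_def by (intro arg_cong[where f = "\<lambda>z. 1/2 * z"] sum.cong refl) (simp add: star_in)

context arrow_order
begin

lemma dbiv_cong:
  fixes V W :: "('e, 'i) fam"
  assumes "\<And>a. a \<in> set ord ==> V a = W a"
  shows "dbiv X V A B = dbiv X W A B"
proof -
  have "pairing (set ord) A V = pairing (set ord) A W" for A :: "('e, 'i) fam"
    unfolding pairing_def by (rule sum.cong) (simp_all add: assms)
  hence "2 * dbiv X V A B = 2 * dbiv X W A B" unfolding dbiv_eq by (simp add: dbiv0_cong[of V W, OF assms])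
  thus ?thesis by simp
qed

lemma dbiv_scl: "dbiv X (\<lambda>a. scl c * V a) A B = c * dbiv X V A B"
proof -
  have "2 * dbiv X (\<lambda>a. scl c * V a) A B = 2 * (c * dbiv X V A B)"
    unfolding mult.left_commute[of 2 c] dbiv_eq dbiv0_scl_vec pairing_scl_right by (simp add: algebra_simps)
  thus ?thesis by simp
qed

end

lemma cubic_antisym: "cubic x z y = - cubic x y z" "cubic y x z = - cubic x y z"
  "cubic y z x = cubic x y z" "cubic z x y = cubic x y z" "cubic z y x = - cubic x y z"
  unfolding cubic_def by (simp_all add: algebra_simps tr_linear tr_comm[of y] tr_comm[of z])

context gl_group
begin

lemma dual_expand:
  assumes "sca Z = 0" "\<And>s i t j. ent Z (s, i) (t, j) \<noteq> 0 ==> s = t \<and> s \<in> S \<and> i < n s \<and> j < n s"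
  shows "(\<Sum>a\<in>Gn. scl (tr (emb (basis_elt a) * Z)) * emb (dual_elt a)) = Z"
proof (rule umat_eqI)
  fix p q :: "'s \<times> nat"
  obtain s i t j where pq: "p = (s, i)" "q = (t, j)" by (cases p, cases q)
  have e: "tr (emb (basis_elt a) * Z) * ent (emb (dual_elt a)) (s, i) (t, j)
      = (if a = (s, j, i) then (if s = t then ent Z (s, i) (t, j) else 0) else 0)" if "a \<in> Gn" for a proof -
    obtain r k l where a: "a = (r, k, l)" by (cases a)
    show ?thesis using that unfolding a
      by (auto simp del: dual_elt.simps simp add: emb_basis emb_dual tr_elem assms(1) ent_elem)
  qed
  have "ent (\<Sum>a\<in>Gn. scl (tr (emb (basis_elt a) * Z)) * emb (dual_elt a)) (s, i) (t, j)
      = (\<Sum>a\<in>Gn. if a = (s, j, i) then (if s = t then ent Z (s, i) (t, j) else 0) else 0)"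
    unfolding ent_sum ent_scl_mult by (rule sum.cong[OF refl e])
  also have "\<dots> = (if (s, j, i) \<in> Gn then (if s = t then ent Z (s, i) (t, j) else 0) else 0)" by simp
  also have "\<dots> = ent Z (s, i) (t, j)" using assms(2)[of s i t j] by (auto simp: gl_entries_iff)
  finally show "ent (\<Sum>a\<in>Gn. scl (tr (emb (basis_elt a) * Z)) * emb (dual_elt a)) p q = ent Z p q"
    by (simp add: pq)
qed (simp add: sca_sum assms(1))

lemma dual_expand_emb: "(\<Sum>a\<in>Gn. scl (tr (emb (basis_elt a) * emb z)) * emb (dual_elt a)) = emb z"
  by (rule dual_expand) (auto simp: ent_emb split: if_splits)

lemma dual_contract: "(\<Sum>a\<in>Gn. tr (emb (basis_elt a) * emb z) * tr (emb (dual_elt a) * Y)) = tr (emb z * Y)"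
  unfolding dual_expand_emb[of z, symmetric, THEN arg_cong[where f = "\<lambda>u. tr (u * Y)"]]
  by (simp add: sum_distrib_right tr_sum mult.assoc tr_scl_mult)

text \<open>Linearity in each slot and the completeness relation \<open>dual_contract\<close> of the
  dual bases, applied from the innermost sum outwards.\<close>

lemma cubic_contract: "(\<Sum>a1\<in>Gn. \<Sum>a2\<in>Gn. \<Sum>a3\<in>Gn.
      cubic (emb (dual_elt a1)) (emb (dual_elt a2)) (emb (dual_elt a3)) *
      (tr (emb (basis_elt a1) * emb u) * tr (emb (basis_elt a2) * emb v) * tr (emb (basis_elt a3) * emb w)))
    = cubic (emb u) (emb v) (emb w)"
proof -
  let ?G = "Gn"
  let ?h = "\<lambda>z a. tr (emb (basis_elt a) * emb z)"
  have lin: "(\<Sum>a\<in>?G. ?h z a * tr (A * (emb (dual_elt a) * B))) = tr (A * (emb z * B))" for z A B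
  proof -
    have "tr (A * (Z * B)) = tr (Z * (B * A))" for Z by (metis mult.assoc tr_comm)
    thus ?thesis by (simp add: dual_contract)
  qed
  have lin1: "(\<Sum>a\<in>?G. ?h z a * tr (emb (dual_elt a) * B)) = tr (emb z * B)" for z B by (rule dual_contract)
  have lin3: "(\<Sum>a\<in>?G. ?h z a * tr (A * (B * emb (dual_elt a)))) = tr (A * (B * emb z))" for z A B
    using lin[of z "A * B" 1] by (simp add: mult.assoc)
  have "(\<Sum>a1\<in>?G. \<Sum>a2\<in>?G. \<Sum>a3\<in>?G.
      cubic (emb (dual_elt a1)) (emb (dual_elt a2)) (emb (dual_elt a3)) * (?h u a1 * ?h v a2 * ?h w a3))
    = (\<Sum>a1\<in>?G. ?h u a1 * (\<Sum>a2\<in>?G. ?h v a2 * (\<Sum>a3\<in>?G. ?h w a3 * tr (emb (dual_elt a1) * (emb (dual_elt a2) * emb (dual_elt a3))))))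
      - (\<Sum>a1\<in>?G. ?h u a1 * (\<Sum>a2\<in>?G. ?h v a2 * (\<Sum>a3\<in>?G. ?h w a3 * tr (emb (dual_elt a1) * (emb (dual_elt a3) * emb (dual_elt a2))))))"
    unfolding cubic_def right_diff_distrib tr_diff left_diff_distrib sum_subtractf
    by (simp add: sum_distrib_left mult_ac)
  also have "\<dots> = cubic (emb u) (emb v) (emb w)" unfolding lin lin3 lin1 cubic_def right_diff_distrib tr_diff ..
  finally show ?thesis .
qed

end

context rep_pencil
begin

lemma M_simps [simp]: "gverts M = verts Q" "gdim M = n" "coords M = C" "act M = act1"
  by (simp_all add: open_rep_variety_def)

abbreviation \<Phi> where "\<Phi> \<equiv> vdb_moment Q n ord"

lemma bivector_field_P: "bivector_field M P" unfolding bivector_field_def alternating_field_def M_simps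
proof (intro conjI ballI allI impI)
  fix x c d
  show "P x c d = - P x d c" by (rule P_antisym)
  show "P x c d = 0" if "c \<notin> C \<or> d \<notin> C"
    using that P_outside[of c x d] P_outside[of d x c] P_antisym[of x c d] by auto
  show "regular_on C (points M) (\<lambda>x. P x c d)" using hasd_biv[of _ "\<lambda>_. 0" "dX c" "dX d"]
    unfolding biv_coords biv_expand
    by (intro regular_diff regular_add regular_mult regular_const regular_sum M.regular_tr M.mreg_mult
        M.mreg_add M.mreg_const mreg_RX star_R)
      (auto simp: fus_def intro!: M.mreg_diff M.mreg_mult M.mreg_const mreg_RX star_R)
qed

lemma dirD_P:
  assumes "x \<in> points M"
  shows "(\<Sum>l\<in>C. P x c l * pderiv_at l (\<lambda>y. P y d e) x)
    = 1/2 * dbiv (RX x) (sharp (RX x) (dX c)) (dX d) (dX e)"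
proof -
  have "(\<Sum>l\<in>C. P x c l * pderiv_at l (\<lambda>y. P y d e) x) = M.dirD (\<lambda>l. P x c l) (\<lambda>y. P y d e) x"
    by (simp add: M.dirD_def)
  also have "\<dots> = dbiv (RX x) (RX (\<lambda>l. P x c l)) (dX d) (dX e)"
    using hasd_biv[OF assms, of "\<lambda>l. P x c l" "dX d" "dX e"] by (simp add: M.hasd_def biv_coords)
  also have "\<dots> = dbiv (RX x) (\<lambda>a. scl (1/2) * sharp (RX x) (dX c) a) (dX d) (dX e)"
    by (rule dbiv_cong) (simp add: RX_sharp set_ord)
  finally show ?thesis by (simp add: dbiv_scl)
qed

text \<open>The bracket is twice the cyclic sum of derivatives, \<open>dirD_P\<close> halves each of
  them, and \<open>jacobi_biv\<close> has a 2 on its left side; this leaves 1/2.\<close>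

lemma schouten_P:
  assumes "x \<in> points M"
  shows "schouten C P P x c d e = 1/2 * cubic (mux x c) (mux x d) (mux x e)"
proof -
  have "schouten C P P x c d e = 2 * ((\<Sum>l\<in>C. P x c l * pderiv_at l (\<lambda>y. P y d e) x)
      + (\<Sum>l\<in>C. P x d l * pderiv_at l (\<lambda>y. P y e c) x) + (\<Sum>l\<in>C. P x e l * pderiv_at l (\<lambda>y. P y c d) x))"
    by (simp add: schouten_def sum.distrib sum_distrib_left)
  also have "\<dots> = dbiv (RX x) (sharp (RX x) (dX c)) (dX d) (dX e)
      + dbiv (RX x) (sharp (RX x) (dX d)) (dX e) (dX c) + dbiv (RX x) (sharp (RX x) (dX e)) (dX c) (dX d)"
    unfolding dirD_P[OF assms] by simp
  finally show ?thesis using jacobi_biv[of "RX x" "dX c" "dX d" "dX e"]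
    by (simp add: set_ord distrib_left algebra_simps)
qed

text \<open>The six terms of the wedge product contribute equally, because the cubic form is totally
  antisymmetric, and 6/12 = 1/2 agrees with \<open>schouten_P\<close>.\<close>

lemma cartan_cubic:
  assumes "c \<in> C" "d \<in> C" "e \<in> C"
  shows "cartan_trivector M x c d e = 1/2 * cubic (mux x c) (mux x d) (mux x e)"
proof -
  let ?G = "Gn"
  let ?h = "\<lambda>c a. tr (emb (basis_elt a) * emb (muz x c))"
  let ?k = "\<lambda>a1 a2 a3. cubic (emb (dual_elt a1)) (emb (dual_elt a2)) (emb (dual_elt a3))"
  have h: "infinitesimal M (basis_elt a) x c = ?h c a" if "c \<in> C" for a c
    by (simp add: infinitesimal_mux[OF that] emb_muz)
  have tf: "trace_form (verts Q) n (dual_elt a1) (lie_bracket (verts Q) n (dual_elt a2) (dual_elt a3)) = ?k a1 a2 a3"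
    for a1 a2 a3 by (simp only: trace_form_emb emb_lie_bracket cubic_def)
  have "cartan_trivector M x c d e = 1/12 * (\<Sum>a1\<in>?G. \<Sum>a2\<in>?G. \<Sum>a3\<in>?G.
       ?k a1 a2 a3 * (?h c a1 * ?h d a2 * ?h e a3) - ?k a1 a2 a3 * (?h c a1 * ?h e a2 * ?h d a3)
     + ?k a1 a2 a3 * (?h e a1 * ?h c a2 * ?h d a3) - ?k a1 a2 a3 * (?h d a1 * ?h c a2 * ?h e a3)
     + ?k a1 a2 a3 * (?h d a1 * ?h e a2 * ?h c a3) - ?k a1 a2 a3 * (?h e a1 * ?h d a2 * ?h c a3))"
    unfolding cartan_trivector_def M_simps tf wedge3_def h[OF assms(1)] h[OF assms(2)] h[OF assms(3)]
    by (intro arg_cong[where f = "\<lambda>z. 1/12 * z"] sum.cong refl) (simp add: algebra_simps)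
  also have "\<dots> = 1/2 * cubic (mux x c) (mux x d) (mux x e)" unfolding sum.distrib sum_subtractf cubic_contract
    unfolding emb_muz cubic_antisym[where x = "mux x c" and y = "mux x d" and z = "mux x e"] by simp
  finally show ?thesis .
qed

text \<open>The action is linear in the point, so its partial derivatives are its values on unit
  vectors.\<close>

lemma act_coord_deriv:
  assumes "g \<in> GLn" "a \<in> C" "c \<in> C"
  shows "pderiv_at a (\<lambda>y. act1 g y c) x = act1 g (unit_pt a) c"
proof -
  obtain b i j where c: "c = (b, i, j)" by (cases c)
  have b: "b \<in> R" "i < rd b" "j < cd b" using assms(3) by (auto simp: c C_iff)
  let ?E = "\<lambda>Z. ent (emb1 g * Z * emb1 (ginvn g)) (tla b, i) (hda b, j)"
  have e: "act1 g y c = ?E (RX y b)" for y using RX_act[OF assms(1) b(1), of y] b by (metis c ent_RX)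
  have u: "x(a := t) = (\<lambda>d. x d + (t - x a) * unit_pt a d)" for t by (auto simp: unit_pt_def)
  have "act1 g (x(a := t)) c = act1 g x c + (t - x a) * act1 g (unit_pt a) c" for t
  proof -
    have "emb1 g * (scl k * Z) * H = scl k * (emb1 g * Z * H)" for k Z H by (metis mult.assoc scl_commute)
    thus ?thesis unfolding e unfolding u RX_add RX_scale by (simp add: distrib_left distrib_right)
  qed
  thus ?thesis unfolding pderiv_at_def by (intro DERIV_imp_deriv) (auto intro!: derivative_eq_intros)
qed

lemma act_linear:
  assumes "g \<in> GLn" "a \<in> R" and c: "c \<in> C"
  shows "RA (\<lambda>b. act1 g (unit_pt b) c) a = emb1 (ginvn g) * dX c a * emb1 g"
proof (rule RA_of_pairing[OF _ _ assms(2)])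
  let ?H = "emb1 (ginvn g)"
  show "inb (hda a) (tla a) (?H * dX c a * emb1 g)" if "a \<in> R" for a
  proof -
    have "?H * dX c a * emb1 g = emb (ginvn g) * dX c a * emb g"
      unfolding RA_def using tl_verts[OF that] hd_verts[OF that] by (simp add: emb1_um um_emb1 emb_um um_emb)
    thus ?thesis using tl_verts[OF that] hd_verts[OF that] by (simp add: inb_emb_left inb_emb_right inb_RA)
  qed
  fix b assume "b \<in> C"
  have "act1 g (unit_pt b) c = pairing R (dX c) (RX (act1 g (unit_pt b)))" by (rule coord_pairing[OF c])
  also have "\<dots> = pairing R (\<lambda>a. ?H * dX c a * emb1 g) (eX b)" unfolding pairing_def
  proof (rule sum.cong[OF refl])
    fix a assume "a \<in> R"
    thus "tr (dX c a * RX (act1 g (unit_pt b)) a) = tr (?H * dX c a * emb1 g * eX b a)"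
      using tr_comm[of ?H "dX c a * emb1 g * eX b a"] by (simp add: RX_act assms(1) mult.assoc)
  qed
  finally show "act1 g (unit_pt b) c = pairing R (\<lambda>a. ?H * dX c a * emb1 g) (eX b)" .
qed

lemma biv_bilinear: "(\<Sum>a\<in>C. \<Sum>b\<in>C. P x a b * \<alpha> a * \<beta> b) = biv (RX x) (RA \<alpha>) (RA \<beta>)"
proof -
  have 1: "(\<Sum>b\<in>C. P x a b * \<beta> b) = - biv (RX x) (RA \<beta>) (dX a)" for a
  proof -
    have "(\<Sum>b\<in>C. P x a b * \<beta> b) = (\<Sum>b\<in>C. \<beta> b * P x a b)" by (simp add: mult.commute)
    also have "\<dots> = pairing R (RA \<beta>) (\<lambda>b. scl (1/2) * sharp (RX x) (dX a) b)"
      unfolding pairing_coords by (rule pairing_cong) (simp_all add: RX_sharp)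
    also have "\<dots> = biv (RX x) (dX a) (RA \<beta>)"
      using pairing_sharp[of "RA \<beta>" "RX x" "dX a"] by (simp add: pairing_scl_right set_ord)
    finally show ?thesis by (simp add: biv_antisym[of "RX x" "dX a"])
  qed
  have V: "RX (\<lambda>a. biv (RX x) (RA \<beta>) (dX a)) b = scl (1/2) * sharp (RX x) (RA \<beta>) b" if "b \<in> R" for b
    by (rule RX_of_pairing[OF _ _ that])
      (use pairing_sharp[of _ "RX x" "RA \<beta>"] in "auto intro!: inb_scl inb_sharp simp: pairing_scl_right set_ord")
  have "(\<Sum>a\<in>C. \<Sum>b\<in>C. P x a b * \<alpha> a * \<beta> b) = (\<Sum>a\<in>C. \<alpha> a * (\<Sum>b\<in>C. P x a b * \<beta> b))"
    by (simp add: sum_distrib_left mult_ac)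
  also have "\<dots> = - (\<Sum>a\<in>C. \<alpha> a * biv (RX x) (RA \<beta>) (dX a))" by (simp add: 1 sum_negf)
  also have "\<dots> = - pairing R (RA \<alpha>) (\<lambda>b. scl (1/2) * sharp (RX x) (RA \<beta>) b)"
    unfolding pairing_coords by (intro arg_cong[where f = uminus] pairing_cong) (simp_all add: V)
  also have "\<dots> = - biv (RX x) (RA \<beta>) (RA \<alpha>)"
    using pairing_sharp[of "RA \<alpha>" "RX x" "RA \<beta>"] by (simp add: pairing_scl_right set_ord)
  finally show ?thesis by (simp add: biv_antisym[of "RX x" "RA \<beta>"])
qed

lemma biv_cong:
  assumes "\<And>a. a \<in> R ==> X a = X' a" "\<And>a. a \<in> R ==> A a = A' a" "\<And>a. a \<in> R ==> B a = B' a"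
  shows "biv X A B = biv X' A' B'"
proof -
  have f: "fus X A a = fus X' A' a" "fus X B a = fus X' B' a" if "a \<in> R" for a
    using that assms star_R by (simp_all add: fus_def)
  show ?thesis unfolding biv_expand
    by (intro arg_cong2[where f = "(-)"] arg_cong2[where f = "(+)"] arg_cong[where f = "\<lambda>z. 1/2 * z"] sum.cong refl)
      (simp_all add: f assms star_R)
qed

lemma biv_conj:
  assumes HG: "H * G = 1" and GH: "G * H = 1"
  shows "biv (\<lambda>a. G * X a * H) A B = biv X (\<lambda>a. H * A a * G) (\<lambda>a. H * B a * G)"
proof -
  have HGl: "H * (G * z) = z" and GHl: "G * (H * z) = z" for z using HG GH by (simp_all add: mult.assoc[symmetric])
  have f: "fus (\<lambda>a. G * X a * H) A q = G * fus X (\<lambda>a. H * A a * G) q * H" for A q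
    by (simp add: fus_def algebra_simps HGl GHl HG GH)
  have t: "tr (G * u * H) = tr u" for u using tr_comm[of G "u * H"] by (simp add: mult.assoc HG)
  have t2: "tr (G * u * H * (G * v * H)) = tr (u * v)" for u v using t[of "u * v"] by (simp add: mult.assoc HGl)
  have "tr ((1 + G * Y * H * (G * Z * H)) * (A1 * B1 - B2 * A2))
     = tr ((1 + Y * Z) * (H * A1 * G * (H * B1 * G) - H * B2 * G * (H * A2 * G)))" for Y Z A1 B1 B2 A2
    using t[of "(1 + Y * Z) * (H * A1 * G * (H * B1 * G) - H * B2 * G * (H * A2 * G))"]
    by (simp add: algebra_simps HGl GHl HG GH)
  thus ?thesis unfolding biv_expand f t t2 by simp
qed

lemma invariant_P: "invariant_bivector M P" unfolding invariant_bivector_def M_simps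
proof (intro ballI)
  fix g x c d assume g: "g \<in> GLn" and x: "x \<in> points M" and c: "c \<in> C" and d: "d \<in> C"
  let ?G = "emb1 g" and ?H = "emb1 (ginvn g)"
  have "bivector_bracket C P (\<lambda>y. act1 g y c) (\<lambda>y. act1 g y d) x
      = (\<Sum>a\<in>C. \<Sum>b\<in>C. P x a b * act1 g (unit_pt a) c * act1 g (unit_pt b) d)"
    unfolding bivector_bracket_def by (intro sum.cong refl) (simp add: act_coord_deriv g c d)
  also have "\<dots> = biv (RX x) (RA (\<lambda>a. act1 g (unit_pt a) c)) (RA (\<lambda>a. act1 g (unit_pt a) d))"
    by (rule biv_bilinear)
  also have "\<dots> = biv (RX x) (\<lambda>a. ?H * dX c a * ?G) (\<lambda>a. ?H * dX d a * ?G)"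
    by (rule biv_cong) (simp_all add: act_linear g c d)
  also have "\<dots> = biv (\<lambda>a. ?G * RX x a * ?H) (dX c) (dX d)"
    by (rule biv_conj[symmetric]) (simp_all add: emb1_ginv_left emb1_ginv_right g)
  also have "\<dots> = P (act1 g x) c d" unfolding biv_coords by (rule biv_cong) (simp_all add: RX_act g)
  finally show "P (act1 g x) c d = bivector_bracket C P (\<lambda>y. act1 g y c) (\<lambda>y. act1 g y d) x" by simp
qed

lemma quasi_poisson_P: "quasi_poisson M P" unfolding quasi_poisson_def
  by (simp add: bivector_field_P invariant_P schouten_P cartan_cubic)

end

section \<open>Equivariance and the moment map\<close>

lemma pprod_conj:
  assumes "H * G = 1" "G * H = 1" "\<And>i. i < m ==> f' i = G * f i * H"
  shows "pprod f' m = G * pprod f m * H" and "pprod_inv f' m = G * pprod_inv f m * H"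
proof -
  have HG: "H * (G * z) = z" for z using assms(1) by (simp add: mult.assoc[symmetric])
  show "pprod f' m = G * pprod f m * H" "pprod_inv f' m = G * pprod_inv f m * H"
    using assms(3) by (induction m) (simp_all add: assms(2) HG mult.assoc)
qed

lemma dpprod_conj:
  assumes "H * G = 1" "G * H = 1" "\<And>i. i < m ==> f' i = G * f i * H" "\<And>i. i < m ==> d' i = G * d i * H"
  shows "dpprod f' d' m = G * dpprod f d m * H" using assms(3,4)
proof (induction m)
  case (Suc m)
  have p: "pprod f' m = G * pprod f m * H" by (rule pprod_conj(1)[OF assms(1,2)]) (use Suc.prems in auto)
  have HG: "H * (G * z) = z" for z using assms(1) by (simp add: mult.assoc[symmetric])
  show ?case using Suc by (simp add: p mult.assoc HG distrib_left distrib_right)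
qed simp

context arrow_point
begin

text \<open>All constructions at a point are ring expressions in the matrices and their inverses, so
  conjugation passes through them and disappears under traces. Equivariance of the moment map and
  invariance of the form both follow.\<close>

lemma
  assumes pt: "arrow_point ord k X' U'" and HG: "H * G = 1" and GH: "G * H = 1"
    and X': "\<And>a. a \<in> set ord ==> X' a = G * X a * H"
    and V': "\<And>a. a \<in> set ord ==> V' a = G * V a * H"
    and W': "\<And>a. a \<in> set ord ==> W' a = G * W a * H"
  shows mom_conj: "arrow_point.mom ord X' U' = G * mom * H"
    and dmom_conj: "arrow_point.dmom ord X' U' V' = G * dmom V * H"
    and form_conj: "arrow_point.form ord k X' U' V' W' = form V W"
proof -
  interpret c: arrow_point ord k X' U' by (rule pt)
  have HGl: "H * (G * z) = z" for z using HG by (simp add: mult.assoc[symmetric])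
  have XX: "1 + X' a * X' (star a) = G * (1 + X a * X (star a)) * H" if "a \<in> set ord" for a
    using that star_ord by (simp add: X' distrib_left distrib_right mult.assoc HGl GH)
  \<comment> \<open>\<open>U'\<close> is known only as an inverse at the conjugated point;
    uniqueness of inverses identifies it.\<close>
  have U': "U' a = G * U a * H" if "a \<in> set ord" for a
  proof -
    have "U' a = U' a * (G * ((1 + X a * X (star a)) * U a) * H)" using that by (simp add: U_right GH)
    also have "\<dots> = (U' a * (1 + X' a * X' (star a))) * (G * U a * H)"
      unfolding XX[OF that] by (simp add: mult.assoc HGl)
    finally show ?thesis by (simp only: c.U_left[OF that] mult_1_left)
  qed
  have tr: "tr (G * u * H) = tr u" for u using tr_comm[of G "u * H"] by (simp add: mult.assoc HG)
  have fac: "c.factor a = G * factor a * H" "c.ifactor a = G * ifactor a * H" if "a \<in> set ord" for a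
    using that by (simp_all add: c.factor_def factor_def c.ifactor_def ifactor_def XX U')
  have dp: "c.dplus Y' a = G * dplus Y a * H" if "a \<in> set ord" "\<And>a. a \<in> set ord ==> Y' a = G * Y a * H" for a Y' Y
    using that star_ord by (simp add: c.dplus_def dplus_def X' distrib_left distrib_right mult.assoc HGl)
  have df: "c.dfactor Y' a = G * dfactor Y a * H" if "a \<in> set ord" "\<And>a. a \<in> set ord ==> Y' a = G * Y a * H" for a Y' Y
    using that(1) by (simp add: c.dfactor_def dfactor_def dp[OF that] U' mult.assoc HGl)
  note V = df[OF _ V'] and W = df[OF _ W']
  have thL: "c.thL V' a = G * thL V a * H" "c.thL W' a = G * thL W a * H" if "a \<in> set ord" for a
    using that by (simp_all add: fac V W mult.assoc HGl)
  have thR: "c.thR V' a = G * thR V a * H" "c.thR W' a = G * thR W a * H" if "a \<in> set ord" for a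
    using that by (simp_all add: fac V W mult.assoc HGl)
  show "c.mom = G * mom * H" "c.dmom V' = G * dmom V * H" unfolding c.mom_def mom_def c.dmom_def dmom_def
    by (intro pprod_conj(1) dpprod_conj HG GH; simp add: fac V)+
  have dV: "dpprod c.gseq (c.dseq V') i = G * dpprod gseq (dseq V) i * H"
    and dW: "dpprod c.gseq (c.dseq W') i = G * dpprod gseq (dseq W) i * H"
    and ip: "pprod_inv c.hseq i = G * pprod_inv hseq i * H" if "i < length ord" for i
    using that by (intro dpprod_conj pprod_conj(2) HG GH; simp add: fac V W)+
  have 0: "c.form0 V' W' = form0 V W" unfolding c.form0_def form0_def
  proof (intro arg_cong[where f = "\<lambda>z. - 1/2 * z"] sum.cong refl)
    fix a assume "a \<in> set ord"
    thus "eps a * (tr (U' a * V' a * W' (star a)) - tr (U' a * W' a * V' (star a)))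
       = eps a * (tr (U a * V a * W (star a)) - tr (U a * W a * V (star a)))"
      using tr[of "U a * (V a * W (star a))"] tr[of "U a * (W a * V (star a))"] star_ord
      by (simp add: U' V' W' mult.assoc HGl)
  qed
  have 1: "c.form1 V' W' = form1 V W" unfolding c.form1_def form1_def
  proof (intro sum.cong refl)
    fix i assume "i \<in> {..<length ord}"
    hence i: "i < length ord" by simp
    let ?t = "\<lambda>Y Z. pprod_inv hseq i * dpprod gseq (dseq Y) i * thR Z (ord ! i)"
    have "pprod_inv c.hseq i * dpprod c.gseq (c.dseq V') i * c.thR W' (ord ! i) = G * ?t V W * H"
      "pprod_inv c.hseq i * dpprod c.gseq (c.dseq W') i * c.thR V' (ord ! i) = G * ?t W V * H"
      unfolding dV[OF i] dW[OF i] ip[OF i] thR[OF nth_mem[OF i]] by (simp_all add: mult.assoc HGl)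
    thus "tr (pprod_inv c.hseq i * dpprod c.gseq (c.dseq V') i * c.thR W' (ord ! i))
        - tr (pprod_inv c.hseq i * dpprod c.gseq (c.dseq W') i * c.thR V' (ord ! i)) = tr (?t V W) - tr (?t W V)"
      by (simp only: tr)
  qed
  have 2: "c.form2 V' W' = form2 V W" unfolding c.form2_def form2_def by (intro sum.cong refl) (simp only: thL tr)
  show "c.form V' W' = form V W" by (simp only: c.form_def form_def 0 1 2)
qed

lemma dmom_scale:
  assumes "\<And>a. a \<in> set ord ==> V a = scl c * W a"
  shows "dmom V = scl c * dmom W"
proof -
  have sc: "z * (scl c * y) = scl c * (z * y)" for z y by (metis mult.assoc scl_commute)
  have d: "dfactor V a = scl c * dfactor W a" if "a \<in> set ord" for a
    using that by (simp add: dfactor_def dplus_def assms star_ord sc distrib_left distrib_right right_diff_distrib mult.assoc)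
  have "dpprod gseq (dseq V) i = scl c * dpprod gseq (dseq W) i" if "i \<le> length ord" for i
    using that by (induction i) (simp_all add: d sc distrib_left mult.assoc)
  thus ?thesis by (simp add: dmom_def)
qed

end

context gl_group
begin

lemma gmul_coord: "(s, i, j) \<in> Gn ==> gmuln g h (s, i, j) = (\<Sum>k<n s. g (s, i, k) * h (s, k, j))"
  by (auto simp: gmul_def of_blocks_def gl_entries_iff block_def scalar_prod_def atLeast0LessThan intro!: sum.cong)

lemma gmul_gone: "g \<in> gln ==> gmuln g gonen = g" "g \<in> gln ==> gmuln gonen g = g"
  by (rule emb1_inj; simp add: gmul_gl emb1_gmul emb1_gone)+

lemma
  assumes F: "regular_on Gn GLn F" and g: "g \<in> GLn"
  shows left_vf_dirD: "left_vf S n z F g = G.dirD (gmuln g z) F g"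
    and right_vf_dirD: "right_vf S n z F g = G.dirD (gmuln z g) F g"
proof -
  have d: "DERIV (\<lambda>t. gexpn (\<lambda>b. t * z b) (s, i, k)) 0 :> z (s, i, k)"
    if "s \<in> S" "i < n s" "k < n s" for s i k by (rule gexp_deriv) (use that in "simp add: gl_entries_iff")
  have "DERIV (\<lambda>t. F (gmuln g (gexpn (\<lambda>b. t * z b)))) 0 :> (\<Sum>b\<in>Gn. pderiv_at b F (gmuln g (gexpn (\<lambda>b. 0 * z b))) * gmuln g z b)"
  proof (rule G.regular_curve[OF F])
    fix b assume b: "b \<in> Gn"
    obtain s i j where e: "b = (s, i, j)" by (cases b)
    show "DERIV (\<lambda>t. gmuln g (gexpn (\<lambda>b. t * z b)) b) 0 :> gmuln g z b"
      unfolding e gmul_coord[OF b[unfolded e]]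
      by (intro DERIV_sum DERIV_cmult d) (use b in "auto simp: e gl_entries_iff")
  qed (use g in "simp_all only: gexp_zero gmul_gone[OF GL_gl] gmul_gl[unfolded gl_alg_def]")
  thus "left_vf S n z F g = G.dirD (gmuln g z) F g" unfolding left_vf_def gexp_zero gmul_gone[OF GL_gl[OF g]]
    by (simp only: DERIV_imp_deriv G.dirD_def mult.commute)
  have "DERIV (\<lambda>t. F (gmuln (gexpn (\<lambda>b. t * z b)) g)) 0 :> (\<Sum>b\<in>Gn. pderiv_at b F (gmuln (gexpn (\<lambda>b. 0 * z b)) g) * gmuln z g b)"
  proof (rule G.regular_curve[OF F])
    fix b assume b: "b \<in> Gn"
    obtain s i j where e: "b = (s, i, j)" by (cases b)
    show "DERIV (\<lambda>t. gmuln (gexpn (\<lambda>b. t * z b)) g b) 0 :> gmuln z g b"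
      unfolding e gmul_coord[OF b[unfolded e]]
      by (intro DERIV_sum DERIV_cmult_right d) (use b in "auto simp: e gl_entries_iff")
  qed (use g in "simp_all only: gexp_zero gmul_gone[OF GL_gl] gmul_gl[unfolded gl_alg_def]")
  thus "right_vf S n z F g = G.dirD (gmuln z g) F g" unfolding right_vf_def gexp_zero gmul_gone[OF GL_gl[OF g]]
    by (simp only: DERIV_imp_deriv G.dirD_def mult.commute)
qed

text \<open>By the dual bases, \<open>averaged_diff\<close> is a gradient for the trace form. The
  direction g z + z g is, up to the factor 1/2, the one in which the moment map moves according to
  \<open>tangent_P\<close>.\<close>

lemma tr_averaged_diff:
  assumes F: "regular_on Gn GLn F" and g: "g \<in> GLn" and z: "z \<in> gln"
  shows "tr (emb (averaged_diff S n F g) * emb z) = 1/2 * G.dirD (\<lambda>b. gmuln g z b + gmuln z g b) F g"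
proof -
  let ?G = "Gn"
  let ?c = "\<lambda>a. left_vf S n (basis_elt a) F g + right_vf S n (basis_elt a) F g"
  have ez: "emb z = (\<Sum>a\<in>?G. scl (z a) * emb (basis_elt a))"
    unfolding emb_scale[symmetric] emb_sum[symmetric] by (subst gl_expand[OF z]) rule
  have lin: "(\<Sum>a\<in>?G. z a * (gmuln g (basis_elt a) b + gmuln (basis_elt a) g b)) = gmuln g z b + gmuln z g b"
    if b: "b \<in> ?G" for b
  proof -
    have c: "h b = tr (emb (dual_elt b) * emb h)" for h using tr_dual_emb[OF b] by simp
    have "tr (Y * (emb z * Z)) = (\<Sum>a\<in>?G. z a * tr (Y * (emb (basis_elt a) * Z)))" for Y Z
    proof -
      have "Y * (scl k * B * Z) = scl k * (Y * (B * Z))" for k B by (metis mult.assoc scl_commute)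
      thus ?thesis unfolding ez by (simp add: sum_distrib_left sum_distrib_right tr_sum tr_scl_mult)
    qed
    from this[of "emb (dual_elt b)" "emb g"] this[of "emb (dual_elt b) * emb g" 1] show ?thesis
      unfolding c[of "gmuln _ _"] emb_gmul by (simp add: distrib_left sum.distrib mult.assoc)
  qed
  have "tr (emb (averaged_diff S n F g) * emb z) = 1/2 * tr (emb z * emb (\<lambda>b. \<Sum>a\<in>?G. ?c a * dual_elt a b))"
    unfolding averaged_diff_def emb_scale by (simp add: mult.assoc tr_scl_mult tr_comm)
  also have "\<dots> = 1/2 * (\<Sum>a\<in>?G. ?c a * z a)"
    unfolding tr_basis_dual[symmetric] by (simp add: tr_dual_emb)
  also have "(\<Sum>a\<in>?G. ?c a * z a) = (\<Sum>a\<in>?G. \<Sum>b\<in>?G. (z a * (gmuln g (basis_elt a) b + gmuln (basis_elt a) g b)) * pderiv_at b F g)"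
    unfolding left_vf_dirD[OF F g] right_vf_dirD[OF F g] G.dirD_def unfolding sum.distrib[symmetric] sum_distrib_right
    by (intro sum.cong refl) (simp only: distrib_right distrib_left mult_ac)
  also have "\<dots> = (\<Sum>b\<in>?G. (\<Sum>a\<in>?G. z a * (gmuln g (basis_elt a) b + gmuln (basis_elt a) g b)) * pderiv_at b F g)"
    unfolding sum_distrib_right by (rule sum.swap)
  also have "\<dots> = G.dirD (\<lambda>b. gmuln g z b + gmuln z g b) F g"
    unfolding G.dirD_def by (rule sum.cong) (simp_all add: lin)
  finally show ?thesis .
qed

end

context rep_pencil
begin

lemma moment_gl: "\<Phi> x \<in> gln" by (cases ord) (simp_all add: vdb_moment_def gone_def of_blocks_gl gmul_gl)

lemma mreg_moment: "M.mreg (\<lambda>y. emb1 (\<Phi> y))"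
proof -
  have "\<forall>y\<in>points M. emb1 (\<Phi> y) = pprod (\<lambda>i. fac y (ord ! i)) (length ord)"
    using emb1_moment_take[OF _ order_refl] by auto
  from mD_emb1_cong(1)[OF this mreg_pprod[OF order_refl]] show ?thesis .
qed

lemma regular_moment:
  assumes b: "b \<in> Gn"
  shows "regular_on C (points M) (\<lambda>y. \<Phi> y b)"
proof -
  obtain s i j where e: "b = (s, i, j)" by (cases b)
  have "M.mreg (\<lambda>y. emb (\<Phi> y))"
    using M.mreg_diff[OF mreg_moment M.mreg_const[of "1 - pr"]] by (simp add: emb1_def)
  from M.mreg_ent[OF this, of "(s, i)" "(s, j)"] show ?thesis using b by (simp add: e emb_coord)
qed

lemma equivariant_moment: "equivariant_morphism M \<Phi>" unfolding equivariant_morphism_def M_simps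
proof (intro conjI ballI)
  show "\<Phi> ` points M \<subseteq> GLn" by (auto simp: moment_GL)
  show "regular_on C (points M) (\<lambda>x. \<Phi> x b)" if "b \<in> Gn" for b by (rule regular_moment[OF that])
  fix g x assume g: "g \<in> GLn" and x: "x \<in> points M"
  interpret arrow_point ord kk "RX x" "UX x" by (rule arrow_point_at[OF x])
  have gx: "act1 g x \<in> points M" by (rule act_points[OF g x])
  have "emb1 (\<Phi> (act1 g x)) = emb1 g * mom * emb1 (ginvn g)" unfolding emb1_moment[OF gx]
    by (rule mom_conj[OF arrow_point_at[OF gx], where V = "RX x" and W = "RX x"])
      (auto simp: emb1_ginv_left emb1_ginv_right g RX_act set_ord)
  thus "\<Phi> (act1 g x) = gmuln (gmuln g (\<Phi> x)) (ginvn g)"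
    by (intro emb1_inj gmul_gl moment_gl) (simp add: emb1_gmul emb1_moment[OF x])
qed

text \<open>The moment map condition for the coordinate functions of the group. The coordinate
  covector sits in the second slot of the bivector here; this changes the sign and cancels the minus
  in \<open>dmom_sharp\<close>.\<close>

lemma tangent_P:
  assumes x: "x \<in> points M" and b: "b \<in> Gn"
  shows "tangent_map C \<Phi> x (\<lambda>c. P x c d) b
    = 1/2 * (gmuln (\<Phi> x) (muz x d) b + gmuln (muz x d) (\<Phi> x) b)"
proof -
  interpret arrow_point ord kk "RX x" "UX x" by (rule arrow_point_at[OF x])
  have V: "RX (\<lambda>c. P x c d) a = scl (- 1/2) * sharp (RX x) (dX d) a" if "a \<in> R" for a
  proof -
    have "RX (\<lambda>c. P x c d) a = scl (- 1) * RX (\<lambda>c. P x d c) a"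
      unfolding RX_scale[symmetric] by (rule RX_cong[OF _ that]) (simp add: P_antisym[of x _ d])
    thus ?thesis by (simp add: RX_sharp[OF that] mult.assoc[symmetric] scl_mult[symmetric])
  qed
  have "emb (tangent_map C \<Phi> x (\<lambda>c. P x c d)) = scl (- 1/2) * dmom (sharp (RX x) (dX d))"
    unfolding emb_tangent_moment[OF x] by (rule dmom_scale) (simp add: V set_ord)
  also have "\<dots> = scl (1/2) * (emb1 (\<Phi> x) * emb (muz x d) + emb (muz x d) * emb1 (\<Phi> x))"
    by (simp add: dmom_sharp emb1_moment[OF x] emb_muz set_ord scl_uminus algebra_simps)
  also have "\<dots> = emb (\<lambda>b. 1/2 * (gmuln (\<Phi> x) (muz x d) b + gmuln (muz x d) (\<Phi> x) b))"
    by (simp only: emb_scale emb_add emb_gmul emb1_emb emb_emb1)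
  finally show ?thesis using b unfolding emb_eq_iff by blast
qed

lemma chain_moment:
  assumes F: "regular_on Gn GLn F" and x: "x \<in> points M" and c: "c \<in> C"
  shows "pderiv_at c (\<lambda>y. F (\<Phi> y)) x = (\<Sum>b\<in>Gn. pderiv_at b F (\<Phi> x) * pderiv_at c (\<lambda>y. \<Phi> y b) x)"
proof -
  have "DERIV (\<lambda>t. F (\<Phi> (x(c := t)))) (x c) :> (\<Sum>b\<in>Gn. pderiv_at b F (\<Phi> (x(c := x c))) * pderiv_at c (\<lambda>y. \<Phi> y b) x)"
  proof (rule G.regular_curve[OF F])
    show "DERIV (\<lambda>t. \<Phi> (x(c := t)) b) (x c) :> pderiv_at c (\<lambda>y. \<Phi> y b) x"
      if "b \<in> Gn" for b by (rule M.regular_line[OF regular_moment[OF that] x c])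
  qed (use x moment_GL moment_gl in "auto simp: gl_alg_def")
  thus ?thesis unfolding pderiv_at_def[of c "\<lambda>y. F (\<Phi> y)"] by (simp add: DERIV_imp_deriv)
qed

lemma moment_map_P: "moment_map M P \<Phi>" unfolding moment_map_def M_simps
proof (intro conjI allI impI ballI equivariant_moment)
  let ?G = "Gn"
  fix F x d assume F: "regular_on ?G GLn F" and x: "x \<in> points M" and d: "d \<in> C"
  have "insert_first C P x (\<lambda>c. pderiv_at c (\<lambda>y. F (\<Phi> y)) x) d
      = (\<Sum>c\<in>C. \<Sum>b\<in>?G. pderiv_at b F (\<Phi> x) * (pderiv_at c (\<lambda>y. \<Phi> y b) x * P x c d))"
    unfolding insert_first_def by (rule sum.cong) (simp_all add: chain_moment[OF F x] sum_distrib_left mult_ac)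
  also have "\<dots> = (\<Sum>b\<in>?G. pderiv_at b F (\<Phi> x) * tangent_map C \<Phi> x (\<lambda>c. P x c d) b)"
    unfolding tangent_map_def sum_distrib_left by (rule sum.swap)
  also have "\<dots> = 1/2 * G.dirD (\<lambda>b. gmuln (\<Phi> x) (muz x d) b + gmuln (muz x d) (\<Phi> x) b) F (\<Phi> x)"
    unfolding G.dirD_def sum_distrib_left by (rule sum.cong) (simp_all add: tangent_P[OF x])
  also have "\<dots> = infinitesimal M (averaged_diff (verts Q) n F (\<Phi> x)) x d"
    using tr_averaged_diff[OF F moment_GL[OF x] muz_gl[of x d]] by (simp add: infinitesimal_mux[OF d] emb_muz)
  finally show "insert_first C P x (\<lambda>c. pderiv_at c (\<lambda>y. F (\<Phi> y)) x) d
    = infinitesimal M (averaged_diff (verts Q) n F (\<Phi> x)) x d" .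
qed

end

section \<open>The quasi-Hamiltonian 2-form\<close>

context arrow_point
begin

lemma form_linear: "form (\<lambda>a. scl c * u a + u' a) v = c * form u v + form u' v"
proof -
  have sc: "z * (scl c * y) = scl c * (z * y)" for z y by (metis mult.assoc scl_commute)
  let ?u = "\<lambda>a. scl c * u a + u' a"
  have d: "dfactor ?u a = scl c * dfactor u a + dfactor u' a" for a
    by (simp add: dfactor_def dplus_def sc distrib_left distrib_right right_diff_distrib left_diff_distrib mult.assoc)
  have dd: "dpprod gseq (dseq ?u) i = scl c * dpprod gseq (dseq u) i + dpprod gseq (dseq u') i" for i
    by (induction i) (simp_all add: d sc distrib_left distrib_right mult.assoc)
  have 0: "form0 ?u v = c * form0 u v + form0 u' v"
  proof -
    have "eps a * (tr (U a * ?u a * v (star a)) - tr (U a * v a * ?u (star a)))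
      = c * (eps a * (tr (U a * u a * v (star a)) - tr (U a * v a * u (star a))))
       + eps a * (tr (U a * u' a * v (star a)) - tr (U a * v a * u' (star a)))" for a
      by (simp only: distrib_left distrib_right mult.assoc sc tr_add tr_scl_mult) (simp add: algebra_simps)
    thus ?thesis unfolding form0_def by (simp only: sum.distrib sum_distrib_left[symmetric] distrib_left) simp
  qed
  have 1: "form1 ?u v = c * form1 u v + form1 u' v" unfolding form1_def dd unfolding d
    by (simp only: distrib_left distrib_right mult.assoc sc tr_add tr_scl_mult sum_distrib_left sum.distrib[symmetric])
      (simp add: algebra_simps)
  have 2: "form2 ?u v = c * form2 u v + form2 u' v" unfolding form2_def d
    by (simp only: distrib_left distrib_right mult.assoc sc tr_add tr_scl_mult sum_distrib_left sum.distrib[symmetric])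
      (simp add: algebra_simps)
  show ?thesis unfolding form_def 0 1 2 by (simp add: algebra_simps)
qed

lemma form_antisym: "form u v = - form v u"
proof -
  have 0: "form0 u v = - form0 v u" unfolding form0_def by (simp add: sum_negf[symmetric] algebra_simps)
  have 1: "form1 u v = - form1 v u" unfolding form1_def by (simp add: sum_negf[symmetric])
  have "form2 u v = (\<Sum>q\<in>set ord. \<Sum>p\<in>set ord. k p q * (tr (thL u p) * tr (thL v q)))"
    unfolding form2_def by (rule sum.swap)
  also have "\<dots> = - form2 v u" unfolding form2_def sum_negf[symmetric]
    by (intro sum.cong refl) (subst k_antisym, simp)
  finally have 2: "form2 u v = - form2 v u" .
  show ?thesis unfolding form_def 0 1 2 by simp
qed

text \<open>\<open>form_conj\<close> with G = H = 1 says that the form sees only the values on the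
  arrows of \<open>ord\<close>.\<close>

lemma form_cong:
  "(\<And>a. a \<in> set ord ==> u' a = u a) ==> (\<And>a. a \<in> set ord ==> v' a = v a) ==> form u' v' = form u v"
  by (rule form_conj[where G = 1 and H = 1 and X' = X and U' = U]) (simp_all add: arrow_point_axioms)

lemma form_zero: "form (\<lambda>_. 0) v = 0" using form_linear[of 1 "\<lambda>_. 0" "\<lambda>_. 0" v] by simp

lemma form_sum: "form (\<lambda>a. \<Sum>i\<in>I. scl (c i) * u i a) v = (\<Sum>i\<in>I. c i * form (u i) v)"
  by (induction I rule: infinite_finite_induct) (simp_all add: form_zero form_linear)

lemma form_scale: "form (\<lambda>a. scl c * u a) v = c * form u v"
  using form_linear[of c u "\<lambda>_. 0" v] by (simp add: form_zero)

end

lemma affine_zero: "V \<in> affine_space C ==> c \<notin> C ==> V c = 0" unfolding affine_space_def by blast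

context rep_pencil
begin

lemma RX_expand:
  assumes a: "a \<in> R"
  shows "RX V a = (\<Sum>c\<in>C. scl (V c) * eX c a)"
proof -
  have "RX V a = RX (\<lambda>d. \<Sum>c\<in>C. V c * unit_pt c d) a"
  proof (rule RX_cong[OF _ a])
    show "V d = (\<Sum>c\<in>C. V c * unit_pt c d)" if "d \<in> C" for d
    proof -
      have "(\<Sum>c\<in>C. V c * unit_pt c d) = (\<Sum>c\<in>C. V c * unit_pt d c)"
        by (rule sum.cong) (auto simp: unit_pt_def)
      thus ?thesis using sum_unit[OF that, of V] by (simp add: mult.commute)
    qed
  qed
  also have "RX (\<lambda>d. \<Sum>c\<in>I. V c * unit_pt c d) a = (\<Sum>c\<in>I. scl (V c) * eX c a)" for I
  proof (induction I rule: infinite_finite_induct)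
    case (insert c I)
    thus ?case by (simp add: RX_add RX_scale)
  qed (use RX_scale[of 0] in simp_all)
  finally show ?thesis .
qed

context
  fixes x assumes x: "x \<in> points M"
begin

interpretation arrow_point ord kk "RX x" "UX x" by (rule arrow_point_at[OF x])

lemma form_left: "(\<Sum>c\<in>C. V c * form (eX c) v) = form (RX V) v"
proof -
  have "form (RX V) v = form (\<lambda>a. \<Sum>c\<in>C. scl (V c) * eX c a) v"
    by (rule form_cong) (simp_all only: set_ord RX_expand[of _ V])
  thus ?thesis by (simp add: form_sum)
qed

lemma form_right: "(\<Sum>c\<in>C. V c * form u (eX c)) = form u (RX V)"
  using form_left[of V u] form_antisym[of u] by (simp add: sum_negf)

lemma insert_form: "d \<in> C ==> insert_first C \<omega> x V d = form (RX V) (eX d)" unfolding insert_first_def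
  by (subst form_left[of V, symmetric], rule sum.cong) (simp_all add: form_coords[OF x])

lemma insert_form_outside: "d \<notin> C ==> insert_first C \<omega> x V d = 0"
  by (simp add: insert_first_def pencil_form_def)

lemma form_infinitesimal:
  assumes c: "c \<in> C"
  shows "insert_first C \<omega> x (infinitesimal M z x) c = 1/2 * trace_form (verts Q) n z
     (\<lambda>b. pthetaL \<Phi> x (unit_pt c) b + pthetaR \<Phi> x (unit_pt c) b)"
proof -
  let ?v = "eX c"
  have "insert_first C \<omega> x (infinitesimal M z x) c = form (\<lambda>a. scl (- 1) * vact (\<lambda>_. emb z) (RX x) a) ?v"
    unfolding insert_form[OF c] by (rule form_cong) (simp_all add: RX_infinitesimal set_ord scl_uminus)
  also have "2 * \<dots> = tr (emb z * (imom * dmom ?v + dmom ?v * imom))"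
    using form_vact[of "emb z" ?v] by (simp add: form_scale)
  finally show ?thesis by (simp add: trace_form_emb emb_add thetaL_moment[OF x] thetaR_moment[OF x] field_simps)
qed

text \<open>\<open>form_sharp\<close> in coordinates. As \<open>sharp\<close> doubles the
  contraction, dividing that identity by 4 isolates the vector and leaves the coefficient 1/4 on the
  moment term.\<close>

lemma form_P:
  assumes d: "d \<in> C"
  shows "insert_first C P x (insert_first C \<omega> x V) d
    = V d - 1/4 * tr (mux x d * (imom * dmom (RX V) - dmom (RX V) * imom))"
proof -
  let ?s = "sharp (RX x) (dX d)"
  have "insert_first C P x (insert_first C \<omega> x V) d = (\<Sum>c\<in>C. P x c d * form (RX V) (eX c))"
    unfolding insert_first_def[of C P] by (simp add: insert_form)
  also have "\<dots> = (\<Sum>c\<in>C. P x d c * form (eX c) (RX V))"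
    by (rule sum.cong) (simp_all add: P_antisym[of x _ d] form_antisym[of "RX V"])
  also have "\<dots> = form (RX (\<lambda>c. P x d c)) (RX V)" by (rule form_left)
  also have "\<dots> = form (\<lambda>a. scl (1/2) * ?s a) (RX V)"
    by (rule form_cong) (simp_all add: RX_sharp set_ord)
  also have "\<dots> = 1/4 * (2 * form ?s (RX V))" by (simp add: form_scale)
  also have "\<dots> = V d - 1/4 * tr (mux x d * (imom * dmom (RX V) - dmom (RX V) * imom))"
    unfolding form_sharp using coord_pairing[OF d, of V] by (simp add: set_ord algebra_simps)
  finally show ?thesis .
qed

lemma theta_contract:
  assumes d: "d \<in> C"
  shows "(\<Sum>a\<in>Gn. infinitesimal M (basis_elt a) x d * trace_form (verts Q) n (dual_elt a) Z)
    = tr (mux x d * emb Z)" using dual_contract[of "muz x d" "emb Z"]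
  by (simp add: infinitesimal_mux[OF d] trace_form_emb emb_muz)

lemma correspondence:
  assumes d: "d \<in> C"
  shows "insert_first C P x (insert_first C \<omega> x V) d = V d - 1/4 * (\<Sum>a\<in>Gn.
    infinitesimal M (basis_elt a) x d * trace_form (verts Q) n (dual_elt a)
      (\<lambda>b. pthetaL \<Phi> x V b - pthetaR \<Phi> x V b))"
  unfolding form_P[OF d] theta_contract[OF d] emb_diff thetaL_moment[OF x] thetaR_moment[OF x] ..

text \<open>The left logarithmic differential determines \<open>dmom\<close>, since the moment map
  is invertible; by \<open>form_P\<close> the vector is then determined by its contraction with the
  form.\<close>

lemma form_injective: "inj_on (\<lambda>V. (insert_first C \<omega> x V, pthetaL \<Phi> x V)) (affine_space C)"
proof (rule inj_onI)
  fix V W assume V: "V \<in> affine_space C" and W: "W \<in> affine_space C"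
    and e: "(insert_first C \<omega> x V, pthetaL \<Phi> x V) = (insert_first C \<omega> x W, pthetaL \<Phi> x W)"
  have "imom * dmom (RX V) = imom * dmom (RX W)" using e unfolding thetaL_moment[OF x, symmetric] by simp
  hence "mom * imom * dmom (RX V) = mom * imom * dmom (RX W)" by (simp only: mult.assoc)
  hence dm: "dmom (RX V) = dmom (RX W)" by (simp add: mom_imom)
  have "V d = W d" if "d \<in> C" for d using form_P[OF that, of V] form_P[OF that, of W] e by (simp add: dm)
  moreover have "V d = W d" if "d \<notin> C" for d using V W that by (simp add: affine_zero)
  ultimately show "V = W" by blast
qed

text \<open>\<open>form_P\<close> read as a decomposition: the covector is the contraction of
  \<open>V\<close> with the form, and the Lie algebra element is 1/4 of the difference of the left
  and right logarithmic differentials on \<open>V\<close>.\<close>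

lemma bivector_surjective:
  assumes V: "V \<in> affine_space C"
  shows "\<exists>\<alpha>\<in>affine_space C. \<exists>z\<in>gln. V = (\<lambda>c. insert_first C P x \<alpha> c + infinitesimal M z x c)"
proof (intro bexI ext)
  let ?Z = "\<lambda>b. 1/4 * (pthetaL \<Phi> x V b - pthetaR \<Phi> x V b)"
  show "insert_first C \<omega> x V \<in> affine_space C" by (simp add: affine_space_def insert_form_outside)
  show "?Z \<in> gln"
    using gl_alg_zero[OF gmul_gl] by (simp add: gl_alg_def affine_space_def pull_thetaL_def pull_thetaR_def)
  fix d
  show "V d = insert_first C P x (insert_first C \<omega> x V) d + infinitesimal M ?Z x d"
  proof (cases "d \<in> C")
    case True
    let ?K = "imom * dmom (RX V) - dmom (RX V) * imom"
    have "emb ?Z = scl (1/4) * ?K" by (simp only: emb_scale emb_diff thetaL_moment[OF x] thetaR_moment[OF x])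
    hence "infinitesimal M ?Z x d = 1/4 * tr (?K * mux x d)"
      by (simp only: infinitesimal_mux[OF True] mult.assoc tr_scl_mult)
    thus ?thesis by (simp only: form_P[OF True] tr_comm[of ?K] diff_add_cancel)
  next
    case False
    hence "insert_first C P x (insert_first C \<omega> x V) d = 0"
      using P_outside[OF False, of x] P_antisym[of x _ d] by (simp add: insert_first_def)
    thus ?thesis using affine_zero[OF V False] affine_zero[OF infinitesimal_affine False] by simp
  qed
qed

end

lemma nondegenerate_P: "nondegenerate M P" unfolding nondegenerate_def M_simps
proof (intro ballI equalityI subsetI)
  fix x V assume x: "x \<in> points M" and V: "V \<in> affine_space C"
  then obtain \<alpha> z where "\<alpha> \<in> affine_space C" "z \<in> gln"
    "V = (\<lambda>c. insert_first C P x \<alpha> c + infinitesimal M z x c)" using bivector_surjective by blast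
  thus "V \<in> (\<lambda>(\<alpha>, z) c. insert_first C P x \<alpha> c + infinitesimal M z x c) ` (affine_space C \<times> gln)"
    by (intro image_eqI[of _ _ "(\<alpha>, z)"]) auto
next
  fix x V assume "x \<in> points M"
    and "V \<in> (\<lambda>(\<alpha>, z) c. insert_first C P x \<alpha> c + infinitesimal M z x c) ` (affine_space C \<times> gln)"
  then obtain \<alpha> z where V: "V = (\<lambda>c. insert_first C P x \<alpha> c + infinitesimal M z x c)" by auto
  have "insert_first C P x \<alpha> c = 0" if "c \<notin> C" for c
    using P_outside[OF that, of x] P_antisym[of x _ c] by (simp add: insert_first_def)
  thus "V \<in> affine_space C" using affine_zero[OF infinitesimal_affine] unfolding V affine_space_def by simp
qed

lemma corresponding_P: "corresponding M P \<omega> \<Phi>"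
  unfolding corresponding_def M_simps using correspondence by blast

lemma invariant_form_P: "invariant_form M \<omega>" unfolding invariant_form_def M_simps
proof (intro ballI)
  fix g x c d assume g: "g \<in> GLn" and x: "x \<in> points M" and c: "c \<in> C" and d: "d \<in> C"
  let ?gx = "act1 g x"
  have gx: "?gx \<in> points M" by (rule act_points[OF g x])
  interpret arrow_point ord kk "RX x" "UX x" by (rule arrow_point_at[OF x])
  interpret g: arrow_point ord kk "RX ?gx" "UX ?gx" by (rule arrow_point_at[OF gx])
  have "(\<Sum>a\<in>C. \<Sum>b\<in>C. \<omega> ?gx a b * pderiv_at c (\<lambda>y. act1 g y a) x * pderiv_at d (\<lambda>y. act1 g y b) x)
    = (\<Sum>a\<in>C. act1 g (unit_pt c) a * (\<Sum>b\<in>C. act1 g (unit_pt d) b * g.form (eX a) (eX b)))"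
    unfolding sum_distrib_left by (intro sum.cong refl) (simp add: act_coord_deriv g c d form_coords[OF gx])
  also have "\<dots> = g.form (RX (act1 g (unit_pt c))) (RX (act1 g (unit_pt d)))"
    unfolding form_right[OF gx] form_left[OF gx] ..
  also have "\<dots> = form (eX c) (eX d)"
    by (rule form_conj[OF arrow_point_at[OF gx], where G = "emb1 g" and H = "emb1 (ginvn g)"])
      (simp_all add: emb1_ginv_left emb1_ginv_right g RX_act set_ord)
  also have "\<dots> = \<omega> x c d" by (simp add: form_coords x c d)
  finally show "\<omega> x c d = (\<Sum>a\<in>C. \<Sum>b\<in>C. \<omega> ?gx a b * pderiv_at c (\<lambda>y. act1 g y a) x * pderiv_at d (\<lambda>y. act1 g y b) x)"
    by simp
qed

end

section \<open>The exterior derivative of the 2-form\<close>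

context affine_open
begin

lemma hasd_cong: "hasd V x g d ==> (\<And>y. y \<in> U ==> f y = g y) ==> hasd V x f d"
  unfolding hasd_def using regular_cong[of U f g] dirD_cong[of f g x V] by auto

lemma
  assumes "mreg g" "mreg h" "\<And>y. y \<in> U ==> g y * h y = 1" "\<And>y. y \<in> U ==> h y * g y = 1" "x \<in> U"
  shows mhasd_thetaL: "mhasd u x (\<lambda>y. h y * mD v g y) (h x * mD u (mD v g) x - (h x * mD u g x) * (h x * mD v g x))"
    and mhasd_thetaR: "mhasd u x (\<lambda>y. mD v g y * h y) (mD u (mD v g) x * h x - (mD v g x * h x) * (mD u g x * h x))"
proof -
  have g: "mhasd u x (mD v g) (mD u (mD v g) x)" and h: "mhasd u x h (- (h x * mD u g x * h x))"
    using assms mD_inverse[OF assms, of u] by (simp_all add: mhasd_def mreg_mD)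
  show "mhasd u x (\<lambda>y. h y * mD v g y) (h x * mD u (mD v g) x - (h x * mD u g x) * (h x * mD v g x))"
    using mhasd_mult[OF h g] by (simp add: mult.assoc)
  show "mhasd u x (\<lambda>y. mD v g y * h y) (mD u (mD v g) x * h x - (mD v g x * h x) * (mD u g x * h x))"
    using mhasd_mult[OF g h] by (simp add: mult.assoc add.commute)
qed

text \<open>Constant vector fields commute, so the second derivatives \<open>?p\<close> and
  \<open>?q\<close> are symmetric, and \<open>polyakov_wiegmann\<close> evaluates the cyclic sum.
  One function \<open>d\<close> serves all directions, so that several such terms can be added
  afterwards.\<close>

lemma theta_wedge_closed:
  fixes g h g' h' :: "'c point => 'i umat"
  assumes g: "mreg g" "mreg h" "\<And>y. y \<in> U ==> g y * h y = 1" "\<And>y. y \<in> U ==> h y * g y = 1"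
    and g': "mreg g'" "mreg h'" "\<And>y. y \<in> U ==> g' y * h' y = 1" "\<And>y. y \<in> U ==> h' y * g' y = 1" and x: "x \<in> U"
  defines "L \<equiv> \<lambda>v y. h y * mD v g y" and "R \<equiv> \<lambda>v y. mD v g' y * h' y"
  defines "\<tau> \<equiv> \<lambda>v w y. tr (L v y * R w y) - tr (L w y * R v y)"
  shows "\<exists>d. (\<forall>u v w. hasd u x (\<tau> v w) (d u v w)) \<and> (\<forall>u v w. d u v w + d v w u + d w u v =
    cubic (L u x) (L v x) (L w x) + cubic (R u x) (R v x) (R w x) - cubic (L u x + R u x) (L v x + R v x) (L w x + R w x))"
proof -
  let ?p = "\<lambda>u v. h x * mD u (mD v g) x" and ?q = "\<lambda>u v. mD u (mD v g') x * h' x"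
  let ?t = "\<lambda>u v w. tr ((?p u v - L u x * L v x) * R w x + L v x * (?q u w - R w x * R u x))"
  have s: "?p u v = ?p v u" "?q u v = ?q v u" for u v using mD_swap[OF g(1) x] mD_swap[OF g'(1) x] by metis+
  have L: "mhasd u x (L v) (?p u v - L u x * L v x)" for u v unfolding L_def by (rule mhasd_thetaL[OF g x])
  have R: "mhasd u x (R v) (?q u v - R v x * R u x)" for u v unfolding R_def by (rule mhasd_thetaR[OF g' x])
  have "hasd u x (\<tau> v w) (?t u v w - ?t u w v)" for u v w
    using hasd_diff[OF hasd_tr[OF mhasd_mult[OF L R]] hasd_tr[OF mhasd_mult[OF L R]], of u v w w v]
    unfolding \<tau>_def by (simp only: add.commute)
  moreover have "(?t u v w - ?t u w v) + (?t v w u - ?t v u w) + (?t w u v - ?t w v u) =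
    cubic (L u x) (L v x) (L w x) + cubic (R u x) (R v x) (R w x) - cubic (L u x + R u x) (L v x + R v x) (L w x + R w x)"
    for u v w
    using polyakov_wiegmann[where a = "L u x" and b = "L v x" and c = "L w x" and x = "R u x" and y = "R v x" and z = "R w x"
        and puv = "?p u v" and puw = "?p u w" and pvw = "?p v w" and quv = "?q u v" and quw = "?q u w" and qvw = "?q v w"]
    unfolding s[of v u] s[of w u] s[of w v] by (simp only: algebra_simps)
  ultimately show ?thesis by (intro exI[of _ "\<lambda>u v w. ?t u v w - ?t u w v"]) blast
qed

end

lemma cubic_conj:
  assumes HG: "H * G = 1"
  shows "cubic (G * x * H) (G * y * H) (G * z * H) = cubic x y z"
proof -
  have HGl: "H * (G * z) = z" for z using HG by (simp add: mult.assoc[symmetric])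
  have "G * x * H * (G * y * H * (G * z * H) - G * z * H * (G * y * H)) = G * (x * (y * z - z * y) * H)"
    by (simp add: algebra_simps HGl)
  thus ?thesis using tr_comm[of G "x * (y * z - z * y) * H"] by (simp add: cubic_def mult.assoc HG)
qed

lemma cubic_zero [simp]: "cubic 0 y z = 0" by (simp add: cubic_def)

context arrow_point
begin

lemma form0_closed:
  defines "E \<equiv> \<lambda>u v w. - 1/2 * (\<Sum>a\<in>set ord. eps a *
    (tr (- (U a * dplus u a * U a) * v a * w (star a)) - tr (- (U a * dplus u a * U a) * w a * v (star a))))"
  shows "E u v w + E v w u + E w u v = 1/2 * (\<Sum>a\<in>set ord. cubic (thR u a) (thR v a) (thR w a))"
proof -
  let ?e = "\<lambda>u v w a. tr (- (U a * dplus u a * U a) * v a * w (star a)) - tr (- (U a * dplus u a * U a) * w a * v (star a))"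
  have "2 * (E u v w + E v w u + E w u v) = (\<Sum>a\<in>set ord. - eps a * (?e u v w a + ?e v w u a + ?e w u v a))"
    unfolding E_def by (simp add: distrib_left sum.distrib sum_negf sum_subtractf)
  also have "\<dots> = (\<Sum>a\<in>set ord. cubic (thR u a) (thR v a) (thR w a))"
  proof (rule sum_pairs)
    fix a assume a: "a \<in> set ord" "eps a = 1"
    have a': "star a \<in> set ord" "eps (star a) = - 1" using a star_ord by auto
    note pair = form_closed_pair[OF U_X[OF a(1)] U_X[OF a'(1), unfolded star_star]
        XX_U[OF a(1)] XX_U[OF a'(1), unfolded star_star],
        where u = "u a" and u' = "u (star a)" and v = "v a" and v' = "v (star a)" and w = "w a" and w' = "w (star a)"]
    have D: "dplus u (star a) = X (star a) * u a + u (star a) * X a" for u by (simp add: dplus_def add.commute)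
    show "- eps a * (?e u v w a + ?e v w u a + ?e w u v a)
       + - eps (star a) * (?e u v w (star a) + ?e v w u (star a) + ?e w u v (star a))
      = cubic (thR u a) (thR v a) (thR w a) + cubic (thR u (star a)) (thR v (star a)) (thR w (star a))"
      using pair a a' by (simp only: thL_thR_eps D star_star) (simp add: dplus_def algebra_simps)
  qed
  finally have "2 * (E u v w + E v w u + E w u v) = (\<Sum>a\<in>set ord. cubic (thR u a) (thR v a) (thR w a))" .
  from arg_cong[OF this, of "\<lambda>z. 1/2 * z"] show ?thesis by (simp only: mult.assoc[symmetric]) simp
qed

end

context rep_pencil
begin

lemma mreg_ifac:
  assumes a: "a \<in> R"
  shows "M.mreg (\<lambda>x. ifac x a)"
proof -
  have e: "ifac x a = (if eps a = 1 then UX x a else 1 + RX x a * RX x (star a))" if "x \<in> points M" for x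
    by (rule arrow_point.ifactor_def[OF arrow_point_at[OF that]])
  have "M.mreg (\<lambda>x. if eps a = 1 then UX x a else 1 + RX x a * RX x (star a))" by (cases "eps a = 1")
      (simp_all add: M.mreg_add M.mreg_const M.mreg_mult mreg_RX mreg_UX a star_R)
  thus ?thesis using M.mreg_cong[of "\<lambda>x. ifac x a", OF e] by simp
qed

lemma mreg_pprod_inv: "p \<le> length ord ==> M.mreg (\<lambda>x. pprod_inv (\<lambda>i. ifac x (ord ! i)) p)"
proof (induction p)
  case (Suc p)
  hence "ord ! p \<in> R" using set_ord nth_mem[of p ord] by simp
  with Suc show ?case by (simp add: M.mreg_mult mreg_ifac)
qed (simp add: M.mreg_const)

lemma fac_inverse: "x \<in> points M ==> a \<in> R ==> fac x a * ifac x a = 1"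
  "x \<in> points M ==> a \<in> R ==> ifac x a * fac x a = 1"
  using arrow_point.factor_ifactor[OF arrow_point_at] arrow_point.ifactor_factor[OF arrow_point_at] by (auto simp: set_ord)

lemma prefix_inverse:
  assumes "x \<in> points M" "p \<le> length ord"
  shows "pprod (\<lambda>i. fac x (ord ! i)) p * pprod_inv (\<lambda>i. ifac x (ord ! i)) p = 1"
    "pprod_inv (\<lambda>i. ifac x (ord ! i)) p * pprod (\<lambda>i. fac x (ord ! i)) p = 1"
  using arrow_point.seq_inverse[OF arrow_point_at[OF assms(1)]] assms(2) by (auto intro!: pprod_inverse)

text \<open>The exterior derivative of a 2-form on constant vector fields, where the terms with
  commutators are absent.\<close>

abbreviation cyclic :: "(('e + 'e) entry point => ('e + 'e) entry point => ('e + 'e) entry point => complex)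
    => ('e + 'e) entry point => ('e + 'e) entry point => ('e + 'e) entry point => complex" where
  "cyclic d u v z \<equiv> d u v z + d v z u + d z u v"

context
  fixes x assumes x: "x \<in> points M"
begin

interpretation arrow_point ord kk "RX x" "UX x" by (rule arrow_point_at[OF x])

abbreviation Th where "Th v \<equiv> dmom (RX v) * imom"

lemma form0_derivative:
  "\<exists>d. (\<forall>u v z. M.hasd u x (\<lambda>y. arrow_point.form0 ord (UX y) (RX v) (RX z)) (d u v z)) \<and>
    (\<forall>u v z. cyclic d u v z = 1/2 * (\<Sum>a\<in>R. cubic (thR (RX u) a) (thR (RX v) a) (thR (RX z) a)))"
proof -
  let ?d = "\<lambda>u v z. - 1/2 * (\<Sum>a\<in>R. eps a *
    (tr (- (UX x a * dplus (RX u) a * UX x a) * RX v a * RX z (star a)) - tr (- (UX x a * dplus (RX u) a * UX x a) * RX z a * RX v (star a))))"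
  let ?F = "\<lambda>v z y. - 1/2 * (\<Sum>a\<in>R. eps a * (tr (UX y a * RX v a * RX z (star a)) - tr (UX y a * RX z a * RX v (star a))))"
  have U: "M.mhasd u x (\<lambda>y. UX y a) (- (UX x a * dplus (RX u) a * UX x a))" if a: "a \<in> R" for u a
  proof -
    have "M.mD u (\<lambda>x. UX x a) x = - (UX x a * M.mD u (\<lambda>x. 1 + RX x a * RX x (star a)) x * UX x a)"
      by (rule M.mD_inverse)
        (use x a star_R in "simp_all add: M.mreg_add M.mreg_const M.mreg_mult mreg_RX mreg_UX UX_inverse")
    thus ?thesis by (simp add: M.mhasd_def mreg_UX a x mD_plus)
  qed
  have "M.hasd u x (?F v z) (?d u v z)" for u v z
    by (intro M.hasd_cmult M.hasd_sum M.hasd_diff M.hasd_tr M.mhasd_multc U x)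
  hence "M.hasd u x (\<lambda>y. arrow_point.form0 ord (UX y) (RX v) (RX z)) (?d u v z)" for u v z
    by (rule M.hasd_cong) (simp add: arrow_point.form0_def[OF arrow_point_at] set_ord)
  moreover have "cyclic ?d u v z = 1/2 * (\<Sum>a\<in>R. cubic (thR (RX u) a) (thR (RX v) a) (thR (RX z) a))" for u v z
    using form0_closed[of "RX u" "RX v" "RX z"] by (simp only: set_ord)
  ultimately show ?thesis by (intro exI[of _ ?d]) blast
qed

text \<open>The left logarithmic differential of a prefix with one more factor is the old one plus
  the right one of the new factor, conjugated by that factor; the cubic form does not see the
  conjugation.\<close>

lemma cubic_prefix:
  defines "L \<equiv> \<lambda>v i. pprod_inv hseq i * dpprod gseq (dseq (RX v)) i"
  assumes i: "i < length ord"
  shows "cubic (L u i + thR (RX u) (ord ! i)) (L v i + thR (RX v) (ord ! i)) (L z i + thR (RX z) (ord ! i))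
    = cubic (L u (Suc i)) (L v (Suc i)) (L z (Suc i))"
proof -
  have inv: "pprod_inv hseq i * pprod gseq i = 1" by (rule pprod_inverse) (use i seq_inverse in auto)
  hence invl: "pprod_inv hseq i * (pprod gseq i * z) = z" for z by (simp add: mult.assoc[symmetric])
  have S: "L v (Suc i) = hseq i * (L v i + thR (RX v) (ord ! i)) * gseq i" for v
    using i by (simp add: L_def distrib_left distrib_right mult.assoc invl seq_inverse)
  show ?thesis unfolding S by (rule cubic_conj[symmetric]) (rule seq_inverse[OF i])
qed

text \<open>\<open>theta_wedge_closed\<close> is applied to each prefix and its next factor. By
  \<open>cubic_prefix\<close> the term of their product is the prefix term of the next step, so the
  prefix terms telescope to that of the whole product while those of the single factors
  remain.\<close>

lemma form1_derivative:
  "\<exists>d. (\<forall>u v z. M.hasd u x (\<lambda>y. arrow_point.form1 ord (RX y) (UX y) (RX v) (RX z)) (d u v z)) \<and>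
    (\<forall>u v z. cyclic d u v z = (\<Sum>a\<in>R. cubic (thR (RX u) a) (thR (RX v) a) (thR (RX z) a)) - cubic (Th u) (Th v) (Th z))"
proof -
  define L where "L = (\<lambda>v i. pprod_inv hseq i * dpprod gseq (dseq (RX v)) i)"
  let ?c = "\<lambda>i u v z. cubic (L u i) (L v i) (L z i)"
  let ?t = "\<lambda>i u v z. cubic (thR (RX u) (ord ! i)) (thR (RX v) (ord ! i)) (thR (RX z) (ord ! i))"
  let ?G = "\<lambda>i y. pprod (\<lambda>i. fac y (ord ! i)) i" and ?I = "\<lambda>i y. pprod_inv (\<lambda>i. ifac y (ord ! i)) i"
  let ?\<tau> = "\<lambda>i v z y. tr (?I i y * M.mD v (?G i) y * (M.mD z (\<lambda>y. fac y (ord ! i)) y * ifac y (ord ! i)))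
      - tr (?I i y * M.mD z (?G i) y * (M.mD v (\<lambda>y. fac y (ord ! i)) y * ifac y (ord ! i)))"
  let ?A = "\<lambda>i d. (\<forall>u v z. M.hasd u x (?\<tau> i v z) (d u v z)) \<and>
      (\<forall>u v z. cyclic d u v z = ?c i u v z + ?t i u v z - ?c (Suc i) u v z)"
  have ex: "\<exists>d. ?A i d" if i: "i < length ord" for i
  proof -
    have a: "ord ! i \<in> R" and i': "i \<le> length ord" using i set_ord nth_mem[of i ord] by simp_all
    have "?I i x * M.mD v (?G i) x = L v i" for v by (simp add: L_def mD_pprod[OF i' x])
    moreover have "M.mD v (\<lambda>y. fac y (ord ! i)) x * ifac x (ord ! i) = thR (RX v) (ord ! i)" for v
      by (simp add: mD_fac[OF x a])
    ultimately show ?thesis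
      using M.theta_wedge_closed[OF mreg_pprod[OF i'] mreg_pprod_inv[OF i'] prefix_inverse(1)[OF _ i'] prefix_inverse(2)[OF _ i']
          mreg_fac[OF a] mreg_ifac[OF a] fac_inverse(1)[OF _ a] fac_inverse(2)[OF _ a] x]
      by (simp only: L_def cubic_prefix[OF i])
  qed
  \<comment> \<open>One derivative is chosen for each position, so that their sum can be
    formed.\<close>
  define d where "d = (\<lambda>i. SOME d. ?A i d)"
  have d: "?A i (d i)" if "i < length ord" for i unfolding d_def by (rule someI_ex[OF ex[OF that]])
  let ?d = "\<lambda>u v z. \<Sum>i<length ord. d i u v z"
  have "M.hasd u x (\<lambda>y. \<Sum>i<length ord. ?\<tau> i v z y) (?d u v z)" for u v z
    using d by (intro M.hasd_sum x) auto
  hence "M.hasd u x (\<lambda>y. arrow_point.form1 ord (RX y) (UX y) (RX v) (RX z)) (?d u v z)" for u v z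
  proof (rule M.hasd_cong)
    fix y assume y: "y \<in> points M"
    show "arrow_point.form1 ord (RX y) (UX y) (RX v) (RX z) = (\<Sum>i<length ord. ?\<tau> i v z y)"
      unfolding arrow_point.form1_def[OF arrow_point_at[OF y]]
    proof (rule sum.cong[OF refl])
      fix i assume "i \<in> {..<length ord}"
      hence a: "ord ! i \<in> R" and i': "i \<le> length ord" using set_ord nth_mem[of i ord] by simp_all
      show "tr (pprod_inv (\<lambda>i. ifac y (ord ! i)) i * dpprod (\<lambda>i. fac y (ord ! i)) (\<lambda>i. dfac y (RX v) (ord ! i)) i * (dfac y (RX z) (ord ! i) * ifac y (ord ! i)))
        - tr (pprod_inv (\<lambda>i. ifac y (ord ! i)) i * dpprod (\<lambda>i. fac y (ord ! i)) (\<lambda>i. dfac y (RX z) (ord ! i)) i * (dfac y (RX v) (ord ! i) * ifac y (ord ! i)))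
        = ?\<tau> i v z y" by (simp only: mD_pprod[OF i' y] mD_fac[OF y a]) qed qed
  moreover have "cyclic ?d u v z = (\<Sum>a\<in>R. cubic (thR (RX u) a) (thR (RX v) a) (thR (RX z) a)) - cubic (Th u) (Th v) (Th z)" for u v z
  proof -
    have "cyclic ?d u v z = (\<Sum>i<length ord. ?t i u v z - (?c (Suc i) u v z - ?c i u v z))"
      unfolding sum.distrib[symmetric] by (rule sum.cong) (use d in auto)
    also have "\<dots> = (\<Sum>i<length ord. ?t i u v z) - (?c (length ord) u v z - ?c 0 u v z)"
      unfolding sum_subtractf[of "\<lambda>i. ?t i u v z"] sum_lessThan_telescope[of "\<lambda>i. ?c i u v z"] ..
    also have "(\<Sum>i<length ord. ?t i u v z) = (\<Sum>a\<in>R. cubic (thR (RX u) a) (thR (RX v) a) (thR (RX z) a))"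
      unfolding set_ord[symmetric] sum_ord ..
    also have "?c 0 u v z = 0" by (simp add: L_def)
    also have "?c (length ord) u v z = cubic (Th u) (Th v) (Th z)"
    proof -
      have "Th v = mom * L v (length ord) * imom" for v
        unfolding L_def dmom_def[symmetric] imom_def[symmetric] using mom_imom by (simp add: mult.assoc[symmetric])
      thus ?thesis by (simp only: cubic_conj[OF imom_mom])
    qed
    finally show ?thesis by simp
  qed
  ultimately show ?thesis by (intro exI[of _ ?d]) blast
qed

text \<open>Wedge products of closed 1-forms are closed: \<open>T p\<close> is the second derivative
  of log det, symmetric in its two directions, and by antisymmetry of \<open>kk\<close> its terms
  cancel in the cyclic sum.\<close>

lemma form2_derivative:
  "\<exists>d. (\<forall>u v z. M.hasd u x (\<lambda>y. arrow_point.form2 ord kk (RX y) (UX y) (RX v) (RX z)) (d u v z)) \<and>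
    (\<forall>u v z. cyclic d u v z = 0)"
proof -
  let ?K = "\<lambda>F. \<Sum>p\<in>R. \<Sum>q\<in>R. kk p q * F p q" and ?t =  "\<lambda>p v y. tr (ifac y p * M.mD v (\<lambda>y. fac y p) y)"
  define T where "T = (\<lambda>p u v. tr (ifac x p * M.mD u (M.mD v (\<lambda>y. fac y p)) x
    - (ifac x p * M.mD u (\<lambda>y. fac y p) x) * (ifac x p * M.mD v (\<lambda>y. fac y p) x)))"
  have T: "M.hasd u x (?t p v) (T p u v)" if p: "p \<in> R" for u v p unfolding T_def
    by (rule M.hasd_tr[OF M.mhasd_thetaL[OF mreg_fac[OF p] mreg_ifac[OF p] fac_inverse(1)[OF _ p] fac_inverse(2)[OF _ p] x]])
  have Ts: "T p u v = T p v u" if p: "p \<in> R" for u v p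
    unfolding T_def M.mD_swap[OF mreg_fac[OF p] x, of u v] tr_diff
    by (simp only: tr_comm[of "ifac x p * M.mD u (\<lambda>y. fac y p) x"])
  let ?d = "\<lambda>u v z. ?K (\<lambda>p q. ?t p v x * T q u z + T p u v * ?t q z x)"
  have "M.hasd u x (\<lambda>y. ?K (\<lambda>p q. ?t p v y * ?t q z y)) (?d u v z)" for u v z
    by (intro M.hasd_sum M.hasd_cmult M.hasd_mult T x)
  hence "M.hasd u x (\<lambda>y. arrow_point.form2 ord kk (RX y) (UX y) (RX v) (RX z)) (?d u v z)" for u v z
    by (rule M.hasd_cong) (simp add: arrow_point.form2_def[OF arrow_point_at] set_ord mD_fac)
  moreover have "cyclic ?d u v z = 0" for u v z
  proof -
    have sw: "?K (\<lambda>p q. ?t p z x * T q u v) = - ?K (\<lambda>p q. T p u v * ?t q z x)" for u v z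
      by (subst sum.swap, unfold sum_negf[symmetric], intro sum.cong refl) (subst k_antisym, simp add: mult.commute)
    have "?d u v z = ?K (\<lambda>p q. T p u v * ?t q z x) - ?K (\<lambda>p q. T p u z * ?t q v x)" for u v z
      using sw[of v u z] by (simp add: distrib_left sum.distrib)
    moreover have "?K (\<lambda>p q. T p u v * ?t q z x) = ?K (\<lambda>p q. T p v u * ?t q z x)" for u v z
      by (intro sum.cong refl) (simp only: Ts)
    ultimately show ?thesis by simp
  qed
  ultimately show ?thesis by (intro exI[of _ ?d]) blast
qed

text \<open>With the coefficients 1 and - 1/2 the cubic terms of the single factors cancel between
  \<open>form0\<close> and \<open>form1\<close>, and half the cubic form of the whole product
  remains.\<close>

lemma form_derivative:
  "\<exists>d. (\<forall>u v z. M.hasd u x (\<lambda>y. arrow_point.form ord kk (RX y) (UX y) (RX v) (RX z)) (d u v z)) \<and>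
    (\<forall>u v z. cyclic d u v z = 1/2 * cubic (Th u) (Th v) (Th z))"
proof -
  obtain d0 where d0: "\<forall>u v z. M.hasd u x (\<lambda>y. arrow_point.form0 ord (UX y) (RX v) (RX z)) (d0 u v z)"
      "\<forall>u v z. cyclic d0 u v z = 1/2 * (\<Sum>a\<in>R. cubic (thR (RX u) a) (thR (RX v) a) (thR (RX z) a))"
    using form0_derivative by (elim exE conjE)
  obtain d1 where d1: "\<forall>u v z. M.hasd u x (\<lambda>y. arrow_point.form1 ord (RX y) (UX y) (RX v) (RX z)) (d1 u v z)"
      "\<forall>u v z. cyclic d1 u v z = (\<Sum>a\<in>R. cubic (thR (RX u) a) (thR (RX v) a) (thR (RX z) a)) - cubic (Th u) (Th v) (Th z)"
    using form1_derivative by (elim exE conjE)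
  obtain d2 where d2: "\<forall>u v z. M.hasd u x (\<lambda>y. arrow_point.form2 ord kk (RX y) (UX y) (RX v) (RX z)) (d2 u v z)"
      "\<forall>u v z. cyclic d2 u v z = 0" using form2_derivative by (elim exE conjE)
  let ?d = "\<lambda>u v z. d0 u v z - 1/2 * d1 u v z + 1/2 * d2 u v z"
  have "M.hasd u x (\<lambda>y. arrow_point.form0 ord (UX y) (RX v) (RX z) - 1/2 * arrow_point.form1 ord (RX y) (UX y) (RX v) (RX z)
     + 1/2 * arrow_point.form2 ord kk (RX y) (UX y) (RX v) (RX z)) (?d u v z)" for u v z
    by (intro M.hasd_add M.hasd_diff M.hasd_cmult d0(1)[rule_format] d1(1)[rule_format] d2(1)[rule_format])
  hence "M.hasd u x (\<lambda>y. arrow_point.form ord kk (RX y) (UX y) (RX v) (RX z)) (?d u v z)" for u v z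
    by (rule M.hasd_cong) (rule arrow_point.form_def[OF arrow_point_at])
  moreover have "cyclic ?d u v z = 1/2 * cubic (Th u) (Th v) (Th z)" for u v z
  proof -
    have "cyclic ?d u v z = cyclic d0 u v z - 1/2 * cyclic d1 u v z + 1/2 * cyclic d2 u v z"
      by (simp add: algebra_simps)
    thus ?thesis unfolding d0(2)[rule_format] d1(2)[rule_format] d2(2)[rule_format] by (simp add: algebra_simps)
  qed
  ultimately show ?thesis by (intro exI[of _ ?d]) blast
qed

text \<open>Rotating the traces makes the six terms equal in two groups of three, so that 1/6
  becomes 1/2.\<close>

lemma pull_eta_cubic: "pull_eta (verts Q) n C \<Phi> x u v z = 1/2 * cubic (Th u) (Th v) (Th z)"
proof -
  have t: "tr (Y * (Z * W)) = tr (Z * (W * Y))" for Y Z W :: "('s \<times> nat) umat" by (metis mult.assoc tr_comm)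
  have e: "pull_eta (verts Q) n C \<Phi> x u v z = 1/6 * (tr (Th u * (Th v * Th z)) - tr (Th u * (Th z * Th v)) + tr (Th v * (Th z * Th u))
    - tr (Th v * (Th u * Th z)) + tr (Th z * (Th u * Th v)) - tr (Th z * (Th v * Th u)))"
    by (simp only: pull_eta_def Let_def gtrace_emb emb_gmul thetaR_moment[OF x])
  have "pull_eta (verts Q) n C \<Phi> x u v z = 1/6 * (3 * (tr (Th u * (Th v * Th z)) - tr (Th u * (Th z * Th v))))"
    unfolding e t[of "Th u" "Th v" "Th z"] t[of "Th v" "Th z" "Th u"] t[of "Th u" "Th z" "Th v"] t[of "Th z" "Th v" "Th u"]
    by (simp add: algebra_simps)
  thus ?thesis by (simp add: cubic_def right_diff_distrib tr_diff)
qed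

end

lemma regular_form:
  assumes c: "c \<in> C" and d: "d \<in> C"
  shows "regular_on C (points M) (\<lambda>x. \<omega> x c d)"
proof (cases "points M = {}")
  case True
  thus ?thesis by (simp add: regular_on_def)
next
  case False
  then obtain x where x: "x \<in> points M" by blast
  \<comment> \<open>Regularity on all of \<open>points M\<close> is part of \<open>hasd\<close> at
    any single point.\<close>
  obtain e where "M.hasd x x (\<lambda>y. arrow_point.form ord kk (RX y) (UX y) (eX c) (eX d)) e"
    using form_derivative[OF x] by blast
  hence "regular_on C (points M) (\<lambda>y. arrow_point.form ord kk (RX y) (UX y) (eX c) (eX d))"
    by (simp add: M.hasd_def)
  thus ?thesis using regular_cong[of "points M" "\<lambda>x. \<omega> x c d"] form_coords c d by auto
qed

lemma form_swap: "x \<in> points M ==> \<omega> x c d = - \<omega> x d c"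
proof (cases "c \<in> C \<and> d \<in> C")
  case True
  assume "x \<in> points M"
  thus ?thesis using True arrow_point.form_antisym[OF arrow_point_at, of x "eX c" "eX d"] by (simp add: form_coords)
qed (auto simp: pencil_form_def)

lemma form_closed:
  assumes x: "x \<in> points M" and c: "c \<in> C" and d: "d \<in> C" and e: "e \<in> C"
  shows "ext_deriv2 \<omega> x c d e = pull_eta (verts Q) n C \<Phi> x (unit_pt c) (unit_pt d) (unit_pt e)"
proof -
  let ?\<omega> = "\<lambda>c d y. arrow_point.form ord kk (RX y) (UX y) (eX c) (eX d)"
  obtain D where "\<forall>u v z. M.hasd u x (\<lambda>y. arrow_point.form ord kk (RX y) (UX y) (RX v) (RX z)) (D u v z)"
      "\<forall>u v z. cyclic D u v z = 1/2 * cubic (Th x u) (Th x v) (Th x z)"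
    using form_derivative[OF x] by (elim exE conjE)
  note D = this(1)[rule_format] this(2)[rule_format]
  have p: "pderiv_at b (\<lambda>y. \<omega> y c d) x = D (unit_pt b) (unit_pt c) (unit_pt d)" if "b \<in> C" "c \<in> C" "d \<in> C" for b c d
  proof -
    have "pderiv_at b (\<lambda>y. \<omega> y c d) x = M.dirD (unit_pt b) (\<lambda>y. \<omega> y c d) x"
      by (rule M.dirD_unit[OF that(1), symmetric])
    also have "\<dots> = M.dirD (unit_pt b) (?\<omega> c d) x"
      by (rule M.dirD_cong[OF _ x]) (rule form_coords[OF _ that(2,3)])
    finally show ?thesis using D(1)[of "unit_pt b" "unit_pt c" "unit_pt d"] by (simp add: M.hasd_def)
  qed
  have "pderiv_at d (\<lambda>y. \<omega> y c e) x = pderiv_at d (\<lambda>y. - 1 * \<omega> y e c) x"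
    by (rule M.pderiv_cong[OF _ x d]) (simp add: form_swap[of _ c e])
  also have "\<dots> = - 1 * pderiv_at d (\<lambda>y. \<omega> y e c) x"
    by (rule M.pderiv_cmult[OF regular_form[OF e c] x d])
  finally have s: "pderiv_at d (\<lambda>y. \<omega> y c e) x = - D (unit_pt d) (unit_pt e) (unit_pt c)"
    by (simp add: p c d e)
  have "ext_deriv2 \<omega> x c d e = cyclic D (unit_pt c) (unit_pt d) (unit_pt e)"
    by (simp add: ext_deriv2_def s p c d e)
  thus ?thesis by (simp only: D(2) pull_eta_cubic[OF x])
qed

lemma two_form_P: "two_form M \<omega>" unfolding two_form_def alternating_field_def M_simps
proof (intro conjI ballI allI impI)
  fix x c d assume x: "x \<in> points M"
  show "\<omega> x c d = - \<omega> x d c" by (rule form_swap[OF x])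
  show "\<omega> x c d = 0" if "c \<notin> C \<or> d \<notin> C"
    unfolding pencil_form_def using that by (intro if_not_P) blast
qed (rule regular_form)

lemma quasi_hamiltonian_P: "quasi_hamiltonian M \<omega> \<Phi>" unfolding quasi_hamiltonian_def M_simps
  by (intro conjI ballI two_form_P invariant_form_P equivariant_moment form_closed form_infinitesimal form_injective)

end

section \<open>Quasi-Poisson reduction\<close>

text \<open>The facts about the action on which reduction depends: it is linear in the point, its
  generators come from curves that lie in the group for small time, and the entries of the moment
  map minus \<open>q\<close> are transformed linearly among themselves, so that the group preserves
  the ideal they generate.\<close>

locale reduction =
  fixes M :: "('s, 'c) GL_variety" and \<Phi> :: "'c point => 's entry point" and q :: "'s entry point" and Z :: "'c point set"
  assumes finite_coords: "finite (coords M)" and finite_gbasis: "finite (gbasis M)"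
    and open_points: "zariski_open (coords M) (points M)"
    and act_affine: "act M g y \<in> affine_space (coords M)"
    and act_points: "g \<in> grp M ==> y \<in> points M ==> act M g y \<in> points M"
    and act_lin: "g \<in> grp M ==> c \<in> coords M ==> act M g y c = (\<Sum>b\<in>coords M. y b * act M g (unit_pt b) c)"
    and flow_grp: "eventually (\<lambda>t. gexp (gverts M) (gdim M) (\<lambda>b. - t * basis_elt a b) \<in> grp M) (nhds 0)"
    and flow_zero: "y \<in> affine_space (coords M) ==> act M (gexp (gverts M) (gdim M) (\<lambda>b. - 0 * basis_elt a b)) y = y"
    and flow_deriv: "c \<in> coords M ==> DERIV (\<lambda>t. act M (gexp (gverts M) (gdim M) (\<lambda>b. - t * basis_elt a b)) y c) 0 :> infinitesimal M (basis_elt a) y c"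
    and moment_regular: "b \<in> gbasis M ==> regular_on (coords M) (points M) (\<lambda>y. \<Phi> y b)"
    and moment_conj: "g \<in> grp M ==> \<exists>k. \<forall>y\<in>points M. \<forall>b\<in>gbasis M.
      \<Phi> (act M g y) b - q b = (\<Sum>b'\<in>gbasis M. k b b' * (\<Phi> y b' - q b'))"
    and Z_points: "Z \<subseteq> points M" and Z_act: "g \<in> grp M ==> x \<in> Z ==> act M g x \<in> Z"
    and orbit_act: "g \<in> grp M ==> x \<in> Z ==> orbit M (act M g x) = orbit M x"
begin

abbreviation C where "C \<equiv> coords M"
abbreviation G where "G \<equiv> gbasis M"
abbreviation vf where "vf a \<equiv> infinitesimal M (basis_elt a)"
abbreviation altM where "altM \<equiv> alternating_field C (points M)"
abbreviation regM where "regM \<equiv> regular_on C (points M)"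
abbreviation geq where "geq \<equiv> germ_eq M \<Phi> q"

lemma affine_open: "zariski_open C V ==> affine_open C V" by (simp add: affine_open_def finite_coords)

subsection \<open>Germs\<close>

definition near :: "'c point => ('c point => bool) => bool" where
  "near x P \<longleftrightarrow> (\<exists>V. zariski_open C V \<and> x \<in> V \<and> V \<subseteq> points M \<and> (\<forall>y\<in>V. P y))"

definition reg_at :: "'c point => ('c point => complex) => bool" where
  "reg_at x f \<longleftrightarrow> (\<exists>V. zariski_open C V \<and> x \<in> V \<and> V \<subseteq> points M \<and> regular_on C V f)"

text \<open>Membership of a germ in the ideal of the fibre. The coefficients are germs with
  neighbourhoods of their own, intersected only where a common one is wanted.\<close>

definition vanish :: "'c point => ('c point => complex) => bool" where
  "vanish x f \<longleftrightarrow> reg_at x f \<and> (\<exists>u. (\<forall>b\<in>G. reg_at x (u b)) \<and> near x (\<lambda>y. f y = (\<Sum>b\<in>G. u b y * (\<Phi> y b - q b))))"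

lemma near_mono: "near x P ==> (\<And>y. y \<in> points M ==> P y ==> Q y) ==> near x Q" unfolding near_def by blast

lemma near_conj:
  assumes "near x P" "near x Q"
  shows "near x (\<lambda>y. P y \<and> Q y)"
proof -
  from assms obtain V W where "zariski_open C V" "x \<in> V" "V \<subseteq> points M" "\<forall>y\<in>V. P y" "zariski_open C W" "x \<in> W" "\<forall>y\<in>W. Q y"
    unfolding near_def by blast
  thus ?thesis unfolding near_def by (intro exI[of _ "V \<inter> W"]) (auto intro: zariski_open_Int)
qed

lemma near_true: "x \<in> points M ==> (\<And>y. y \<in> points M ==> P y) ==> near x P"
  using open_points by (auto simp: near_def)

lemma near_cases: "near x P ==> x \<in> points M \<and> P x" by (auto simp: near_def)

lemma reg_at_points: "reg_at x f ==> x \<in> points M" by (auto simp: reg_at_def)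

lemma reg_atI: "regM f ==> x \<in> points M ==> reg_at x f" using open_points by (auto simp: reg_at_def)

lemma reg_at_finite:
  assumes "finite K" "x \<in> points M" "\<And>k. k \<in> K ==> reg_at x (f k)"
  shows "\<exists>V. zariski_open C V \<and> x \<in> V \<and> V \<subseteq> points M \<and> (\<forall>k\<in>K. regular_on C V (f k))"
  using assms(1,3)
proof (induction K rule: finite_induct)
  case empty
  thus ?case using open_points assms(2) by auto
next
  case (insert k K)
  then obtain V where V: "zariski_open C V" "x \<in> V" "V \<subseteq> points M" "\<forall>k\<in>K. regular_on C V (f k)" by auto
  have "reg_at x (f k)" using insert.prems by simp
  then obtain W where W: "zariski_open C W" "x \<in> W" "W \<subseteq> points M" "regular_on C W (f k)"
    unfolding reg_at_def by blast
  have "regular_on C (V \<inter> W) (f l)" if "l \<in> insert k K" for l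
    using that V(4) W(4) regular_subset[of C V "f l" "V \<inter> W"] regular_subset[of C W "f l" "V \<inter> W"] by auto
  thus ?case using V(2,3) W(2) zariski_open_Int[OF V(1) W(1)] by (intro exI[of _ "V \<inter> W"]) auto
qed

lemma reg_at_near:
  assumes "near x P" "finite K" "\<And>k. k \<in> K ==> reg_at x (f k)"
  obtains V where "zariski_open C V" "x \<in> V" "V \<subseteq> points M" "\<And>k. k \<in> K ==> regular_on C V (f k)" "\<And>y. y \<in> V ==> P y"
proof -
  from assms(1) obtain W where W: "zariski_open C W" "x \<in> W" "W \<subseteq> points M" "\<forall>y\<in>W. P y"
    unfolding near_def by blast
  obtain V where V: "zariski_open C V" "x \<in> V" "V \<subseteq> points M" "\<forall>k\<in>K. regular_on C V (f k)"
    using reg_at_finite[of K x f, OF assms(2) conjunct1[OF near_cases[OF assms(1)]] assms(3)] by auto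
  show thesis
  proof (rule that)
    show "zariski_open C (V \<inter> W)" by (rule zariski_open_Int[OF V(1) W(1)])
    show "regular_on C (V \<inter> W) (f k)" if "k \<in> K" for k
      by (rule regular_subset[OF V(4)[rule_format, OF that] Int_lower1])
  qed (use V W in auto)
qed

lemma reg_at_cong:
  assumes f: "reg_at x f" and n: "near x (\<lambda>y. f y = g y)"
  shows "reg_at x g"
proof -
  obtain V where V: "zariski_open C V" "x \<in> V" "V \<subseteq> points M" "regular_on C V f" "\<And>y. y \<in> V ==> f y = g y"
    by (rule reg_at_near[OF n, of "{()}" "\<lambda>_. f"]) (use f in auto)
  thus ?thesis using regular_cong[of V f g C] by (auto simp: reg_at_def)
qed

lemma reg_at_const: "x \<in> points M ==> reg_at x (\<lambda>_. k)" by (rule reg_atI[OF regular_const])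

lemma reg_at_moment: "x \<in> points M ==> b \<in> G ==> reg_at x (\<lambda>y. \<Phi> y b)"
  by (intro reg_atI moment_regular)

lemma
  assumes "reg_at x f" "reg_at x g"
  shows reg_at_add: "reg_at x (\<lambda>y. f y + g y)" and reg_at_mult: "reg_at x (\<lambda>y. f y * g y)"
    and reg_at_diff: "reg_at x (\<lambda>y. f y - g y)"
proof -
  have "reg_at x (if k then f else g)" for k using assms by simp
  then obtain V where V: "zariski_open C V" "x \<in> V" "V \<subseteq> points M" "\<forall>k\<in>UNIV. regular_on C V (if k then f else g)"
    using reg_at_finite[of UNIV x "\<lambda>k. if k then f else g", OF _ reg_at_points[OF assms(1)]] by auto
  hence "regular_on C V f" "regular_on C V g" by (metis UNIV_I)+
  thus "reg_at x (\<lambda>y. f y + g y)" "reg_at x (\<lambda>y. f y * g y)" "reg_at x (\<lambda>y. f y - g y)"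
    using V unfolding reg_at_def by (blast intro: regular_intros)+
qed

lemma reg_at_sum: "x \<in> points M ==> (\<And>i. i \<in> I ==> reg_at x (f i)) ==> reg_at x (\<lambda>y. \<Sum>i\<in>I. f i y)"
  by (induction I rule: infinite_finite_induct) (simp_all add: reg_at_const reg_at_add)

lemma reg_at_pderiv: "reg_at x f ==> c \<in> C ==> reg_at x (pderiv_at c f)"
  unfolding reg_at_def using affine_open.regular_pderiv[OF affine_open] by blast

lemma vanish_reg: "vanish x f ==> reg_at x f" by (simp add: vanish_def)

lemma vanish_cong:
  assumes f: "vanish x f" and n: "near x (\<lambda>y. f y = g y)"
  shows "vanish x g"
proof -
  from assms obtain u where u: "\<forall>b\<in>G. reg_at x (u b)" "near x (\<lambda>y. f y = (\<Sum>b\<in>G. u b y * (\<Phi> y b - q b)))"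
    unfolding vanish_def by blast
  have "near x (\<lambda>y. g y = (\<Sum>b\<in>G. u b y * (\<Phi> y b - q b)))"
    using near_conj[OF u(2) n] by (rule near_mono) auto
  thus ?thesis using reg_at_cong[OF vanish_reg[OF f] n] u(1) unfolding vanish_def by blast
qed

lemma vanish_zero: "x \<in> points M ==> vanish x (\<lambda>_. 0)"
  unfolding vanish_def by (auto intro!: reg_at_const exI[of _ "\<lambda>_ _. 0"] near_true)

lemma vanish_add:
  assumes f: "vanish x f" and g: "vanish x g"
  shows "vanish x (\<lambda>y. f y + g y)"
proof -
  from assms obtain u v where u: "\<forall>b\<in>G. reg_at x (u b)" "near x (\<lambda>y. f y = (\<Sum>b\<in>G. u b y * (\<Phi> y b - q b)))"
    and v: "\<forall>b\<in>G. reg_at x (v b)" "near x (\<lambda>y. g y = (\<Sum>b\<in>G. v b y * (\<Phi> y b - q b)))"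
    unfolding vanish_def by blast
  have "near x (\<lambda>y. f y + g y = (\<Sum>b\<in>G. (u b y + v b y) * (\<Phi> y b - q b)))"
    using near_conj[OF u(2) v(2)] by (rule near_mono) (auto simp: distrib_right sum.distrib)
  thus ?thesis using f g u(1) v(1) unfolding vanish_def
    by (intro conjI reg_at_add exI[of _ "\<lambda>b y. u b y + v b y"]) (auto intro: reg_at_add)
qed

lemma vanish_mult:
  assumes g: "reg_at x g" and f: "vanish x f"
  shows "vanish x (\<lambda>y. g y * f y)"
proof -
  from assms obtain u where u: "\<forall>b\<in>G. reg_at x (u b)" "near x (\<lambda>y. f y = (\<Sum>b\<in>G. u b y * (\<Phi> y b - q b)))"
    unfolding vanish_def by blast
  have "near x (\<lambda>y. g y * f y = (\<Sum>b\<in>G. (g y * u b y) * (\<Phi> y b - q b)))"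
    using u(2) by (rule near_mono) (auto simp: sum_distrib_left mult.assoc)
  thus ?thesis using f g u(1) unfolding vanish_def
    by (intro conjI reg_at_mult exI[of _ "\<lambda>b y. g y * u b y"]) (auto intro: reg_at_mult)
qed

lemma vanish_scale: "vanish x f ==> vanish x (\<lambda>y. k * f y)"
  using vanish_mult[OF reg_at_const] vanish_reg reg_at_points by blast

lemma vanish_sum: "x \<in> points M ==> (\<And>i. i \<in> I ==> vanish x (f i)) ==> vanish x (\<lambda>y. \<Sum>i\<in>I. f i y)"
  by (induction I rule: infinite_finite_induct) (simp_all add: vanish_zero vanish_add)

lemma vanish_diff: "vanish x f ==> vanish x g ==> vanish x (\<lambda>y. f y - g y)"
  using vanish_add[OF _ vanish_scale[of x g "- 1"]] by simp

lemma vanish_moment: "x \<in> points M ==> b \<in> G ==> vanish x (\<lambda>y. \<Phi> y b - q b)"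
  unfolding vanish_def using finite_gbasis
  by (intro conjI reg_at_diff reg_at_moment reg_at_const exI[of _ "\<lambda>b' y. if b' = b then 1 else 0"])
    (auto intro!: reg_at_const near_true simp: if_distrib[of "\<lambda>z. z * _"] cong: if_cong)

lemma geq_iff: "geq x f h \<longleftrightarrow> reg_at x f \<and> reg_at x h \<and> vanish x (\<lambda>y. f y - h y)"
proof
  assume "geq x f h"
  then obtain V u where V: "zariski_open C V" "x \<in> V" "V \<subseteq> points M" "regular_on C V f" "regular_on C V h"
    "\<forall>b\<in>G. regular_on C V (u b)" "\<forall>y\<in>V. f y - h y = (\<Sum>b\<in>G. u b y * (\<Phi> y b - q b))"
    unfolding germ_eq_def by blast
  hence f: "reg_at x f" and h: "reg_at x h" and "\<forall>b\<in>G. reg_at x (u b)"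
    and "near x (\<lambda>y. f y - h y = (\<Sum>b\<in>G. u b y * (\<Phi> y b - q b)))"
    unfolding reg_at_def near_def by blast+
  thus "reg_at x f \<and> reg_at x h \<and> vanish x (\<lambda>y. f y - h y)"
    unfolding vanish_def using reg_at_diff by blast
next
  assume h: "reg_at x f \<and> reg_at x h \<and> vanish x (\<lambda>y. f y - h y)"
  then obtain u where u: "\<forall>b\<in>G. reg_at x (u b)" "near x (\<lambda>y. f y - h y = (\<Sum>b\<in>G. u b y * (\<Phi> y b - q b)))"
    unfolding vanish_def by blast
  \<comment> \<open>Both functions and all coefficients form one finite family, which has a common
    neighbourhood of regularity.\<close>
  let ?F = "\<lambda>k. case k of None => f | Some None => h | Some (Some b) => u b"
  let ?K = "{None, Some None} \<union> (\<lambda>b. Some (Some b)) ` G"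
  obtain V where V: "zariski_open C V" "x \<in> V" "V \<subseteq> points M" "\<And>k. k \<in> ?K ==> regular_on C V (?F k)"
    "\<And>y. y \<in> V ==> f y - h y = (\<Sum>b\<in>G. u b y * (\<Phi> y b - q b))"
    by (rule reg_at_near[OF u(2), of ?K ?F]) (use h u(1) finite_gbasis in auto)
  have "regular_on C V f" "regular_on C V h" using V(4)[of None] V(4)[of "Some None"] by simp_all
  moreover have "regular_on C V (u b)" if "b \<in> G" for b using V(4)[of "Some (Some b)"] that by simp
  ultimately show "geq x f h" unfolding germ_eq_def using V(1-3,5) by (intro exI[of _ V] exI[of _ u]) simp
qed

lemma geq_refl: "reg_at x f ==> geq x f f" by (simp add: geq_iff vanish_zero reg_at_points)

lemma geq_sym: "geq x f h ==> geq x h f" using vanish_scale[of x "\<lambda>y. f y - h y" "- 1"] by (simp add: geq_iff)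

lemma geq_trans: "geq x f g ==> geq x g h ==> geq x f h"
  using vanish_add[of x "\<lambda>y. f y - g y" "\<lambda>y. g y - h y"] by (simp add: geq_iff)

lemma geq_near:
  assumes f: "reg_at x f" and n: "near x (\<lambda>y. f y = h y)"
  shows "geq x f h"
proof -
  have "vanish x (\<lambda>y. f y - h y)"
    by (rule vanish_cong[OF vanish_zero[OF reg_at_points[OF f]]]) (rule near_mono[OF n], simp)
  thus ?thesis by (simp add: geq_iff f reg_at_cong[OF f n])
qed

lemma geq_add: "geq x f f' ==> geq x h h' ==> geq x (\<lambda>y. f y + h y) (\<lambda>y. f' y + h' y)"
  using vanish_add[of x "\<lambda>y. f y - f' y" "\<lambda>y. h y - h' y"] by (simp add: geq_iff reg_at_add algebra_simps)

lemma geq_mult: "geq x f f' ==> geq x h h' ==> geq x (\<lambda>y. f y * h y) (\<lambda>y. f' y * h' y)"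
  using vanish_add[OF vanish_mult[of x f "\<lambda>y. h y - h' y"] vanish_mult[of x h' "\<lambda>y. f y - f' y"]]
  by (simp add: geq_iff reg_at_mult algebra_simps)

lemma geq_scale: "geq x f f' ==> geq x (\<lambda>y. k * f y) (\<lambda>y. k * f' y)"
  using geq_mult[OF geq_refl[OF reg_at_const]] reg_at_points unfolding geq_iff by blast

lemma geq_sum: "x \<in> points M ==> (\<And>i. i \<in> I ==> geq x (f i) (h i)) ==> geq x (\<lambda>y. \<Sum>i\<in>I. f i y) (\<lambda>y. \<Sum>i\<in>I. h i y)"
  by (induction I rule: infinite_finite_induct) (simp_all add: geq_refl reg_at_const geq_add)

lemma germ_class_iff: "reg_at x f ==> germ_class M \<Phi> q f x = germ_class M \<Phi> q h x \<longleftrightarrow> geq x f h"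
  unfolding germ_class_def using geq_refl geq_sym geq_trans by blast

subsection \<open>The group action on germs\<close>

lemma poly_act: "g \<in> grp M ==> p \<in> poly_functions C ==> (\<lambda>y. p (act M g y)) \<in> poly_functions C"
proof (rotate_tac, induction rule: poly_functions.induct)
  case (coord c)
  hence "(\<lambda>y. act M g y c) = (\<lambda>y. \<Sum>b\<in>C. y b * act M g (unit_pt b) c)" using act_lin by blast
  thus ?case by (auto intro!: poly_sum poly_functions.mult poly_functions.coord poly_functions.const)
qed (auto intro: poly_functions.intros)

lemma open_act:
  assumes g: "g \<in> grp M" and V: "zariski_open C V"
  shows "zariski_open C {y \<in> points M. act M g y \<in> V}" unfolding zariski_open_def
proof (intro conjI ballI)
  show "{y \<in> points M. act M g y \<in> V} \<subseteq> affine_space C"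
    using zariski_open_subset[OF open_points] by blast
  fix x assume "x \<in> {y \<in> points M. act M g y \<in> V}"
  then obtain p r where p: "p \<in> poly_functions C" "p (act M g x) \<noteq> 0" "{y \<in> affine_space C. p y \<noteq> 0} \<subseteq> V"
    and r: "r \<in> poly_functions C" "r x \<noteq> 0" "{y \<in> affine_space C. r y \<noteq> 0} \<subseteq> points M"
    using V open_points unfolding zariski_open_def by blast
  show "\<exists>p\<in>poly_functions C. p x \<noteq> 0 \<and> {y \<in> affine_space C. p y \<noteq> 0} \<subseteq> {y \<in> points M. act M g y \<in> V}"
    by (rule bexI[OF _ poly_functions.mult[OF poly_act[OF g p(1)] r(1)]]) (use p r act_affine in auto)
qed

lemma near_act:
  assumes g: "g \<in> grp M" and x: "x \<in> points M" and "near (act M g x) P"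
  shows "near x (\<lambda>y. P (act M g y))"
proof -
  from assms obtain V where V: "zariski_open C V" "act M g x \<in> V" "\<forall>y\<in>V. P y" unfolding near_def by blast
  thus ?thesis
    unfolding near_def by (intro exI[of _ "{y \<in> points M. act M g y \<in> V}"]) (auto intro: open_act[OF g] x)
qed

lemma reg_at_act:
  assumes g: "g \<in> grp M" and x: "x \<in> points M" and "reg_at (act M g x) f"
  shows "reg_at x (\<lambda>y. f (act M g y))"
proof -
  from assms obtain V where V: "zariski_open C V" "act M g x \<in> V" "regular_on C V f" unfolding reg_at_def by blast
  let ?W = "{y \<in> points M. act M g y \<in> V}"
  have "regular_on C ?W (\<lambda>y. f (act M g y))" unfolding regular_on_def
  proof
    fix y assume y: "y \<in> ?W"
    then obtain p r where p: "p \<in> poly_functions C" "r \<in> poly_functions C" "r (act M g y) \<noteq> 0"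
      "\<forall>z\<in>V. r z \<noteq> 0 \<longrightarrow> f z = p z / r z" using regular_onD[OF V(3)] by blast
    show "\<exists>p\<in>poly_functions C. \<exists>q\<in>poly_functions C. q y \<noteq> 0 \<and> (\<forall>y\<in>?W. q y \<noteq> 0 \<longrightarrow> f (act M g y) = p y / q y)"
      by (rule bexI[OF _ poly_act[OF g p(1)]], rule bexI[OF _ poly_act[OF g p(2)]]) (use p in auto)
  qed
  thus ?thesis unfolding reg_at_def using V(2) x by (intro exI[of _ ?W]) (auto intro: open_act[OF g V(1)])
qed

lemma vanish_act:
  assumes g: "g \<in> grp M" and x: "x \<in> points M" and f: "vanish (act M g x) f"
  shows "vanish x (\<lambda>y. f (act M g y))"
proof -
  obtain u where u: "\<forall>b\<in>G. reg_at (act M g x) (u b)" "near (act M g x) (\<lambda>y. f y = (\<Sum>b\<in>G. u b y * (\<Phi> y b - q b)))"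
    using f unfolding vanish_def by blast
  obtain k where k: "\<forall>y\<in>points M. \<forall>b\<in>G. \<Phi> (act M g y) b - q b = (\<Sum>b'\<in>G. k b b' * (\<Phi> y b' - q b'))"
    using moment_conj[OF g] by (rule exE)
  let ?k = "\<lambda>b y. \<Sum>b'\<in>G. k b b' * (\<Phi> y b' - q b')"
  have "vanish x (\<lambda>y. \<Sum>b\<in>G. u b (act M g y) * ?k b y)"
  proof (rule vanish_sum[OF x])
    fix b assume "b \<in> G"
    hence "reg_at x (\<lambda>y. u b (act M g y))" using u(1) reg_at_act[OF g x] by blast
    moreover have "vanish x (?k b)" by (rule vanish_sum[OF x], rule vanish_scale, rule vanish_moment[OF x])
    ultimately show "vanish x (\<lambda>y. u b (act M g y) * ?k b y)" by (rule vanish_mult)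
  qed
  moreover have "near x (\<lambda>y. (\<Sum>b\<in>G. u b (act M g y) * ?k b y) = f (act M g y))"
  proof (rule near_mono[OF near_act[OF g x u(2)]])
    fix y assume y: "y \<in> points M" and e: "f (act M g y) = (\<Sum>b\<in>G. u b (act M g y) * (\<Phi> (act M g y) b - q b))"
    show "(\<Sum>b\<in>G. u b (act M g y) * ?k b y) = f (act M g y)"
      unfolding e by (rule sum.cong) (simp_all add: k[rule_format, OF y])
  qed
  ultimately show ?thesis by (rule vanish_cong)
qed

lemma geq_act: "g \<in> grp M ==> x \<in> points M ==> geq (act M g x) f h ==> geq x (\<lambda>y. f (act M g y)) (\<lambda>y. h (act M g y))"
  unfolding geq_iff by (auto intro: reg_at_act vanish_act[of g x "\<lambda>y. f y - h y"])

lemma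
  assumes g: "g \<in> grp M" and c: "c \<in> C" and a: "a \<in> C"
  shows pderiv_act_coord: "pderiv_at a (\<lambda>y. act M g y c) x = act M g (unit_pt a) c"
  and act_line: "DERIV (\<lambda>t. act M g (x(a := t)) c) s :> act M g (unit_pt a) c"
proof -
  have "DERIV (\<lambda>t. \<Sum>b\<in>C. (x(a := t)) b * act M g (unit_pt b) c) s :> (\<Sum>b\<in>C. (if b = a then 1 else 0) * act M g (unit_pt b) c)" for s
    by (intro DERIV_sum DERIV_cmult_right line_deriv)
  moreover have "(\<Sum>b\<in>C. (if b = a then 1 else 0) * act M g (unit_pt b) c) = act M g (unit_pt a) c"
    using a finite_coords by (simp add: if_distrib[of "\<lambda>z. z * _"] cong: if_cong)
  ultimately have d: "DERIV (\<lambda>t. act M g (x(a := t)) c) s :> act M g (unit_pt a) c" for s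
    unfolding act_lin[OF g c, of "x(a := _)"] by simp
  thus "pderiv_at a (\<lambda>y. act M g y c) x = act M g (unit_pt a) c"
    "DERIV (\<lambda>t. act M g (x(a := t)) c) s :> act M g (unit_pt a) c"
    unfolding pderiv_at_def by (auto intro: DERIV_imp_deriv)
qed

lemma pderiv_act:
  assumes g: "g \<in> grp M" and f: "reg_at (act M g y) f" and a: "a \<in> C"
  shows "pderiv_at a (\<lambda>y. f (act M g y)) y = (\<Sum>c\<in>C. pderiv_at c f (act M g y) * act M g (unit_pt a) c)"
proof -
  obtain V where V: "zariski_open C V" "act M g y \<in> V" "regular_on C V f" using f unfolding reg_at_def by blast
  interpret V: affine_open C V by (rule affine_open[OF V(1)])
  have "DERIV (\<lambda>t. f (act M g (y(a := t)))) (y a) :> (\<Sum>c\<in>C. pderiv_at c f (act M g (y(a := y a))) * act M g (unit_pt a) c)"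
    by (rule V.regular_curve[OF V(3)]) (use V(2) act_affine act_line[OF g _ a] in auto)
  thus ?thesis unfolding pderiv_at_def[of a "\<lambda>y. f (act M g y)"] by (simp add: DERIV_imp_deriv)
qed

abbreviation flow where "flow a t \<equiv> gexp (gverts M) (gdim M) (\<lambda>b. - t * basis_elt a b)"

definition E :: "'s entry => ('c point => complex) => 'c point => complex" where
  "E a f y = (\<Sum>d\<in>C. vf a y d * pderiv_at d f y)"

text \<open>
  If \<open>\<Sum>\<^sub>i \<phi>\<^sub>i(t) h\<^sub>i\<close> lies in the ideal for all small \<open>t\<close>, then so does its derivative at \<open>t = 0\<close>, since the
  \<open>h\<^sub>i\<close> span a finite-dimensional space modulo the ideal.
\<close>
lemma vanish_derivative:
  fixes \<phi> :: "nat => complex => complex" and h :: "nat => 'c point => complex"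
  assumes "\<And>i. i < m ==> \<phi> i field_differentiable (at 0)" and x: "x \<in> points M"
    and "eventually (\<lambda>t. vanish x (\<lambda>y. \<Sum>i<m. \<phi> i t * h i y)) (nhds 0)"
  shows "vanish x (\<lambda>y. \<Sum>i<m. deriv (\<phi> i) 0 * h i y)" using assms(1,3)
proof (induction m arbitrary: \<phi>)
  case 0
  thus ?case using vanish_zero[OF x] by simp
next
  case (Suc m)
  have d: "\<phi> i field_differentiable (at 0)" if "i < m" for i using Suc.prems(1) that by simp
  show ?case
  proof (cases "eventually (\<lambda>t. \<phi> m t = 0) (nhds 0)")
    case True
    have "deriv (\<phi> m) 0 = deriv (\<lambda>_. 0) 0" by (rule deriv_cong_ev[OF True refl])
    moreover have "eventually (\<lambda>t. vanish x (\<lambda>y. \<Sum>i<m. \<phi> i t * h i y)) (nhds 0)"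
      using Suc.prems(2) True by eventually_elim simp
    ultimately show ?thesis using Suc.IH[OF d] by simp
  next
    case False
    have "\<exists>t. \<phi> m t \<noteq> 0 \<and> vanish x (\<lambda>y. \<Sum>i<Suc m. \<phi> i t * h i y)"
    proof (rule ccontr)
      assume n: "\<not> ?thesis"
      have "eventually (\<lambda>t. \<phi> m t = 0) (nhds 0)"
        using Suc.prems(2) by (rule eventually_mono) (use n in blast)
      thus False using False by blast
    qed
    then obtain s where s: "\<phi> m s \<noteq> 0" "vanish x (\<lambda>y. \<Sum>i<Suc m. \<phi> i s * h i y)" by blast
    \<comment> \<open>At time \<open>s\<close> the relation expresses \<open>h m\<close> through the
      other \<open>h i\<close> modulo the ideal; substituting it leaves \<open>m\<close> functions
      with the new coefficients \<open>?\<psi> i\<close>.\<close>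
    define k where "k = (\<lambda>i. \<phi> i s / \<phi> m s)"
    have K: "vanish x (\<lambda>y. (\<Sum>i<m. k i * h i y) + h m y)"
      using vanish_scale[OF s(2), of "1 / \<phi> m s"] s(1) by (simp add: k_def distrib_left sum_distrib_left)
    let ?\<psi> = "\<lambda>i t. \<phi> i t - k i * \<phi> m t"
    have \<phi>m: "\<phi> m field_differentiable (at 0)" using Suc.prems(1) by simp
    have d': "?\<psi> i field_differentiable (at 0)" if "i < m" for i
      using d[OF that] \<phi>m by (intro field_differentiable_diff field_differentiable_mult field_differentiable_const)
    have "eventually (\<lambda>t. vanish x (\<lambda>y. \<Sum>i<m. ?\<psi> i t * h i y)) (nhds 0)" using Suc.prems(2)
    proof eventually_elim
      case (elim t)
      have "vanish x (\<lambda>y. (\<Sum>i<Suc m. \<phi> i t * h i y) - \<phi> m t * ((\<Sum>i<m. k i * h i y) + h m y))"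
        by (intro vanish_diff elim vanish_scale K)
      moreover have "(\<lambda>y. (\<Sum>i<Suc m. \<phi> i t * h i y) - \<phi> m t * ((\<Sum>i<m. k i * h i y) + h m y))
          = (\<lambda>y. \<Sum>i<m. ?\<psi> i t * h i y)"
        by (simp add: algebra_simps sum_subtractf sum_distrib_left fun_eq_iff)
      ultimately show ?case by simp
    qed
    from Suc.IH[OF d' this] have 1: "vanish x (\<lambda>y. \<Sum>i<m. deriv (?\<psi> i) 0 * h i y)" .
    have dp: "deriv (?\<psi> i) 0 = deriv (\<phi> i) 0 - k i * deriv (\<phi> m) 0" if "i < m" for i
      using d[OF that] \<phi>m unfolding DERIV_deriv_iff_field_differentiable[symmetric]
      by (intro DERIV_imp_deriv DERIV_diff DERIV_cmult)
    have "vanish x (\<lambda>y. (\<Sum>i<m. deriv (?\<psi> i) 0 * h i y) + deriv (\<phi> m) 0 * ((\<Sum>i<m. k i * h i y) + h m y))"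
      by (intro vanish_add 1 vanish_scale K)
    moreover have "(\<lambda>y. (\<Sum>i<m. deriv (?\<psi> i) 0 * h i y) + deriv (\<phi> m) 0 * ((\<Sum>i<m. k i * h i y) + h m y))
        = (\<lambda>y. \<Sum>i<Suc m. deriv (\<phi> i) 0 * h i y)"
      by (simp add: dp algebra_simps sum_subtractf sum_distrib_left fun_eq_iff)
    ultimately show ?thesis by simp
  qed
qed

text \<open>The shape required by \<open>vanish_derivative\<close>. The identity is demanded only
  for small \<open>t\<close>, since \<open>act_lin\<close> is about group elements and the flow is
  known to lie in the group only near 0.\<close>

definition separated :: "(complex => 'c point => complex) => bool" where
  "separated F \<longleftrightarrow> (\<exists>l :: ((complex => complex) \<times> ('c point => complex)) list.
     (\<forall>(\<phi>, h)\<in>set l. \<phi> field_differentiable (at 0) \<and> h \<in> poly_functions C) \<and>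
     eventually (\<lambda>t. \<forall>y. F t y = (\<Sum>(\<phi>, h)\<leftarrow>l. \<phi> t * h y)) (nhds 0))"

lemma separatedI:
  assumes "\<phi> field_differentiable (at 0)" "h \<in> poly_functions C"
  shows "separated (\<lambda>t y. \<phi> t * h y)"
  unfolding separated_def using assms by (intro exI[of _ "[(\<phi>, h)]"]) simp

lemma separated_poly: "h \<in> poly_functions C ==> separated (\<lambda>t. h)"
  using separatedI[of "\<lambda>_. 1" h] by simp

lemma separated_cong:
  assumes "separated F" and e: "eventually (\<lambda>t. \<forall>y. F' t y = F t y) (nhds 0)"
  shows "separated F'"
proof -
  from assms obtain l where l: "\<forall>(\<phi>, h)\<in>set l. \<phi> field_differentiable (at 0) \<and> h \<in> poly_functions C"
    "eventually (\<lambda>t. \<forall>y. F t y = (\<Sum>(\<phi>, h)\<leftarrow>l. \<phi> t * h y)) (nhds 0)"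
    unfolding separated_def by blast
  have "eventually (\<lambda>t. \<forall>y. F' t y = (\<Sum>(\<phi>, h)\<leftarrow>l. \<phi> t * h y)) (nhds 0)"
    using e l(2) by eventually_elim simp
  thus ?thesis unfolding separated_def using l(1) by blast
qed

lemma separated_add:
  assumes "separated F" "separated F'"
  shows "separated (\<lambda>t y. F t y + F' t y)"
proof -
  obtain l where l: "\<forall>(\<phi>, h)\<in>set l. \<phi> field_differentiable (at 0) \<and> h \<in> poly_functions C"
    "eventually (\<lambda>t. \<forall>y. F t y = (\<Sum>(\<phi>, h)\<leftarrow>l. \<phi> t * h y)) (nhds 0)"
    using assms(1) unfolding separated_def by blast
  obtain l' where l': "\<forall>(\<phi>, h)\<in>set l'. \<phi> field_differentiable (at 0) \<and> h \<in> poly_functions C"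
    "eventually (\<lambda>t. \<forall>y. F' t y = (\<Sum>(\<phi>, h)\<leftarrow>l'. \<phi> t * h y)) (nhds 0)"
    using assms(2) unfolding separated_def by blast
  have "eventually (\<lambda>t. \<forall>y. F t y + F' t y = (\<Sum>(\<phi>, h)\<leftarrow>l @ l'. \<phi> t * h y)) (nhds 0)"
    using l(2) l'(2) by eventually_elim simp
  thus ?thesis unfolding separated_def using l(1) l'(1) by (intro exI[of _ "l @ l'"]) auto
qed

lemma separated_mult:
  assumes "separated F" "separated F'"
  shows "separated (\<lambda>t y. F t y * F' t y)"
proof -
  obtain l where l: "\<forall>(\<phi>, h)\<in>set l. \<phi> field_differentiable (at 0) \<and> h \<in> poly_functions C"
    "eventually (\<lambda>t. \<forall>y. F t y = (\<Sum>(\<phi>, h)\<leftarrow>l. \<phi> t * h y)) (nhds 0)"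
    using assms(1) unfolding separated_def by blast
  obtain l' where l': "\<forall>(\<phi>, h)\<in>set l'. \<phi> field_differentiable (at 0) \<and> h \<in> poly_functions C"
    "eventually (\<lambda>t. \<forall>y. F' t y = (\<Sum>(\<phi>, h)\<leftarrow>l'. \<phi> t * h y)) (nhds 0)"
    using assms(2) unfolding separated_def by blast
  let ?m = "\<lambda>l. concat (map (\<lambda>(\<phi>, h). map (\<lambda>(\<psi>, k). ((\<lambda>t. \<phi> t * \<psi> t), (\<lambda>y. h y * k y))) l') l)"
  have 1: "(\<Sum>(\<psi>, k)\<leftarrow>map (\<lambda>(\<psi>, k). ((\<lambda>t. \<phi> t * \<psi> t), (\<lambda>y. h y * k y))) l'. \<psi> t * k y)
      = \<phi> t * h y * (\<Sum>(\<psi>, k)\<leftarrow>l'. \<psi> t * k y)" for \<phi> h t and y :: "'c point"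
    by (induction l') (auto simp: algebra_simps)
  have 2: "(\<Sum>(\<phi>, h)\<leftarrow>?m l. \<phi> t * h y) = (\<Sum>(\<phi>, h)\<leftarrow>l. \<phi> t * h y) * (\<Sum>(\<psi>, k)\<leftarrow>l'. \<psi> t * k y)" for t y l
    by (induction l) (auto simp: 1 distrib_right simp flip: map_map)
  have "eventually (\<lambda>t. \<forall>y. F t y * F' t y = (\<Sum>(\<phi>, h)\<leftarrow>?m l. \<phi> t * h y)) (nhds 0)"
    using l(2) l'(2) by eventually_elim (simp only: 2, simp)
  moreover have "\<forall>(\<phi>, h)\<in>set (?m l). \<phi> field_differentiable (at 0) \<and> h \<in> poly_functions C"
    using l(1) l'(1) by (fastforce intro!: field_differentiable_mult poly_functions.mult)
  ultimately show ?thesis unfolding separated_def by blast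
qed

lemma separated_flow:
  assumes "p \<in> poly_functions C"
  shows "separated (\<lambda>t y. p (act M (flow a t) y))" using assms
proof (induction rule: poly_functions.induct)
  case (coord c)
  have d: "(\<lambda>t. act M (flow a t) (unit_pt b) c) field_differentiable (at 0)" for b
    unfolding field_differentiable_def by (rule exI, rule flow_deriv[OF coord])
  have "separated (\<lambda>t y. \<Sum>b\<in>B. act M (flow a t) (unit_pt b) c * y b)" if "finite B" "B \<subseteq> C" for B
    using that
  proof (induction B rule: finite_induct)
    case empty
    show ?case using separated_poly[OF poly_functions.const[of 0]] by simp
  next
    case (insert b B)
    have "separated (\<lambda>t y. act M (flow a t) (unit_pt b) c * y b + (\<Sum>b\<in>B. act M (flow a t) (unit_pt b) c * y b))"
      by (rule separated_add[OF separatedI[OF d] insert.IH]) (use insert.prems in "auto intro: poly_functions.coord")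
    thus ?case by (simp only: sum.insert[OF insert.hyps])
  qed
  hence "separated (\<lambda>t y. \<Sum>b\<in>C. act M (flow a t) (unit_pt b) c * y b)" using finite_coords by blast
  thus ?case
  proof (rule separated_cong)
    show "\<forall>\<^sub>F t in nhds 0. \<forall>y. act M (flow a t) y c = (\<Sum>b\<in>C. act M (flow a t) (unit_pt b) c * y b)"
      using flow_grp[of a]
    proof eventually_elim
      case (elim t)
      show ?case by (intro allI trans[OF act_lin[OF elim coord]] sum.cong refl) (rule mult.commute)
    qed
  qed
qed (auto intro: separated_poly poly_functions.const separated_add separated_mult)

lemma poly_flow:
  assumes "p \<in> poly_functions C" "y \<in> affine_space C"
  shows "DERIV (\<lambda>t. p (act M (flow a t) y)) 0 :> E a p y"
proof -
  have "DERIV (\<lambda>t. p (act M (flow a t) y)) 0 :> (\<Sum>d\<in>C. pderiv_at d p (act M (flow a 0) y) * vf a y d)"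
    by (rule poly_curve[OF finite_coords assms(1)]) (rule flow_deriv)
  thus ?thesis unfolding flow_zero[OF assms(2)] by (simp only: E_def mult.commute)
qed

lemma separated_derivative:
  assumes F: "separated F" and x: "x \<in> points M" and v: "eventually (\<lambda>t. vanish x (F t)) (nhds 0)"
    and d: "\<And>y. y \<in> points M ==> DERIV (\<lambda>t. F t y) 0 :> D y"
  shows "vanish x D"
proof -
  obtain l where l: "\<forall>(\<phi>, h)\<in>set l. \<phi> field_differentiable (at 0) \<and> h \<in> poly_functions C"
    "eventually (\<lambda>t. \<forall>y. F t y = (\<Sum>(\<phi>, h)\<leftarrow>l. \<phi> t * h y)) (nhds 0)"
    using F unfolding separated_def by blast
  let ?\<phi> = "\<lambda>i. fst (l ! i)" and ?h = "\<lambda>i. snd (l ! i)"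
  have s: "(\<Sum>(\<phi>, h)\<leftarrow>l. \<phi> t * h y) = (\<Sum>i<length l. ?\<phi> i t * ?h i y)" for t y
    by (simp add: sum_list_sum_nth atLeast0LessThan case_prod_beta)
  have \<phi>: "?\<phi> i field_differentiable (at 0)" if "i < length l" for i
    using l(1) nth_mem[OF that] by (auto simp: case_prod_beta)
  have "vanish x (\<lambda>y. \<Sum>i<length l. deriv (?\<phi> i) 0 * ?h i y)"
  proof (rule vanish_derivative[OF \<phi> x])
    show "\<forall>\<^sub>F t in nhds 0. vanish x (\<lambda>y. \<Sum>i<length l. ?\<phi> i t * ?h i y)" using v l(2)
    proof eventually_elim
      case (elim t)
      hence "F t = (\<lambda>y. \<Sum>i<length l. ?\<phi> i t * ?h i y)" by (simp add: fun_eq_iff s)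
      thus ?case using elim(1) by simp
    qed
  qed
  moreover have "(\<Sum>i<length l. deriv (?\<phi> i) 0 * ?h i y) = D y" if y: "y \<in> points M" for y
  proof -
    have "DERIV (\<lambda>t. \<Sum>i<length l. ?\<phi> i t * ?h i y) 0 :> (\<Sum>i<length l. deriv (?\<phi> i) 0 * ?h i y)"
      by (intro DERIV_sum DERIV_cmult_right) (use \<phi> in "simp add: DERIV_deriv_iff_field_differentiable")
    moreover have "eventually (\<lambda>t. F t y = (\<Sum>i<length l. ?\<phi> i t * ?h i y)) (nhds 0)"
      using l(2) by eventually_elim (simp add: s)
    ultimately have "DERIV (\<lambda>t. F t y) 0 :> (\<Sum>i<length l. deriv (?\<phi> i) 0 * ?h i y)"
      by (subst DERIV_cong_ev[OF refl _ refl])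
    thus ?thesis using d[OF y] by (rule DERIV_unique)
  qed
  ultimately show ?thesis by (rule vanish_cong[OF _ near_true[OF x]])
qed

text \<open>The group moves the base point too, so the hypothesis concerns only elements that keep
  \<open>x\<close> in a neighbourhood. Writing h = p / r and clearing denominators gives polynomials
  along the flow that lie in the ideal for small time and are separated; their derivative at 0 is
  r^2 times \<open>E a h\<close> near \<open>x\<close>.\<close>

lemma E_vanish:
  assumes x: "x \<in> points M" and h: "reg_at x h"
    and inv: "\<exists>V. zariski_open C V \<and> x \<in> V \<and> (\<forall>g\<in>grp M. act M g x \<in> V \<longrightarrow> vanish x (\<lambda>y. h (act M g y) - h y))"
  shows "vanish x (E a h)"
proof -
  obtain V where V: "zariski_open C V" "x \<in> V" "V \<subseteq> points M" "regular_on C V h" using h unfolding reg_at_def by blast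
  obtain W where W: "zariski_open C W" "x \<in> W" "\<forall>g\<in>grp M. act M g x \<in> W \<longrightarrow> vanish x (\<lambda>y. h (act M g y) - h y)"
    using inv by blast
  obtain p r where p: "p \<in> poly_functions C" and r: "r \<in> poly_functions C" and rx: "r x \<noteq> 0"
    and e: "\<forall>y\<in>V. r y \<noteq> 0 \<longrightarrow> h y = p y / r y" using regular_onD[OF V(4,2)] by blast
  let ?U = "V \<inter> {y \<in> affine_space C. r y \<noteq> 0}"
  have U: "zariski_open C ?U" by (rule zariski_open_Int[OF V(1) zariski_open_nonzero[OF r]])
  have xa: "x \<in> affine_space C" using x zariski_open_subset[OF open_points] by blast
  have xU: "x \<in> ?U" using V(2) rx xa by simp
  interpret UW: affine_open C "?U \<inter> W" by (rule affine_open[OF zariski_open_Int[OF U W(1)]])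
  let ?A = "\<lambda>t. act M (flow a t)"
  have near_U: "near x (\<lambda>y. y \<in> ?U)" unfolding near_def using U xU V(3) by blast
  have stay: "eventually (\<lambda>t. ?A t x \<in> ?U \<inter> W) (nhds 0)"
    by (rule UW.curve_stays[where \<gamma>' = "vf a x"]) (use flow_deriv act_affine xU W(2) flow_zero[OF xa] in auto)
  let ?N = "\<lambda>t y. p (?A t y) * r y + (- p y) * r (?A t y)"
  have "separated ?N" by (intro separated_add separated_mult separated_flow separated_poly p r poly_uminus)
  moreover have "eventually (\<lambda>t. vanish x (?N t)) (nhds 0)" using stay flow_grp[of a]
  proof eventually_elim
    case (elim t)
    hence g: "flow a t \<in> grp M" and AU: "?A t x \<in> ?U" and AW: "?A t x \<in> W" by auto
    have nA: "near x (\<lambda>y. ?A t y \<in> ?U)"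
      by (rule near_act[OF g x]) (use U AU V(3) in "unfold near_def, blast")
    have rr: "reg_at x (\<lambda>y. r y * r (?A t y))"
      by (intro reg_atI[OF regular_poly x] poly_functions.mult r poly_act g)
    have "vanish x (\<lambda>y. (r y * r (?A t y)) * (h (?A t y) - h y))"
      by (rule vanish_mult[OF rr]) (use W(3) g AW in blast)
    thus "vanish x (?N t)"
    proof (rule vanish_cong)
      show "near x (\<lambda>y. (r y * r (?A t y)) * (h (?A t y) - h y) = ?N t y)" using near_conj[OF near_U nA]
        by (rule near_mono) (use e in "auto simp: field_simps")
    qed
  qed
  moreover have "DERIV (\<lambda>t. ?N t y) 0 :> E a p y * r y + (- p y) * E a r y" if "y \<in> points M" for y
  proof -
    have ya: "y \<in> affine_space C" using that zariski_open_subset[OF open_points] by blast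
    show ?thesis by (intro DERIV_add DERIV_cmult DERIV_cmult_right poly_flow p r ya)
  qed
  ultimately have N: "vanish x (\<lambda>y. E a p y * r y + (- p y) * E a r y)" by (rule separated_derivative[OF _ x])
  have "regular_on C ?U (\<lambda>y. inverse (r y * r y))"
    by (rule regular_inverse[OF regular_poly[OF poly_functions.mult[OF r r]]]) simp
  hence "reg_at x (\<lambda>y. inverse (r y * r y))" unfolding reg_at_def using U xU V(3) by blast
  from vanish_mult[OF this N] show ?thesis
  proof (rule vanish_cong)
    interpret V: affine_open C V by (rule affine_open[OF V(1)])
    show "near x (\<lambda>y. inverse (r y * r y) * (E a p y * r y + (- p y) * E a r y) = E a h y)"
    proof (rule near_mono[OF near_U])
      fix y assume y: "y \<in> ?U"
      have "pderiv_at d h y = inverse (r y * r y) * (pderiv_at d p y * r y - p y * pderiv_at d r y)" if "d \<in> C" for d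
        using V.pderiv_quotient[of r h p y d] e p r y that by (simp add: divide_inverse mult.commute)
      hence "E a h y = (\<Sum>d\<in>C. vf a y d * (inverse (r y * r y) * (pderiv_at d p y * r y - p y * pderiv_at d r y)))"
        unfolding E_def by simp
      also have "\<dots> = inverse (r y * r y) * (E a p y * r y + (- p y) * E a r y)"
        unfolding E_def by (simp add: sum_distrib_left sum_distrib_right algebra_simps sum_subtractf sum_negf)
      finally show "inverse (r y * r y) * (E a p y * r y + (- p y) * E a r y) = E a h y" by simp
    qed
  qed
qed

end

lemma sum_swap3: "(\<Sum>c\<in>C. \<Sum>d\<in>D. \<Sum>b\<in>B. F c d b) = (\<Sum>b\<in>B. \<Sum>c\<in>C. \<Sum>d\<in>D. F c d b)"
proof -
  have "(\<Sum>c\<in>C. \<Sum>d\<in>D. \<Sum>b\<in>B. F c d b) = (\<Sum>c\<in>C. \<Sum>b\<in>B. \<Sum>d\<in>D. F c d b)"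
    by (intro sum.cong refl sum.swap)
  thus ?thesis by (simp only: sum.swap[of _ B C])
qed

lemma sum_swap4: "(\<Sum>c\<in>C. \<Sum>d\<in>D. \<Sum>a\<in>A. \<Sum>b\<in>B. F c d a b) = (\<Sum>a\<in>A. \<Sum>b\<in>B. \<Sum>c\<in>C. \<Sum>d\<in>D. F c d a b)"
  unfolding sum_swap3[of "\<lambda>c d a. \<Sum>b\<in>B. F c d a b"] by (intro sum.cong refl sum_swap3)

context reduction
begin

subsection \<open>Brackets of germs\<close>

abbreviation bk where "bk \<equiv> bivector_bracket C"

text \<open>Infinitesimal invariance modulo the ideal; by \<open>section_inv_germ\<close> the
  representatives of functions on the quotient have this property.\<close>

definition inv_germ :: "'c point => ('c point => complex) => bool" where
  "inv_germ x f \<longleftrightarrow> reg_at x f \<and> (\<forall>a\<in>G. vanish x (E a f))"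

text \<open>The last part is the moment map condition in the form used for reduction: the
  Hamiltonian fields of the entries of the moment map are combinations of the generating fields with
  regular coefficients. It is linear in \<open>T\<close>, and so passes to combinations
  (\<open>compatible_lin\<close>).\<close>

definition compatible :: "'c tensor2 => bool" where
  "compatible T \<longleftrightarrow> altM T \<and> invariant_bivector M T \<and>
    (\<exists>\<kappa>. (\<forall>b\<in>G. \<forall>a\<in>G. regM (\<kappa> b a)) \<and>
      (\<forall>b\<in>G. \<forall>y\<in>points M. \<forall>d\<in>C. (\<Sum>c\<in>C. T y c d * pderiv_at c (\<lambda>y. \<Phi> y b) y)
         = (\<Sum>a\<in>G. \<kappa> b a y * vf a y d)))"

lemma near_pderivs:
  assumes "reg_at x f" "reg_at x h"
  shows "near x (\<lambda>y. \<forall>c\<in>C. pderiv_at c (\<lambda>y. f y + h y) y = pderiv_at c f y + pderiv_at c h y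
    \<and> pderiv_at c (\<lambda>y. f y - h y) y = pderiv_at c f y - pderiv_at c h y
    \<and> pderiv_at c (\<lambda>y. k * f y) y = k * pderiv_at c f y
    \<and> pderiv_at c (\<lambda>y. f y * h y) y = f y * pderiv_at c h y + pderiv_at c f y * h y)"
proof -
  have n: "near x (\<lambda>_. True)" using near_true[OF reg_at_points[OF assms(1)]] by simp
  have r: "reg_at x (if b then f else h)" for b using assms by simp
  obtain V where V: "zariski_open C V" "x \<in> V" "V \<subseteq> points M" "\<And>b. b \<in> UNIV ==> regular_on C V (if b then f else h)"
    by (rule reg_at_near[of x "\<lambda>_. True" "UNIV :: bool set" "\<lambda>b. if b then f else h"]) (use n r in auto)
  have fh: "regular_on C V f" "regular_on C V h" using V(4)[of True] V(4)[of False] by simp_all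
  interpret V: affine_open C V by (rule affine_open[OF V(1)])
  show ?thesis
    unfolding near_def using V(1-3) V.pderiv_add[OF fh] V.pderiv_diff[OF fh] V.pderiv_cmult[OF fh(1)] V.pderiv_mult[OF fh]
    by (intro exI[of _ V]) auto
qed

lemma reg_at_bk:
  assumes T: "altM T" and f: "reg_at x f" and h: "reg_at x h"
  shows "reg_at x (bk T f h)"
proof -
  have x: "x \<in> points M" by (rule reg_at_points[OF f])
  have "reg_at x (\<lambda>y. \<Sum>c\<in>C. \<Sum>d\<in>C. T y c d * pderiv_at c f y * pderiv_at d h y)"
  proof (intro reg_at_sum[OF x] reg_at_mult)
    fix c d assume c: "c \<in> C" and d: "d \<in> C"
    show "reg_at x (\<lambda>y. T y c d)" by (rule reg_atI[OF _ x]) (use T c d in "simp add: alternating_field_def")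
    show "reg_at x (pderiv_at c f)" "reg_at x (pderiv_at d h)"
      by (rule reg_at_pderiv[OF f c], rule reg_at_pderiv[OF h d])
  qed
  thus ?thesis unfolding bivector_bracket_def[abs_def] .
qed

lemma bk_swap:
  assumes T: "altM T" and y: "y \<in> points M"
  shows "bk T f h y = - bk T h f y"
proof -
  have a: "T y c d = - T y d c" for c d using T y unfolding alternating_field_def by blast
  have "bk T f h y = (\<Sum>d\<in>C. \<Sum>c\<in>C. T y c d * pderiv_at c f y * pderiv_at d h y)"
    unfolding bivector_bracket_def by (rule sum.swap)
  also have "\<dots> = - bk T h f y" unfolding bivector_bracket_def sum_negf[symmetric]
    by (intro sum.cong refl) (subst a, simp add: mult_ac)
  finally show ?thesis .
qed

lemma
  assumes "reg_at x h" "reg_at x h'"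
  shows bk_add: "near x (\<lambda>y. bk T f (\<lambda>y. h y + h' y) y = bk T f h y + bk T f h' y)"
    and bk_diff: "near x (\<lambda>y. bk T f (\<lambda>y. h y - h' y) y = bk T f h y - bk T f h' y)"
    and bk_scale: "near x (\<lambda>y. bk T f (\<lambda>y. k * h y) y = k * bk T f h y)"
    and bk_mult: "near x (\<lambda>y. bk T f (\<lambda>y. h y * h' y) y = bk T f h y * h' y + h y * bk T f h' y)"
  by (rule near_mono[OF near_pderivs[OF assms, of k]], simp add: bivector_bracket_def cong: sum.cong,
      simp add: sum.distrib sum_subtractf sum_distrib_left sum_distrib_right algebra_simps)+

lemma bk_moment:
  assumes "\<forall>y\<in>points M. \<forall>d\<in>C. (\<Sum>c\<in>C. T y c d * pderiv_at c (\<lambda>y. \<Phi> y b) y)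
         = (\<Sum>a\<in>G. \<kappa> b a y * vf a y d)" "y \<in> points M"
  shows "bk T (\<lambda>y. \<Phi> y b) h y = (\<Sum>a\<in>G. \<kappa> b a y * E a h y)"
proof -
  have "bk T (\<lambda>y. \<Phi> y b) h y = (\<Sum>d\<in>C. (\<Sum>c\<in>C. T y c d * pderiv_at c (\<lambda>y. \<Phi> y b) y) * pderiv_at d h y)"
    unfolding bivector_bracket_def sum_distrib_right by (rule sum.swap)
  also have "\<dots> = (\<Sum>d\<in>C. \<Sum>a\<in>G. \<kappa> b a y * (vf a y d * pderiv_at d h y))"
    using assms by (intro sum.cong refl) (simp add: sum_distrib_right mult.assoc)
  also have "\<dots> = (\<Sum>a\<in>G. \<kappa> b a y * E a h y)" unfolding E_def sum_distrib_left by (rule sum.swap)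
  finally show ?thesis .
qed

text \<open>By the Leibniz rule a term u(\<Phi> - q) contributes u{\<Phi>, h} + {u, h}(\<Phi> - q).
  The second part is visibly in the ideal; the first is so because {\<Phi>, h} is a combination of
  the derivatives of h along the generators, and h is invariant modulo the ideal.\<close>

lemma vanish_bk:
  assumes T: "compatible T" and f: "vanish x f" and h: "inv_germ x h"
  shows "vanish x (bk T f h)"
proof -
  have x: "x \<in> points M" using f vanish_reg reg_at_points by blast
  obtain u where u: "\<forall>b\<in>G. reg_at x (u b)" "near x (\<lambda>y. f y = (\<Sum>b\<in>G. u b y * (\<Phi> y b - q b)))"
    using f unfolding vanish_def by blast
  obtain \<kappa> where \<kappa>: "\<forall>b\<in>G. \<forall>a\<in>G. regM (\<kappa> b a)"
    "\<forall>b\<in>G. \<forall>y\<in>points M. \<forall>d\<in>C. (\<Sum>c\<in>C. T y c d * pderiv_at c (\<lambda>y. \<Phi> y b) y)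
         = (\<Sum>a\<in>G. \<kappa> b a y * vf a y d)" and alt: "altM T"
    using T unfolding compatible_def by (elim conjE exE)
  let ?p = "\<lambda>c y b. u b y * pderiv_at c (\<lambda>y. \<Phi> y b) y + pderiv_at c (u b) y * (\<Phi> y b - q b)" and ?S = "\<lambda>y. \<Sum>b\<in>G. u b y * bk T (\<lambda>y. \<Phi> y b) h y + bk T (u b) h y * (\<Phi> y b - q b)"
  have hr: "reg_at x h" and hv: "\<And>a. a \<in> G ==> vanish x (E a h)" using h by (auto simp: inv_germ_def)
  have bm: "vanish x (bk T (\<lambda>y. \<Phi> y b) h)" if b: "b \<in> G" for b
  proof -
    have "vanish x (\<lambda>y. \<Sum>a\<in>G. \<kappa> b a y * E a h y)"
      by (rule vanish_sum[OF x], rule vanish_mult[OF reg_atI[OF _ x] hv]) (use \<kappa>(1) b in auto)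
    thus ?thesis by (rule vanish_cong) (rule near_true[OF x], rule bk_moment[symmetric], use \<kappa>(2) b in auto)
  qed
  have v: "vanish x ?S" by (rule vanish_sum[OF x], rule vanish_add; rule vanish_mult)
      (use u(1) bm vanish_moment[OF x] reg_at_bk[OF alt _ hr] in auto)
  obtain V where V: "zariski_open C V" "x \<in> V" "V \<subseteq> points M" "\<And>b. b \<in> G ==> regular_on C V (u b)"
    "\<And>y. y \<in> V ==> f y = (\<Sum>b\<in>G. u b y * (\<Phi> y b - q b))"
    by (rule reg_at_near[OF u(2) finite_gbasis, of u]) (use u(1) in auto)
  interpret V: affine_open C V by (rule affine_open[OF V(1)])
  have m: "regular_on C V (\<lambda>y. \<Phi> y b)" if "b \<in> G" for b
    by (rule regular_subset[OF moment_regular[OF that] V(3)])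
  have "pderiv_at c f y = sum (?p c y) G"
    if y: "y \<in> V" and c: "c \<in> C" for y c
  proof -
    have "pderiv_at c f y = pderiv_at c (\<lambda>y. \<Sum>b\<in>G. u b y * (\<Phi> y b - q b)) y"
      by (rule V.pderiv_cong[OF V(5) y c])
    also have "\<dots> = (\<Sum>b\<in>G. pderiv_at c (\<lambda>y. u b y * (\<Phi> y b - q b)) y)"
      by (rule V.pderiv_sum[OF _ y c]) (intro regular_intros V(4) m)
    also have "\<dots> = sum (?p c y) G"
      by (rule sum.cong) (use y c in "simp_all add: V.pderiv_mult V.pderiv_diff V(4) m regular_intros")
    finally show ?thesis .
  qed
  note pd = this
  have "bk T f h y = ?S y" if y: "y \<in> V" for y
  proof -
    have "bk T f h y = (\<Sum>c\<in>C. \<Sum>d\<in>C. \<Sum>b\<in>G. T y c d * ?p c y b * pderiv_at d h y)"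
      unfolding bivector_bracket_def by (intro sum.cong refl) (simp only: pd[OF y] sum_distrib_left sum_distrib_right)
    also have "\<dots> = (\<Sum>b\<in>G. \<Sum>c\<in>C. \<Sum>d\<in>C. T y c d * ?p c y b * pderiv_at d h y)"
      by (rule sum_swap3)
    also have "\<dots> = ?S y"
      unfolding bivector_bracket_def sum_distrib_left sum_distrib_right sum.distrib[symmetric]
      by (intro sum.cong refl) (simp add: algebra_simps)
    finally show ?thesis .
  qed
  hence "near x (\<lambda>y. ?S y = bk T f h y)" unfolding near_def using V(1-3) by (intro exI[of _ V]) simp
  with v show ?thesis by (rule vanish_cong)
qed

lemma near_vanish:
  assumes f: "vanish x f"
  shows "near x (\<lambda>y. vanish y f)"
proof -
  from assms have "geq x f (\<lambda>_. 0)" using reg_at_const[OF reg_at_points[OF vanish_reg[OF f]]] by (simp add: geq_iff vanish_reg)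
  hence "near x (\<lambda>y. geq y f (\<lambda>_. 0))" unfolding germ_eq_def near_def by blast
  thus ?thesis by (rule near_mono) (simp add: geq_iff)
qed

lemma near_geq: "geq x f h ==> near x (\<lambda>y. geq y f h)" unfolding germ_eq_def near_def by blast

text \<open>Membership in the ideal is an open condition and is preserved by the group, so near
  \<open>x\<close> the difference of \<open>f\<close> and its translate lies in the ideal, as
  \<open>E_vanish\<close> requires.\<close>

lemma E_vanish_ideal:
  assumes f: "vanish x f"
  shows "vanish x (E a f)"
proof -
  have x: "x \<in> points M" by (rule reg_at_points[OF vanish_reg[OF f]])
  obtain V where V: "zariski_open C V" "x \<in> V" "\<forall>y\<in>V. vanish y f"
    using near_vanish[OF f] unfolding near_def by blast
  show ?thesis by (rule E_vanish[OF x vanish_reg[OF f]], intro exI[of _ V])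
      (use V f in "auto intro!: vanish_diff vanish_act[OF _ x, where f = f]")
qed

lemma near_E:
  assumes "reg_at x f" "reg_at x h"
  shows "near x (\<lambda>y. E a (\<lambda>y. f y + h y) y = E a f y + E a h y \<and> E a (\<lambda>y. f y - h y) y = E a f y - E a h y
    \<and> E a (\<lambda>y. k * f y) y = k * E a f y \<and> E a (\<lambda>y. f y * h y) y = f y * E a h y + h y * E a f y)"
  by (rule near_mono[OF near_pderivs[OF assms, of k]], simp add: E_def cong: sum.cong)
    (simp add: sum.distrib sum_subtractf sum_distrib_left algebra_simps)

lemma inv_germI:
  assumes "reg_at x k" "\<And>a. a \<in> G ==> vanish x (r a)" "\<And>a. near x (\<lambda>y. r a y = E a k y)"
  shows "inv_germ x k" unfolding inv_germ_def by (intro conjI ballI assms(1)) (rule vanish_cong[OF assms(2,3)])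

lemma
  assumes f: "inv_germ x f" and h: "inv_germ x h"
  shows inv_germ_add: "inv_germ x (\<lambda>y. f y + h y)" and inv_germ_mult: "inv_germ x (\<lambda>y. f y * h y)"
proof -
  have r: "reg_at x f" "reg_at x h" using f h by (simp_all add: inv_germ_def)
  have v: "vanish x (\<lambda>y. E a f y + E a h y)" "vanish x (\<lambda>y. f y * E a h y + h y * E a f y)" if "a \<in> G" for a
    using f h that by (simp_all add: inv_germ_def vanish_add vanish_mult)
  have n: "near x (\<lambda>y. E a f y + E a h y = E a (\<lambda>y. f y + h y) y)"
    "near x (\<lambda>y. f y * E a h y + h y * E a f y = E a (\<lambda>y. f y * h y) y)" for a
    by (rule near_mono[OF near_E[OF r, of a 0]], simp)+
  show "inv_germ x (\<lambda>y. f y + h y)" by (rule inv_germI[OF reg_at_add[OF r] v(1) n(1)])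
  show "inv_germ x (\<lambda>y. f y * h y)" by (rule inv_germI[OF reg_at_mult[OF r] v(2) n(2)])
qed

lemma inv_germ_scale:
  assumes f: "inv_germ x f"
  shows "inv_germ x (\<lambda>y. k * f y)"
proof -
  have v: "vanish x (\<lambda>y. k * E a f y)" if "a \<in> G" for a
    using f that by (simp add: inv_germ_def vanish_scale)
  have r: "reg_at x f" using f by (simp add: inv_germ_def)
  have n: "near x (\<lambda>y. k * E a f y = E a (\<lambda>y. k * f y) y)" for a
    by (rule near_mono[OF near_E[OF r r, of a k]]) simp
  show ?thesis by (rule inv_germI[OF reg_at_mult[OF reg_at_const[OF reg_at_points[OF r]] r] v n])
qed

lemma inv_germ_geq:
  assumes f: "inv_germ x f" and g: "geq x h f"
  shows "inv_germ x h"
proof -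
  have r: "reg_at x h" "reg_at x f" using g by (simp_all add: geq_iff)
  have v: "vanish x (\<lambda>y. E a (\<lambda>y. h y - f y) y + E a f y)" if "a \<in> G" for a
    using f g that by (simp add: inv_germ_def geq_iff vanish_add E_vanish_ideal)
  have n: "near x (\<lambda>y. E a (\<lambda>y. h y - f y) y + E a f y = E a h y)" for a
    by (rule near_mono[OF near_E[OF r, of a 0]]) simp
  show ?thesis by (rule inv_germI[OF r(1) v n])
qed

text \<open>{f, h} - {f', h'} = {f - f', h'} + {f, h - h'}, and in each bracket one entry lies in
  the ideal while the other is invariant modulo it.\<close>

lemma geq_bk:
  assumes T: "compatible T" and f: "geq x f f'" "inv_germ x f" and h: "geq x h h'" "inv_germ x h"
  shows "geq x (bk T f h) (bk T f' h')"
proof -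
  have alt: "altM T" using T by (simp add: compatible_def)
  have f': "inv_germ x f'" and h': "inv_germ x h'" using inv_germ_geq f h geq_sym by blast+
  have r: "reg_at x f" "reg_at x f'" "reg_at x h" "reg_at x h'" using f h by (simp_all add: geq_iff)
  have 1: "vanish x (bk T (\<lambda>y. h y - h' y) f)" and 2: "vanish x (bk T (\<lambda>y. f y - f' y) h')"
    using f h h' by (auto intro!: vanish_bk[OF T] simp: geq_iff)
  have "vanish x (\<lambda>y. bk T (\<lambda>y. f y - f' y) h' y - bk T (\<lambda>y. h y - h' y) f y)"
    by (rule vanish_diff[OF 2 1])
  moreover have "near x (\<lambda>y. bk T (\<lambda>y. f y - f' y) h' y - bk T (\<lambda>y. h y - h' y) f y = bk T f h y - bk T f' h' y)"
    using near_conj[OF bk_diff[OF r(1,2), of T h'] bk_diff[OF r(3,4), of T f]]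
  proof (rule near_mono)
    fix y assume y: "y \<in> points M"
      and e: "bk T h' (\<lambda>y. f y - f' y) y = bk T h' f y - bk T h' f' y \<and> bk T f (\<lambda>y. h y - h' y) y = bk T f h y - bk T f h' y"
    show "bk T (\<lambda>y. f y - f' y) h' y - bk T (\<lambda>y. h y - h' y) f y = bk T f h y - bk T f' h' y"
      unfolding bk_swap[OF alt y, of "\<lambda>y. f y - f' y" h'] bk_swap[OF alt y, of "\<lambda>y. h y - h' y" f] conjunct1[OF e] conjunct2[OF e]
        bk_swap[OF alt y, of h' f] bk_swap[OF alt y, of h' f'] by simp
  qed
  ultimately show ?thesis unfolding geq_iff by (intro conjI reg_at_bk[OF alt] r) (rule vanish_cong)
qed

lemma bk_act:
  assumes T: "invariant_bivector M T" and g: "g \<in> grp M" and y: "y \<in> points M"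
    and f: "reg_at (act M g y) f" and h: "reg_at (act M g y) h"
  shows "bk T (\<lambda>y. f (act M g y)) (\<lambda>y. h (act M g y)) y = bk T f h (act M g y)"
proof -
  let ?A = "\<lambda>a c. act M g (unit_pt a) c"
  have "T (act M g y) c d = (\<Sum>a\<in>C. \<Sum>b\<in>C. T y a b * ?A a c * ?A b d)" if "c \<in> C" "d \<in> C" for c d
    using T g y that unfolding invariant_bivector_def bivector_bracket_def by (simp add: pderiv_act_coord)
  hence "bk T f h (act M g y)
    = (\<Sum>c\<in>C. \<Sum>d\<in>C. \<Sum>a\<in>C. \<Sum>b\<in>C. T y a b * (pderiv_at c f (act M g y) * ?A a c) * (pderiv_at d h (act M g y) * ?A b d))"
    unfolding bivector_bracket_def by (intro sum.cong refl) (simp add: sum_distrib_left sum_distrib_right mult_ac)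
  also have "\<dots> = (\<Sum>a\<in>C. \<Sum>b\<in>C. \<Sum>c\<in>C. \<Sum>d\<in>C. T y a b * (pderiv_at c f (act M g y) * ?A a c) * (pderiv_at d h (act M g y) * ?A b d))"
    by (rule sum_swap4)
  also have "\<dots> = bk T (\<lambda>y. f (act M g y)) (\<lambda>y. h (act M g y)) y" unfolding bivector_bracket_def
    by (intro sum.cong refl) (simp add: pderiv_act[OF g f] pderiv_act[OF g h] sum_product sum_distrib_left mult_ac)
  finally show ?thesis by simp
qed

subsection \<open>Invariant sections and the reduced pencil\<close>

abbreviation pre where "pre U \<equiv> quot_preimage M Z U"
abbreviation OU where "OU U \<equiv> quot_functions M \<Phi> q Z U"
abbreviation gc where "gc \<equiv> germ_class M \<Phi> q"

lemma pre_points: "x \<in> pre U ==> x \<in> points M" using Z_points by (auto simp: quot_preimage_def)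

text \<open>The class of a point in the quotient depends only on its orbit.\<close>

lemma pre_act: "g \<in> grp M ==> x \<in> pre U ==> act M g x \<in> pre U"
  by (auto simp: quot_preimage_def Z_act quot_map_def orbit_act)

lemma section_germ:
  assumes s: "\<sigma> \<in> OU U" and x: "x \<in> pre U"
  obtains f where "f \<in> \<sigma> x"
proof -
  obtain V f where V: "zariski_open C V" "x \<in> V" "V \<subseteq> points M" "regular_on C V f" "\<forall>y\<in>V \<inter> pre U. \<sigma> y = gc f y"
    using s x unfolding quot_functions_def fibre_sections_def by blast
  hence "f \<in> gc f x" unfolding germ_class_def by (auto intro!: geq_refl simp: reg_at_def)
  thus thesis using V(2,5) x that by blast
qed

lemma section_class:
  assumes s: "\<sigma> \<in> OU U" and x: "x \<in> pre U" and f: "f \<in> \<sigma> x"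
  shows "\<sigma> x = gc f x" and "near x (\<lambda>y. y \<in> pre U \<longrightarrow> f \<in> \<sigma> y)"
proof -
  obtain V h where V: "zariski_open C V" "x \<in> V" "V \<subseteq> points M" "regular_on C V h" "\<forall>y\<in>V \<inter> pre U. \<sigma> y = gc h y"
    using s x unfolding quot_functions_def fibre_sections_def by blast
  have sx: "\<sigma> x = gc h x" using V(2,5) x by blast
  hence fh: "geq x f h" using f by (simp add: germ_class_def)
  hence "reg_at x f" by (simp add: geq_iff)
  thus "\<sigma> x = gc f x" unfolding sx using germ_class_iff[of x f h] fh by simp
  have "near x (\<lambda>y. y \<in> V)" unfolding near_def using V(1-3) by blast
  from near_conj[OF this near_geq[OF fh]] show "near x (\<lambda>y. y \<in> pre U \<longrightarrow> f \<in> \<sigma> y)"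
    by (rule near_mono) (use V(5) in "auto simp: germ_class_def")
qed

lemma section_reg: "\<sigma> \<in> OU U ==> x \<in> pre U ==> f \<in> \<sigma> x ==> reg_at x f"
  using section_class(1)[of \<sigma> U x f] unfolding germ_class_def geq_iff by blast

text \<open>One representative serves all points of the preimage near \<open>x\<close>, so
  invariance of the section compares \<open>f\<close> with its own translates as long as these stay
  near \<open>x\<close>; this is the hypothesis of \<open>E_vanish\<close>.\<close>

lemma section_inv_germ:
  assumes s: "\<sigma> \<in> OU U" and x: "x \<in> pre U" and f: "f \<in> \<sigma> x"
  shows "inv_germ x f"
proof -
  have r: "reg_at x f" by (rule section_reg[OF s x f])
  obtain V where V: "zariski_open C V" "x \<in> V" "\<forall>y\<in>V. y \<in> pre U \<longrightarrow> f \<in> \<sigma> y"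
    using section_class(2)[OF s x f] unfolding near_def by blast
  have "vanish x (\<lambda>y. f (act M g y) - f y)" if g: "g \<in> grp M" and gV: "act M g x \<in> V" for g
  proof -
    have "f \<in> \<sigma> (act M g x)" using V(3) gV pre_act[OF g x] by blast
    hence "(\<lambda>y. f (act M g y)) \<in> \<sigma> x"
      using s x g unfolding quot_functions_def invariant_section_def by blast
    hence "geq x (\<lambda>y. f (act M g y)) f" unfolding section_class(1)[OF s x f] by (simp add: germ_class_def)
    thus ?thesis by (simp add: geq_iff)
  qed
  hence "vanish x (E a f)" for a using E_vanish[OF pre_points[OF x] r] V(1,2) by blast
  thus ?thesis using r by (simp add: inv_germ_def)
qed

lemma gc_eqI: "geq x f h ==> gc f x = gc h x" using germ_class_iff[of x f h] by (simp add: geq_iff)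

lemma gc_self: "reg_at x f ==> f \<in> gc f x" by (simp add: germ_class_def geq_refl)

definition reps :: "'c point => 'c fibre_section => ('c point => complex) => bool" where
  "reps x \<sigma> f \<longleftrightarrow> \<sigma> x = gc f x"

lemma section_reps: "\<sigma> \<in> OU U ==> x \<in> pre U ==> f \<in> \<sigma> x ==> reps x \<sigma> f"
  unfolding reps_def by (rule section_class(1))

lemma reps_eq: "reps x \<sigma> f ==> reps x \<tau> f ==> \<sigma> x = \<tau> x" by (simp add: reps_def)

lemma reps_geq: "reps x \<sigma> f ==> geq x f h ==> reps x \<sigma> h" by (simp add: reps_def gc_eqI)

lemma reps_add:
  "reps x \<sigma> f ==> reps x \<tau> h ==> reg_at x f ==> reg_at x h ==> reps x (section_add M \<Phi> q \<sigma> \<tau>) (\<lambda>y. f y + h y)"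
  unfolding section_add_def germ_class_def reps_def by (auto intro: geq_trans[OF _ geq_add] geq_refl)

lemma reps_mult:
  "reps x \<sigma> f ==> reps x \<tau> h ==> reg_at x f ==> reg_at x h ==> reps x (section_mult M \<Phi> q \<sigma> \<tau>) (\<lambda>y. f y * h y)"
  unfolding section_mult_def germ_class_def reps_def by (auto intro: geq_trans[OF _ geq_mult] geq_refl)

lemma reps_scale: "reps x \<sigma> f ==> reg_at x f ==> reps x (section_scale M \<Phi> q k \<sigma>) (\<lambda>y. k * f y)"
  unfolding section_scale_def germ_class_def reps_def by (auto intro: geq_trans[OF _ geq_scale] geq_refl)

lemma reps_comb:
  assumes x: "x \<in> points M" and \<sigma>: "\<And>k. k \<in> K ==> reps x (\<sigma> k) (f k)" and r: "\<And>k. k \<in> K ==> reg_at x (f k)"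
  shows "reps x (section_comb M \<Phi> q K w \<sigma>) (\<lambda>y. \<Sum>k\<in>K. w k * f k y)" unfolding reps_def
proof (rule Set.set_eqI)
  fix h
  show "h \<in> section_comb M \<Phi> q K w \<sigma> x \<longleftrightarrow> h \<in> gc (\<lambda>y. \<Sum>k\<in>K. w k * f k y) x"
  proof
    assume "h \<in> section_comb M \<Phi> q K w \<sigma> x"
    then obtain f' where f': "\<forall>k\<in>K. f' k \<in> \<sigma> k x" "geq x h (\<lambda>y. \<Sum>k\<in>K. w k * f' k y)"
      unfolding section_comb_def by blast
    have "geq x (\<lambda>y. \<Sum>k\<in>K. w k * f' k y) (\<lambda>y. \<Sum>k\<in>K. w k * f k y)"
      by (rule geq_sum[OF x], rule geq_scale) (use f'(1) \<sigma> in "auto simp: germ_class_def reps_def")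
    with f'(2) show "h \<in> gc (\<lambda>y. \<Sum>k\<in>K. w k * f k y) x"
      unfolding germ_class_def by (auto intro: geq_trans)
  next
    assume h: "h \<in> gc (\<lambda>y. \<Sum>k\<in>K. w k * f k y) x"
    have "\<forall>k\<in>K. f k \<in> \<sigma> k x" using \<sigma> r gc_self by (auto simp: reps_def)
    with h show "h \<in> section_comb M \<Phi> q K w \<sigma> x" unfolding section_comb_def germ_class_def by auto
  qed
qed

text \<open>All germs that agree modulo the ideal with a bracket of representatives. By
  \<open>geq_bk\<close> they form a single class when the representatives are invariant modulo the
  ideal.\<close>

definition br :: "'c tensor2 => 'c fibre_section => 'c fibre_section => 'c fibre_section" where
  "br T \<sigma> \<tau> x = {k. \<exists>f\<in>\<sigma> x. \<exists>h\<in>\<tau> x. geq x k (bk T f h)}"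

lemma reps_br:
  assumes T: "compatible T" and "reps x \<sigma> f" and "reps x \<tau> h" and f: "inv_germ x f" and h: "inv_germ x h"
  shows "reps x (br T \<sigma> \<tau>) (bk T f h)" unfolding reps_def
proof (rule Set.set_eqI)
  have \<sigma>: "\<sigma> x = gc f x" and \<tau>: "\<tau> x = gc h x" using assms(2,3) by (simp_all add: reps_def)
  fix k
  show "k \<in> br T \<sigma> \<tau> x \<longleftrightarrow> k \<in> gc (bk T f h) x"
  proof
    assume "k \<in> br T \<sigma> \<tau> x"
    then obtain f' h' where "geq x f' f" "geq x h' h" "geq x k (bk T f' h')"
      unfolding br_def \<sigma> \<tau> germ_class_def by blast
    thus "k \<in> gc (bk T f h) x"
      using geq_trans geq_bk[OF T _ inv_germ_geq[OF f] _ inv_germ_geq[OF h]] unfolding germ_class_def by blast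
  next
    assume "k \<in> gc (bk T f h) x"
    moreover have "f \<in> \<sigma> x" "h \<in> \<tau> x" unfolding \<sigma> \<tau> using f h by (auto simp: inv_germ_def intro: gc_self)
    ultimately show "k \<in> br T \<sigma> \<tau> x" unfolding br_def germ_class_def by blast
  qed
qed

lemma br_at:
  assumes T: "compatible T" and s: "\<sigma> \<in> OU U" and t: "\<tau> \<in> OU U" and x: "x \<in> pre U" and f: "f \<in> \<sigma> x" and h: "h \<in> \<tau> x"
  shows "reps x (br T \<sigma> \<tau>) (bk T f h)"
  by (rule reps_br[OF T section_reps[OF s x f] section_reps[OF t x h] section_inv_germ[OF s x f] section_inv_germ[OF t x h]])

lemma compatible_alt: "compatible T ==> altM T" by (simp add: compatible_def)

lemma br_closed:
  assumes T: "compatible T" and s: "\<sigma> \<in> OU U" and t: "\<tau> \<in> OU U"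
  shows "br T \<sigma> \<tau> \<in> OU U" unfolding quot_functions_def
proof (intro CollectI conjI)
  note alt = compatible_alt[OF T]
  show "br T \<sigma> \<tau> \<in> fibre_sections M \<Phi> q (pre U)" unfolding fibre_sections_def
  proof (intro CollectI ballI)
    fix x assume x: "x \<in> pre U"
    obtain f where f: "f \<in> \<sigma> x" by (rule section_germ[OF s x])
    obtain h where h: "h \<in> \<tau> x" by (rule section_germ[OF t x])
    have n: "near x (\<lambda>y. (y \<in> pre U \<longrightarrow> f \<in> \<sigma> y) \<and> (y \<in> pre U \<longrightarrow> h \<in> \<tau> y))"
      by (rule near_conj[OF section_class(2)[OF s x f] section_class(2)[OF t x h]])
    have r: "reg_at x (bk T f h)" by (rule reg_at_bk[OF alt section_reg[OF s x f] section_reg[OF t x h]])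
    obtain V where V: "zariski_open C V" "x \<in> V" "V \<subseteq> points M" "\<And>b. b \<in> {()} ==> regular_on C V (bk T f h)"
      "\<And>y. y \<in> V ==> (y \<in> pre U \<longrightarrow> f \<in> \<sigma> y) \<and> (y \<in> pre U \<longrightarrow> h \<in> \<tau> y)"
      by (rule reg_at_near[OF n, of "{()}" "\<lambda>_. bk T f h"]) (use r in auto)
    have "br T \<sigma> \<tau> y = gc (bk T f h) y" if "y \<in> V \<inter> pre U" for y
      by (rule br_at[unfolded reps_def, OF T s t]) (use that V(5) in auto)
    thus "\<exists>V f. zariski_open C V \<and> x \<in> V \<and> V \<subseteq> points M \<and> regular_on C V f \<and> (\<forall>y\<in>V \<inter> pre U. br T \<sigma> \<tau> y = gc f y)"
      using V(1-4) by (intro exI[of _ V] exI[of _ "bk T f h"]) auto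
  qed
  show "invariant_section M (pre U) (br T \<sigma> \<tau>)" unfolding invariant_section_def
  proof (intro ballI)
    fix g x k assume g: "g \<in> grp M" and x: "x \<in> pre U" and k: "k \<in> br T \<sigma> \<tau> (act M g x)"
    have xp: "x \<in> points M" by (rule pre_points[OF x])
    have gx: "act M g x \<in> pre U" by (rule pre_act[OF g x])
    obtain f h where f: "f \<in> \<sigma> (act M g x)" and h: "h \<in> \<tau> (act M g x)" and kfh: "geq (act M g x) k (bk T f h)"
      using k unfolding br_def by blast
    have fg: "(\<lambda>y. f (act M g y)) \<in> \<sigma> x" and hg: "(\<lambda>y. h (act M g y)) \<in> \<tau> x"
      using s t f h g x unfolding quot_functions_def invariant_section_def by blast+
    have fr: "reg_at (act M g x) f" and hr: "reg_at (act M g x) h"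
      by (rule section_reg[OF s gx f], rule section_reg[OF t gx h])
    have "geq x (\<lambda>y. k (act M g y)) (\<lambda>y. bk T f h (act M g y))" by (rule geq_act[OF g xp kfh])
    moreover have "geq x (\<lambda>y. bk T f h (act M g y)) (bk T (\<lambda>y. f (act M g y)) (\<lambda>y. h (act M g y)))"
    proof (rule geq_near)
      show "reg_at x (\<lambda>y. bk T f h (act M g y))" by (rule reg_at_act[OF g xp reg_at_bk[OF alt fr hr]])
      have "near (act M g x) (\<lambda>y. reg_at y f \<and> reg_at y h)"
        by (rule near_mono[OF near_conj[OF near_geq[OF geq_refl[OF fr]] near_geq[OF geq_refl[OF hr]]]]) (simp add: geq_iff)
      from near_act[OF g xp this]
      show "near x (\<lambda>y. bk T f h (act M g y) = bk T (\<lambda>y. f (act M g y)) (\<lambda>y. h (act M g y)) y)"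
        by (rule near_mono) (use bk_act[OF _ g] T in "auto simp: compatible_def")
    qed
    ultimately have "geq x (\<lambda>y. k (act M g y)) (bk T (\<lambda>y. f (act M g y)) (\<lambda>y. h (act M g y)))" by (rule geq_trans)
    thus "(\<lambda>y. k (act M g y)) \<in> br T \<sigma> \<tau> x" unfolding br_def using fg hg by blast
  qed
qed

text \<open>Covers \<open>br T\<close> itself as well as the combinations formed by
  \<open>section_comb\<close>. The hypothesis \<open>gen\<close> speaks of germs instead of sections
  because it is applied to sums, products and multiples of sections.\<close>

lemma quot_bracket_br:
  assumes T: "compatible T"
    and eq: "\<And>U \<sigma> \<tau> x. \<sigma> \<in> OU U ==> \<tau> \<in> OU U ==> x \<in> pre U ==> \<gamma> \<sigma> \<tau> x = br T \<sigma> \<tau> x"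
    and gen: "\<And>U \<sigma> \<tau> f h x. x \<in> pre U ==> reps x \<sigma> f ==> reps x \<tau> h ==> inv_germ x f ==> inv_germ x h ==> reps x (\<gamma> \<sigma> \<tau>) (bk T f h)"
  shows "quot_bracket M \<Phi> q Z \<gamma>" unfolding quot_bracket_def Let_def
proof (intro allI impI conjI ballI)
  fix U
  note alt = compatible_alt[OF T]
  have ig: "inv_germ x f" "reg_at x f" "reps x \<sigma> f" "x \<in> points M" if "\<sigma> \<in> OU U" "x \<in> pre U" "f \<in> \<sigma> x" for \<sigma> x f
    using section_inv_germ[OF that] section_reg[OF that] section_reps[OF that] pre_points[OF that(2)] by simp_all
  { fix \<sigma> \<tau> assume s: "\<sigma> \<in> OU U" and t: "\<tau> \<in> OU U"
    have c: "br T \<sigma> \<tau> \<in> OU U" by (rule br_closed[OF T s t])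
    have e: "\<gamma> \<sigma> \<tau> x = br T \<sigma> \<tau> x" if "x \<in> pre U" for x by (rule eq[OF s t that])
    show "\<gamma> \<sigma> \<tau> \<in> OU U"
      using c pre_act e unfolding quot_functions_def fibre_sections_def invariant_section_def by simp
  }
  { fix \<sigma> \<sigma>' \<tau> \<tau>' x assume s: "\<sigma> \<in> OU U" "\<sigma>' \<in> OU U" "\<tau> \<in> OU U" "\<tau>' \<in> OU U"
      and h: "(\<forall>x\<in>pre U. \<sigma> x = \<sigma>' x) \<and> (\<forall>x\<in>pre U. \<tau> x = \<tau>' x)" and x: "x \<in> pre U"
    thus "\<gamma> \<sigma> \<tau> x = \<gamma> \<sigma>' \<tau>' x"
      by (simp add: eq[OF s(1,3) x] eq[OF s(2,4) x] br_def)
  }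
  { fix \<sigma> \<tau> x assume s: "\<sigma> \<in> OU U" and t: "\<tau> \<in> OU U" and x: "x \<in> pre U"
    obtain f where f: "f \<in> \<sigma> x" by (rule section_germ[OF s x])
    obtain h where h: "h \<in> \<tau> x" by (rule section_germ[OF t x])
    note F = ig[OF s x f] and H = ig[OF t x h]
    have r: "reg_at x (bk T f h)" "reg_at x (bk T h f)" by (intro reg_at_bk alt F H)+
    have "geq x (\<lambda>y. - 1 * bk T h f y) (bk T f h)"
      by (rule geq_sym[OF geq_near[OF r(1)]], rule near_true[OF F(4)]) (simp add: bk_swap[OF alt, of _ f h])
    from reps_geq[OF reps_scale[OF gen[OF x H(3) F(3) H(1) F(1)] r(2)] this]
    show "\<gamma> \<sigma> \<tau> x = section_scale M \<Phi> q (- 1) (\<gamma> \<tau> \<sigma>) x"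
      by (rule reps_eq[OF gen[OF x F(3) H(3) F(1) H(1)]])
  }
  { fix \<rho> \<sigma> \<tau> x assume r: "\<rho> \<in> OU U" and s: "\<sigma> \<in> OU U" and t: "\<tau> \<in> OU U" and x: "x \<in> pre U"
    obtain e where e: "e \<in> \<rho> x" by (rule section_germ[OF r x])
    obtain f where f: "f \<in> \<sigma> x" by (rule section_germ[OF s x])
    obtain h where h: "h \<in> \<tau> x" by (rule section_germ[OF t x])
    note D = ig[OF r x e] and F = ig[OF s x f] and H = ig[OF t x h]
    have rb: "reg_at x (bk T e f)" "reg_at x (bk T e h)" by (intro reg_at_bk alt D F H)+
    note g = gen[OF x D(3) F(3) D(1) F(1)] gen[OF x D(3) H(3) D(1) H(1)]
    from reps_geq[OF gen[OF x D(3) reps_add[OF F(3) H(3) F(2) H(2)] D(1) inv_germ_add[OF F(1) H(1)]]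
        geq_near[OF reg_at_bk[OF alt D(2) reg_at_add[OF F(2) H(2)]] bk_add[OF F(2) H(2)]]]
    show "\<gamma> \<rho> (section_add M \<Phi> q \<sigma> \<tau>) x = section_add M \<Phi> q (\<gamma> \<rho> \<sigma>) (\<gamma> \<rho> \<tau>) x"
      by (rule reps_eq[OF _ reps_add[OF g rb]])
    from reps_geq[OF gen[OF x D(3) reps_mult[OF F(3) H(3) F(2) H(2)] D(1) inv_germ_mult[OF F(1) H(1)]]
        geq_near[OF reg_at_bk[OF alt D(2) reg_at_mult[OF F(2) H(2)]] bk_mult[OF F(2) H(2)]]]
    show "\<gamma> \<rho> (section_mult M \<Phi> q \<sigma> \<tau>) x
      = section_add M \<Phi> q (section_mult M \<Phi> q (\<gamma> \<rho> \<sigma>) \<tau>) (section_mult M \<Phi> q \<sigma> (\<gamma> \<rho> \<tau>)) x"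
      by (rule reps_eq[OF _ reps_add[OF reps_mult[OF g(1) H(3) rb(1) H(2)] reps_mult[OF F(3) g(2) F(2) rb(2)]
            reg_at_mult[OF rb(1) H(2)] reg_at_mult[OF F(2) rb(2)]]])
  }
  { fix k \<rho> \<sigma> x assume r: "\<rho> \<in> OU U" and s: "\<sigma> \<in> OU U" and x: "x \<in> pre U"
    obtain e where e: "e \<in> \<rho> x" by (rule section_germ[OF r x])
    obtain f where f: "f \<in> \<sigma> x" by (rule section_germ[OF s x])
    note D = ig[OF r x e] and F = ig[OF s x f]
    from reps_geq[OF gen[OF x D(3) reps_scale[OF F(3) F(2)] D(1) inv_germ_scale[OF F(1)]]
        geq_near[OF reg_at_bk[OF alt D(2) reg_at_mult[OF reg_at_const[OF F(4)] F(2)]] bk_scale[OF F(2) F(2)]]]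
    show "\<gamma> \<rho> (section_scale M \<Phi> q k \<sigma>) x = section_scale M \<Phi> q k (\<gamma> \<rho> \<sigma>) x"
      by (rule reps_eq[OF _ reps_scale[OF gen[OF x D(3) F(3) D(1) F(1)] reg_at_bk[OF alt D(2) F(2)]]])
  }
qed

lemma quot_jacobi_br:
  assumes T: "compatible T"
    and jac: "\<And>x f h k. inv_germ x f ==> inv_germ x h ==> inv_germ x k ==>
      vanish x (\<lambda>y. bk T f (bk T h k) y + (bk T h (bk T k f) y + bk T k (bk T f h) y))"
    and eq: "\<And>U \<sigma> \<tau> x. \<sigma> \<in> OU U ==> \<tau> \<in> OU U ==> x \<in> pre U ==> \<gamma> \<sigma> \<tau> x = br T \<sigma> \<tau> x"
    and closed: "\<And>U \<sigma> \<tau>. quot_open M Z U ==> \<sigma> \<in> OU U ==> \<tau> \<in> OU U ==> \<gamma> \<sigma> \<tau> \<in> OU U"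
  shows "quot_jacobi M \<Phi> q Z \<gamma>" unfolding quot_jacobi_def
proof (intro allI impI ballI)
  fix U \<rho> \<sigma> \<tau> x assume U: "quot_open M Z U" and r: "\<rho> \<in> OU U" and s: "\<sigma> \<in> OU U" and t: "\<tau> \<in> OU U" and x: "x \<in> pre U"
  note alt = compatible_alt[OF T]
  obtain e where e: "e \<in> \<rho> x" by (rule section_germ[OF r x])
  obtain f where f: "f \<in> \<sigma> x" by (rule section_germ[OF s x])
  obtain h where h: "h \<in> \<tau> x" by (rule section_germ[OF t x])
  have b: "reps x (\<gamma> \<sigma>1 (\<gamma> \<sigma>2 \<sigma>3)) (bk T f1 (bk T f2 f3))" and br: "reg_at x (bk T f1 (bk T f2 f3))"
    if s: "\<sigma>1 \<in> OU U" "\<sigma>2 \<in> OU U" "\<sigma>3 \<in> OU U" and f: "f1 \<in> \<sigma>1 x" "f2 \<in> \<sigma>2 x" "f3 \<in> \<sigma>3 x" for \<sigma>1 \<sigma>2 \<sigma>3 f1 f2 f3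
  proof -
    have c: "\<gamma> \<sigma>2 \<sigma>3 \<in> OU U" by (rule closed[OF U s(2,3)])
    have "\<gamma> \<sigma>2 \<sigma>3 x = gc (bk T f2 f3) x"
      unfolding eq[OF s(2,3) x] by (rule br_at[unfolded reps_def, OF T s(2,3) x f(2,3)])
    hence m: "bk T f2 f3 \<in> \<gamma> \<sigma>2 \<sigma>3 x"
      by (simp add: gc_self reg_at_bk[OF alt section_reg[OF s(2) x f(2)] section_reg[OF s(3) x f(3)]])
    show "reps x (\<gamma> \<sigma>1 (\<gamma> \<sigma>2 \<sigma>3)) (bk T f1 (bk T f2 f3))"
      unfolding reps_def eq[OF s(1) c x] by (rule br_at[unfolded reps_def, OF T s(1) c x f(1) m])
    show "reg_at x (bk T f1 (bk T f2 f3))"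
      by (rule reg_at_bk[OF alt section_reg[OF s(1) x f(1)] section_reg[OF c x m]])
  qed
  note B = b[OF r s t e f h] b[OF s t r f h e] b[OF t r s h e f] and R = br[OF r s t e f h] br[OF s t r f h e] br[OF t r s h e f]
  have "geq x (\<lambda>y. bk T e (bk T f h) y + (bk T f (bk T h e) y + bk T h (bk T e f) y)) (\<lambda>_. 0)"
    using jac[OF section_inv_germ[OF r x e] section_inv_germ[OF s x f] section_inv_germ[OF t x h]]
      reg_at_const[OF pre_points[OF x]] vanish_reg by (auto simp: geq_iff)
  from reps_geq[OF reps_add[OF B(1) reps_add[OF B(2,3) R(2,3)] R(1) reg_at_add[OF R(2,3)]] this]
  show "section_add M \<Phi> q (\<gamma> \<rho> (\<gamma> \<sigma> \<tau>)) (section_add M \<Phi> q (\<gamma> \<sigma> (\<gamma> \<tau> \<rho>)) (\<gamma> \<tau> (\<gamma> \<rho> \<sigma>))) x = gc (\<lambda>y. 0) x"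
    by (simp add: reps_def)
qed

end

lemma sum_reverse4: "(\<Sum>c\<in>C. \<Sum>l\<in>C. \<Sum>d\<in>C. \<Sum>e\<in>C. F c l d e) = (\<Sum>c\<in>C. \<Sum>l\<in>C. \<Sum>d\<in>C. \<Sum>e\<in>C. F e d l c)"
proof -
  have "(\<Sum>c\<in>C. \<Sum>l\<in>C. \<Sum>d\<in>C. \<Sum>e\<in>C. F c l d e) = (\<Sum>d\<in>C. \<Sum>e\<in>C. \<Sum>c\<in>C. \<Sum>l\<in>C. F c l d e)"
    by (rule sum_swap4)
  also have "\<dots> = (\<Sum>d\<in>C. \<Sum>e\<in>C. \<Sum>l\<in>C. \<Sum>c\<in>C. F c l d e)"
    by (intro sum.cong refl sum.swap)
  also have "\<dots> = (\<Sum>e\<in>C. \<Sum>d\<in>C. \<Sum>l\<in>C. \<Sum>c\<in>C. F c l d e)" by (rule sum.swap)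
  finally show ?thesis .
qed

lemma sum_swap6: "(\<Sum>c\<in>C. \<Sum>d\<in>C. \<Sum>e\<in>C. \<Sum>a\<in>A. \<Sum>a'\<in>A. \<Sum>a''\<in>A. F c d e a a' a'')
    = (\<Sum>a\<in>A. \<Sum>a'\<in>A. \<Sum>a''\<in>A. \<Sum>c\<in>C. \<Sum>d\<in>C. \<Sum>e\<in>C. F c d e a a' a'')"
proof -
  have "(\<Sum>c\<in>C. \<Sum>d\<in>C. \<Sum>e\<in>C. \<Sum>a\<in>A. \<Sum>a'\<in>A. \<Sum>a''\<in>A. F c d e a a' a'')
    = (\<Sum>c\<in>C. \<Sum>d\<in>C. \<Sum>a\<in>A. \<Sum>a'\<in>A. \<Sum>a''\<in>A. \<Sum>e\<in>C. F c d e a a' a'')"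
    by (intro sum.cong refl) (subst sum.swap, intro sum.cong refl sum_swap3[symmetric])
  also have "\<dots> = (\<Sum>c\<in>C. \<Sum>a\<in>A. \<Sum>a'\<in>A. \<Sum>a''\<in>A. \<Sum>d\<in>C. \<Sum>e\<in>C. F c d e a a' a'')"
    by (intro sum.cong refl) (subst sum.swap, intro sum.cong refl sum_swap3[symmetric])
  also have "\<dots> = (\<Sum>a\<in>A. \<Sum>a'\<in>A. \<Sum>a''\<in>A. \<Sum>c\<in>C. \<Sum>d\<in>C. \<Sum>e\<in>C. F c d e a a' a'')"
    by (subst sum.swap, intro sum.cong refl sum_swap3[symmetric])
  finally show ?thesis .
qed

text \<open>The terms with second derivatives are the sums \<open>A\<close>; by symmetry of the
  Hessians and antisymmetry of \<open>T\<close> they cancel in pairs in the cyclic sum, and only the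
  derivatives of \<open>T\<close> are left.\<close>

lemma jacobi_algebra:
  fixes T :: "'c => 'c => complex" and C :: "'c set" and DT :: "'c => 'c => 'c => complex"
  assumes T: "\<And>c d. T c d = - T d c"
    and sym: "\<And>c d. c \<in> C ==> d \<in> C ==> Hf c d = Hf d c" "\<And>c d. c \<in> C ==> d \<in> C ==> Hh c d = Hh d c"
      "\<And>c d. c \<in> C ==> d \<in> C ==> Hk c d = Hk d c"
  defines "X \<equiv> \<lambda>f h k Hh Hk. \<Sum>c\<in>C. \<Sum>l\<in>C. T c l * f c * (\<Sum>d\<in>C. \<Sum>e\<in>C.
      DT l d e * h d * k e + T d e * Hh l d * k e + T d e * h d * Hk l e)"
  shows "X f h k Hh Hk + (X h k f Hk Hf + X k f h Hf Hh)
    = (\<Sum>c\<in>C. \<Sum>d\<in>C. \<Sum>e\<in>C. f c * h d * k e * (\<Sum>l\<in>C. T c l * DT l d e + T d l * DT l e c + T e l * DT l c d))"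
proof -
  let ?S3 = "\<lambda>F. \<Sum>c\<in>C. \<Sum>d\<in>C. \<Sum>e\<in>C. F c d e" and ?S4 = "\<lambda>F. \<Sum>c\<in>C. \<Sum>l\<in>C. \<Sum>d\<in>C. \<Sum>e\<in>C. F c l d e"
  define A where "A = (\<lambda>f H k. ?S4 (\<lambda>c l d e. T c l * f c * (T d e * H l d * k e)))"
  define Q where "Q = (\<lambda>c d e. \<Sum>l\<in>C. T c l * DT l d e)"
  have J: "?S4 (\<lambda>c l d e. T c l * f c * (DT l d e * h d * k e)) = ?S3 (\<lambda>c d e. f c * h d * k e * Q c d e)" for f h k
  proof (rule sum.cong[OF refl])
    fix c
    have "(\<Sum>l\<in>C. \<Sum>d\<in>C. \<Sum>e\<in>C. T c l * f c * (DT l d e * h d * k e)) = (\<Sum>d\<in>C. \<Sum>e\<in>C. \<Sum>l\<in>C. T c l * f c * (DT l d e * h d * k e))"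
      by (rule sum_swap3[symmetric])
    thus "(\<Sum>l\<in>C. \<Sum>d\<in>C. \<Sum>e\<in>C. T c l * f c * (DT l d e * h d * k e)) = (\<Sum>d\<in>C. \<Sum>e\<in>C. f c * h d * k e * Q c d e)"
      unfolding Q_def sum_distrib_left by (simp add: mult_ac)
  qed
  have B: "?S4 (\<lambda>c l d e. T c l * f c * (T d e * h d * H l e)) = - A f H h" for f h H
  proof -
    have "?S4 (\<lambda>c l d e. T c l * f c * (T d e * h d * H l e))
        = (\<Sum>c\<in>C. \<Sum>l\<in>C. \<Sum>e\<in>C. \<Sum>d\<in>C. T c l * f c * (T d e * h d * H l e))"
      by (intro sum.cong refl sum.swap)
    also have "\<dots> = - A f H h" unfolding A_def sum_negf[symmetric]
    proof (intro sum.cong refl)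
      fix c l e d
      show "T c l * f c * (T d e * h d * H l e) = - (T c l * f c * (T e d * H l e * h d))"
        by (subst T[of d e]) (simp add: mult_ac)
    qed
    finally show ?thesis .
  qed
  have Asym: "A f H k = A k H f" if "\<And>c d. c \<in> C ==> d \<in> C ==> H c d = H d c" for f H k unfolding A_def
  proof (subst sum_reverse4, intro sum.cong refl)
    fix c l d e assume "l \<in> C" "d \<in> C"
    thus "T e d * f e * (T l c * H d l * k c) = T c l * k c * (T d e * H l d * f e)"
      using that[of d l] T[of e d] T[of l c] by (simp add: mult_ac)
  qed
  have X: "X f h k Hh Hk = ?S3 (\<lambda>c d e. f c * h d * k e * Q c d e) + A f Hh k - A f Hk h" for f h k Hh Hk
  proof -
    have "X f h k Hh Hk = ?S4 (\<lambda>c l d e. T c l * f c * (DT l d e * h d * k e)) + A f Hh k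
        + ?S4 (\<lambda>c l d e. T c l * f c * (T d e * h d * Hk l e))"
      unfolding X_def A_def by (simp add: sum_distrib_left sum.distrib distrib_left)
    thus ?thesis unfolding J B by simp
  qed
  have "X f h k Hh Hk + (X h k f Hk Hf + X k f h Hf Hh)
    = ?S3 (\<lambda>c d e. f c * h d * k e * Q c d e) + (?S3 (\<lambda>c d e. h c * k d * f e * Q c d e)
      + ?S3 (\<lambda>c d e. k c * f d * h e * Q c d e))"
    unfolding X using Asym[of Hf h k] Asym[of Hh f k] Asym[of Hk f h] sym by (simp add: algebra_simps)
  also have "?S3 (\<lambda>c d e. h c * k d * f e * Q c d e) = ?S3 (\<lambda>c d e. f c * h d * k e * Q d e c)"
    by (subst sum_swap3) (simp add: mult_ac)
  also have "?S3 (\<lambda>c d e. k c * f d * h e * Q c d e) = ?S3 (\<lambda>c d e. f c * h d * k e * Q e c d)"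
    by (subst sum_swap3, subst sum_swap3) (simp add: mult_ac)
  finally show ?thesis unfolding Q_def sum.distrib[symmetric] distrib_left[symmetric] by (simp only: add.assoc)
qed

context reduction
begin

lemma bk_bk:
  assumes alt: "altM T" and V: "zariski_open C V" "V \<subseteq> points M"
    and h: "regular_on C V h" and k: "regular_on C V k" and y: "y \<in> V"
  shows "bk T f (bk T h k) y = (\<Sum>c\<in>C. \<Sum>l\<in>C. T y c l * pderiv_at c f y * (\<Sum>d\<in>C. \<Sum>e\<in>C.
     pderiv_at l (\<lambda>y. T y d e) y * pderiv_at d h y * pderiv_at e k y
     + T y d e * pderiv_at l (pderiv_at d h) y * pderiv_at e k y + T y d e * pderiv_at d h y * pderiv_at l (pderiv_at e k) y))"
    (is "_ = (\<Sum>c\<in>C. \<Sum>l\<in>C. _ * _ * (\<Sum>d\<in>C. \<Sum>e\<in>C. ?F l d e))")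
proof -
  interpret V: affine_open C V by (rule affine_open[OF V(1)])
  have T: "regular_on C V (\<lambda>y. T y d e)" if "d \<in> C" "e \<in> C" for d e
    by (rule regular_subset[OF _ V(2)]) (use alt that in "simp add: alternating_field_def")
  have "pderiv_at l (bk T h k) y = (\<Sum>d\<in>C. \<Sum>e\<in>C. ?F l d e)"
    if l: "l \<in> C" for l
  proof -
    have h': "regular_on C V (pderiv_at d h)" and k': "regular_on C V (pderiv_at d k)" if "d \<in> C" for d
      by (rule V.regular_pderiv[OF h that], rule V.regular_pderiv[OF k that])
    have "pderiv_at l (bk T h k) y = pderiv_at l (\<lambda>y. \<Sum>d\<in>C. \<Sum>e\<in>C. T y d e * pderiv_at d h y * pderiv_at e k y) y"
      unfolding bivector_bracket_def[abs_def] ..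
    also have "\<dots> = (\<Sum>d\<in>C. \<Sum>e\<in>C. pderiv_at l (\<lambda>y. T y d e * pderiv_at d h y * pderiv_at e k y) y)"
      by (subst V.pderiv_sum[OF _ y l], intro regular_sum regular_mult T h' k', assumption+, intro sum.cong refl,
          subst V.pderiv_sum[OF _ y l], intro regular_mult T h' k', assumption+, rule refl)
    also have "\<dots> = (\<Sum>d\<in>C. \<Sum>e\<in>C. ?F l d e)"
    proof (intro sum.cong refl)
      fix d e assume d: "d \<in> C" and e: "e \<in> C"
      show "pderiv_at l (\<lambda>y. T y d e * pderiv_at d h y * pderiv_at e k y) y = ?F l d e"
        unfolding V.pderiv_mult[OF regular_mult[OF T[OF d e] h'[OF d]] k'[OF e] y l] V.pderiv_mult[OF T[OF d e] h'[OF d] y l]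
        by (simp add: algebra_simps)
    qed
    finally show ?thesis .
  qed
  thus ?thesis unfolding bivector_bracket_def[of C T f] by (intro sum.cong refl) (simp add: mult_ac)
qed

lemma wedge3_contract: "(\<Sum>c\<in>C. \<Sum>d\<in>C. \<Sum>e\<in>C. f c * h d * k e * wedge3 u v w c d e) =
    (let p = \<lambda>f u. \<Sum>c\<in>C. u c * f c in p f u * p h v * p k w - p f u * p h w * p k v + p f v * p h w * p k u
      - p f v * p h u * p k w + p f w * p h u * p k v - p f w * p h v * p k u)"
proof -
  have t: "(\<Sum>c\<in>C. \<Sum>d\<in>C. \<Sum>e\<in>C. f c * h d * k e * (u c * v d * w e)) = (\<Sum>c\<in>C. u c * f c) * (\<Sum>c\<in>C. v c * h c) * (\<Sum>c\<in>C. w c * k c)"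
    for u v w
  proof -
    have "(\<Sum>c\<in>C. \<Sum>d\<in>C. \<Sum>e\<in>C. f c * h d * k e * (u c * v d * w e))
      = (\<Sum>c\<in>C. (u c * f c) * (\<Sum>d\<in>C. (v d * h d) * (\<Sum>e\<in>C. w e * k e)))"
      by (simp add: sum_distrib_left mult_ac)
    thus ?thesis by (simp only: sum_distrib_right[symmetric] mult.assoc[symmetric])
  qed
  show ?thesis unfolding wedge3_def Let_def t[symmetric] sum_subtractf[symmetric] sum.distrib[symmetric]
    by (intro sum.cong refl) (simp add: algebra_simps)
qed

text \<open>The Jacobiator is half the Schouten square contracted with three differentials, hence a
  multiple of the Cartan trivector. Each of its terms is a product of derivatives of the three germs
  along generators, and these lie in the ideal. The factor \<open>\<mu>\<close> allows for
  combinations in which the centre of the pencil is rescaled.\<close>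

lemma vanish_jacobi:
  assumes alt: "altM T"
    and jac: "\<And>x c d e. x \<in> points M ==> c \<in> C ==> d \<in> C ==> e \<in> C ==> schouten C T T x c d e = \<mu> * cartan_trivector M x c d e"
    and f: "inv_germ x f" and h: "inv_germ x h" and k: "inv_germ x k"
  shows "vanish x (\<lambda>y. bk T f (bk T h k) y + (bk T h (bk T k f) y + bk T k (bk T f h) y))" (is "vanish x ?J")
proof -
  have r: "reg_at x f" "reg_at x h" "reg_at x k" and v: "\<And>a. a \<in> G ==> vanish x (E a f)" "\<And>a. a \<in> G ==> vanish x (E a h)"
    "\<And>a. a \<in> G ==> vanish x (E a k)" using f h k by (auto simp: inv_germ_def)
  have x: "x \<in> points M" by (rule reg_at_points[OF r(1)])
  let ?t = "\<lambda>a1 a2 a3. trace_form (gverts M) (gdim M) (dual_elt a1) (lie_bracket (gverts M) (gdim M) (dual_elt a2) (dual_elt a3))"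
  let ?w = "\<lambda>a1 a2 a3 y. E a1 f y * E a2 h y * E a3 k y - E a1 f y * E a3 h y * E a2 k y + E a2 f y * E a3 h y * E a1 k y
      - E a2 f y * E a1 h y * E a3 k y + E a3 f y * E a1 h y * E a2 k y - E a3 f y * E a2 h y * E a1 k y"
  let ?R = "\<lambda>y. 1/2 * \<mu> * 1/12 * (\<Sum>a1\<in>G. \<Sum>a2\<in>G. \<Sum>a3\<in>G. ?t a1 a2 a3 * ?w a1 a2 a3 y)"
  have p: "vanish x (\<lambda>y. E a f y * E b h y * E c k y)" if "a \<in> G" "b \<in> G" "c \<in> G" for a b c
    by (rule vanish_mult[OF reg_at_mult[OF vanish_reg[OF v(1)] vanish_reg[OF v(2)]] v(3)]) (use that in auto)
  have "vanish x (\<lambda>y. ?R y)"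
    by (rule vanish_scale, rule vanish_sum[OF x], rule vanish_sum[OF x], rule vanish_sum[OF x], rule vanish_scale)
      (intro vanish_add vanish_diff p)
  thus ?thesis
  proof (rule vanish_cong)
    let ?F = "\<lambda>i :: nat. if i = 0 then f else if i = 1 then h else k"
    obtain V where V: "zariski_open C V" "x \<in> V" "V \<subseteq> points M" "\<And>i. i \<in> {0,1,2} ==> regular_on C V (?F i)"
      by (rule reg_at_near[OF near_true[OF x, of "\<lambda>_. True"], of "{0,1,2}" ?F]) (use r in auto)
    have R: "regular_on C V f" "regular_on C V h" "regular_on C V k" using V(4)[of 0] V(4)[of 1] V(4)[of 2] by simp_all
    interpret V: affine_open C V by (rule affine_open[OF V(1)])
    have "?R y = ?J y" if y: "y \<in> V" for y
    proof -
      have yp: "y \<in> points M" using V(3) y by blast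
      have a: "T y c d = - T y d c" for c d using alt yp unfolding alternating_field_def by blast
      let ?D = "\<lambda>c d e. \<Sum>l\<in>C. T y c l * pderiv_at l (\<lambda>y. T y d e) y + T y d l * pderiv_at l (\<lambda>y. T y e c) y + T y e l * pderiv_at l (\<lambda>y. T y c d) y" and ?f = "\<lambda>c d e. pderiv_at c f y * pderiv_at d h y * pderiv_at e k y"
      let ?W = "\<lambda>a1 a2 a3 c d e. 1/2 * \<mu> * 1/12 * (?t a1 a2 a3 * (?f c d e * wedge3 (vf a1 y) (vf a2 y) (vf a3 y) c d e))"
      have s: "?D c d e = 1/2 * \<mu> * cartan_trivector M y c d e" if "c \<in> C" "d \<in> C" "e \<in> C" for c d e
      proof -
        have "schouten C T T y c d e = 2 * ?D c d e"
          unfolding schouten_def sum_distrib_left by (intro sum.cong refl) simp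
        thus ?thesis using jac[OF yp that] by simp
      qed
      have "?J y = (\<Sum>c\<in>C. \<Sum>d\<in>C. \<Sum>e\<in>C. ?f c d e * ?D c d e)"
        unfolding bk_bk[OF alt V(1,3) R(2,3) y] bk_bk[OF alt V(1,3) R(3,1) y] bk_bk[OF alt V(1,3) R(1,2) y]
        by (rule jacobi_algebra[where Hf = "\<lambda>l d. pderiv_at l (pderiv_at d f) y" and Hh = "\<lambda>l d. pderiv_at l (pderiv_at d h) y"
              and Hk = "\<lambda>l d. pderiv_at l (pderiv_at d k) y" and T = "T y" and DT = "\<lambda>l d e. pderiv_at l (\<lambda>y. T y d e) y", OF a])
          (rule V.pderiv_swap[OF R(1) y] V.pderiv_swap[OF R(2) y] V.pderiv_swap[OF R(3) y]; assumption)+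
      also have "\<dots> = (\<Sum>c\<in>C. \<Sum>d\<in>C. \<Sum>e\<in>C. ?f c d e * (1/2 * \<mu> * cartan_trivector M y c d e))"
        by (intro sum.cong refl) (simp only: s)
      also have "\<dots> = (\<Sum>c\<in>C. \<Sum>d\<in>C. \<Sum>e\<in>C. \<Sum>a1\<in>G. \<Sum>a2\<in>G. \<Sum>a3\<in>G. ?W a1 a2 a3 c d e)"
        unfolding cartan_trivector_def sum_distrib_left by (intro sum.cong refl) (simp add: mult_ac)
      also have "\<dots> = (\<Sum>a1\<in>G. \<Sum>a2\<in>G. \<Sum>a3\<in>G. \<Sum>c\<in>C. \<Sum>d\<in>C. \<Sum>e\<in>C. ?W a1 a2 a3 c d e)"
        by (rule sum_swap6)
      also have "\<dots> = ?R y" unfolding sum_distrib_left[symmetric] wedge3_contract Let_def E_def[symmetric] ..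
      finally show ?thesis by simp
    qed
    thus "near x (\<lambda>y. ?R y = ?J y)" unfolding near_def using V(1-3) by (intro exI[of _ V]) blast
  qed
qed

lemma quot_bracket_closed:
  assumes "quot_bracket M \<Phi> q Z \<gamma>" "quot_open M Z U" "\<sigma> \<in> OU U" "\<tau> \<in> OU U"
  shows "\<gamma> \<sigma> \<tau> \<in> OU U"
  by (rule bspec[OF bspec[OF conjunct1[OF mp[OF spec[OF assms(1)[unfolded quot_bracket_def Let_def]] assms(2)]] assms(3)] assms(4)])

definition ten :: "'c tensor2 => ('j => 'c tensor2) => 'j option => 'c tensor2" where
  "ten P\<^sub>0 Pf k = (case k of None => P\<^sub>0 | Some j => Pf j)"

text \<open>The bracket at each index is \<open>br\<close> of its bivector. On representatives a
  combination of these brackets is the bracket of the combined bivector, so the same lemmas serve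
  single members and combinations.\<close>

lemma descends:
  fixes J :: "'j set"
  assumes pen: "\<And>K w. finite K ==> K \<subseteq> insert None (Some ` J) ==>
      compatible (\<lambda>x c d. \<Sum>k\<in>K. w k * ten P\<^sub>0 Pf k x c d) \<and>
      (\<exists>\<mu>. \<forall>x\<in>points M. \<forall>c\<in>C. \<forall>d\<in>C. \<forall>e\<in>C. schouten C (\<lambda>x c d. \<Sum>k\<in>K. w k * ten P\<^sub>0 Pf k x c d)
         (\<lambda>x c d. \<Sum>k\<in>K. w k * ten P\<^sub>0 Pf k x c d) x c d e = \<mu> * cartan_trivector M x c d e)"
  shows "descends_to_poisson_pencil M \<Phi> q Z P\<^sub>0 J Pf"
proof -
  let ?t = "ten P\<^sub>0 Pf"
  let ?K = "insert None (Some ` J)" and ?\<beta> = "\<lambda>k. br (?t k)"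
  have ct: "compatible (?t k)" if "k \<in> ?K" for k using pen[of "{k}" "\<lambda>_. 1"] that by simp
  have ind: "induces_bracket M \<Phi> q Z (?t k) (?\<beta> k)" if "k \<in> ?K" for k
    unfolding induces_bracket_def using br_at[OF ct[OF that], unfolded reps_def] by blast
  have single: "quot_bracket M \<Phi> q Z (?\<beta> k)" if "k \<in> ?K" for k
    by (rule quot_bracket_br[OF ct[OF that] refl reps_br[OF ct[OF that]]])
  have comb: "quot_bracket M \<Phi> q Z (\<lambda>\<sigma> \<tau>. section_comb M \<Phi> q K w (\<lambda>k. ?\<beta> k \<sigma> \<tau>)) \<and>
      quot_jacobi M \<Phi> q Z (\<lambda>\<sigma> \<tau>. section_comb M \<Phi> q K w (\<lambda>k. ?\<beta> k \<sigma> \<tau>))" if K: "finite K" "K \<subseteq> ?K" for K w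
  proof -
    let ?T = "\<lambda>x c d. \<Sum>k\<in>K. w k * ?t k x c d" and ?\<gamma> = "\<lambda>\<sigma> \<tau>. section_comb M \<Phi> q K w (\<lambda>k. ?\<beta> k \<sigma> \<tau>)"
    have T: "compatible ?T" using pen[OF K] by blast
    obtain \<mu> where \<mu>: "\<forall>x\<in>points M. \<forall>c\<in>C. \<forall>d\<in>C. \<forall>e\<in>C. schouten C ?T ?T x c d e = \<mu> * cartan_trivector M x c d e"
      using pen[OF K] by blast
    have lin: "(\<lambda>y. \<Sum>k\<in>K. w k * bk (?t k) f h y) = bk ?T f h" for f h
    proof
      fix y
      have "bk ?T f h y = (\<Sum>c\<in>C. \<Sum>d\<in>C. \<Sum>k\<in>K. w k * (?t k y c d * pderiv_at c f y * pderiv_at d h y))"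
        unfolding bivector_bracket_def by (simp add: sum_distrib_right mult.assoc)
      also have "\<dots> = (\<Sum>k\<in>K. w k * bk (?t k) f h y)"
        unfolding bivector_bracket_def sum_distrib_left by (rule sum_swap3)
      finally show "(\<Sum>k\<in>K. w k * bk (?t k) f h y) = bk ?T f h y" ..
    qed
    have gen: "reps x (?\<gamma> \<sigma> \<tau>) (bk ?T f h)" if "x \<in> pre U" "reps x \<sigma> f" "reps x \<tau> h" "inv_germ x f" "inv_germ x h" for U x \<sigma> \<tau> f h
      unfolding lin[symmetric]
    proof (rule reps_comb[OF pre_points[OF that(1)]])
      fix k assume "k \<in> K"
      hence c: "compatible (?t k)" using K(2) ct by blast
      show "reps x (br (?t k) \<sigma> \<tau>) (bk (?t k) f h)" by (rule reps_br[OF c that(2-5)])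
      show "reg_at x (bk (?t k) f h)"
        using that(4,5) by (intro reg_at_bk compatible_alt[OF c]) (simp_all add: inv_germ_def)
    qed
    have eq: "?\<gamma> \<sigma> \<tau> x = br ?T \<sigma> \<tau> x" if s: "\<sigma> \<in> OU U" and t: "\<tau> \<in> OU U" and x: "x \<in> pre U" for U \<sigma> \<tau> x
    proof -
      obtain f where f: "f \<in> \<sigma> x" by (rule section_germ[OF s x])
      obtain h where h: "h \<in> \<tau> x" by (rule section_germ[OF t x])
      show ?thesis
        by (rule reps_eq[OF gen[OF x section_reps[OF s x f] section_reps[OF t x h] section_inv_germ[OF s x f] section_inv_germ[OF t x h]]
              br_at[OF T s t x f h]])
    qed
    have b: "quot_bracket M \<Phi> q Z ?\<gamma>" by (rule quot_bracket_br[OF T eq gen])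
    moreover have "quot_jacobi M \<Phi> q Z ?\<gamma>"
    proof (rule quot_jacobi_br[OF T vanish_jacobi[OF compatible_alt[OF T]] eq])
      show "?\<gamma> \<sigma> \<tau> \<in> OU U" if "quot_open M Z U" "\<sigma> \<in> OU U" "\<tau> \<in> OU U" for U \<sigma> \<tau>
        by (rule quot_bracket_closed[OF b that])
    qed (use \<mu> in blast)
    ultimately show ?thesis by blast
  qed
  show ?thesis unfolding descends_to_poisson_pencil_def quot_poisson_pencil_def Let_def
  proof (intro exI[of _ ?\<beta>] conjI ballI allI impI)
    show "induces_bracket M \<Phi> q Z P\<^sub>0 (?\<beta> None)" using ind[of None] by (simp add: ten_def)
    show "induces_bracket M \<Phi> q Z (Pf j) (?\<beta> (Some j))" if "j \<in> J" for j
      using ind[of "Some j"] that by (simp add: ten_def)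
    show "quot_bracket M \<Phi> q Z (?\<beta> k)" if "k \<in> ?K" for k by (rule single[OF that])
  qed (use comb in blast)+
qed

lemma compatible_lin:
  assumes T: "compatible T" and T': "compatible T'"
  shows "compatible (\<lambda>x c d. k * T x c d + l * T' x c d)" unfolding compatible_def
proof (intro conjI)
  let ?T = "\<lambda>x c d. k * T x c d + l * T' x c d" and ?v = "\<lambda>a. vf a"
    and ?D = "\<lambda>T b y d. \<Sum>c\<in>C. T y c d * pderiv_at c (\<lambda>y. \<Phi> y b) y"
  have al: "altM T" "altM T'"
    and inv: "invariant_bivector M T" "invariant_bivector M T'" using T T' by (simp_all add: compatible_def)
  have a: "T x c d = - T x d c \<and> (c \<notin> C \<or> d \<notin> C \<longrightarrow> T x c d = 0)" "T' x c d = - T' x d c \<and> (c \<notin> C \<or> d \<notin> C \<longrightarrow> T' x c d = 0)"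
    if "x \<in> points M" for x c d using al that unfolding alternating_field_def by blast+
  show "altM ?T" unfolding alternating_field_def
  proof (intro conjI ballI allI impI)
    fix x c d assume x: "x \<in> points M"
    show "k * T x c d + l * T' x c d = - (k * T x d c + l * T' x d c)"
      using conjunct1[OF a(1)[OF x, of c d]] conjunct1[OF a(2)[OF x, of c d]] by simp
    show "k * T x c d + l * T' x c d = 0" if "c \<notin> C \<or> d \<notin> C"
      using mp[OF conjunct2[OF a(1)[OF x]] that] mp[OF conjunct2[OF a(2)[OF x]] that] by simp
  next
    fix c d assume "c \<in> C" "d \<in> C"
    thus "regM (\<lambda>x. k * T x c d + l * T' x c d)"
      using al unfolding alternating_field_def by (intro regular_intros) auto
  qed
  show "invariant_bivector M ?T" unfolding invariant_bivector_def
  proof (intro ballI)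
    fix g x c d assume g: "g \<in> grp M" and x: "x \<in> points M" and c: "c \<in> C" and d: "d \<in> C"
    have "bk ?T f h x = k * bk T f h x + l * bk T' f h x" for f h
      by (simp add: bivector_bracket_def sum_distrib_left sum.distrib algebra_simps)
    thus "k * T (act M g x) c d + l * T' (act M g x) c d
      = bk ?T (\<lambda>y. act M g y c) (\<lambda>y. act M g y d) x"
      using inv g x c d by (simp add: invariant_bivector_def)
  qed
  let ?H = "\<lambda>T \<kappa>. \<forall>b\<in>G. \<forall>y\<in>points M. \<forall>d\<in>C. ?D T b y d
         = (\<Sum>a\<in>G. \<kappa> b a y * ?v a y d)"
  obtain \<kappa> where \<kappa>: "\<forall>b\<in>G. \<forall>a\<in>G. regM (\<kappa> b a)" "?H T \<kappa>"
    using T unfolding compatible_def by (elim conjE exE)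
  obtain \<kappa>' where \<kappa>': "\<forall>b\<in>G. \<forall>a\<in>G. regM (\<kappa>' b a)" "?H T' \<kappa>'"
    using T' unfolding compatible_def by (elim conjE exE)
  let ?\<kappa> = "\<lambda>b a y. k * \<kappa> b a y + l * \<kappa>' b a y"
  have "?H ?T ?\<kappa>"
  proof (intro ballI)
    fix b y d assume "b \<in> G" "y \<in> points M" "d \<in> C"
    hence e: "?D T b y d = (\<Sum>a\<in>G. \<kappa> b a y * ?v a y d)"
      "?D T' b y d = (\<Sum>a\<in>G. \<kappa>' b a y * ?v a y d)" using \<kappa>(2) \<kappa>'(2) by blast+
    have "?D ?T b y d = k * ?D T b y d + l * ?D T' b y d" by (simp add: sum_distrib_left sum.distrib algebra_simps)
    thus "?D ?T b y d = (\<Sum>a\<in>G. ?\<kappa> b a y * ?v a y d)"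
      unfolding e by (simp add: sum_distrib_left sum.distrib algebra_simps)
  qed
  moreover have "\<forall>b\<in>G. \<forall>a\<in>G. regM (?\<kappa> b a)"
    using \<kappa>(1) \<kappa>'(1) by (intro ballI regular_intros) auto
  ultimately show "\<exists>\<kappa>. (\<forall>b\<in>G. \<forall>a\<in>G. regM (\<kappa> b a)) \<and> ?H ?T \<kappa>"
    by (intro exI[of _ ?\<kappa>] conjI)
qed

text \<open>\<open>schouten\<close> is symmetric in its two bivectors, so the two mixed terms are
  equal.\<close>

lemma schouten_lin:
  assumes T: "altM T" and T': "altM T'"
    and x: "x \<in> points M" and cde: "c \<in> C" "d \<in> C" "e \<in> C"
  shows "schouten C (\<lambda>x c d. k * T x c d + l * T' x c d) (\<lambda>x c d. k * T x c d + l * T' x c d) x c d e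
    = k * k * schouten C T T x c d e + 2 * (k * l) * schouten C T T' x c d e + l * l * schouten C T' T' x c d e"
proof -
  interpret p: affine_open C "points M" by (rule affine_open[OF open_points])
  have "pderiv_at a (\<lambda>y. k * T y c d + l * T' y c d) x = k * pderiv_at a (\<lambda>y. T y c d) x + l * pderiv_at a (\<lambda>y. T' y c d) x"
    if "a \<in> C" "c \<in> C" "d \<in> C" for a c d
  proof -
    have r: "regM (\<lambda>y. T y c d)" "regM (\<lambda>y. T' y c d)"
      using T T' that unfolding alternating_field_def by blast+
    show ?thesis
      using p.pderiv_add[OF regular_mult[OF regular_const r(1)] regular_mult[OF regular_const r(2)] x that(1), of k l]
      by (simp add: p.pderiv_cmult[OF r(1) x that(1)] p.pderiv_cmult[OF r(2) x that(1)])
  qed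
  note pd = this
  show ?thesis unfolding schouten_def sum_distrib_left sum.distrib[symmetric]
    by (intro sum.cong refl) (simp add: pd cde algebra_simps)
qed

text \<open>
  As the Schouten bracket is quadratic, the values at \<open>P\<close> and \<open>P \<plusminus> R\<close> show that \<open>P\<close> and \<open>R\<close> commute and
  that \<open>R\<close> is Poisson.
\<close>
lemma descends_pencil:
  fixes J :: "'j set"
  assumes pen: "\<And>J\<^sub>0 w. finite J\<^sub>0 ==> J\<^sub>0 \<subseteq> J ==> compatible (pencil_element P\<^sub>0 Pf J\<^sub>0 w) \<and>
    (\<forall>x\<in>points M. \<forall>c\<in>C. \<forall>d\<in>C. \<forall>e\<in>C.
       schouten C (pencil_element P\<^sub>0 Pf J\<^sub>0 w) (pencil_element P\<^sub>0 Pf J\<^sub>0 w) x c d e = cartan_trivector M x c d e)"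
  shows "descends_to_poisson_pencil M \<Phi> q Z P\<^sub>0 J Pf"
proof (rule descends)
  let ?t = "ten P\<^sub>0 Pf" and ?c = "cartan_trivector M"
  fix K :: "'j option set" and w :: "'j option => complex" assume K: "finite K" "K \<subseteq> insert None (Some ` J)"
  let ?J = "{j. Some j \<in> K}" and ?w = "\<lambda>j. w (Some j)"
  define w0 where "w0 = (if None \<in> K then w None else 0)"
  have J: "finite ?J" "?J \<subseteq> J" using K finite_vimageI[OF K(1), of Some] by (auto simp: vimage_def)
  define T where "T = pencil_element P\<^sub>0 Pf ?J ?w"
  \<comment> \<open>Opposite weights give 2 P_0 - T, whose Schouten square is known too and
    determines the mixed bracket of P_0 and T.\<close>
  define T' where "T' = pencil_element P\<^sub>0 Pf ?J (\<lambda>j. - ?w j)"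
  have P0: "pencil_element P\<^sub>0 Pf {} ?w = P\<^sub>0" by (simp add: pencil_element_def)
  note h0 = pen[of "{}" ?w, unfolded P0] and h1 = pen[OF J, of ?w, folded T_def] and h2 = pen[OF J, of "\<lambda>j. - ?w j", folded T'_def]
  have c: "compatible P\<^sub>0" "compatible T" using h0 h1 by simp_all
  have T': "T' = (\<lambda>x c d. 2 * P\<^sub>0 x c d + (- 1) * T x c d)"
    by (simp add: T'_def T_def pencil_element_def fun_eq_iff sum_negf)
  let ?S = "\<lambda>x c d. \<Sum>k\<in>K. w k * ?t k x c d"
  \<comment> \<open>The coefficient \<open>w0\<close> of the centre is split as (w0 - 1) + 1, so
    that the remaining summand \<open>T\<close> is an element of the pencil.\<close>
  have s: "?S x c d = (w0 - 1) * P\<^sub>0 x c d + 1 * T x c d" for x c d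
  proof -
    let ?N = "if None \<in> K then {None} else {}"
    have "K = ?N \<union> Some ` ?J"
    proof (rule Set.set_eqI)
      show "k \<in> K \<longleftrightarrow> k \<in> ?N \<union> Some ` ?J" for k by (cases k) auto
    qed
    hence "?S x c d = (\<Sum>k\<in>?N. w k * ?t k x c d) + (\<Sum>k\<in>Some ` ?J. w k * ?t k x c d)"
      using J(1) by (subst (1) \<open>K = _\<close>, intro sum.union_disjoint) auto
    also have "(\<Sum>k\<in>Some ` ?J. w k * ?t k x c d) = (\<Sum>j\<in>?J. ?w j * Pf j x c d)"
      by (subst sum.reindex) (auto simp: ten_def)
    finally show ?thesis by (simp add: w0_def T_def pencil_element_def ten_def algebra_simps)
  qed
  have "schouten C (\<lambda>x c d. (w0 - 1) * P\<^sub>0 x c d + 1 * T x c d) (\<lambda>x c d. (w0 - 1) * P\<^sub>0 x c d + 1 * T x c d) x c d e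
      = w0 * w0 * ?c x c d e" if "x \<in> points M" "c \<in> C" "d \<in> C" "e \<in> C" for x c d e proof -
    note lin = schouten_lin[OF compatible_alt[OF c(1)] compatible_alt[OF c(2)] that]
    have e: "schouten C P\<^sub>0 P\<^sub>0 x c d e = ?c x c d e" "schouten C T T x c d e = ?c x c d e"
      "schouten C T' T' x c d e = ?c x c d e" using h0 h1 h2 that by simp_all
    have "?c x c d e = 4 * ?c x c d e - 4 * schouten C P\<^sub>0 T x c d e + ?c x c d e"
      using lin[of 2 "- 1"] by (simp only: T'[symmetric] e) simp
    hence "4 * schouten C P\<^sub>0 T x c d e = 4 * ?c x c d e" by (simp add: algebra_simps)
    hence "schouten C P\<^sub>0 T x c d e = ?c x c d e" by simp
    \<comment> \<open>(w0 - 1)^2 + 2 (w0 - 1) + 1 = w0^2; in particular combinations without the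
      centre are Poisson.\<close>
    thus ?thesis unfolding lin e by (simp add: algebra_simps)
  qed
  thus "compatible ?S \<and>
      (\<exists>\<mu>. \<forall>x\<in>points M. \<forall>c\<in>C. \<forall>d\<in>C. \<forall>e\<in>C. schouten C ?S
         ?S x c d e = \<mu> * ?c x c d e)" unfolding s using compatible_lin[OF c, of "w0 - 1" 1] by blast
qed

end

subsection \<open>Semistability is invariant under the group\<close>

text \<open>If one space is not finite-dimensional, neither is the other, and \<open>dim\<close> is
  then the least number with a property that fails for every number on both sides. Surjections in
  both directions thus avoid a separate proof of finiteness.\<close>

lemma dim_iso:
  assumes "linear_map K V W T" and inj: "inj_on T (carrier V)" and surj: "T ` carrier V = carrier W"
    and "linear_map K W V T'" and surj': "T' ` carrier W = carrier V"
  shows "vectorspace.dim K V = vectorspace.dim K W"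
proof -
  interpret T: linear_map K V W T by fact
  interpret T': linear_map K W V T' by fact
  show ?thesis
  proof (cases "T.V.fin_dim")
    case True
    thus ?thesis by (rule T.dim_eq[OF _ inj surj])
  next
    case False
    hence "\<not> T.W.fin_dim" using T'.image_fin_dim[OF _ surj'] by blast
    with False show ?thesis
      unfolding T.V.dim_def T.W.dim_def T.V.fin_dim_def T.W.fin_dim_def by (intro arg_cong[where f = Least] ext) blast
  qed
qed

lemma
  fixes B B' :: "complex mat"
  assumes B: "B \<in> carrier_mat n n" "B' \<in> carrier_mat n n" "B' * B = 1\<^sub>m n" "B * B' = 1\<^sub>m n"
    and W: "VectorSpace.subspace class_ring W (module_vec TYPE(complex) n)"
  defines "W' \<equiv> {v \<in> carrier_vec n. B *\<^sub>v v \<in> W}"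
  shows subspace_preimage: "VectorSpace.subspace class_ring W' (module_vec TYPE(complex) n)"
    and dim_preimage: "vectorspace.dim class_ring (module_vec TYPE(complex) n\<lparr>carrier := W'\<rparr>)
      = vectorspace.dim class_ring (module_vec TYPE(complex) n\<lparr>carrier := W\<rparr>)"
proof -
  let ?V = "module_vec TYPE(complex) n" and ?f = "\<lambda>v. B *\<^sub>v v" and ?g = "\<lambda>v. B' *\<^sub>v v"
  let ?W = "?V\<lparr>carrier := W\<rparr>" and ?W' = "?V\<lparr>carrier := W'\<rparr>"
  interpret vec_space "TYPE(complex)" n .
  have sm: "submodule class_ring W ?V" using W by (simp add: VectorSpace.subspace_def)
  have WC: "W \<subseteq> carrier_vec n" and Wadd: "\<And>v w. v \<in> W ==> w \<in> W ==> v + w \<in> W" and W0: "0\<^sub>v n \<in> W"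
    and Wsm: "\<And>c v. v \<in> W ==> c \<cdot>\<^sub>v v \<in> W"
    using submodule.subset[OF sm] submodule.m_closed[OF sm] submodule.zero_closed[OF sm] submodule.smult_closed[OF sm]
    by (auto simp: module_vec_simps)
  have B0: "B *\<^sub>v 0\<^sub>v n = 0\<^sub>v n" using B(1) by auto
  have Badd: "B *\<^sub>v (v + w) = B *\<^sub>v v + B *\<^sub>v w" and Badd': "B' *\<^sub>v (v + w) = B' *\<^sub>v v + B' *\<^sub>v w"
    if "v \<in> carrier_vec n" "w \<in> carrier_vec n" for v w
    using mult_add_distrib_mat_vec[OF B(1) that] mult_add_distrib_mat_vec[OF B(2) that] by auto
  have Bsm: "B *\<^sub>v (c \<cdot>\<^sub>v v) = c \<cdot>\<^sub>v (B *\<^sub>v v)" and Bsm': "B' *\<^sub>v (c \<cdot>\<^sub>v v) = c \<cdot>\<^sub>v (B' *\<^sub>v v)" if "v \<in> carrier_vec n" for c v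
    using mult_mat_vec[OF B(1) that] mult_mat_vec[OF B(2) that] by auto
  have BB: "B *\<^sub>v (B' *\<^sub>v v) = v" and BB': "B' *\<^sub>v (B *\<^sub>v v) = v" if "v \<in> carrier_vec n" for v
    using assoc_mult_mat_vec[OF B(1,2) that] assoc_mult_mat_vec[OF B(2,1) that] that by (simp_all add: B(3,4))
  have Bc: "B *\<^sub>v v \<in> carrier_vec n" and Bc': "B' *\<^sub>v v \<in> carrier_vec n" if "v \<in> carrier_vec n" for v
    using mult_mat_vec_carrier[OF B(1) that] mult_mat_vec_carrier[OF B(2) that] by auto
  show sub: "VectorSpace.subspace class_ring W' ?V" unfolding VectorSpace.subspace_def
  proof (intro conjI vec_vs)
    show "submodule class_ring W' ?V" by (unfold_locales) (auto simp: module_vec_simps W'_def Badd Bsm B0 Wadd Wsm W0)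
  qed
  have v: "vectorspace class_ring ?W" "vectorspace class_ring ?W'"
    by (rule subspace_is_vs[OF W], rule subspace_is_vs[OF sub])
  have lm: "linear_map class_ring ?W' ?W ?f" "linear_map class_ring ?W ?W' ?g"
    unfolding linear_map_def mod_hom_def mod_hom_axioms_def using v WC Bc' BB
    by (auto simp: vectorspace_def module_hom_def module_vec_simps W'_def Badd Badd' Bsm Bsm' subset_iff)
  show "vectorspace.dim class_ring ?W' = vectorspace.dim class_ring ?W"
  proof (rule dim_iso[OF lm(1) _ _ lm(2)])
    show "inj_on ?f (carrier ?W')" by (rule inj_on_inverseI[of _ "\<lambda>v. B' *\<^sub>v v"]) (simp add: W'_def BB')
    show "?f ` carrier ?W' = carrier ?W"
    proof
      show "carrier ?W \<subseteq> ?f ` carrier ?W'"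
        using WC BB Bc' by (auto simp: W'_def intro!: image_eqI[of _ _ "B' *\<^sub>v _"])
    qed (auto simp: W'_def)
    show "?g ` carrier ?W = carrier ?W'"
    proof
      show "carrier ?W' \<subseteq> ?g ` carrier ?W"
        using BB' by (auto simp: W'_def intro!: image_eqI[of _ _ "B *\<^sub>v _"])
      show "?g ` carrier ?W \<subseteq> carrier ?W'" using WC BB Bc' by (auto simp: W'_def subset_iff)
    qed
  qed
qed

subsection \<open>Multiplicative quiver varieties\<close>

context gl_group
begin

lemma gmul_expand:
  assumes b: "b \<in> Gn"
  shows "gmuln g z b = (\<Sum>a\<in>Gn. tr (emb (basis_elt a) * emb z) * gmuln g (dual_elt a) b)"
    and "gmuln z g b = (\<Sum>a\<in>Gn. tr (emb (basis_elt a) * emb z) * gmuln (dual_elt a) g b)"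
proof -
  let ?c = "\<lambda>a. tr (emb (basis_elt a) * emb z)"
  have c: "h b = tr (emb (dual_elt b) * emb h)" for h using tr_dual_emb[OF b] by simp
  have "tr (Y * (emb z * Z)) = (\<Sum>a\<in>Gn. ?c a * tr (Y * (emb (dual_elt a) * Z)))" for Y Z
  proof -
    have "tr (Y * ((\<Sum>a\<in>Gn. scl (?c a) * emb (dual_elt a)) * Z))
       = (\<Sum>a\<in>Gn. ?c a * tr (Y * (emb (dual_elt a) * Z)))" unfolding sum_distrib_right sum_distrib_left tr_sum
    proof (rule sum.cong[OF refl])
      fix a
      have "Y * (scl k * B * Z) = scl k * (Y * (B * Z))" for k B by (metis mult.assoc scl_commute)
      thus "tr (Y * (scl (?c a) * emb (dual_elt a) * Z)) = ?c a * tr (Y * (emb (dual_elt a) * Z))"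
        by (simp only: tr_scl_mult)
    qed
    thus ?thesis by (simp only: dual_expand_emb)
  qed
  from this[of "emb (dual_elt b) * emb g" 1] this[of "emb (dual_elt b)" "emb g"]
  show "gmuln g z b = (\<Sum>a\<in>Gn. ?c a * gmuln g (dual_elt a) b)"
    "gmuln z g b = (\<Sum>a\<in>Gn. ?c a * gmuln (dual_elt a) g b)"
    unfolding c[of "gmuln _ _"] emb_gmul by (simp_all only: mult_1_right mult.assoc)
qed

lemma gmul_diff: "gmuln g (\<lambda>b. y b - z b) = (\<lambda>b. gmuln g y b - gmuln g z b)"
  "gmuln (\<lambda>b. y b - z b) g = (\<lambda>b. gmuln y g b - gmuln z g b)"
proof -
  have z: "(\<lambda>b. gmuln u v b - gmuln u' v' b) \<in> gln" for u v u' v'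
    using gl_alg_zero[OF gmul_gl] by (simp add: gl_alg_def affine_space_def)
  show "gmuln g (\<lambda>b. y b - z b) = (\<lambda>b. gmuln g y b - gmuln g z b)"
    "gmuln (\<lambda>b. y b - z b) g = (\<lambda>b. gmuln y g b - gmuln z g b)"
    by (intro emb_inj gmul_gl z; simp add: emb_gmul emb_diff algebra_simps)+
qed

end

lemma (in rep_variety) block_rep:
  assumes "\<And>a. a \<in> R ==> A a \<in> carrier_mat (rd a) (cd a)" and a: "a \<in> R"
  shows "rep_mat Q n (of_blocks R rd cd A) a = A a"
proof -
  have d: "dim_row (A a) = rd a" "dim_col (A a) = cd a" using assms(1)[OF a] by (metis carrier_matD)+
  show ?thesis by (rule eq_matI) (use a in "simp_all add: rep_mat_def block_def of_blocks_def d")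
qed

context rep_pencil
begin

lemma act_comp:
  assumes g: "g \<in> GLn" and h: "h \<in> GLn"
  shows "act1 h (act1 g x) = act1 (gmuln h g) x"
proof (rule RX_inj[OF act_affine act_affine])
  fix a assume a: "a \<in> R"
  have "emb1 (ginvn (gmuln h g)) = emb1 (ginvn g) * emb1 (ginvn h)"
  proof (rule emb1_inverse_unique[OF gmul_GL[OF h g]])
    have "emb1 h * (emb1 g * emb1 (ginvn g)) * emb1 (ginvn h) = 1" by (simp add: emb1_ginv_right g h)
    thus "emb1 (gmuln h g) * (emb1 (ginvn g) * emb1 (ginvn h)) = 1" by (simp only: emb1_gmul mult.assoc)
  qed
  thus "RX (act1 h (act1 g x)) a = RX (act1 (gmuln h g) x) a" by (simp add: RX_act g h gmul_GL a emb1_gmul mult.assoc)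
qed

lemma act_one: "x \<in> affine_space C ==> act1 gonen x = x"
proof (rule RX_inj[OF act_affine])
  fix a assume a: "a \<in> R"
  have "emb1 (ginvn gonen) = 1" by (rule emb1_inverse_unique[OF gone_GL]) (simp add: emb1_gone)
  thus "RX (act1 gonen x) a = RX x a" by (simp add: RX_act gone_GL a emb1_gone)
qed

lemma act_sum:
  assumes g: "g \<in> GLn" and c: "c \<in> C"
  shows "act1 g y c = (\<Sum>b\<in>C. y b * act1 g (unit_pt b) c)"
proof -
  let ?H = "emb1 (ginvn g)"
  have "act1 g y c = pairing R (dX c) (RX (act1 g y))" by (rule coord_pairing[OF c])
  also have "\<dots> = pairing R (RA (\<lambda>b. act1 g (unit_pt b) c)) (RX y)" unfolding pairing_def
  proof (rule sum.cong[OF refl])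
    fix a assume a: "a \<in> R"
    show "tr (dX c a * RX (act1 g y) a) = tr (RA (\<lambda>b. act1 g (unit_pt b) c) a * RX y a)"
      using tr_comm[of ?H "dX c a * emb1 g * RX y a"] by (simp add: RX_act act_linear g a c mult.assoc)
  qed
  also have "\<dots> = (\<Sum>b\<in>C. act1 g (unit_pt b) c * y b)" by (rule pairing_coords[symmetric])
  finally show ?thesis by (simp add: mult.commute)
qed

lemma scalar_GL_commute: "gmuln (scalar_elt Q n q) g = gmuln g (scalar_elt Q n q)"
proof
  fix b
  show "gmuln (scalar_elt Q n q) g b = gmuln g (scalar_elt Q n q) b"
  proof (cases "b \<in> Gn")
    case True
    obtain s i j where b: "b = (s, i, j)" by (cases b)
    have s: "s \<in> verts Q" "i < n s" "j < n s" using True by (auto simp: b gl_entries_iff)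
    have e: "scalar_elt Q n q (s, k, l) = (if k = l then q s else 0)" if "k < n s" "l < n s" for k l
      using that s by (simp add: scalar_elt_def of_blocks_def)
    have "(\<Sum>k<n s. scalar_elt Q n q (s, i, k) * g (s, k, j)) = (\<Sum>k<n s. if k = i then q s * g (s, i, j) else 0)"
      by (rule sum.cong) (auto simp: e s)
    moreover have "(\<Sum>k<n s. g (s, i, k) * scalar_elt Q n q (s, k, j)) = (\<Sum>k<n s. if k = j then q s * g (s, i, j) else 0)"
      by (rule sum.cong) (auto simp: e s)
    ultimately show ?thesis using s by (simp add: b gmul_coord[OF True[unfolded b]])
  qed (simp add: gl_alg_zero[OF gmul_gl])
qed

lemma scalar_gl: "scalar_elt Q n q \<in> gln" unfolding scalar_elt_def by (rule of_blocks_gl)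

lemma scalar_conj: "g \<in> GLn ==> gmuln (gmuln g (scalar_elt Q n q)) (ginvn g) = scalar_elt Q n q"
proof (rule emb1_inj[OF gmul_gl scalar_gl])
  assume g: "g \<in> GLn"
  show "emb1 (gmuln (gmuln g (scalar_elt Q n q)) (ginvn g)) = emb1 (scalar_elt Q n q)"
    unfolding scalar_GL_commute[symmetric] by (simp add: emb1_gmul mult.assoc emb1_ginv_right g)
qed

lemma moment_equiv: "g \<in> GLn ==> x \<in> points M ==> \<Phi> (act1 g x) = gmuln (gmuln g (\<Phi> x)) (ginvn g)"
  using equivariant_moment by (simp add: equivariant_morphism_def)

text \<open>The scalar element is central, so the moment map minus it is conjugated as a whole;
  expanding in elementary matrices exhibits coefficients that do not depend on the point.\<close>

lemma moment_conj_lin: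
  assumes g: "g \<in> GLn" and y: "y \<in> points M" and b: "b \<in> Gn"
  shows "\<Phi> (act1 g y) b - scalar_elt Q n q b = (\<Sum>a\<in>Gn.
    gmuln (gmuln g (basis_elt a)) (ginvn g) b * (\<Phi> y a - scalar_elt Q n q a))"
proof -
  let ?G = "Gn"
  let ?L = "\<lambda>z. gmuln (gmuln g z) (ginvn g)"
  let ?z = "\<lambda>b. \<Phi> y b - scalar_elt Q n q b"
  have z: "?z \<in> gln"
    using gl_alg_zero[OF moment_gl] gl_alg_zero[OF scalar_gl] by (simp add: gl_alg_def affine_space_def)
  have "\<Phi> (act1 g y) b - scalar_elt Q n q b = ?L (\<Phi> y) b - ?L (scalar_elt Q n q) b"
    unfolding moment_equiv[OF g y] scalar_conj[OF g] ..
  also have "\<dots> = ?L ?z b" by (simp only: gmul_diff)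
  also have "\<dots> = tr (emb (dual_elt b) * (emb g * emb ?z * emb (ginvn g)))"
    using tr_dual_emb[OF b, of "?L ?z"] by (simp only: emb_gmul)
  also have "emb ?z = (\<Sum>a\<in>?G. scl (?z a) * emb (basis_elt a))"
    unfolding emb_scale[symmetric] emb_sum[symmetric] by (subst gl_expand[OF z]) rule
  also have "tr (emb (dual_elt b) * (emb g * (\<Sum>a\<in>?G. scl (?z a) * emb (basis_elt a)) * emb (ginvn g)))
    = (\<Sum>a\<in>?G. ?z a * tr (emb (dual_elt b) * (emb g * emb (basis_elt a) * emb (ginvn g))))"
    unfolding sum_distrib_left sum_distrib_right tr_sum
  proof (rule sum.cong[OF refl])
    fix a
    have "Y * (W * (scl k * B) * Z) = scl k * (Y * (W * B * Z))" for k and Y W B Z :: "('s \<times> nat) umat"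
      by (metis mult.assoc scl_commute)
    thus "tr (emb (dual_elt b) * (emb g * (scl (?z a) * emb (basis_elt a)) * emb (ginvn g)))
      = ?z a * tr (emb (dual_elt b) * (emb g * emb (basis_elt a) * emb (ginvn g)))" by (simp only: tr_scl_mult) qed
  also have "\<dots> = (\<Sum>a\<in>?G. ?L (basis_elt a) b * ?z a)"
    by (rule sum.cong[OF refl], subst tr_dual_emb[OF b, symmetric]) (simp only: emb_gmul mult.commute)
  finally show ?thesis .
qed

text \<open>A family of subspaces stable under the matrices of the translated point is pulled back
  along the blocks of \<open>g\<close> to a family for \<open>x\<close>, again proper and of the
  same dimensions.\<close>

lemma semistable_act:
  assumes g: "g \<in> GLn" and ss: "semistable Q n \<theta> x"
  shows "semistable Q n \<theta> (act1 g x)" unfolding semistable_def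
proof (intro allI impI, elim conjE)
  let ?M = "\<lambda>s. module_vec TYPE(complex) (n s)" and ?X = "rep_mat Q n x"
  let ?D = "\<lambda>V. (\<Sum>s\<in>verts Q. \<theta> s * of_nat (vectorspace.dim class_ring (?M s\<lparr>carrier := V s\<rparr>))) \<le> 0"
  let ?B = "\<lambda>s. block n n g s" and ?I = "\<lambda>s. minv (block n n g s)"
  fix V assume V: "\<forall>s\<in>verts Q. VectorSpace.subspace class_ring (V s) (?M s)"
    and ne: "\<exists>s\<in>verts Q. V s \<noteq> carrier_vec (n s)"
    and inv: "\<forall>a\<in>R. \<forall>v\<in>V (hda a). rep_mat Q n (act1 g x) a *\<^sub>v v \<in> V (tla a)"
  define V' where "V' = (\<lambda>s. {v \<in> carrier_vec (n s). ?B s *\<^sub>v v \<in> V s})"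
  have B: "?B s \<in> carrier_mat (n s) (n s)" "?I s \<in> carrier_mat (n s) (n s)" "?I s * ?B s = 1\<^sub>m (n s)" "?B s * ?I s = 1\<^sub>m (n s)"
    if "s \<in> verts Q" for s using g that by (auto simp: GL_iff intro!: minv_block minv_left minv_right)
  note sub = subspace_preimage[OF B V[rule_format], folded V'_def] and dims = dim_preimage[OF B V[rule_format], folded V'_def]
  have VC: "V s \<subseteq> carrier_vec (n s)" if "s \<in> verts Q" for s
    using V that submodule.subset[of class_ring "V s" "?M s"]
    by (auto simp: VectorSpace.subspace_def module_vec_simps)
  have sub': "\<forall>s\<in>verts Q. VectorSpace.subspace class_ring (V' s) (?M s)" using sub by (simp add: V'_def)
  moreover have "\<exists>s\<in>verts Q. V' s \<noteq> carrier_vec (n s)"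
  proof -
    obtain s where s: "s \<in> verts Q" "V s \<noteq> carrier_vec (n s)" using ne by blast
    then obtain v where v: "v \<in> carrier_vec (n s)" "v \<notin> V s" using VC by blast
    have c: "?I s *\<^sub>v v \<in> carrier_vec (n s)" by (rule mult_mat_vec_carrier[OF B(2)[OF s(1)] v(1)])
    have "?B s *\<^sub>v (?I s *\<^sub>v v) = v"
      using assoc_mult_mat_vec[OF B(1)[OF s(1)] B(2)[OF s(1)] v(1)] v(1) by (simp add: B(4)[OF s(1)])
    hence "?I s *\<^sub>v v \<notin> V' s" using v(2) by (simp add: V'_def)
    thus ?thesis using c s(1) by blast
  qed
  moreover have "\<forall>a\<in>R. \<forall>v\<in>V' (hda a). ?X a *\<^sub>v v \<in> V' (tla a)"
  proof (intro ballI)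
    fix a v assume a: "a \<in> R" and v: "v \<in> V' (hda a)"
    note t = tl_verts[OF a] and h = hd_verts[OF a]
    have vc: "v \<in> carrier_vec (n (hda a))" and Bv: "?B (hda a) *\<^sub>v v \<in> V (hda a)" using v by (simp_all add: V'_def)
    have X: "?X a \<in> carrier_mat (n (tla a)) (n (hda a))" using rep_mat_carrier[of x a] by simp
    have BX: "?B (tla a) * ?X a \<in> carrier_mat (n (tla a)) (n (hda a))" by (rule mult_carrier_mat[OF B(1)[OF t] X])
    have r: "rep_mat Q n (act1 g x) a = ?B (tla a) * ?X a * ?I (hda a)" unfolding rep_action_def
    proof (rule block_rep[OF _ a])
      fix a assume a: "a \<in> R"
      have "?X a \<in> carrier_mat (n (tla a)) (n (hda a))" using rep_mat_carrier[of x a] by simp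
      from mult_carrier_mat[OF mult_carrier_mat[OF B(1)[OF tl_verts[OF a]] this] B(2)[OF hd_verts[OF a]]]
      show "?B (tla a) * ?X a * ?I (hda a) \<in> carrier_mat (rd a) (cd a)" by simp
    qed
    have "rep_mat Q n (act1 g x) a *\<^sub>v (?B (hda a) *\<^sub>v v) = ?B (tla a) * ?X a *\<^sub>v (?I (hda a) *\<^sub>v (?B (hda a) *\<^sub>v v))"
      unfolding r by (rule assoc_mult_mat_vec[OF BX B(2)[OF h] mult_mat_vec_carrier[OF B(1)[OF h] vc]])
    also have "?I (hda a) *\<^sub>v (?B (hda a) *\<^sub>v v) = v"
      using assoc_mult_mat_vec[OF B(2)[OF h] B(1)[OF h] vc] vc by (simp add: B(3)[OF h])
    also have "?B (tla a) * ?X a *\<^sub>v v = ?B (tla a) *\<^sub>v (?X a *\<^sub>v v)"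
      by (rule assoc_mult_mat_vec[OF B(1)[OF t] X vc])
    finally have "?B (tla a) *\<^sub>v (?X a *\<^sub>v v) \<in> V (tla a)" using inv a Bv by metis
    thus "?X a *\<^sub>v v \<in> V' (tla a)" using mult_mat_vec_carrier[OF X vc] by (simp add: V'_def)
  qed
  ultimately have "?D V'" using ss unfolding semistable_def by blast
  moreover have "vectorspace.dim class_ring (?M s\<lparr>carrier := V' s\<rparr>)
      = vectorspace.dim class_ring (?M s\<lparr>carrier := V s\<rparr>)" if "s \<in> verts Q" for s
    using dims[OF that that that that that] by (simp add: V'_def)
  ultimately show "?D V" by simp
qed

lemma reduction_fibre: "reduction M \<Phi> (scalar_elt Q n q) (semistable_fibre Q n ord q \<theta>)"
proof (unfold_locales, unfold M_simps)
  let ?Z = "semistable_fibre Q n ord q \<theta>"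
  show "finite C" by (rule finite_C)
  show "finite Gn" by (rule finite_gl_entries)
  show "zariski_open C (points M)" by (rule M.openU)
  show "act1 g y \<in> affine_space C" for g y by (rule act_affine)
  show "act1 g y \<in> points M" if "g \<in> GLn" "y \<in> points M" for g y by (rule act_points[OF that])
  show "act1 g y c = (\<Sum>b\<in>C. y b * act1 g (unit_pt b) c)" if "g \<in> GLn" "c \<in> C" for g c y by (rule act_sum[OF that])
  show "\<forall>\<^sub>F t in nhds 0. gexpn (\<lambda>b. - t * basis_elt a b) \<in> GLn" for a
  proof (rule G.curve_stays[where \<gamma>' = "\<lambda>b. - basis_elt a b"])
    show "DERIV (\<lambda>t. gexpn (\<lambda>b. - t * basis_elt a b) b) 0 :> - basis_elt a b"
      if "b \<in> Gn" for b using gexp_deriv[OF that, of "\<lambda>b. - basis_elt a b"] by simp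
    show "gexpn (\<lambda>b. - t * basis_elt a b) \<in> affine_space Gn" for t using gexp_gl by (simp add: gl_alg_def)
    show "gexpn (\<lambda>b. - 0 * basis_elt a b) \<in> GLn" using gexp_zero[of "basis_elt a"] gone_GL by simp
  qed
  show "act1 (gexpn (\<lambda>b. - 0 * basis_elt a b)) y = y" if "y \<in> affine_space C" for y a
    using gexp_zero[of "basis_elt a"] act_one[OF that] by simp
  show "DERIV (\<lambda>t. act1 (gexpn (\<lambda>b. - t * basis_elt a b)) y c) 0 :> infinitesimal M (basis_elt a) y c"
    if "c \<in> C" for c a y by (rule act_curve[OF that])
  show "regular_on C (points M) (\<lambda>y. \<Phi> y b)" if "b \<in> Gn" for b by (rule regular_moment[OF that])
  show "\<exists>k. \<forall>y\<in>points M. \<forall>b\<in>Gn. \<Phi> (act1 g y) b - scalar_elt Q n q b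
      = (\<Sum>b'\<in>Gn. k b b' * (\<Phi> y b' - scalar_elt Q n q b'))" if "g \<in> GLn" for g
    using moment_conj_lin[OF that]
    by (intro exI[of _ "\<lambda>b b'. gmuln (gmuln g (basis_elt b')) (ginvn g) b"]) blast
  show "?Z \<subseteq> points M" by (auto simp: semistable_fibre_def)
  show "act1 g x \<in> ?Z" if g: "g \<in> GLn" and x: "x \<in> ?Z" for g x
    using x act_points[OF g] semistable_act[OF g] moment_equiv[OF g] scalar_conj[OF g] by (simp add: semistable_fibre_def)
  show "orbit M (act1 g x) = orbit M x" if g: "g \<in> GLn" and x: "x \<in> ?Z" for g x unfolding orbit_def M_simps
  proof (intro equalityI image_subsetI)
    fix h assume h: "h \<in> GLn"
    show "act1 h (act1 g x) \<in> (\<lambda>g. act1 g x) ` GLn"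
      unfolding act_comp[OF g h] by (intro imageI gmul_GL h g)
    have "gmuln (gmuln h (ginvn g)) g = h"
      by (rule emb1_inj[OF gmul_gl GL_gl[OF h]]) (simp add: emb1_gmul mult.assoc emb1_ginv_left g)
    hence "act1 h x = act1 (gmuln h (ginvn g)) (act1 g x)" by (simp add: act_comp[OF g gmul_GL[OF h ginv_GL[OF g]]])
    thus "act1 h x \<in> (\<lambda>h. act1 h (act1 g x)) ` GLn" by (intro image_eqI[OF _ gmul_GL[OF h ginv_GL[OF g]]])
  qed
qed

lemma compatible_P: "reduction.compatible M \<Phi> P" unfolding reduction.compatible_def[OF reduction_fibre] M_simps
proof (intro conjI)
  show "alternating_field C (points M) P" using bivector_field_P by (simp add: bivector_field_def)
  show "invariant_bivector M P" by (rule invariant_P)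
  let ?G = "Gn"
  \<comment> \<open>The coefficients come from \<open>tangent_P\<close> when the moment matrix is
    expanded in the dual basis.\<close>
  let ?\<kappa> = "\<lambda>b a y. 1/2 * (gmuln (\<Phi> y) (dual_elt a) b + gmuln (dual_elt a) (\<Phi> y) b)"
  have "regular_on C (points M) (?\<kappa> b a)" if b: "b \<in> ?G" for b a
  proof -
    have m: "M.mreg (\<lambda>y. emb (\<Phi> y))"
      using M.mreg_diff[OF mreg_moment M.mreg_const[of "1 - pr"]] by (simp add: emb1_def)
    have "regular_on C (points M) (\<lambda>y. 1/2 * (tr (emb (dual_elt b) * (emb (\<Phi> y) * emb (dual_elt a)))
        + tr (emb (dual_elt b) * (emb (dual_elt a) * emb (\<Phi> y)))))"
      by (intro regular_mult regular_const regular_add M.regular_tr M.mreg_mult M.mreg_const m)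
    moreover have "gmuln u v b = tr (emb (dual_elt b) * (emb u * emb v))" for u v
      using tr_dual_emb[OF b, of "gmuln u v"] by (simp only: emb_gmul)
    ultimately show ?thesis by simp
  qed
  moreover have "(\<Sum>c\<in>C. P y c d * pderiv_at c (\<lambda>y. \<Phi> y b) y) = (\<Sum>a\<in>?G. ?\<kappa> b a y * infinitesimal M (basis_elt a) y d)"
    if b: "b \<in> ?G" and y: "y \<in> points M" and d: "d \<in> C" for b y d
  proof -
    have "(\<Sum>c\<in>C. P y c d * pderiv_at c (\<lambda>y. \<Phi> y b) y) = tangent_map C \<Phi> y (\<lambda>c. P y c d) b"
      by (simp only: tangent_map_def mult.commute)
    also have "\<dots> = 1/2 * (gmuln (\<Phi> y) (muz y d) b + gmuln (muz y d) (\<Phi> y) b)"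
      by (rule tangent_P[OF y b])
    also have "\<dots> = (\<Sum>a\<in>?G. ?\<kappa> b a y * infinitesimal M (basis_elt a) y d)"
      unfolding gmul_expand(1)[OF b, of _ "muz y d"] gmul_expand(2)[OF b, of "muz y d"] infinitesimal_mux[OF d] emb_muz
        sum.distrib[symmetric] sum_distrib_left by (intro sum.cong refl) (simp add: algebra_simps)
    finally show ?thesis .
  qed
  ultimately show "\<exists>\<kappa>. (\<forall>b\<in>?G. \<forall>a\<in>?G. regular_on C (points M) (\<kappa> b a)) \<and>
      (\<forall>b\<in>?G. \<forall>y\<in>points M. \<forall>d\<in>C. (\<Sum>c\<in>C. P y c d * pderiv_at c (\<lambda>y. \<Phi> y b) y)
         = (\<Sum>a\<in>?G. \<kappa> b a y * infinitesimal M (basis_elt a) y d))"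
    by (intro exI[of _ ?\<kappa>] conjI ballI)
qed

end

section \<open>The order of the pencil\<close>

context rep_variety
begin

text \<open>Every product X_a X_(star a) contains a starred factor and therefore vanishes.\<close>

lemma half_points:
  assumes x: "x \<in> affine_space C" and z: "\<And>a i j. x (Inr a, i, j) = 0"
  shows "x \<in> points M"
proof -
  have "one_plus Q n a x = 1\<^sub>m (rd a)" if a: "a \<in> R" for a
  proof -
    have zm: "rep_mat Q n x (Inr b) = 0\<^sub>m (rd (Inr b)) (cd (Inr b))" for b
      by (rule eq_matI) (simp_all add: rep_mat_def block_def z)
    have "rep_mat Q n x a * rep_mat Q n x (star a) = 0\<^sub>m (rd a) (rd a)"
    proof (cases a)
      case (Inl b)
      thus ?thesis using zm[of b] right_mult_zero_mat[OF rep_mat_carrier[of x "Inl b"], of "rd (Inl b)"]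
        by (simp add: star_def row_dim_def col_dim_def double_def)
    next
      case (Inr b)
      thus ?thesis using zm[of b] left_mult_zero_mat[OF rep_mat_carrier[of x "Inl b"], of "rd (Inr b)"]
        by (simp add: star_def row_dim_def col_dim_def double_def)
    qed
    thus ?thesis by (simp add: one_plus_def right_add_zero_mat[OF one_carrier_mat])
  qed
  thus ?thesis using x by (simp add: points_iff)
qed

lemma bivector_field_pencil: "bivector_field M (pencil_biv j)" unfolding bivector_field_def alternating_field_def
proof (intro conjI ballI allI impI)
  fix x c d
  show "pencil_biv j x c d = - pencil_biv j x d c" by (simp add: pencil_biv_def wedge2_def)
  show "pencil_biv j x c d = 0" if "c \<notin> coords M \<or> d \<notin> coords M"
    using that by (auto simp: pencil_biv_def wedge2_def euler_def open_rep_variety_def)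
next
  fix c d assume "c \<in> coords M" "d \<in> coords M"
  hence c: "c \<in> C" "d \<in> C" by (simp_all add: open_rep_variety_def)
  have e: "regular_on C (points M) (\<lambda>x. euler a x c)" if "c \<in> C" for a c
    using that by (cases "fst c = Inl a"; cases "fst c = Inr a") (simp_all add: euler_def regular_intros)
  have "regular_on C (points M) (\<lambda>x. euler (fst j) x c * euler (snd j) x d - euler (snd j) x c * euler (fst j) x d)"
    by (intro regular_intros e c)
  thus "regular_on (coords M) (points M) (\<lambda>x. pencil_biv j x c d)"
    by (simp add: pencil_biv_def wedge2_def open_rep_variety_def)
qed

text \<open>For a distinct list, one ordered pair for each two-element set of arrows:
  \<open>pencil_biv\<close> changes sign when the pair is reversed and vanishes on equal
  arrows.\<close>

definition pairs :: "'e list => ('e \<times> 'e) set" where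
  "pairs l = (\<lambda>(k, i). (l ! i, l ! k)) ` (SIGMA k:{..<length l}. {..<k})"

lemma pairs_subset: "pairs l \<subseteq> set l \<times> set l" by (auto simp: pairs_def)

lemma finite_pairs: "finite (pairs l)" by (simp add: pairs_def)

lemma card_pairs:
  assumes "distinct l"
  shows "card (pairs l) = length l * (length l - 1) div 2"
proof -
  have "inj_on (\<lambda>(k, i). (l ! i, l ! k)) (SIGMA k:{..<length l}. {..<k})"
    by (rule inj_onI) (use nth_eq_iff_index_eq[OF assms] in auto)
  hence "card (pairs l) = card (SIGMA k:{..<length l}. {..<k})" unfolding pairs_def by (rule card_image)
  also have "\<dots> = (\<Sum>k<length l. k)" by simp
  also have "\<dots> = length l * (length l - 1) div 2"
  proof -
    have "2 * (\<Sum>k<m. k) = m * (m - 1)" for m :: nat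
      by (induction m) (auto simp: algebra_simps diff_mult_distrib2 split: nat_diff_split)
    from this[of "length l"] show ?thesis by simp
  qed
  finally show ?thesis .
qed

lemma pairs_antisym:
  assumes "distinct l" "(a, b) \<in> pairs l"
  shows "a \<noteq> b" "(b, a) \<notin> pairs l"
proof -
  obtain i k where ik: "i < k" "k < length l" "a = l ! i" "b = l ! k" using assms(2) by (auto simp: pairs_def)
  thus "a \<noteq> b" using nth_eq_iff_index_eq[OF assms(1), of i k] by auto
  show "(b, a) \<notin> pairs l"
  proof
    assume "(b, a) \<in> pairs l"
    then obtain i' k' where "i' < k'" "k' < length l" "b = l ! i'" "a = l ! k'" by (auto simp: pairs_def)
    thus False using ik nth_eq_iff_index_eq[OF assms(1), of i k'] nth_eq_iff_index_eq[OF assms(1), of k i'] by auto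
  qed
qed

text \<open>At the chosen point the coordinate (0, 0) of an arrow of Q is seen only by the Euler
  field of that arrow, so the component at two such coordinates isolates a single weight. Positive
  dimensions guarantee that the entry (0, 0) exists.\<close>

lemma pairs_independent:
  assumes l: "distinct l" "set l = arcs Q" and pos: "\<forall>s\<in>verts Q. n s \<ge> 1"
  shows "\<exists>x\<in>points M. independent_at M pencil_biv (pairs l) x"
proof (rule bexI)
  let ?x = "\<lambda>c. if c \<in> C \<and> isl (fst c) \<and> snd c = (0, 0) then 1 else 0 :: complex"
  show "?x \<in> points M" by (rule half_points) (auto simp: affine_space_def)
  show "independent_at M pencil_biv (pairs l) ?x" unfolding independent_at_def
  proof (intro allI impI ballI)
    fix w :: "'e \<times> 'e => complex" and j
    assume w: "\<forall>c\<in>coords M. \<forall>d\<in>coords M. (\<Sum>j\<in>pairs l. w j * pencil_biv j ?x c d) = 0" and j: "j \<in> pairs l"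
    obtain a b where ab: "j = (a, b)" by (cases j)
    have arcs: "a \<in> arcs Q" "b \<in> arcs Q" using j pairs_subset[of l] l(2) by (auto simp: ab)
    have C: "(Inl a, 0, 0) \<in> C" if "a \<in> arcs Q" for a
    proof -
      have R: "Inl a \<in> R" using that by (simp add: double_def)
      have "1 \<le> n (tla (Inl a))" "1 \<le> n (hda (Inl a))" using pos tl_verts[OF R] hd_verts[OF R] by blast+
      thus ?thesis using R by (simp add: C_iff)
    qed
    have e: "euler a' ?x (Inl b', 0, 0) = of_bool (a' = b')" if "b' \<in> arcs Q" for a' b'
      using C[OF that] by (auto simp: euler_def)
    have "w j' * pencil_biv j' ?x (Inl a, 0, 0) (Inl b, 0, 0) = (if j' = j then w j else 0)" if j': "j' \<in> pairs l" for j'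
    proof -
      obtain a' b' where ab': "j' = (a', b')" by (cases j')
      have "\<not> (a' = b \<and> b' = a)" using pairs_antisym[OF l(1) j[unfolded ab]] j' by (auto simp: ab')
      thus ?thesis using pairs_antisym(1)[OF l(1) j[unfolded ab]]
        by (auto simp: ab ab' pencil_biv_def wedge2_def e[OF arcs(1)] e[OF arcs(2)])
    qed
    hence "(\<Sum>j'\<in>pairs l. w j' * pencil_biv j' ?x (Inl a, 0, 0) (Inl b, 0, 0)) = (\<Sum>j'\<in>pairs l. if j' = j then w j else 0)"
      by (intro sum.cong refl)
    moreover have "(Inl a, 0, 0) \<in> coords M" "(Inl b, 0, 0) \<in> coords M"
      using C arcs by (simp_all add: open_rep_variety_def)
    ultimately show "w j = 0" using w j finite_pairs[of l] by simp
  qed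
qed

text \<open>For any dimension vector the order exists as a maximum: the empty family is independent
  at the origin, and the number of pairs is a bound. Only equality with this bound uses positive
  dimensions.\<close>

lemma pairs_order:
  assumes l: "distinct l" "set l = arcs Q"
  shows "\<exists>r. has_order M (pairs l) pencil_biv r \<and> r \<le> length l * (length l - 1) div 2 \<and>
    ((\<forall>s\<in>verts Q. n s \<ge> 1) \<longrightarrow> r = length l * (length l - 1) div 2)"
proof -
  define att where "att = (\<lambda>k. \<exists>S x. S \<subseteq> pairs l \<and> finite S \<and> card S = k \<and> x \<in> points M \<and> independent_at M pencil_biv S x)"
  have bound: "k \<le> card (pairs l)" if "att k" for k using that card_mono[OF finite_pairs] by (auto simp: att_def)
  have "(\<lambda>_. 0) \<in> points M" by (rule half_points) (simp_all add: affine_space_def)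
  hence "att 0" unfolding att_def by (intro exI[of _ "{}"] exI[of _ "\<lambda>_. 0"]) (simp add: independent_at_def)
  hence G: "att (GREATEST k. att k)" "\<And>k. att k ==> k \<le> (GREATEST k. att k)"
    using GreatestI_nat[of att 0] Greatest_le_nat[of att] bound by blast+
  have "(GREATEST k. att k) = card (pairs l)" if "\<forall>s\<in>verts Q. n s \<ge> 1"
  proof -
    have "att (card (pairs l))" using pairs_independent[OF l that] finite_pairs[of l] unfolding att_def by blast
    thus ?thesis using G bound by (intro antisym) auto
  qed
  thus ?thesis using G bound[OF G(1)] unfolding has_order_def att_def[symmetric] Let_def card_pairs[OF l(1)] by blast
qed

end

lemma (in rep_pencil) schouten_cartan:
  "\<forall>x\<in>points M. \<forall>c\<in>coords M. \<forall>d\<in>coords M. \<forall>e\<in>coords M. schouten (coords M) P P x c d e = cartan_trivector M x c d e"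
  using quasi_poisson_P unfolding quasi_poisson_def by (elim conjE)

theorem theorem1:
  fixes Q :: "('s, 'e) pre_digraph"
    and n :: "'s \<Rightarrow> nat"
    and ord :: "('e + 'e) list"
  assumes "fin_digraph Q"
    and "distinct ord" and "set ord = arcs (double Q)"
  defines "M \<equiv> open_rep_variety Q n"
    and "P \<equiv> vdb_bivector Q n ord"
    and "\<Phi> \<equiv> vdb_moment Q n ord"
    and "r\<^sub>Q \<equiv> card (arcs Q) * (card (arcs Q) - 1) div 2"
  shows "\<exists>(J :: ('e \<times> 'e) set) Pf.
     J \<subseteq> arcs Q \<times> arcs Q \<and>
     hamiltonian_pencil M P J Pf \<Phi> \<and>
     (\<exists>r. has_order M J Pf r \<and> r \<le> r\<^sub>Q \<and> ((\<forall>s\<in>verts Q. n s \<ge> 1) \<longrightarrow> r = r\<^sub>Q)) \<and>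
     (\<forall>J\<^sub>0 w. finite J\<^sub>0 \<and> J\<^sub>0 \<subseteq> J \<longrightarrow>
        nondegenerate M (pencil_element P Pf J\<^sub>0 w) \<and>
        quasi_hamiltonian M (pencil_form Q n ord J\<^sub>0 w) \<Phi> \<and>
        corresponding M (pencil_element P Pf J\<^sub>0 w) (pencil_form Q n ord J\<^sub>0 w) \<Phi>) \<and>
     (\<forall>q \<theta>. (\<forall>s\<in>verts Q. q s \<noteq> 0) \<and> (\<Sum>s\<in>verts Q. \<theta> s * of_nat (n s)) = 0 \<and>
        multiplicative_quiver_variety Q n ord q \<theta> \<noteq> {} \<longrightarrow>
        descends_to_poisson_pencil M \<Phi> (scalar_elt Q n q) (semistable_fibre Q n ord q \<theta>) P J Pf)"
proof -
  have rv: "rep_variety Q ord" unfolding rep_variety_def rep_variety_axioms_def using assms(1-3) by blast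
  interpret rep_variety Q n ord by (rule rv)
  \<comment> \<open>Any enumeration of the arrows of Q may select the pairs; it is unrelated to
    \<open>ord\<close>.\<close>
  obtain l where l: "distinct l" "set l = arcs Q" using finite_distinct_list[OF finite_arcs] by blast
  have len: "length l = card (arcs Q)" using distinct_card[OF l(1)] l(2) by simp
  have rp: "rep_pencil Q ord J\<^sub>0" if "finite J\<^sub>0" "J\<^sub>0 \<subseteq> pairs l" for J\<^sub>0
    unfolding rep_pencil_def rep_pencil_axioms_def using rv that pairs_subset[of l] l(2) by blast
  show ?thesis
  proof (intro exI[of _ "pairs l"] exI[of _ pencil_biv] conjI allI impI)
    show "pairs l \<subseteq> arcs Q \<times> arcs Q" using pairs_subset[of l] l(2) by simp
    show "hamiltonian_pencil M P (pairs l) pencil_biv \<Phi>"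
      unfolding hamiltonian_pencil_def quasi_poisson_pencil_def
    proof (intro conjI allI impI ballI)
      \<comment> \<open>The centre is the element of the pencil for the empty index set.\<close>
      show "quasi_poisson M P"
        using rep_pencil.quasi_poisson_P[OF rp[of "{}"], of n "\<lambda>_. 0"] unfolding M_def P_def by (simp add: pencil_element_def)
      show "bivector_field M (pencil_biv j)" for j unfolding M_def by (rule bivector_field_pencil)
      show "quasi_poisson M (pencil_element P pencil_biv J\<^sub>0 w)" "moment_map M (pencil_element P pencil_biv J\<^sub>0 w) \<Phi>"
        if "finite J\<^sub>0 \<and> J\<^sub>0 \<subseteq> pairs l" for J\<^sub>0 w
        using rep_pencil.quasi_poisson_P[OF rp[of J\<^sub>0]] rep_pencil.moment_map_P[OF rp[of J\<^sub>0]] that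
        unfolding M_def P_def \<Phi>_def by blast+
    qed
    show "\<exists>r. has_order M (pairs l) pencil_biv r \<and> r \<le> r\<^sub>Q \<and> ((\<forall>s\<in>verts Q. n s \<ge> 1) \<longrightarrow> r = r\<^sub>Q)"
      using pairs_order[OF l] unfolding len M_def r\<^sub>Q_def .
    fix J\<^sub>0 w assume J: "finite J\<^sub>0 \<and> J\<^sub>0 \<subseteq> pairs l"
    note r = rp[of J\<^sub>0, OF conjunct1[OF J] conjunct2[OF J]]
    show "nondegenerate M (pencil_element P pencil_biv J\<^sub>0 w)" "quasi_hamiltonian M (pencil_form Q n ord J\<^sub>0 w) \<Phi>"
      "corresponding M (pencil_element P pencil_biv J\<^sub>0 w) (pencil_form Q n ord J\<^sub>0 w) \<Phi>"
      unfolding M_def P_def \<Phi>_def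
      by (rule rep_pencil.nondegenerate_P[OF r], rule rep_pencil.quasi_hamiltonian_P[OF r], rule rep_pencil.corresponding_P[OF r])
  next
    fix q \<theta>
    \<comment> \<open>The locale \<open>reduction\<close> concerns only the action, the moment map
      and the fibre, so the instance for the empty set of pairs provides it.\<close>
    show "descends_to_poisson_pencil M \<Phi> (scalar_elt Q n q) (semistable_fibre Q n ord q \<theta>) P (pairs l) pencil_biv"
      unfolding M_def P_def \<Phi>_def
    proof (rule reduction.descends_pencil[OF rep_pencil.reduction_fibre[OF rp[of "{}"]]])
      fix J\<^sub>0 w assume J: "finite J\<^sub>0" "J\<^sub>0 \<subseteq> pairs l"
      show "reduction.compatible (open_rep_variety Q n) (vdb_moment Q n ord) (pencil_element (vdb_bivector Q n ord) pencil_biv J\<^sub>0 w) \<and>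
         (\<forall>x\<in>points (open_rep_variety Q n). \<forall>c\<in>coords (open_rep_variety Q n). \<forall>d\<in>coords (open_rep_variety Q n). \<forall>e\<in>coords (open_rep_variety Q n).
         schouten (coords (open_rep_variety Q n)) (pencil_element (vdb_bivector Q n ord) pencil_biv J\<^sub>0 w)
           (pencil_element (vdb_bivector Q n ord) pencil_biv J\<^sub>0 w) x c d e = cartan_trivector (open_rep_variety Q n) x c d e)"
        by (intro conjI rep_pencil.compatible_P[OF rp[OF J]] rep_pencil.schouten_cartan[OF rp[OF J]])
    qed simp_all
  qed
qed

end
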